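(* Let $p$ be a prime number and let $K$ be a finite Galois extension of $\mathbb{Q}$ with infinite $p$-class field tower. Suppose that $K$ has a subfield $\widetilde{k}$ which is Galois over $\mathbb{Q}$ with $[\widetilde{k}:\mathbb{Q}]=q$, where $q$ is a prime number. Let $K_0=K$ and, for $n\ge1$, let $K_n$ be the Hilbert $p$-class field of $K_{n-1}$. Put $G_n=\mathrm{Gal}(K_n/\mathbb{Q})$ and $\widetilde{H}_n=\mathrm{Gal}(K_n/\widetilde{k})$, and let $\chi\in Irr(G_n)$. (i) If $Res_{\widetilde{H}_n}^{G_n}\chi=\theta$ for some $\theta\in Irr(\widetilde{H}_n)$, then $$f_{\chi}^{1/\chi(1)}\leq |D_{\widetilde{k}/\mathbb{Q}}|\,N_{\widetilde{k}/\mathbb{Q}}(f_{\theta})^{1/\theta(1)}.$$ (ii) If $\chi=Ind_{\widetilde{H}_n}^{G_n}\theta$ for some $\theta\in Irr(\widetilde{H}_n)$, then $$f_{\chi}^{1/\chi(1)}=|D_{\widetilde{k}/\mathbb{Q}}|^{1/q}\,N_{\widetilde{k}/\mathbb{Q}}(f_{\theta})^{1/(q\theta(1))}.$$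
   Context: For a finite group $G$, $Irr(G)$ is the set of irreducible complex characters of $G$. For a subgroup $H$ of $G$, $Res_H^G\chi$ is the restriction to $H$ of a character $\chi$ of $G$, and $Ind_H^G\theta$ is the character of $G$ induced by a character $\theta$ of $H$. $D_{\widetilde{k}/\mathbb{Q}}$ is the discriminant of $\widetilde{k}$ and $N_{\widetilde{k}/\mathbb{Q}}$ is the ideal norm. The Hilbert $p$-class field of a number field $F$ is the maximal unramified abelian extension of $F$ whose Galois group is a $p$-group. With $K_n$ as in the statement, $K$ has infinite $p$-class field tower if $K_n\ne K_{n-1}$ for all $n\ge 1$. Each $K_n$ is Galois over $\mathbb{Q}$ when $K$ is. Artin conductor: for a finite Galois extension $L/M$ of number fields and a character $\chi$ of $\mathrm{Gal}(L/M)$, the Artin conductor is the ideal $f_\chi=\prod_{\mathfrak{p}\nmid\infty}\mathfrak{p}^{f_\chi(\mathfrak{p})}$ of $M$, where $f_\chi(\mathfrak{p})=\frac{1}{|G_0|}\sum_{j\ge 0}\bigl(|G_j|\chi(1)-\chi(G_j)\bigr)$, $G_j$ is the $j$-th (lower numbering) ramification group of the local extension $L_{\mathfrak{b}}/M_{\mathfrak{p}}$ with $\mathfrak{b}$ a prime of $L$ over $\mathfrak{p}$, and $\chi(G_j)=\sum_{g\in G_j}\chi(g)$. When $M=\mathbb{Q}$, $f_\chi$ is identified with the positive integer generating it. Here $f_\chi$ is taken for $K_n/\mathbb{Q}$ and $f_\theta$ (an ideal of $\widetilde{k}$) for $K_n/\widetilde{k}$. *)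

theory Defs
  imports
    "HOL-Algebra.Algebra"
    "HOL-Computational_Algebra.Computational_Algebra"
    "Jordan_Normal_Form.VS_Connect"
    "Jordan_Normal_Form.Determinant"
begin

text \<open>
  Number fields are taken inside the algebraically closed field of complex numbers, as carriers of
  subfields of \<^term>\<open>class_ring :: complex ring\<close>.
\<close>

section \<open>Number fields and Galois groups\<close>

abbreviation field_ring :: "complex set \<Rightarrow> complex ring" where
  "field_ring F \<equiv> class_ring\<lparr>carrier := F\<rparr>"

definition finite_field_ext :: "complex set \<Rightarrow> complex set \<Rightarrow> bool" where
  "finite_field_ext L M \<longleftrightarrow>
     subfield L (class_ring :: complex ring) \<and> subfield M (class_ring :: complex ring) \<and>
     M \<subseteq> L \<and> ring.finite_dimension (class_ring :: complex ring) M L"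

definition field_degree :: "complex set \<Rightarrow> complex set \<Rightarrow> nat" where
  "field_degree L M = ring.dim (class_ring :: complex ring) M L"

definition gal_group :: "complex set \<Rightarrow> complex set \<Rightarrow> (complex \<Rightarrow> complex) monoid" where
  "gal_group L M = BijGroup L
     \<lparr>carrier := {\<sigma> \<in> Bij L. \<sigma> \<in> Ring.ring_hom (field_ring L) (field_ring L) \<and> (\<forall>x\<in>M. \<sigma> x = x)}\<rparr>"

definition galois_ext :: "complex set \<Rightarrow> complex set \<Rightarrow> bool" where
  "galois_ext L M \<longleftrightarrow> finite_field_ext L M \<and>
     {x \<in> L. \<forall>\<sigma>\<in>carrier (gal_group L M). \<sigma> x = x} = M"

definition embeddings :: "complex set \<Rightarrow> (complex \<Rightarrow> complex) set" where
  "embeddings F = Ring.ring_hom (field_ring F) (class_ring :: complex ring) \<inter> extensional F"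

section \<open>Rings of integers, ideals, discriminants\<close>

definition ring_of_integers :: "complex set \<Rightarrow> complex ring" where
  "ring_of_integers F = field_ring {x \<in> F. algebraic_int x}"

definition primes_of :: "complex set \<Rightarrow> complex set set" where
  "primes_of F = {P. primeideal P (ring_of_integers F) \<and> P \<noteq> {0}}"

definition primes_above :: "complex set \<Rightarrow> complex set \<Rightarrow> complex set \<Rightarrow> complex set set" where
  "primes_above L M P = {B \<in> primes_of L. B \<inter> M = P}"

definition ideal_power :: "complex set \<Rightarrow> complex set \<Rightarrow> nat \<Rightarrow> complex set" where
  "ideal_power F I n = I [^]\<^bsub>ideals_set (ring_of_integers F)\<^esub> n"

definition ideal_norm :: "complex set \<Rightarrow> complex set \<Rightarrow> nat" where
  "ideal_norm F I = Coset.order (ring_of_integers F Quot I)"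

definition integral_basis :: "complex set \<Rightarrow> complex list \<Rightarrow> bool" where
  "integral_basis F ws \<longleftrightarrow> set ws \<subseteq> carrier (ring_of_integers F) \<and>
     (\<forall>x\<in>carrier (ring_of_integers F). \<exists>!c :: int list.
        length c = length ws \<and> x = (\<Sum>i<length ws. of_int (c ! i) * ws ! i))"

definition discriminant :: "complex set \<Rightarrow> int" where
  "discriminant F = (THE d. \<exists>ws ss. integral_basis F ws \<and> distinct ss \<and> set ss = embeddings F \<and>
     of_int d = (Determinant.det (mat (length ss) (length ws) (\<lambda>(i, j). (ss ! i) (ws ! j))))\<^sup>2)"

section \<open>Hilbert class fields\<close>

definition ramification_index :: "complex set \<Rightarrow> complex set \<Rightarrow> complex set \<Rightarrow> nat" where
  "ramification_index L M B =
     (GREATEST e. Idl\<^bsub>ring_of_integers L\<^esub> (B \<inter> M) \<subseteq> ideal_power L B e)"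

text \<open>
  The second conjunct says that no real place becomes complex; it is only relevant for the Hilbert
  class field in the case \<open>p = 2\<close>.
\<close>

definition unramified_ext :: "complex set \<Rightarrow> complex set \<Rightarrow> bool" where
  "unramified_ext L M \<longleftrightarrow>
     (\<forall>B\<in>primes_of L. ramification_index L M B = 1) \<and>
     (\<forall>\<tau>\<in>embeddings L. \<tau> ` M \<subseteq> \<real> \<longrightarrow> \<tau> ` L \<subseteq> \<real>)"

definition unramified_abelian_p_ext :: "nat \<Rightarrow> complex set \<Rightarrow> complex set \<Rightarrow> bool" where
  "unramified_abelian_p_ext p L F \<longleftrightarrow>
     galois_ext L F \<and> unramified_ext L F \<and> comm_group (gal_group L F) \<and>
     (\<exists>k. Coset.order (gal_group L F) = p ^ k)"

definition is_hilbert_p_class_field :: "nat \<Rightarrow> complex set \<Rightarrow> complex set \<Rightarrow> bool" where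
  "is_hilbert_p_class_field p F L \<longleftrightarrow>
     unramified_abelian_p_ext p L F \<and> (\<forall>E. unramified_abelian_p_ext p E F \<longrightarrow> E \<subseteq> L)"

section \<open>Characters\<close>

abbreviation GL :: "nat \<Rightarrow> complex mat monoid" where
  "GL n \<equiv> units_of (ring_mat TYPE(complex) n ())"

definition irreducible_rep ::
    "('g, 'r) monoid_scheme \<Rightarrow> nat \<Rightarrow> ('g \<Rightarrow> complex mat) \<Rightarrow> bool" where
  "irreducible_rep G n \<rho> \<longleftrightarrow> n > 0 \<and> \<rho> \<in> hom G (GL n) \<and>
     (\<forall>W. VectorSpace.subspace class_ring W (module_vec TYPE(complex) n) \<and>
          (\<forall>g\<in>carrier G. \<forall>w\<in>W. \<rho> g *\<^sub>v w \<in> W)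
        \<longrightarrow> W = {0\<^sub>v n} \<or> W = carrier_vec n)"

text \<open>
  Characters are extensional functions on the carrier, so that equality of characters is equality
  of functions.
\<close>

definition Irr :: "('g, 'r) monoid_scheme \<Rightarrow> ('g \<Rightarrow> complex) set" where
  "Irr G = {\<chi>. \<exists>n \<rho>. irreducible_rep G n \<rho> \<and>
     \<chi> = restrict (\<lambda>g. \<Sum>i<n. \<rho> g $$ (i, i)) (carrier G)}"

definition Ind ::
    "('g, 'r) monoid_scheme \<Rightarrow> 'g set \<Rightarrow> ('g \<Rightarrow> complex) \<Rightarrow> 'g \<Rightarrow> complex" where
  "Ind G H \<theta> = restrict (\<lambda>g. (\<Sum>x\<in>{x \<in> carrier G. inv\<^bsub>G\<^esub> x \<otimes>\<^bsub>G\<^esub> g \<otimes>\<^bsub>G\<^esub> x \<in> H}.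
       \<theta> (inv\<^bsub>G\<^esub> x \<otimes>\<^bsub>G\<^esub> g \<otimes>\<^bsub>G\<^esub> x)) / of_nat (card H)) (carrier G)"

definition char_degree :: "('g, 'r) monoid_scheme \<Rightarrow> ('g \<Rightarrow> complex) \<Rightarrow> real" where
  "char_degree G \<chi> = Re (\<chi> \<one>\<^bsub>G\<^esub>)"

section \<open>Artin conductors\<close>

text \<open>
  Restriction to \<open>L\<close> identifies the Galois group of the local extension at \<open>B\<close> with the
  decomposition group of \<open>B\<close>, and the elements of the local group acting trivially modulo the
  \<open>(j + 1)\<close>-st power of the maximal ideal with the group below, because the integers of \<open>L\<close>
  surject onto every quotient of the completed valuation ring by such a power.
\<close>

definition ramification_group ::
    "complex set \<Rightarrow> complex set \<Rightarrow> complex set \<Rightarrow> nat \<Rightarrow> (complex \<Rightarrow> complex) set" where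
  "ramification_group L M B j = {\<sigma> \<in> carrier (gal_group L M).
     \<sigma> ` B = B \<and> (\<forall>x\<in>carrier (ring_of_integers L). \<sigma> x - x \<in> ideal_power L B (j + 1))}"

text \<open>Only finitely many terms of the series are nonzero.\<close>

definition conductor_exponent ::
    "complex set \<Rightarrow> complex set \<Rightarrow> ((complex \<Rightarrow> complex) \<Rightarrow> complex) \<Rightarrow> complex set \<Rightarrow> complex" where
  "conductor_exponent L M \<chi> P =
     (let B = (SOME B. B \<in> primes_above L M P); G = ramification_group L M B
      in suminf (\<lambda>j. of_nat (card (G j)) * \<chi> \<one>\<^bsub>gal_group L M\<^esub> - (\<Sum>g\<in>G j. \<chi> g)) / of_nat (card (G 0)))"

text \<open>
  The exponents are nonnegative integers by a theorem of Artin, and almost all of them vanish, so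
  every character has exactly one conductor. The product in the monoid of ideals runs over the
  finitely many primes with nonzero exponent.
\<close>

definition is_artin_conductor ::
    "complex set \<Rightarrow> complex set \<Rightarrow> ((complex \<Rightarrow> complex) \<Rightarrow> complex) \<Rightarrow> complex set \<Rightarrow> bool" where
  "is_artin_conductor L M \<chi> I \<longleftrightarrow> (\<exists>e :: complex set \<Rightarrow> nat.
     (\<forall>P\<in>primes_of M. of_nat (e P) = conductor_exponent L M \<chi> P) \<and>
     finite {P \<in> primes_of M. e P \<noteq> 0} \<and>
     I = (\<Otimes>\<^bsub>ideals_set (ring_of_integers M)\<^esub>P\<in>{P \<in> primes_of M. e P \<noteq> 0}. ideal_power M P (e P)))"

text \<open>Over \<open>\<rat>\<close> the conductor is replaced by its positive generator.\<close>

definition is_rational_artin_conductor ::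
    "complex set \<Rightarrow> ((complex \<Rightarrow> complex) \<Rightarrow> complex) \<Rightarrow> nat \<Rightarrow> bool" where
  "is_rational_artin_conductor L \<chi> f \<longleftrightarrow>
     f > 0 \<and> is_artin_conductor L \<rat> \<chi> (PIdl\<^bsub>ring_of_integers \<rat>\<^esub> (of_nat f))"

end

theory Submission
  imports Defs "Jordan_Normal_Form.Schur_Decomposition"
begin

text \<open>Let \<open>L\<close> be the field \<open>Kn n\<close>, \<open>G\<close> and \<open>\<Gamma>\<close> the automorphism groups of \<open>L\<close> and \<open>k\<close>, and \<open>H\<close> the
  subgroup of \<open>G\<close> fixing \<open>k\<close>. At a prime \<open>B\<close> of \<open>L\<close> with inertia group \<open>I\<close> put
  \<open>i s = v (s \<pi> - \<pi>)\<close> for \<open>s \<noteq> 1\<close> in \<open>I\<close>, where \<open>\<pi>\<close> is a uniformizer and \<open>v\<close> the valuation. Summing the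
  ramification filtration over the group, the conductor exponent of \<open>\<chi>\<close> below \<open>B\<close> is
  \<open>(\<Sum>s\<in>I. i s * (\<chi> 1 - \<chi> s)) / card I\<close> (\<open>conductor_exponent_eq\<close>).

  The sum is split at \<open>H\<close>. If \<open>\<chi>\<close> is induced from \<open>\<theta>\<close>, it vanishes off \<open>H\<close>, so the outer part is
  \<open>\<chi> 1 = q * \<theta> 1\<close> times the sum of \<open>i\<close> over \<open>I - H\<close>; and \<open>q\<close> times this sum is \<open>card I\<close> times the
  exponent of the prime in the discriminant of \<open>k\<close> (\<open>val_discriminant\<close>). That in turn is Serre's formula
  for \<open>i\<close> of a quotient group (\<open>val_quotient_different\<close>) together with the fact that, \<open>q\<close> being prime, the
  prime of \<open>k\<close> is either unramified or totally ramified, in which case powers of a uniformizer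
  are a local integral basis. The inner part is the sum over \<open>\<Gamma>\<close> of the conductor exponents of \<open>\<theta>\<close> at the
  conjugates of the prime, times \<open>card (I \<inter> H)\<close> (\<open>conductor_induced\<close>). For \<open>\<chi>\<close> restricting to \<open>\<theta>\<close> only
  one of these conjugates occurs in the inner part, and in the outer part \<open>\<bar>\<chi> 1 - \<chi> s\<bar> \<le> 2 * \<chi> 1 \<le> q * \<chi> 1\<close>, whence an inequality
  (\<open>conductor_restricted\<close>).

  Multiplying by \<open>ln p\<close> and adding over all primes \<open>p\<close>, with \<open>e f g = n\<close> turning sums over
  conjugates into norms, gives \<open>ln f\<close> compared with \<open>\<theta> 1 * ln \<bar>D\<bar> + ln (N f)\<close>; dividing by \<open>\<chi> 1\<close>
  proves both parts. The fields \<open>Kn n\<close> are Galois over the rationals by induction, since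
  the Hilbert class field, being maximal, is stable under every extension of an
  automorphism of its base (\<open>hilbert_p_class_field_galois\<close>).

  The local theory is developed without completions, in the localizations of the ring of integers inside
  the complex numbers. Prime ideals are locally principal since the stabilizer of a lattice is
  integral; the structure of inertia groups comes from the independence of automorphisms modulo a prime.\<close>

section \<open>Linear algebra and algebraic integers\<close>

definition csubring :: "complex set => bool" where
 "csubring R \<longleftrightarrow> 0 : R & 1 : R & (ALL x:R. ALL y:R. x + y : R & x - y : R & x * y : R)"

definition csubfield :: "complex set => bool" where
 "csubfield F \<longleftrightarrow> csubring F & (ALL x:F. inverse x : F)"

context
 fixes R :: "complex set"
 assumes R: "csubring R"
begin

lemma csubringD:
 shows "0 : R" and "1 : R"
  and "!!x y. x : R ==> y : R ==> x + y : R"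
  and "!!x y. x : R ==> y : R ==> x - y : R"
  and "!!x y. x : R ==> y : R ==> x * y : R"
 using R unfolding csubring_def by auto

lemma csubring_uminus: "x : R ==> - x : R"
 using csubringD(4)[OF csubringD(1), of x] by simp

lemma csubring_power: "x : R ==> x ^ n : R"
 by (induction n) (auto intro: csubringD)

lemma csubring_sum: "(!!i. i : A ==> f i : R) ==> sum f A : R"
 by (induction A rule: infinite_finite_induct) (auto intro: csubringD)

lemma csubring_prod: "(!!i. i : A ==> f i : R) ==> prod f A : R"
 by (induction A rule: infinite_finite_induct) (auto intro: csubringD)

lemma csubring_of_nat: "of_nat n : R"
 by (induction n) (auto intro: csubringD)

lemma csubring_of_int: "of_int n : R"
 by (cases n rule: int_diff_cases) (auto intro: csubringD csubring_of_nat)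

lemma csubring_Ints: "x : \<int> ==> x : R"
 by (auto elim!: Ints_cases intro: csubring_of_int)

lemma csubring_det:
 assumes "A : carrier_mat n n" "!!i j. i < n ==> j < n ==> A $$ (i, j) : R"
 shows "Determinant.det A : R"
 unfolding det_def'[OF assms(1)]
proof (intro csubring_sum csubringD(5) csubring_prod)
 fix p i assume p: "p : {p. p permutes {0..<n}}"
 show "signof p : R" by (intro csubring_of_int)
 assume "i : {0..<n}"
 thus "A $$ (i, p i) : R" using p by (auto intro!: assms(2) simp: permutes_in_image dest: permutes_in_image[of _ "{0..<n}" i])
qed

end

lemma csubfieldD:
 assumes "csubfield F"
 shows "csubring F" and "x : F ==> inverse x : F" and "x : F ==> y : F ==> x / y : F"
 using assms unfolding csubfield_def by (auto simp: field_class.field_divide_inverse intro: csubringD)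

lemma csubfield_Rats:
 assumes "csubfield F" "x : \<rat>"
 shows "x : F"
 using assms(2) csubfieldD[OF assms(1)] csubring_of_int
 by (auto elim!: Rats_cases')

lemma csubfield_Rats_self: "csubfield \<rat>"
 unfolding csubfield_def csubring_def by auto

text \<open>Gaussian elimination: an equation involving some unknown is used to remove it from the others.\<close>

lemma homogeneous_system_nonzero_solution:
 assumes K: "csubfield K" and fin: "finite A" and card: "m < card A"
  and a: "!!i j. i : A ==> j < m ==> a i j : K"
 shows "EX c. (ALL i:A. c i : K) & (EX i:A. c i ~= 0) & (ALL j<m. (\<Sum>i\<in>A. c i * a i j) = 0)"
 using fin card a
proof (induction m arbitrary: A a)
 case 0
 thus ?case
  using csubfieldD(1)[OF K] by (intro exI[of _ "%_. 1"]) (auto intro: csubringD simp: card_gt_0_iff)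
next
 case (Suc m)
 note K' = csubringD[OF csubfieldD(1)[OF K]]
 show ?case
 proof (cases "ALL i:A. a i m = 0")
  case True
  have "EX c. (ALL i:A. c i : K) & (EX i:A. c i ~= 0) & (ALL j<m. (\<Sum>i\<in>A. c i * a i j) = 0)"
   using Suc.prems by (intro Suc.IH) auto
  then obtain c where "ALL i:A. c i : K" "EX i:A. c i ~= 0" "ALL j<m. (\<Sum>i\<in>A. c i * a i j) = 0"
   by blast
  thus ?thesis
   using True by (intro exI[of _ c]) (auto simp: less_Suc_eq)
 next
  case False
  then obtain i0 where i0: "i0 : A" "a i0 m ~= 0" by blast
  define b where "b i j = a i j - a i m / a i0 m * a i0 j" for i j
  have "EX c. (ALL i:A - {i0}. c i : K) & (EX i:A - {i0}. c i ~= 0) &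
    (ALL j<m. (\<Sum>i\<in>A - {i0}. c i * b i j) = 0)"
   using Suc.prems i0
   by (intro Suc.IH) (auto simp: b_def intro!: K' csubfieldD(3)[OF K])
  then obtain c where c: "ALL i:A - {i0}. c i : K" "EX i:A - {i0}. c i ~= 0"
   "ALL j<m. (\<Sum>i\<in>A - {i0}. c i * b i j) = 0" by blast
  define d where "d = c(i0 := - (\<Sum>i\<in>A - {i0}. c i * (a i m / a i0 m)))"
  have split: "(\<Sum>i\<in>A. d i * a i j) = (\<Sum>i\<in>A - {i0}. c i * b i j)" for j
  proof -
   have "(\<Sum>i\<in>A. d i * a i j) = d i0 * a i0 j + (\<Sum>i\<in>A - {i0}. d i * a i j)"
    using i0 Suc.prems by (simp add: sum.remove)
   also have "(\<Sum>i\<in>A - {i0}. d i * a i j) = (\<Sum>i\<in>A - {i0}. c i * a i j)"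
    by (intro sum.cong) (auto simp: d_def)
   finally show ?thesis
    by (simp add: b_def d_def sum_distrib_right sum_distrib_left right_diff_distrib sum_subtractf mult.assoc)
  qed
  have "(\<Sum>i\<in>A - {i0}. c i * b i m) = 0"
   using i0 by (simp add: b_def)
  hence "ALL j<Suc m. (\<Sum>i\<in>A. d i * a i j) = 0"
   using c(3) split by (auto simp: less_Suc_eq)
  moreover have "ALL i:A. d i : K"
   using c(1) i0 Suc.prems
   by (auto simp: d_def intro!: csubring_uminus csubring_sum csubfieldD(1)[OF K] K' csubfieldD(3)[OF K])
  moreover have "EX i:A. d i ~= 0"
   using c(2) by (auto simp: d_def)
  ultimately show ?thesis by blast
 qed
qed

lemma nonsingular_system_unique:
 fixes a :: "nat => nat => complex"
 assumes det: "Determinant.det (mat n n (%(i, j). a i j)) ~= 0"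
  and zero: "!!i. i < n ==> (\<Sum>j<n. a i j * c j) = 0" and j: "j < n"
 shows "c j = 0"
proof (rule ccontr)
 assume "c j ~= 0"
 let ?A = "mat n n (%(i, j). a i j)"
 have "vec n c ~= 0\<^sub>v n"
  using \<open>c j ~= 0\<close> j by (metis index_vec index_zero_vec(1))
 moreover have "?A *\<^sub>v vec n c = 0\<^sub>v n"
  using zero by (intro eq_vecI) (auto simp: scalar_prod_def atLeast0LessThan)
 ultimately show False
  using det det_0_iff_vec_prod_zero_field[of ?A n] vec_carrier[of n c] mat_carrier by metis
qed

text \<open>Multiplying by the coefficients of the Newton polynomials, a unitriangular matrix, makes the
  Vandermonde matrix triangular.\<close>

lemma vandermonde_det:
 fixes x :: "nat => complex"
 shows "Determinant.det (mat n n (%(i, j). x i ^ j)) = (\<Prod>j<n. \<Prod>i<j. x j - x i)"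
proof -
 define N where "N j = (\<Prod>i<j. [:- x i, 1:])" for j
 have deg: "Polynomial.degree (N j) = j" for j
  unfolding N_def by (subst degree_prod_eq_sum_degree) auto
 have lc: "poly.coeff (N j) j = 1" for j
  using deg[of j] monic_prod[of "{..<j}" "%i. [:- x i, 1:]"] unfolding N_def by simp
 define V where "V = mat n n (%(i, j). x i ^ j)"
 define U where "U = mat n n (%(i, j). poly.coeff (N j) i)"
 have V: "V : carrier_mat n n" and U: "U : carrier_mat n n" by (auto simp: V_def U_def)
 have "upper_triangular U"
  unfolding upper_triangular_def U_def by (auto simp: deg intro!: coeff_eq_0)
 hence "Determinant.det U = prod_list (diag_mat U)" using U by (rule det_upper_triangular)
 also have "diag_mat U = map (%_. 1) [0..<n]"
  using U by (auto simp: diag_mat_def U_def lc)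
 finally have detU: "Determinant.det U = 1" by (simp add: map_replicate_const)
 have VU: "V * U = mat n n (%(i, j). poly (N j) (x i))"
 proof (intro eq_matI)
  fix i j assume "i < dim_row (mat n n (%(i, j). poly (N j) (x i)))" "j < dim_col (mat n n (%(i, j). poly (N j) (x i)))"
  hence ij: "i < n" "j < n" by auto
  have "poly (N j) (x i) = (\<Sum>k\<le>j. poly.coeff (N j) k * x i ^ k)"
   by (simp add: poly_altdef deg)
  also have "... = (\<Sum>k<n. poly.coeff (N j) k * x i ^ k)"
   using ij by (intro sum.mono_neutral_left) (auto simp: deg intro!: coeff_eq_0)
  finally show "(V * U) $$ (i, j) = mat n n (%(i, j). poly (N j) (x i)) $$ (i, j)"
   using ij by (simp add: V_def U_def scalar_prod_def atLeast0LessThan mult.commute)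
 qed (auto simp: V_def U_def)
 have N0: "poly (N j) (x i) = (\<Prod>k<j. x i - x k)" for i j
  by (simp add: N_def poly_prod)
 have "Determinant.det (V * U) = prod_list (diag_mat (V * U))"
 proof (rule det_lower_triangular[of n])
  fix i j assume "i < j" "j < n"
  thus "(V * U) $$ (i, j) = 0" unfolding VU by (auto simp: N0)
 qed (use V U in auto)
 also have "diag_mat (V * U) = map (%j. \<Prod>i<j. x j - x i) [0..<n]"
  unfolding VU by (auto simp: diag_mat_def N0)
 also have "prod_list ... = (\<Prod>j<n. \<Prod>i<j. x j - x i)"
  by (simp add: prod.distinct_set_conv_list[symmetric] atLeast0LessThan)
 finally show ?thesis
  using det_mult[OF V U] detU by (simp add: V_def)
qed

lemma vandermonde_det_nonzero:
 fixes x :: "nat => complex"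
 assumes "inj_on x {..<n}"
 shows "Determinant.det (mat n n (%(i, j). x i ^ j)) ~= 0"
 unfolding vandermonde_det using inj_onD[OF assms] by fastforce

text \<open>A finite set spanning a \<open>z\<close>-stable lattice exhibits \<open>z\<close> as an eigenvalue of an integer matrix.\<close>

lemma algebraic_int_if_stable_lattice:
 fixes z :: complex
 assumes "finite S" "s0 : S" "s0 ~= 0"
  and "!!s. s : S ==> EX c. z * s = (\<Sum>t\<in>S. of_int (c t) * t)"
 shows "algebraic_int z"
proof -
 obtain xs where xs: "set xs = S" "distinct xs" using finite_distinct_list[OF assms(1)] by blast
 define n where "n = length xs"
 obtain c where c: "!!s. s : S ==> z * s = (\<Sum>t\<in>S. of_int (c s t) * t)"
  using assms(4) by metis
 define A where "A = mat n n (%(i, j). c (xs ! i) (xs ! j))"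
 have A: "A : carrier_mat n n" by (simp add: A_def)
 let ?B = "map_mat of_int A :: complex mat"
 define v where "v = vec n (%i. xs ! i)"
 have "v ~= 0\<^sub>v n"
 proof -
  obtain i where "i < n" "xs ! i = s0" using assms(2) xs unfolding n_def by (metis in_set_conv_nth)
  thus ?thesis using assms(3) unfolding v_def by (metis index_vec index_zero_vec(1))
 qed
 moreover have "?B *\<^sub>v v = z \<cdot>\<^sub>v v"
 proof (intro eq_vecI)
  fix i assume "i < dim_vec (z \<cdot>\<^sub>v v)"
  hence i: "i < n" by (simp add: v_def)
  hence "z * xs ! i = (\<Sum>t\<in>S. of_int (c (xs ! i) t) * t)"
   using c xs by (metis n_def nth_mem)
  also have "... = (\<Sum>j<n. of_int (c (xs ! i) (xs ! j)) * xs ! j)"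
   using sum.reindex_bij_betw[OF bij_betw_nth[OF xs(2), of "{..<n}" S], of "%t. of_int (c (xs ! i) t) * t"] xs
   by (auto simp: n_def)
  finally show "(?B *\<^sub>v v) $ i = (z \<cdot>\<^sub>v v) $ i"
   using i by (simp add: A_def v_def scalar_prod_def atLeast0LessThan)
 qed (auto simp: A_def v_def)
 ultimately have "eigenvalue ?B z"
  unfolding eigenvalue_def eigenvector_def using A by (intro exI[of _ v]) (auto simp: v_def)
 hence "poly (char_poly ?B) z = 0"
  using eigenvalue_root_char_poly[of ?B n z] A by auto
 moreover have "char_poly ?B = map_poly of_int (char_poly A)"
  by (rule of_int_hom.char_poly_hom[OF A])
 ultimately show ?thesis
  unfolding algebraic_int_altdef_ipoly using degree_monic_char_poly[OF A]
  by (intro exI[of _ "char_poly A"]) auto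
qed

definition int_span :: "complex set => complex set" where
 "int_span S = {\<Sum>t\<in>S. of_int (c t) * t |c. True}"

lemma int_spanI: "x = (\<Sum>t\<in>S. of_int (c t) * t) ==> x : int_span S"
 unfolding int_span_def by blast

lemma int_span_add: "x : int_span S ==> y : int_span S ==> x + y : int_span S"
proof -
 assume "x : int_span S" "y : int_span S"
 then obtain c d where "x = (\<Sum>t\<in>S. of_int (c t) * t)" "y = (\<Sum>t\<in>S. of_int (d t) * t)"
  unfolding int_span_def by auto
 thus ?thesis
  by (intro int_spanI[where c = "%t. c t + d t"]) (simp add: sum.distrib distrib_right)
qed

lemma int_span_scale: "x : int_span S ==> of_int m * x : int_span S"
proof -
 assume "x : int_span S"
 then obtain c where "x = (\<Sum>t\<in>S. of_int (c t) * t)" unfolding int_span_def by auto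
 thus ?thesis
  by (intro int_spanI[where c = "%t. m * c t"]) (simp add: sum_distrib_left mult.assoc)
qed

lemma int_span_uminus: "x : int_span S ==> - x : int_span S"
 using int_span_scale[of x S "-1"] by simp

lemma int_span_zero: "0 : int_span S"
 by (intro int_spanI[where c = "%_. 0"]) simp

lemma int_span_sum: "(!!i. i : A ==> f i : int_span S) ==> sum f A : int_span S"
 by (induction A rule: infinite_finite_induct) (auto intro: int_span_add int_span_zero)

lemma int_span_base: "finite S ==> s : S ==> s : int_span S"
 by (intro int_spanI[where c = "%t. if t = s then 1 else 0"]) (simp add: if_distrib[of of_int] if_distrib[of "%x. x * _"] cong: if_cong)

lemma algebraic_int_if_int_span_stable:
 fixes z :: complex
 assumes "finite S" "s0 : S" "s0 ~= 0" "!!s. s : S ==> z * s : int_span S"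
 shows "algebraic_int z"
 using assms(4) by (intro algebraic_int_if_stable_lattice[OF assms(1-3)]) (auto simp: int_span_def)

text \<open>The products \<open>x ^ i * y ^ j\<close> below the degrees of integral equations span a ring.\<close>

lemma algebraic_int_add_mult:
 fixes x y :: complex
 assumes "algebraic_int x" "algebraic_int y"
 shows "algebraic_int (x + y)" and "algebraic_int (x * y)"
proof -
 obtain p where p: "poly (map_poly of_int p) x = 0" "lead_coeff p = 1"
  using assms(1) unfolding algebraic_int_altdef_ipoly by auto
 obtain q where q: "poly (map_poly of_int q) y = 0" "lead_coeff q = 1"
  using assms(2) unfolding algebraic_int_altdef_ipoly by auto
 define m where "m = Polynomial.degree p"
 define n where "n = Polynomial.degree q"
 have reduce: "z ^ Polynomial.degree r = (\<Sum>i<Polynomial.degree r. of_int (- poly.coeff r i) * z ^ i)"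
  if "poly (map_poly of_int r) z = 0" "lead_coeff r = 1" for r and z :: complex
 proof -
  have "0 = (\<Sum>i\<le>Polynomial.degree r. of_int (poly.coeff r i) * z ^ i)"
   using that(1) by (simp add: poly_altdef)
  also have "... = z ^ Polynomial.degree r + (\<Sum>i<Polynomial.degree r. of_int (poly.coeff r i) * z ^ i)"
   using that(2) by (simp add: lessThan_Suc_atMost[symmetric])
  finally show ?thesis by (simp add: sum_negf eq_neg_iff_add_eq_0)
 qed
 define S where "S = (%(i, j). x ^ i * y ^ j) ` ({..<m} \<times> {..<n})"
 have fin: "finite S" by (simp add: S_def)
 have mn: "m > 0" "n > 0"
 proof -
  have "Polynomial.degree r > 0" if "poly (map_poly of_int r) z = 0" "lead_coeff r = 1" for r and z :: complex
   using that by (intro Nat.gr0I) (auto elim!: degree_eq_zeroE)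
  thus "m > 0" "n > 0" using p q by (auto simp: m_def n_def)
 qed
 hence one: "1 : S" by (auto simp: S_def intro!: rev_image_eqI[of "(0,0)"])
 have base: "x ^ i * y ^ j : int_span S" if "i < m" "j < n" for i j
  using that by (intro int_span_base[OF fin]) (auto simp: S_def)
 have xs: "x * (x ^ i * y ^ j) : int_span S" if "i < m" "j < n" for i j
 proof (cases "Suc i < m")
  case True
  thus ?thesis using base[of "Suc i" j] that by (simp add: mult.assoc)
 next
  case False
  hence "Suc i = m" using that by simp
  hence "x * (x ^ i * y ^ j) = x ^ m * y ^ j" by (auto simp: mult.assoc)
  also have "... = (\<Sum>i<m. of_int (- poly.coeff p i) * (x ^ i * y ^ j))"
   unfolding m_def reduce[OF p] by (simp only: sum_distrib_right mult.assoc)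
  finally show ?thesis using that by (auto intro!: int_span_sum int_span_uminus int_span_scale base)
 qed
 have ys: "y * (x ^ i * y ^ j) : int_span S" if "i < m" "j < n" for i j
 proof (cases "Suc j < n")
  case True
  thus ?thesis using base[of i "Suc j"] that by (simp add: mult_ac)
 next
  case False
  hence "Suc j = n" using that by simp
  hence "y * (x ^ i * y ^ j) = x ^ i * y ^ n" by (auto simp: mult_ac)
  also have "... = (\<Sum>j<n. of_int (- poly.coeff q j) * (x ^ i * y ^ j))"
   unfolding n_def reduce[OF q] by (simp only: sum_distrib_left mult_ac)
  finally show ?thesis using that by (auto intro!: int_span_sum int_span_uminus int_span_scale base)
 qed
 have span: "u * s : int_span S" if "!!s. s : S ==> u * s : int_span S" "s : int_span S" for u s
 proof -
  obtain c where c: "s = (\<Sum>t\<in>S. of_int (c t) * t)" using \<open>s : int_span S\<close> by (auto simp: int_span_def)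
  have "u * s = (\<Sum>t\<in>S. of_int (c t) * (u * t))" by (simp add: c sum_distrib_left mult_ac)
  thus ?thesis using that(1) by (auto intro!: int_span_sum int_span_scale)
 qed
 show "algebraic_int (x + y)"
  by (rule algebraic_int_if_int_span_stable[OF fin one]) (auto simp: S_def distrib_right intro!: int_span_add xs[unfolded S_def] ys[unfolded S_def])
 show "algebraic_int (x * y)"
 proof (rule algebraic_int_if_int_span_stable[OF fin one])
  fix s assume s: "s : S"
  have "x * (y * s) : int_span S"
   by (rule span) (use s in \<open>auto simp: S_def intro!: xs[unfolded S_def] ys[unfolded S_def]\<close>)
  thus "x * y * s : int_span S" by (simp add: mult.assoc)
 qed simp
qed

lemma csubring_algebraic_int: "csubring {x. algebraic_int x}"
proof -
 have "algebraic_int (x - y)" if "algebraic_int x" "algebraic_int y" for x y :: complex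
  using algebraic_int_add_mult(1)[OF that(1) algebraic_int_minus[OF that(2)]] by simp
 thus ?thesis unfolding csubring_def by (auto intro: algebraic_int_add_mult)
qed

section \<open>Finite groups of field automorphisms\<close>

definition hom_on :: "complex set => (complex => complex) => bool" where
 "hom_on L \<sigma> \<longleftrightarrow> \<sigma> 1 = 1 & (ALL x:L. ALL y:L. \<sigma> (x + y) = \<sigma> x + \<sigma> y & \<sigma> (x * y) = \<sigma> x * \<sigma> y)"

context
 fixes L :: "complex set" and \<sigma> :: "complex => complex"
 assumes L: "csubfield L" and \<sigma>: "hom_on L \<sigma>"
begin

lemma hom_on_one: "\<sigma> 1 = 1"
 and hom_on_add: "x : L ==> y : L ==> \<sigma> (x + y) = \<sigma> x + \<sigma> y"
 and hom_on_mult: "x : L ==> y : L ==> \<sigma> (x * y) = \<sigma> x * \<sigma> y"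
 using \<sigma> unfolding hom_on_def by auto

lemmas L' = csubringD[OF csubfieldD(1)[OF L]]

lemma hom_on_zero: "\<sigma> 0 = 0"
 using hom_on_add[OF L'(1) L'(1)] by simp

lemma hom_on_diff: "x : L ==> y : L ==> \<sigma> (x - y) = \<sigma> x - \<sigma> y"
 using hom_on_add[of "x - y" y] by (simp add: L')

lemma hom_on_uminus: "x : L ==> \<sigma> (- x) = - \<sigma> x"
 using hom_on_diff[of 0 x] by (simp add: L' hom_on_zero)

lemma hom_on_power: "x : L ==> \<sigma> (x ^ n) = \<sigma> x ^ n"
 by (induction n) (auto simp: hom_on_one hom_on_mult csubring_power csubfieldD(1)[OF L])

lemma hom_on_sum: "(!!i. i : A ==> f i : L) ==> \<sigma> (sum f A) = (\<Sum>i\<in>A. \<sigma> (f i))"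
 by (induction A rule: infinite_finite_induct)
  (auto simp: hom_on_zero hom_on_add csubring_sum csubfieldD(1)[OF L])

lemma hom_on_prod: "(!!i. i : A ==> f i : L) ==> \<sigma> (prod f A) = (\<Prod>i\<in>A. \<sigma> (f i))"
 by (induction A rule: infinite_finite_induct)
  (auto simp: hom_on_one hom_on_mult csubring_prod csubfieldD(1)[OF L])

lemma hom_on_of_nat: "\<sigma> (of_nat n) = of_nat n"
 by (induction n) (auto simp: hom_on_zero hom_on_one hom_on_add L' csubring_of_nat csubfieldD(1)[OF L])

lemma hom_on_of_int: "\<sigma> (of_int n) = of_int n"
 by (cases n rule: int_diff_cases)
  (auto simp: hom_on_diff hom_on_of_nat csubring_of_nat csubfieldD(1)[OF L])

lemma hom_on_inverse: "x : L ==> \<sigma> (inverse x) = inverse (\<sigma> x)"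
proof (cases "x = 0")
 case False
 assume x: "x : L"
 have "\<sigma> x * \<sigma> (inverse x) = 1"
  using hom_on_mult[of x "inverse x"] x False csubfieldD(2)[OF L x] by (simp add: hom_on_one)
 thus ?thesis by (metis inverse_unique)
qed (simp add: hom_on_zero)

lemma hom_on_divide: "x : L ==> y : L ==> \<sigma> (x / y) = \<sigma> x / \<sigma> y"
 by (simp add: field_class.field_divide_inverse hom_on_mult hom_on_inverse csubfieldD(2)[OF L])

lemma hom_on_Rats: "x : \<rat> ==> \<sigma> x = x"
 by (auto elim!: Rats_cases' simp: hom_on_divide hom_on_of_int csubring_of_int csubfieldD(1)[OF L])

lemma hom_on_eq_0_iff: "x : L ==> \<sigma> x = 0 \<longleftrightarrow> x = 0"
proof
 assume x: "x : L" "\<sigma> x = 0"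
 show "x = 0"
 proof (rule ccontr)
  assume "x ~= 0"
  hence "1 = \<sigma> x * \<sigma> (inverse x)"
   using hom_on_mult[of x "inverse x"] x(1) csubfieldD(2)[OF L x(1)] by (simp add: hom_on_one)
  thus False using x(2) by simp
 qed
qed (simp add: hom_on_zero)

lemma hom_on_inj: "inj_on \<sigma> L"
proof (rule inj_onI)
 fix x y assume "x : L" "y : L" "\<sigma> x = \<sigma> y"
 thus "x = y" using hom_on_eq_0_iff[of "x - y"] by (simp add: hom_on_diff L')
qed

lemma hom_on_poly_eval:
 assumes "!!i. poly.coeff f i : L" "x : L"
 shows "\<sigma> (poly f x) = (\<Sum>i\<le>Polynomial.degree f. \<sigma> (poly.coeff f i) * \<sigma> x ^ i)"
 using assms unfolding poly_altdef
 by (subst hom_on_sum) (auto simp: hom_on_mult hom_on_power L' csubring_power csubfieldD(1)[OF L])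

lemma hom_on_algebraic_int:
 assumes "x : L" "algebraic_int x"
 shows "algebraic_int (\<sigma> x)"
proof -
 obtain f where f: "lead_coeff f = 1" "ALL i. poly.coeff f i : \<int>" "poly f x = 0"
  using assms(2) by (auto simp: algebraic_int.simps)
 have "0 = \<sigma> (poly f x)" by (simp add: f hom_on_zero)
 also have "... = (\<Sum>i\<le>Polynomial.degree f. \<sigma> (poly.coeff f i) * \<sigma> x ^ i)"
  using f assms csubring_Ints[OF csubfieldD(1)[OF L]] by (intro hom_on_poly_eval) auto
 also have "... = poly f (\<sigma> x)"
 proof -
  have "\<sigma> c = c" if "c : \<int>" for c using that by (auto elim!: Ints_cases simp: hom_on_of_int)
  thus ?thesis using f(2) by (simp add: poly_altdef)
 qed
 finally show ?thesis using f by (metis algebraic_int.intros)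
qed

lemma hom_on_coeff_linear_factors:
 assumes "!!a. a : A ==> f a : L"
 shows "poly.coeff (\<Prod>a\<in>A. [:- f a, 1:]) i : L"
  and "\<sigma> (poly.coeff (\<Prod>a\<in>A. [:- f a, 1:]) i) = poly.coeff (\<Prod>a\<in>A. [:- \<sigma> (f a), 1:]) i"
proof -
 have "(ALL i. poly.coeff (\<Prod>a\<in>A. [:- f a, 1:]) i : L) &
   (ALL i. \<sigma> (poly.coeff (\<Prod>a\<in>A. [:- f a, 1:]) i) = poly.coeff (\<Prod>a\<in>A. [:- \<sigma> (f a), 1:]) i)"
  using assms
 proof (induction A rule: infinite_finite_induct)
  case (insert a A)
  have c: "poly.coeff ([:- c, 1:] * g) i = - c * poly.coeff g i + (if i = 0 then 0 else poly.coeff g (i - 1))" for c :: complex and g i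
   by (auto simp: coeff_pCons split: nat.splits)
  have "f a : L" using insert.prems by simp
  thus ?case
   using insert by (auto simp del: mult_pCons_left simp: c hom_on_zero hom_on_add hom_on_diff hom_on_mult hom_on_uminus L' csubring_uminus csubfieldD(1)[OF L])
 qed (auto simp: hom_on_zero hom_on_one L' coeff_1 one_pCons coeff_pCons split: nat.splits)
 thus "poly.coeff (\<Prod>a\<in>A. [:- f a, 1:]) i : L"
  and "\<sigma> (poly.coeff (\<Prod>a\<in>A. [:- f a, 1:]) i) = poly.coeff (\<Prod>a\<in>A. [:- \<sigma> (f a), 1:]) i" by auto
qed

end

locale aut_group =
 fixes L :: "complex set" and U :: "(complex => complex) set"
 assumes L: "csubfield L" and fin: "finite U"
  and hom: "\<sigma> : U ==> hom_on L \<sigma>"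
  and into: "\<sigma> : U ==> x : L ==> \<sigma> x : L"
  and ext: "\<sigma> : U ==> \<sigma> : extensional L"
  and id_mem: "restrict id L : U"
  and comp_mem: "\<sigma> : U ==> \<tau> : U ==> compose L \<sigma> \<tau> : U"
  and inv_ex: "\<sigma> : U ==> EX \<tau>:U. ALL x:L. \<tau> (\<sigma> x) = x & \<sigma> (\<tau> x) = x"
begin

lemmas LR = csubfieldD(1)[OF L]
lemmas Lcl = csubringD[OF LR] csubring_uminus[OF LR] csubring_power[OF LR] csubring_sum[OF LR]
 csubring_prod[OF LR] csubring_of_nat[OF LR] csubring_of_int[OF LR] csubfieldD(2,3)[OF L]

lemmas hom_simps = hom_on_one[OF L hom] hom_on_zero[OF L hom] hom_on_add[OF L hom] hom_on_mult[OF L hom]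
 hom_on_diff[OF L hom] hom_on_uminus[OF L hom] hom_on_power[OF L hom] hom_on_of_nat[OF L hom]
 hom_on_of_int[OF L hom] hom_on_inverse[OF L hom] hom_on_divide[OF L hom] hom_on_Rats[OF L hom]
 hom_on_eq_0_iff[OF L hom]

definition Fix :: "complex set" where
 "Fix = {x : L. ALL \<sigma>:U. \<sigma> x = x}"

lemma Fix_subfield: "csubfield Fix"
 unfolding csubfield_def csubring_def Fix_def by (auto simp: hom_simps intro: Lcl)

lemma Fix_subset: "Fix <= L" by (auto simp: Fix_def)

lemma ext_eqI: "\<sigma> : U ==> \<tau> : U ==> (!!x. x : L ==> \<sigma> x = \<tau> x) ==> \<sigma> = \<tau>"
 using ext by (meson extensionalityI)

lemma comp_apply: "x : L ==> compose L \<sigma> \<tau> x = \<sigma> (\<tau> x)"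
 by (simp add: compose_def)

lemma card_pos: "card U > 0"
 using fin id_mem by (auto simp: card_gt_0_iff)

lemma bij_comp_left: "\<tau> : U ==> bij_betw (compose L \<tau>) U U"
proof -
 assume \<tau>: "\<tau> : U"
 have "inj_on (compose L \<tau>) U"
 proof (rule inj_onI)
  fix s t assume st: "s : U" "t : U" "compose L \<tau> s = compose L \<tau> t"
  show "s = t"
  proof (rule ext_eqI[OF st(1,2)])
   fix x assume x: "x : L"
   hence "\<tau> (s x) = \<tau> (t x)" using st(3) comp_apply by metis
   thus "s x = t x" using inj_onD[OF hom_on_inj[OF L hom[OF \<tau>]]] into st x by metis
  qed
 qed
 thus ?thesis
  using endo_inj_surj[OF fin] \<tau> comp_mem by (simp add: bij_betw_def image_subset_iff)
qed

lemma norm_mem: "x : L ==> (\<Prod>\<sigma>\<in>U. \<sigma> x) : Fix"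
proof -
 assume x: "x : L"
 have "\<tau> (\<Prod>\<sigma>\<in>U. \<sigma> x) = (\<Prod>\<sigma>\<in>U. \<sigma> x)" if \<tau>: "\<tau> : U" for \<tau>
 proof -
  have "\<tau> (\<Prod>\<sigma>\<in>U. \<sigma> x) = (\<Prod>\<sigma>\<in>U. compose L \<tau> \<sigma> x)"
   using x into by (subst hom_on_prod[OF L hom[OF \<tau>]]) (auto simp: comp_apply)
  also have "... = (\<Prod>\<sigma>\<in>U. \<sigma> x)" by (rule prod.reindex_bij_betw[OF bij_comp_left[OF \<tau>]])
  finally show ?thesis .
 qed
 moreover have "A : L" if "A = (\<Prod>\<sigma>\<in>U. \<sigma> x)" for A unfolding that using x into by (intro Lcl) auto
 ultimately show ?thesis unfolding Fix_def by auto
qed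

definition cpoly :: "complex => complex poly" where
 "cpoly x = (\<Prod>\<sigma>\<in>U. [:- \<sigma> x, 1:])"

lemma cpoly_coeff: "x : L ==> poly.coeff (cpoly x) i : Fix"
proof -
 assume x: "x : L"
 have m: "poly.coeff (cpoly x) i : L"
  unfolding cpoly_def by (rule hom_on_coeff_linear_factors(1)[OF L hom[OF id_mem]]) (simp add: x into)
 moreover have "\<tau> (poly.coeff (cpoly x) i) = poly.coeff (cpoly x) i" if \<tau>: "\<tau> : U" for \<tau>
 proof -
  have "\<tau> (poly.coeff (cpoly x) i) = poly.coeff (\<Prod>\<sigma>\<in>U. [:- \<tau> (\<sigma> x), 1:]) i"
   unfolding cpoly_def by (rule hom_on_coeff_linear_factors(2)[OF L hom[OF \<tau>]]) (simp add: x into)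
  also have "(\<Prod>\<sigma>\<in>U. [:- \<tau> (\<sigma> x), 1:]) = (\<Prod>\<sigma>\<in>U. [:- compose L \<tau> \<sigma> x, 1:])"
   using x by (simp add: comp_apply)
  also have "... = cpoly x"
   unfolding cpoly_def by (rule prod.reindex_bij_betw[OF bij_comp_left[OF \<tau>]])
  finally show ?thesis .
 qed
 ultimately show ?thesis by (simp add: Fix_def)
qed

lemma cpoly_root: "x : L ==> \<sigma> : U ==> poly (cpoly x) (\<sigma> x) = 0"
 unfolding cpoly_def poly_prod using fin by (intro prod_zero) auto

lemma cpoly_self: "x : L ==> poly (cpoly x) x = 0"
 using cpoly_root[OF _ id_mem] by simp

lemma cpoly_monic: "lead_coeff (cpoly x) = 1"
 unfolding cpoly_def by (intro monic_prod) auto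

lemma cpoly_degree: "Polynomial.degree (cpoly x) = card U"
 unfolding cpoly_def by (subst degree_prod_eq_sum_degree) auto

lemma cpoly_zeros: "poly (cpoly x) y = 0 ==> EX \<sigma>:U. y = \<sigma> x"
proof -
 assume "poly (cpoly x) y = 0"
 then obtain \<sigma> where "\<sigma> : U" "poly [:- \<sigma> x, 1:] y = 0"
  unfolding cpoly_def poly_prod prod_zero_iff[OF fin] by blast
 hence "y - \<sigma> x = 0" by simp
 thus ?thesis using \<open>\<sigma> : U\<close> eq_iff_diff_eq_0 by blast
qed

text \<open>A line through a point outside one subspace, with a direction outside the others, meets each of
  them at most once, but contains infinitely many points.\<close>

lemma avoid_proper_subspaces:
 assumes "finite \<V>"
  and "!!V. V : \<V> ==> EX x:L. x ~: V"
  and "!!V x y. V : \<V> ==> x : V ==> y : V ==> x - y : V"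
  and "!!V x n. V : \<V> ==> of_int n * x : V ==> n ~= 0 ==> x : V"
  and "!!V x n. V : \<V> ==> x : V ==> of_int n * x : V"
 shows "EX x:L. ALL V:\<V>. x ~: V"
 using assms
proof (induction \<V> rule: finite_induct)
 case empty
 show ?case using Lcl(1) by auto
next
 case (insert V \<V>)
 have "EX x:L. ALL V:\<V>. x ~: V"
 proof (rule insert.IH)
  show "EX x:L. x ~: W" if "W : \<V>" for W using that by (intro insert.prems(1)) simp
  show "x - y : W" if "W : \<V>" "x : W" "y : W" for W x y
   using that by (intro insert.prems(2)) auto
  show "x : W" if "W : \<V>" "of_int n * x : W" "n ~= 0" for W x n
   using that insert.prems(3)[of W n x] by auto
  show "of_int n * x : W" if "W : \<V>" "x : W" for W x n
   using that by (intro insert.prems(4)) auto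
 qed
 then obtain a where a: "a : L" "ALL V:\<V>. a ~: V" by blast
 show ?case
 proof (cases "a : V")
  case True
  obtain b where b: "b : L" "b ~: V" using insert.prems(1)[of V] by auto
  have V: "b + of_nat t * a ~: V" for t
  proof
   assume "b + of_nat t * a : V"
   moreover have "of_nat t * a : V" using insert.prems(4)[of V a "int t"] True by simp
   ultimately have "b + of_nat t * a - of_nat t * a : V" by (intro insert.prems(2)) auto
   thus False using b by simp
  qed
  have "EX t::nat. ALL W:\<V>. b + of_nat t * a ~: W"
  proof (rule ccontr)
   assume "\<nexists>t::nat. ALL W:\<V>. b + of_nat t * a ~: W"
   hence "ALL t::nat. EX W. W : \<V> & b + of_nat t * a : W" by blast
   then obtain W where W': "ALL t::nat. W t : \<V> & b + of_nat t * a : W t" by (rule choice[THEN exE])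
   hence W: "W t : \<V> & b + of_nat t * a : W t" for t by blast
   have "finite (range W)" using W by (intro finite_subset[OF _ insert.hyps(1)]) auto
   hence "~ inj W" using finite_imageD[of W UNIV] by auto
   then obtain s t where st: "W s = W t" "s ~= t" by (auto simp: inj_def)
   have "b + of_nat s * a - (b + of_nat t * a) : W s"
    using W[of s] W[of t] st by (intro insert.prems(2)) simp_all
   moreover have "b + of_nat s * a - (b + of_nat t * a) = of_int (int s - int t) * a" by (simp add: algebra_simps)
   ultimately have "of_int (int s - int t) * a : W s" by simp
   hence "a : W s" using insert.prems(3)[of "W s" "int s - int t" a] W[of s] st by auto
   thus False using a W[of s] by auto
  qed
  then obtain t :: nat where "ALL W:\<V>. b + of_nat t * a ~: W" by blast
  moreover have "b + of_nat t * a : L" by (intro Lcl a b)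
  ultimately show ?thesis using V[of t] by blast
 next
  case False
  thus ?thesis using a by (intro bexI[of _ a]) auto
 qed
qed

text \<open>The elements identified by two given automorphisms form a proper subspace.\<close>

lemma primitive_element_exists:
 "EX \<alpha>:L. inj_on (%\<sigma>. \<sigma> \<alpha>) U"
proof -
 define \<V> where "\<V> = (%(\<sigma>, \<tau>). {x : L. \<sigma> x = \<tau> x}) ` {(\<sigma>, \<tau>). \<sigma> : U & \<tau> : U & \<sigma> ~= \<tau>}"
 have "EX x:L. ALL V:\<V>. x ~: V"
 proof (rule avoid_proper_subspaces)
  have "{(\<sigma>, \<tau>). \<sigma> : U & \<tau> : U & \<sigma> ~= \<tau>} <= U \<times> U" by auto
  thus "finite \<V>" unfolding \<V>_def using fin by (meson finite_SigmaI finite_imageI finite_subset)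
  show "EX x:L. x ~: V" if V: "V : \<V>" for V
  proof -
   obtain s t where st: "V = {x : L. s x = t x}" "s : U" "t : U" "s ~= t"
    using V unfolding \<V>_def by fastforce
   hence "~ (ALL x:L. s x = t x)" using ext_eqI[of s t] by blast
   thus ?thesis using st(1) by blast
  qed
  show "x - y : V" if "V : \<V>" "x : V" "y : V" for V x y
   using that unfolding \<V>_def by (auto simp: hom_simps Lcl)
  show "x : V" if V: "V : \<V>" "of_int n * x : V" "n ~= 0" for V x n
  proof -
   obtain s t where st: "V = {x : L. s x = t x}" "s : U" "t : U" using V(1) unfolding \<V>_def by fastforce
   have m: "of_int n * x : L" "s (of_int n * x) = t (of_int n * x)" using V st by auto
   have "x = of_int n * x / of_int n" using V by simp
   hence x: "x : L" using m(1) Lcl by metis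
   thus ?thesis using m st V(3) by (auto simp: hom_simps Lcl)
  qed
  show "of_int n * x : V" if "V : \<V>" "x : V" for V x n
   using that unfolding \<V>_def by (auto simp: hom_simps Lcl)
 qed
 then obtain x where x: "x : L" "ALL V:\<V>. x ~: V" by blast
 have "inj_on (%\<sigma>. \<sigma> x) U"
 proof (rule inj_onI, rule ccontr)
  fix s t assume st: "s : U" "t : U" "s x = t x" "s ~= t"
  have "(%(\<sigma>, \<tau>). {x : L. \<sigma> x = \<tau> x}) (s, t) : \<V>"
   unfolding \<V>_def using st by (intro imageI) blast
  with x(2) have "x ~: (%(\<sigma>, \<tau>). {x : L. \<sigma> x = \<tau> x}) (s, t)" by (rule bspec)
  thus False using st(3) x(1) by simp
 qed
 thus ?thesis using x(1) by blast
qed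

text \<open>Cramer's rule: the coordinates of \<open>x\<close> solve a system which the group permutes.\<close>

lemma coordinates_in_Fix:
 assumes s: "bij_betw s {..<n} U"
  and det: "Determinant.det (mat n n (%(i, j). s i (u j))) ~= 0"
  and u: "!!j. j < n ==> u j : L" and x: "x : L"
 shows "EX c. (ALL j<n. c j : Fix) & x = (\<Sum>j<n. c j * u j)"
proof -
 have sU: "s i : U" if "i < n" for i using s that by (auto simp: bij_betw_def)
 define a where "a j i = (if j = n then - s i x else s i (u j))" for i j
 have "EX c. (ALL j:{..n}. c j : L) & (EX j:{..n}. c j ~= 0) & (ALL i<n. (\<Sum>j\<in>{..n}. c j * a j i) = 0)"
  using u x sU into by (intro homogeneous_system_nonzero_solution[OF L]) (auto simp: a_def intro!: Lcl)
 then obtain c where c: "ALL j:{..n}. c j : L" "EX j:{..n}. c j ~= 0" "ALL i<n. (\<Sum>j\<in>{..n}. c j * a j i) = 0"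
  by blast
 have eq: "(\<Sum>j<n. s i (u j) * c j) = c n * s i x" if "i < n" for i
 proof -
  have "(\<Sum>j\<in>{..n}. c j * a j i) = (\<Sum>j<n. c j * a j i) + c n * a n i"
   by (simp add: lessThan_Suc_atMost[symmetric])
  also have "(\<Sum>j<n. c j * a j i) = (\<Sum>j<n. s i (u j) * c j)" by (intro sum.cong) (auto simp: a_def)
  finally show ?thesis using c(3) that by (simp add: a_def)
 qed
 have cn: "c n ~= 0"
 proof
  assume "c n = 0"
  hence "c j = 0" if "j < n" for j
   using nonsingular_system_unique[OF det _ that, of c] eq by auto
  thus False using c(2) \<open>c n = 0\<close> by (auto simp: le_less)
 qed
 define d where "d j = c j / c n" for j
 have dL: "d j : L" if "j < n" for j unfolding d_def using c(1) that by (auto intro!: Lcl)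
 have deq: "(\<Sum>j<n. s i (u j) * d j) = s i x" if "i < n" for i
  using eq[OF that] cn by (simp add: d_def sum_divide_distrib[symmetric])
 have "\<tau> (d j) = d j" if \<tau>: "\<tau> : U" and j: "j < n" for \<tau> j
 proof -
  have "(\<Sum>j<n. s i (u j) * (\<tau> (d j) - d j)) = 0" if i: "i < n" for i
  proof -
   have "s i : compose L \<tau> ` U" using bij_comp_left[OF \<tau>] sU[OF i] by (simp add: bij_betw_def)
   then obtain t where t: "t : U" "s i = compose L \<tau> t" by blast
   then obtain k where k: "k < n" "t = s k" using s by (auto simp: bij_betw_def)
   have "\<tau> (\<Sum>j<n. s k (u j) * d j) = \<tau> (s k x)" using deq[OF k(1)] by simp
   moreover have "\<tau> (\<Sum>j<n. s k (u j) * d j) = (\<Sum>j<n. s i (u j) * \<tau> (d j))"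
    using u dL into t k \<tau> by (subst hom_on_sum[OF L hom[OF \<tau>]]) (auto simp: comp_apply hom_simps Lcl intro!: sum.cong)
   ultimately have "(\<Sum>j<n. s i (u j) * \<tau> (d j)) = s i x"
    using t k x by (simp add: comp_apply)
   thus ?thesis using deq[OF i] by (simp add: right_diff_distrib sum_subtractf)
  qed
  from nonsingular_system_unique[OF det this j] show ?thesis by simp
 qed
 hence dF: "d j : Fix" if "j < n" for j using dL that by (auto simp: Fix_def)
 obtain k where k: "k < n" "s k = restrict id L" using s id_mem by (auto simp: bij_betw_def)
 have "x = (\<Sum>j<n. d j * u j)"
  using deq[OF k(1)] u x by (simp add: k(2) mult.commute)
 thus ?thesis using dF by blast
qed

lemma ex_enum: "EX s. bij_betw s {..<card U} U"
 using ex_bij_betw_nat_finite[OF fin] by (simp add: atLeast0LessThan)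

lemma power_coordinates:
 assumes \<alpha>: "\<alpha> : L" "inj_on (%\<sigma>. \<sigma> \<alpha>) U" and x: "x : L"
 shows "EX c. (ALL j<card U. c j : Fix) & x = (\<Sum>j<card U. c j * \<alpha> ^ j)"
proof -
 obtain s where s: "bij_betw s {..<card U} U" using ex_enum by blast
 have "inj_on (%i. s i \<alpha>) {..<card U}"
  using comp_inj_on[of s "{..<card U}" "%\<sigma>. \<sigma> \<alpha>"] s \<alpha>(2) by (simp add: bij_betw_def comp_def)
 hence "Determinant.det (mat (card U) (card U) (%(i, j). s i \<alpha> ^ j)) ~= 0"
  by (rule vandermonde_det_nonzero)
 moreover have "mat (card U) (card U) (%(i, j). s i \<alpha> ^ j) = mat (card U) (card U) (%(i, j). s i (\<alpha> ^ j))"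
  using hom_simps(7)[OF bij_betw_apply[OF s] \<alpha>(1)] by (intro eq_matI) simp_all
 ultimately show ?thesis using coordinates_in_Fix[OF s, of "%j. \<alpha> ^ j"] \<alpha>(1) x Lcl by auto
qed

text \<open>Artin's independence of characters, relative to a prime ideal \<open>B\<close> of a subring \<open>R\<close>.\<close>

end

lemma characters_independent_mod_prime:
 fixes R B :: "complex set" and \<Phi> :: "('a => complex) set"
 assumes R: "csubring R"
  and B: "!!x y. x : B ==> y : B ==> x - y : B" "!!x y. x : B ==> y : R ==> x * y : B"
   "!!x y. x : R ==> y : R ==> x * y : B ==> x : B | y : B"
  and M: "m1 : M" "!!x y. x : M ==> y : M ==> mul x y : M"
  and \<Phi>: "finite \<Phi>" "!!\<phi> x. \<phi> : \<Phi> ==> x : M ==> \<phi> x : R"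
   "!!\<phi> x y. \<phi> : \<Phi> ==> x : M ==> y : M ==> \<phi> (mul x y) = \<phi> x * \<phi> y"
   "!!\<phi>. \<phi> : \<Phi> ==> \<phi> m1 = 1"
  and distinct: "!!\<phi> \<psi>. \<phi> : \<Phi> ==> \<psi> : \<Phi> ==> \<phi> ~= \<psi> ==> EX x:M. \<phi> x - \<psi> x ~: B"
  and u: "!!\<phi>. \<phi> : \<Phi> ==> u \<phi> : R"
  and rel: "!!x. x : M ==> (\<Sum>\<phi>\<in>\<Phi>. u \<phi> * \<phi> x) : B"
  and \<phi>: "\<phi> : \<Phi>"
 shows "u \<phi> : B"
 using \<phi> \<Phi> distinct u rel
proof (induction "card \<Phi>" arbitrary: \<Phi> u \<phi>)
 case 0
 thus ?case by auto
next
 case (Suc n)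
 note R' = csubringD[OF R]
 show ?case
 proof (cases "\<Phi> = {\<phi>}")
  case True
  thus ?thesis using Suc.prems(8)[OF M(1)] Suc.prems(5)[of \<phi>] by simp
 next
  case False
  then obtain \<psi> where \<psi>: "\<psi> : \<Phi>" "\<psi> ~= \<phi>" using Suc.prems(1) by blast
  obtain a where a: "a : M" "\<phi> a - \<psi> a ~: B" using Suc.prems(6)[OF Suc.prems(1) \<psi>(1)] \<psi>(2) by blast
  define w where "w \<rho> = u \<rho> * (\<rho> a - \<psi> a)" for \<rho>
  have "w \<phi> : B"
  proof (rule Suc.hyps(1)[where \<Phi> = "\<Phi> - {\<psi>}" and \<phi> = \<phi> and u = w])
   show "n = card (\<Phi> - {\<psi>})" using Suc.hyps(2) \<psi> Suc.prems(2) by simp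
   show "\<phi> : \<Phi> - {\<psi>}" using \<psi> Suc.prems(1) by auto
   show "w \<rho> : R" if "\<rho> : \<Phi> - {\<psi>}" for \<rho>
    using that a(1) \<psi>(1) unfolding w_def by (intro R'(4,5) Suc.prems(3,7)) auto
   show "(\<Sum>\<rho>\<in>\<Phi> - {\<psi>}. w \<rho> * \<rho> x) : B" if x: "x : M" for x
   proof -
    have "(\<Sum>\<rho>\<in>\<Phi>. u \<rho> * \<rho> (mul a x)) - (\<Sum>\<rho>\<in>\<Phi>. u \<rho> * \<rho> x) * \<psi> a : B"
     by (intro B(1,2) Suc.prems(8) M(2)[OF a(1) x] x Suc.prems(3)[OF \<psi>(1) a(1)])
    also have "(\<Sum>\<rho>\<in>\<Phi>. u \<rho> * \<rho> (mul a x)) - (\<Sum>\<rho>\<in>\<Phi>. u \<rho> * \<rho> x) * \<psi> a = (\<Sum>\<rho>\<in>\<Phi>. w \<rho> * \<rho> x)"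
     unfolding sum_distrib_right sum_subtractf[symmetric] w_def
     using Suc.prems(4) a x by (intro sum.cong) (auto simp: algebra_simps)
    also have "... = (\<Sum>\<rho>\<in>\<Phi> - {\<psi>}. w \<rho> * \<rho> x)"
     using \<psi> Suc.prems(2) by (simp add: sum.remove[of _ \<psi>] w_def)
    finally show ?thesis .
   qed
   show "finite (\<Phi> - {\<psi>})" using Suc.prems(2) by simp
   show "\<rho> x : R" if "\<rho> : \<Phi> - {\<psi>}" "x : M" for \<rho> x
    using that by (intro Suc.prems(3)) auto
   show "\<rho> (mul x y) = \<rho> x * \<rho> y" if "\<rho> : \<Phi> - {\<psi>}" "x : M" "y : M" for \<rho> x y
    using that by (intro Suc.prems(4)) auto
   show "\<rho> m1 = 1" if "\<rho> : \<Phi> - {\<psi>}" for \<rho>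
    using that by (intro Suc.prems(5)) auto
   show "EX x:M. \<rho> x - \<rho>' x ~: B" if "\<rho> : \<Phi> - {\<psi>}" "\<rho>' : \<Phi> - {\<psi>}" "\<rho> ~= \<rho>'" for \<rho> \<rho>'
    using that by (intro Suc.prems(6)) auto
  qed
  moreover have "\<phi> a - \<psi> a : R"
   using a(1) \<psi>(1) Suc.prems(1) by (intro R'(4) Suc.prems(3))
  ultimately show ?thesis
   using B(3)[OF Suc.prems(7)[OF Suc.prems(1)]] a(2) unfolding w_def by blast
 qed
qed

section \<open>Rings of integers and integral bases\<close>

text \<open>Clearing denominators: substituting \<open>X / d\<close> in a monic polynomial and rescaling.\<close>

lemma algebraic_int_scaled:
 fixes f :: "complex poly"
 assumes f: "lead_coeff f = 1" "poly f x = 0" and d: "d ~= 0" "!!i. of_int d * poly.coeff f i : \<int>"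
 shows "algebraic_int (of_int d * x)"
proof -
 define n where "n = Polynomial.degree f"
 define g where "g = Polynomial.smult (of_int d ^ n) (pcompose f [:0, 1 / of_int d:])"
 have co: "poly.coeff g i = of_int d ^ n * (1 / of_int d) ^ i * poly.coeff f i" for i
  by (simp add: g_def coeff_pcompose_linear)
 have deg: "Polynomial.degree g = n"
  using d(1) by (simp add: g_def n_def)
 show ?thesis
 proof (rule algebraic_int.intros)
  show "lead_coeff g = 1"
   unfolding deg co using f(1) d(1) by (simp add: n_def power_divide)
  show "poly g (of_int d * x) = 0"
   using f(2) d(1) by (simp add: g_def poly_pcompose)
  show "ALL i. poly.coeff g i : \<int>"
  proof
   fix i
   consider "i > n" | "i = n" | "i < n" by linarith
   thus "poly.coeff g i : \<int>"
   proof cases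
    case 1
    thus ?thesis by (simp add: deg coeff_eq_0)
   next
    case 2
    thus ?thesis using f(1) d(1) by (simp add: co n_def power_divide)
   next
    case 3
    hence "of_int d ^ n = of_int d ^ (n - i - 1) * (of_int d * of_int d ^ i :: complex)"
     using power_add[of "of_int d :: complex" "n - i - 1" "Suc i"] by simp
    hence "poly.coeff g i = of_int d ^ (n - i - 1) * (of_int d * poly.coeff f i)"
     using d(1) by (simp add: co power_divide)
    thus ?thesis using d(2) by (metis Ints_mult Ints_of_int Ints_power)
   qed
  qed
 qed
qed

lemma common_denominator:
 assumes "finite A" "!!a. a : A ==> f a : (\<rat> :: complex set)"
 shows "EX d::int. d > 0 & (ALL a:A. of_int d * f a : \<int>)"
 using assms
proof (induction A rule: finite_induct)
 case empty
 show ?case by (intro exI[of _ 1]) simp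
next
 case (insert a A)
 obtain d where d: "d > 0" "ALL a:A. of_int d * f a : \<int>" using insert by auto
 obtain p q where q: "q > 0" "f a = of_int p / of_int q"
  using insert.prems[of a] by (auto elim: Rats_cases')
 have "of_int (d * q) * f a : \<int>" using q by simp
 moreover have "of_int (d * q) * f b : \<int>" if "b : A" for b
 proof -
  have "of_int (d * q) * f b = of_int q * (of_int d * f b)" by simp
  thus ?thesis using d(2) that by (metis Ints_mult Ints_of_int)
 qed
 ultimately show ?case using d(1) q(1) by (intro exI[of _ "d * q"]) auto
qed

lemma det_mat_permutations:
 fixes a :: "nat => nat => complex"
 shows "Determinant.det (mat n n (%(i, j). a i j)) =
  (\<Sum>p\<in>{p. p permutes {0..<n}}. of_int (sign p) * (\<Prod>i = 0..<n. a i (p i)))"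
 unfolding det_def'[OF mat_carrier]
proof (intro sum.cong refl arg_cong2[of _ _ _ _ "(*)"] prod.cong)
 fix p i assume "p : {p. p permutes {0..<n}}" "i : {0..<n}"
 thus "mat n n (%(i, j). a i j) $$ (i, p i) = a i (p i)"
  using permutes_in_image[of p "{0..<n}" i] by simp
qed

lemma hom_on_det:
 assumes L: "csubfield L" and \<sigma>: "hom_on L \<sigma>" and a: "!!i j. i < n ==> j < n ==> a i j : L"
 shows "\<sigma> (Determinant.det (mat n n (%(i, j). a i j))) = Determinant.det (mat n n (%(i, j). \<sigma> (a i j)))"
proof -
 note LR = csubfieldD(1)[OF L]
 have aL: "a i (p i) : L" if "p : {p. p permutes {0..<n}}" "i : {0..<n}" for p i
  using that permutes_in_image[of p "{0..<n}" i] by (intro a) auto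
 have prodL: "(\<Prod>i = 0..<n. a i (p i)) : L" if "p : {p. p permutes {0..<n}}" for p
  by (rule csubring_prod[OF LR aL[OF that]])
 have "\<sigma> (\<Sum>p\<in>{p. p permutes {0..<n}}. of_int (sign p) * (\<Prod>i = 0..<n. a i (p i))) =
  (\<Sum>p\<in>{p. p permutes {0..<n}}. \<sigma> (of_int (sign p) * (\<Prod>i = 0..<n. a i (p i))))"
  by (intro hom_on_sum[OF L \<sigma>] csubringD(5)[OF LR] csubring_of_int[OF LR] prodL)
 also have "... = (\<Sum>p\<in>{p. p permutes {0..<n}}. of_int (sign p) * (\<Prod>i = 0..<n. \<sigma> (a i (p i))))"
 proof (rule sum.cong[OF refl])
  fix p assume p: "p : {p. p permutes {0..<n}}"
  have "\<sigma> (\<Prod>i = 0..<n. a i (p i)) = (\<Prod>i = 0..<n. \<sigma> (a i (p i)))"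
   by (rule hom_on_prod[OF L \<sigma> aL[OF p]])
  thus "\<sigma> (of_int (sign p) * (\<Prod>i = 0..<n. a i (p i))) = of_int (sign p) * (\<Prod>i = 0..<n. \<sigma> (a i (p i)))"
   using hom_on_mult[OF L \<sigma> csubring_of_int[OF LR] prodL[OF p]] hom_on_of_int[OF L \<sigma>] by simp
 qed
 finally show ?thesis unfolding det_mat_permutations .
qed

context aut_group
begin

definition \<O> :: "complex set" where
 "\<O> = {x : L. algebraic_int x}"

lemma Int_ring: "csubring \<O>"
 unfolding \<O>_def using LR csubring_algebraic_int unfolding csubring_def by blast

lemmas Int_cl = csubringD[OF Int_ring] csubring_uminus[OF Int_ring] csubring_power[OF Int_ring]
 csubring_sum[OF Int_ring] csubring_prod[OF Int_ring] csubring_of_nat[OF Int_ring] csubring_of_int[OF Int_ring]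

lemma Int_L: "x : \<O> ==> x : L" by (simp add: \<O>_def)

lemma Int_into: "\<sigma> : U ==> x : \<O> ==> \<sigma> x : \<O>"
 unfolding \<O>_def using into hom_on_algebraic_int[OF L hom] by blast

lemma Int_Rats: "x : \<O> ==> x : \<rat> ==> x : \<int>"
 unfolding \<O>_def using rational_algebraic_int_is_int by blast

definition enum :: "nat => complex => complex" where
 "enum = (SOME s. bij_betw s {..<card U} U)"

lemma enum: "bij_betw enum {..<card U} U"
 unfolding enum_def using ex_enum by (rule someI_ex)

lemma enum_mem: "i < card U ==> enum i : U"
 using bij_betw_apply[OF enum] by simp

text \<open>The square of this determinant of conjugates is the discriminant of the family \<open>w\<close>; its sign
  depends on the chosen enumeration of the group.\<close>

definition dm :: "(nat => complex) => complex" where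
 "dm w = Determinant.det (mat (card U) (card U) (%(i, j). enum i (w j)))"

lemma dm_mem_Int: "(!!j. j < card U ==> w j : \<O>) ==> dm w : \<O>"
 unfolding dm_def by (rule csubring_det[OF Int_ring mat_carrier]) (simp add: Int_into enum_mem)

lemma dm_square_enum:
 assumes s: "bij_betw s {..<card U} U"
 shows "(Determinant.det (mat (card U) (card U) (%(i, j). s i (w j))))\<^sup>2 = (dm w)\<^sup>2"
proof -
 let ?n = "card U"
 define p where "p i = (if i < ?n then inv_into {..<?n} enum (s i) else i)" for i
 have "bij_betw (inv_into {..<?n} enum \<circ> s) {..<?n} {..<?n}"
  using bij_betw_trans[OF s bij_betw_inv_into[OF enum]] .
 hence "bij_betw p {..<?n} {..<?n}"
  by (rule bij_betw_cong[THEN iffD1, rotated]) (simp add: p_def)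
 hence p: "p permutes {0..<?n}"
  unfolding atLeast0LessThan by (rule bij_imp_permutes) (simp add: p_def)
 have e: "enum (p i) = s i" if "i < ?n" for i
  using that s enum by (auto simp: p_def bij_betw_def intro!: f_inv_into_f)
 let ?A = "mat ?n ?n (%(i, j). enum i (w j))"
 have "Determinant.det (mat ?n ?n (%(i, j). ?A $$ (p i, j))) = of_int (sign p) * Determinant.det ?A"
  using det_permute_rows[OF mat_carrier p, of "%(i, j). enum i (w j)"] by simp
 also have "mat ?n ?n (%(i, j). ?A $$ (p i, j)) = mat ?n ?n (%(i, j). s i (w j))"
  using permutes_in_image[OF p] by (intro eq_matI) (auto simp: e)
 moreover have "(of_int (sign p) :: complex)\<^sup>2 = 1" by (simp add: sign_def)
 ultimately show ?thesis by (simp add: dm_def power_mult_distrib)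
qed

text \<open>An automorphism permutes the rows, which changes at most the sign of the determinant.\<close>

lemma dm_square_Fix:
 assumes w: "!!j. j < card U ==> w j : L"
 shows "(dm w)\<^sup>2 : Fix"
proof -
 let ?n = "card U"
 have dL: "dm w : L"
  unfolding dm_def by (rule csubring_det[OF LR mat_carrier]) (simp add: into enum_mem w)
 have "\<tau> ((dm w)\<^sup>2) = (dm w)\<^sup>2" if \<tau>: "\<tau> : U" for \<tau>
 proof -
  have "\<tau> (dm w) = Determinant.det (mat ?n ?n (%(i, j). \<tau> (enum i (w j))))"
   unfolding dm_def by (rule hom_on_det[OF L hom[OF \<tau>]]) (simp add: into enum_mem w)
  also have "mat ?n ?n (%(i, j). \<tau> (enum i (w j))) = mat ?n ?n (%(i, j). compose L \<tau> (enum i) (w j))"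
   by (intro eq_matI) (simp_all add: comp_apply w)
  finally have "\<tau> (dm w) = Determinant.det (mat ?n ?n (%(i, j). compose L \<tau> (enum i) (w j)))" .
  moreover have "bij_betw (%i. compose L \<tau> (enum i)) {..<?n} U"
   using bij_betw_trans[OF enum bij_comp_left[OF \<tau>]] by (simp add: comp_def)
  ultimately have "(\<tau> (dm w))\<^sup>2 = (dm w)\<^sup>2"
   using dm_square_enum[of "%i. compose L \<tau> (enum i)" w] by simp
  thus ?thesis using dL by (simp add: hom_simps(7)[OF \<tau>])
 qed
 thus ?thesis using dL by (auto simp: Fix_def intro: Lcl)
qed

lemma dm_base_change:
 assumes w: "!!j. j < card U ==> w j : L"
  and C: "!!i j. i < card U ==> j < card U ==> C i j : Fix"
  and w': "!!j. j < card U ==> w' j = (\<Sum>k<card U. C k j * w k)"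
 shows "dm w' = dm w * Determinant.det (mat (card U) (card U) (%(i, j). C i j))"
proof -
 let ?n = "card U"
 have "mat ?n ?n (%(i, j). enum i (w' j)) =
  mat ?n ?n (%(i, j). enum i (w j)) * mat ?n ?n (%(i, j). C i j)"
 proof (intro eq_matI)
  fix i j assume "i < dim_row (mat ?n ?n (%(i, j). enum i (w j)) * mat ?n ?n (%(i, j). C i j))"
   "j < dim_col (mat ?n ?n (%(i, j). enum i (w j)) * mat ?n ?n (%(i, j). C i j))"
  hence ij: "i < ?n" "j < ?n" by auto
  have e: "enum i : U" using ij by (simp add: enum_mem)
  have CL: "C k j : L" "enum i (C k j) = C k j" if "k < ?n" for k
   using C[OF that ij(2)] e by (auto simp: Fix_def)
  have "enum i (w' j) = (\<Sum>k<?n. enum i (C k j * w k))"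
   unfolding w'[OF ij(2)] using CL w by (intro hom_on_sum[OF L hom[OF e]]) (auto intro!: Lcl)
  also have "... = (\<Sum>k<?n. enum i (w k) * C k j)"
   using CL w by (intro sum.cong) (auto simp: hom_simps(4)[OF e] mult.commute)
  finally show "mat ?n ?n (%(i, j). enum i (w' j)) $$ (i, j) =
   (mat ?n ?n (%(i, j). enum i (w j)) * mat ?n ?n (%(i, j). C i j)) $$ (i, j)"
   using ij by (simp add: scalar_prod_def atLeast0LessThan)
 qed auto
 thus ?thesis
  unfolding dm_def by (metis det_mult mat_carrier)
qed

lemma dm_powers:
 assumes y: "y : L"
 shows "dm (%j. y ^ j) = (\<Prod>j<card U. \<Prod>i<j. enum j y - enum i y)"
proof -
 have "mat (card U) (card U) (%(i, j). enum i (y ^ j)) = mat (card U) (card U) (%(i, j). enum i y ^ j)"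
  by (intro eq_matI) (auto simp: hom_simps(7)[OF enum_mem y])
 thus ?thesis unfolding dm_def by (simp add: vandermonde_det)
qed

end

text \<open>A number field which is Galois over the rationals, with its full group of automorphisms.\<close>

locale galois_field = aut_group L G for L G +
 assumes full: "hom_on L \<sigma> ==> bij_betw \<sigma> L L ==> \<sigma> : extensional L ==> \<sigma> : G"
  and Fix_Rats: "Fix = \<rat>"
begin

abbreviation "n \<equiv> card G"

lemma Rats_L: "x : \<rat> ==> x : L" using Fix_Rats Fix_subset by blast

lemma denominator: "x : L ==> EX d::int. d > 0 & of_int d * x : \<O>"
proof -
 assume x: "x : L"
 have "EX d::int. d > 0 & (ALL i:{..Polynomial.degree (cpoly x)}. of_int d * poly.coeff (cpoly x) i : \<int>)"
  using cpoly_coeff[OF x] Fix_Rats by (intro common_denominator) auto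
 then obtain d :: int where d: "d > 0" "!!i. i <= Polynomial.degree (cpoly x) ==> of_int d * poly.coeff (cpoly x) i : \<int>"
  by auto
 have "algebraic_int (of_int d * x)"
 proof (rule algebraic_int_scaled[OF cpoly_monic cpoly_self[OF x]])
  show "of_int d * poly.coeff (cpoly x) i : \<int>" for i
   using d(2)[of i] by (cases "i <= Polynomial.degree (cpoly x)") (auto simp: coeff_eq_0)
 qed (use d in simp)
 thus ?thesis using d(1) x by (auto simp: \<O>_def intro!: Lcl)
qed

lemma Int_Fix: "x : \<O> ==> x : Fix ==> x : \<int>"
 using Int_Rats Fix_Rats by simp

lemma dm_square_int: "(!!j. j < n ==> w j : \<O>) ==> (dm w)\<^sup>2 : \<int>"
 by (intro Int_Fix dm_square_Fix) (auto intro!: Int_cl dm_mem_Int dest: Int_L)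

lemma integral_primitive_element: "EX \<alpha>:\<O>. inj_on (%\<sigma>. \<sigma> \<alpha>) G"
proof -
 obtain \<alpha> where \<alpha>: "\<alpha> : L" "inj_on (%\<sigma>. \<sigma> \<alpha>) G" using primitive_element_exists by blast
 obtain d :: int where d: "d > 0" "of_int d * \<alpha> : \<O>" using denominator[OF \<alpha>(1)] by blast
 have "inj_on (%\<sigma>. \<sigma> (of_int d * \<alpha>)) G"
 proof (rule inj_onI)
  fix s t assume st: "s : G" "t : G" "s (of_int d * \<alpha>) = t (of_int d * \<alpha>)"
  hence "of_int d * s \<alpha> = of_int d * t \<alpha>" using \<alpha>(1) by (simp add: hom_simps Lcl)
  hence "s \<alpha> = t \<alpha>" using d(1) by simp
  thus "s = t" using inj_onD[OF \<alpha>(2)] st by blast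
 qed
 thus ?thesis using d(2) by blast
qed

definition is_int_basis :: "(nat => complex) => bool" where
 "is_int_basis w \<longleftrightarrow> (ALL j<n. w j : \<O>) & dm w ~= 0 &
  (ALL x:\<O>. EX c::nat => int. x = (\<Sum>j<n. of_int (c j) * w j))"

text \<open>If some integer had a fractional coordinate, exchanging a basis vector for a combination with
  that fractional part would shrink the discriminant; so a basis of least discriminant is integral.\<close>

lemma int_basis_exists: "EX w. is_int_basis w"
proof -
 define P where "P w \<longleftrightarrow> (ALL j<n. w j : \<O>) & dm w ~= 0" for w
 obtain \<alpha> where \<alpha>: "\<alpha> : \<O>" "inj_on (%\<sigma>. \<sigma> \<alpha>) G" using integral_primitive_element by blast
 have "dm (%j. \<alpha> ^ j) ~= 0"
 proof -
  have inj: "inj_on (%i. enum i \<alpha>) {..<n}"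
   using comp_inj_on[of enum "{..<n}" "%\<sigma>. \<sigma> \<alpha>"] enum \<alpha>(2) by (simp add: bij_betw_def comp_def)
  have "enum j \<alpha> - enum i \<alpha> ~= 0" if "j < n" "i < j" for i j
   using inj_onD[OF inj, of j i] that by auto
  thus ?thesis
   unfolding dm_powers[OF Int_L[OF \<alpha>(1)]] by (simp add: prod_zero_iff)
 qed
 hence "P (%j. \<alpha> ^ j)" unfolding P_def using Int_cl(7)[OF \<alpha>(1)] by simp
 then obtain w where w: "P w" "!!w'. P w' ==> nat \<lfloor>norm ((dm w)\<^sup>2)\<rfloor> <= nat \<lfloor>norm ((dm w')\<^sup>2)\<rfloor>"
  using ex_has_least_nat[of P _ "%w. nat \<lfloor>norm ((dm w)\<^sup>2)\<rfloor>"] by blast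
 have wI: "w j : \<O>" if "j < n" for j using w(1) that by (simp add: P_def)
 have wL: "w j : L" if "j < n" for j using wI that Int_L by blast
 have dw: "dm w ~= 0" using w(1) by (simp add: P_def)
 have "EX c::nat => int. x = (\<Sum>j<n. of_int (c j) * w j)" if x: "x : \<O>" for x
 proof -
  obtain c where c: "!!j. j < n ==> c j : \<rat>" "x = (\<Sum>j<n. c j * w j)"
   using coordinates_in_Fix[OF enum dw[unfolded dm_def] wL Int_L[OF x]] Fix_Rats by auto
  have "c j : \<int>" if "j < n" for j
  proof (rule ccontr)
   assume "c j ~: \<int>"
   define k where "k = (LEAST j. j < n & c j ~: \<int>)"
   have k: "k < n" "c k ~: \<int>"
    using LeastI[of "%j. j < n & c j ~: \<int>" j] \<open>j < n\<close> \<open>c j ~: \<int>\<close> by (auto simp: k_def)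
   have below: "c i : \<int>" if "i < k" for i
    using not_less_Least[of i "%j. j < n & c j ~: \<int>"] that k(1) by (auto simp: k_def)
   obtain r where r: "c k = of_rat r" using c(1)[OF k(1)] by (auto elim: Rats_cases)
   define b where "b i = (if i < k then c i else if i = k then of_int \<lfloor>r\<rfloor> else 0)" for i
   have b: "b i : \<int>" for i using below by (auto simp: b_def)
   define C where "C i j = (if j = k then c i - b i else if i = j then 1 else 0)" for i j
   define w' where "w' j = (if j = k then x - (\<Sum>i<n. b i * w i) else w j)" for j
   have w'I: "w' j : \<O>" if "j < n" for j
   proof -
    have "x - (\<Sum>i<n. b i * w i) : \<O>"
     by (intro Int_cl(4,8,5) x csubring_Ints[OF Int_ring b] wI) auto
    thus ?thesis using wI[OF that] by (simp add: w'_def)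
   qed
   have "dm w' = dm w * Determinant.det (mat n n (%(i, j). C i j))"
   proof (rule dm_base_change[OF wL])
    show "C i j : Fix" if "i < n" "j < n" for i j
     using c(1)[OF that(1)] b[of i] Ints_subset_Rats unfolding C_def Fix_Rats by auto
    show "w' j = (\<Sum>i<n. C i j * w i)" if "j < n" for j
     using that by (auto simp: w'_def C_def c(2) left_diff_distrib sum_subtractf
      if_distrib[of "%x. x * _"] cong: if_cong)
   qed
   also have "Determinant.det (mat n n (%(i, j). C i j)) = prod_list (diag_mat (mat n n (%(i, j). C i j)))"
    by (rule det_lower_triangular[of n]) (auto simp: C_def b_def)
   also have "diag_mat (mat n n (%(i, j). C i j)) = map (%i. if i = k then c k - b k else 1) [0..<n]"
    by (auto simp: diag_mat_def C_def)
   also have "prod_list ... = (\<Prod>i\<in>{..<n}. if i = k then c k - b k else 1)"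
    by (simp add: prod.distinct_set_conv_list[symmetric] atLeast0LessThan)
   also have "... = c k - b k" using k(1) by (simp add: prod.delta)
   finally have dm': "dm w' = dm w * of_rat (frac r)"
    by (simp add: b_def r frac_def of_rat_diff)
   have "r ~: \<int>" using k(2) r by (auto elim!: Ints_cases)
   hence fr: "0 < frac r" "frac r < 1" by (auto simp: frac_gt_0_iff frac_lt_1)
   hence "P w'" unfolding P_def using w'I dw dm' by simp
   moreover have "nat \<lfloor>norm ((dm w')\<^sup>2)\<rfloor> < nat \<lfloor>norm ((dm w)\<^sup>2)\<rfloor>"
   proof -
    obtain z where z: "(dm w)\<^sup>2 = of_int z" using dm_square_int[of w] wI by (auto elim: Ints_cases)
    obtain z' where z': "(dm w')\<^sup>2 = of_int z'" using dm_square_int[of w'] w'I by (auto elim: Ints_cases)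
    have "norm ((dm w')\<^sup>2) = norm ((dm w)\<^sup>2) * (real_of_rat (frac r))\<^sup>2"
    proof -
     have "norm (of_rat (frac r) :: complex) = \<bar>real_of_rat (frac r)\<bar>"
     proof -
      have "(of_rat (frac r) :: complex) = of_real (of_rat (frac r))"
       by (cases "frac r") (simp add: of_rat_rat)
      thus ?thesis by (simp only: norm_of_real)
     qed
     thus ?thesis by (simp add: dm' norm_mult norm_power power_mult_distrib)
    qed
    also have "... < norm ((dm w)\<^sup>2) * 1"
    proof (rule mult_strict_left_mono)
     have "0 < real_of_rat (frac r)" "real_of_rat (frac r) < 1" using fr by (simp_all add: zero_less_of_rat_iff of_rat_less_1_iff)
     thus "(real_of_rat (frac r))\<^sup>2 < 1" by (simp add: power_less_one_iff abs_square_less_1)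
    qed (use dw in simp)
    finally have "\<bar>z'\<bar> < \<bar>z\<bar>" unfolding z z' by (simp flip: of_int_abs)
    moreover have "nat \<lfloor>norm (of_int m :: complex)\<rfloor> = nat \<bar>m\<bar>" for m
     by (simp flip: of_int_abs)
    ultimately show ?thesis unfolding z z' by simp
   qed
   ultimately show False using w(2)[of w'] by linarith
  qed
  hence "ALL j:{..<n}. EX e::int. c j = of_int e" by (auto elim: Ints_cases)
  then obtain e :: "nat => int" where "ALL j:{..<n}. c j = of_int (e j)" by (rule bchoice[THEN exE])
  thus ?thesis using c(2) by (intro exI[of _ e]) simp
 qed
 thus ?thesis unfolding is_int_basis_def using wI dw by blast
qed

lemma int_basis_unique:
 assumes w: "is_int_basis w" and eq: "(\<Sum>j<n. of_int (c j) * w j) = (\<Sum>j<n. of_int (d j) * w j)" and j: "j < n"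
 shows "c j = d j"
proof -
 have "(\<Sum>j<n. enum i (w j) * of_int (c j - d j)) = 0" if "i < n" for i
 proof -
  note e = enum_mem[OF that]
  have wL: "w j : L" if "j < n" for j using w that Int_L by (auto simp: is_int_basis_def)
  have "0 = enum i (\<Sum>j<n. of_int (c j - d j) * w j)"
   using eq by (simp add: left_diff_distrib sum_subtractf hom_simps(2)[OF e])
  also have "... = (\<Sum>j<n. enum i (of_int (c j - d j) * w j))"
   using wL by (intro hom_on_sum[OF L hom[OF e]]) (auto intro!: Lcl)
  also have "... = (\<Sum>j<n. enum i (w j) * of_int (c j - d j))"
   using wL by (intro sum.cong refl, subst hom_simps(4)[OF e]) (auto intro: Lcl simp: hom_simps(9)[OF e] simp del: of_int_diff)
  finally show ?thesis by simp
 qed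
 from nonsingular_system_unique[where a = "%i j. enum i (w j)", OF _ this j] w
 have "(of_int (c j - d j) :: complex) = 0" by (simp add: is_int_basis_def dm_def)
 thus ?thesis by simp
qed

end

section \<open>Prime ideals and their valuations\<close>

definition coset :: "complex set => complex => complex set" where
 "coset I x = (%h. h + x) ` I"

definition additive :: "complex set => bool" where
 "additive I \<longleftrightarrow> 0 : I & (ALL x:I. ALL y:I. x - y : I)"

lemma additiveD:
 assumes "additive I"
 shows "0 : I" "x : I ==> y : I ==> x - y : I" "x : I ==> - x : I" "x : I ==> y : I ==> x + y : I"
proof -
 show *: "0 : I" "x : I ==> y : I ==> x - y : I" for x y using assms by (auto simp: additive_def)
 show **: "x : I ==> - x : I" for x using *(2)[OF *(1), of x] by simp
 show "x : I ==> y : I ==> x + y : I" using *(2)[OF _ **, of x y] by simp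
qed

lemma additive_sum: "additive I ==> (!!i. i : A ==> f i : I) ==> sum f A : I"
 by (induction A rule: infinite_finite_induct) (auto intro: additiveD)

lemma mem_coset_iff: "y : coset I x \<longleftrightarrow> y - x : I"
proof
 assume "y - x : I"
 hence "(y - x) + x : (%h. h + x) ` I" by (rule imageI)
 thus "y : coset I x" by (simp add: coset_def)
qed (auto simp: coset_def)

lemma coset_eq_iff: "additive I ==> coset I x = coset I y \<longleftrightarrow> x - y : I"
proof
 assume I: "additive I"
 {
  assume "coset I x = coset I y"
  moreover have "x : coset I x" using additiveD(1)[OF I] by (simp add: mem_coset_iff)
  ultimately show "x - y : I" by (simp add: mem_coset_iff)
 next
  assume xy: "x - y : I"
  have "z - x : I \<longleftrightarrow> z - y : I" for z
   using additiveD(4)[OF I, of "z - x" "x - y"] additiveD(2)[OF I, of "z - y" "x - y"] xy by auto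
  thus "coset I x = coset I y" by (auto simp: mem_coset_iff)
 }
qed

context galois_field
begin

definition Ideal :: "complex set => bool" where
 "Ideal I \<longleftrightarrow> I <= \<O> & 0 : I & (ALL x:I. ALL y:I. x + y : I) & (ALL x:I. ALL y:\<O>. x * y : I)"

lemma IdealD:
 assumes "Ideal I"
 shows "x : I ==> x : \<O>" "0 : I" "x : I ==> y : I ==> x + y : I"
  "x : I ==> y : \<O> ==> x * y : I" "x : \<O> ==> y : I ==> x * y : I"
  "x : I ==> y : I ==> x - y : I" "x : I ==> - x : I"
proof -
 show *: "x : I ==> x : \<O>" "0 : I" "x : I ==> y : I ==> x + y : I"
  "x : I ==> y : \<O> ==> x * y : I" for x y using assms by (auto simp: Ideal_def)
 show "x : \<O> ==> y : I ==> x * y : I" using *(4)[of y x] by (simp add: mult.commute)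
 show **: "x : I ==> - x : I" for x using *(4)[of x "-1"] Int_cl(6)[OF Int_cl(2)] by simp
 show "x : I ==> y : I ==> x - y : I" using *(3)[OF _ **, of x y] by simp
qed

lemma Ideal_additive: "Ideal I ==> additive I"
 using IdealD(2,6) by (auto simp: additive_def)

text \<open>The zero ideal is excluded, so these are the maximal ideals.\<close>

definition Prime :: "complex set => bool" where
 "Prime B \<longleftrightarrow> Ideal B & B ~= {0} & 1 ~: B &
  (ALL x:\<O>. ALL y:\<O>. x * y : B --> x : B | y : B)"

definition mult_of :: "nat => complex set" where
 "mult_of m = (%x. of_nat m * x) ` \<O>"

lemma mult_of_ideal: "Ideal (mult_of m)"
 unfolding Ideal_def
proof (intro conjI ballI)
 show "mult_of m <= \<O>" unfolding mult_of_def by (auto intro: Int_cl)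
 show "0 : mult_of m" unfolding mult_of_def using imageI[OF Int_cl(1), of "%x. of_nat m * x"] by simp
 fix x assume x: "x : mult_of m"
 {
  fix y assume "y : mult_of m"
  then obtain a b where "a : \<O>" "b : \<O>" "x = of_nat m * a" "y = of_nat m * b"
   using x by (auto simp: mult_of_def)
  thus "x + y : mult_of m"
   unfolding mult_of_def using imageI[of "a + b" \<O> "%x. of_nat m * x"]
   by (simp add: distrib_left Int_cl)
 next
  fix y assume "y : \<O>"
  obtain a where "a : \<O>" "x = of_nat m * a" using x by (auto simp: mult_of_def)
  thus "x * y : mult_of m"
   unfolding mult_of_def using imageI[of "a * y" \<O> "%x. of_nat m * x"] \<open>y : \<O>\<close>
   by (simp add: mult.assoc Int_cl)
 }
qed

lemma card_mod_mult_of: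
 assumes m: "m > 0"
 shows "finite (coset (mult_of m) ` \<O>)" and "card (coset (mult_of m) ` \<O>) = m ^ n"
proof -
 obtain w where w: "is_int_basis w" using int_basis_exists by blast
 have wI: "w j : \<O>" if "j < n" for j using w that by (simp add: is_int_basis_def)
 define F where "F = {..<n} \<rightarrow>\<^sub>E {0..<int m}"
 define g where "g f = coset (mult_of m) (\<Sum>j<n. of_int (f j) * w j)" for f
 have spanI: "(\<Sum>j<n. of_int (f j) * w j) : \<O>" for f
  using wI by (intro Int_cl) auto
 note add = Ideal_additive[OF mult_of_ideal]
 have "bij_betw g F (coset (mult_of m) ` \<O>)"
 proof (rule bij_betwI')
  fix f f' assume f: "f : F" "f' : F"
  show "g f = g f' \<longleftrightarrow> f = f'"
  proof
   assume "g f = g f'"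
   hence "(\<Sum>j<n. of_int (f j) * w j) - (\<Sum>j<n. of_int (f' j) * w j) : mult_of m"
    unfolding g_def coset_eq_iff[OF add] .
   then obtain z where z: "z : \<O>"
    "(\<Sum>j<n. of_int (f j) * w j) - (\<Sum>j<n. of_int (f' j) * w j) = of_nat m * z"
    by (auto simp: mult_of_def)
   obtain e :: "nat => int" where e: "z = (\<Sum>j<n. of_int (e j) * w j)"
    using w z(1) by (auto simp: is_int_basis_def)
   have "(\<Sum>j<n. of_int (f j - f' j) * w j) = (\<Sum>j<n. of_int (int m * e j) * w j)"
    using z(2) by (simp add: e left_diff_distrib sum_subtractf sum_distrib_left mult.assoc)
   from int_basis_unique[OF w this]
   have eq: "f j - f' j = int m * e j" if "j < n" for j using that .
   have "f j = f' j" if "j < n" for j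
   proof -
    have "0 <= f j" "f j < int m" "0 <= f' j" "f' j < int m"
     using f that by (auto simp: F_def PiE_iff)
    moreover have "f j mod int m = f' j mod int m"
     using eq[OF that] by (simp add: mod_eq_dvd_iff)
    ultimately show ?thesis by simp
   qed
   thus "f = f'" using f unfolding F_def by (intro PiE_ext[of f "{..<n}" _ f']) auto
  qed simp
 next
  fix f assume "f : F"
  show "g f : coset (mult_of m) ` \<O>" unfolding g_def using spanI by (rule imageI)
 next
  fix K assume "K : coset (mult_of m) ` \<O>"
  then obtain x where x: "x : \<O>" "K = coset (mult_of m) x" by blast
  obtain c :: "nat => int" where c: "x = (\<Sum>j<n. of_int (c j) * w j)"
   using w x(1) by (auto simp: is_int_basis_def)
  define f where "f = restrict (%j. c j mod int m) {..<n}"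
  have "f : F" using m by (auto simp: F_def f_def)
  moreover have "K = g f"
  proof -
   have "c j = f j + int m * (c j div int m)" if "j < n" for j
    using that by (simp add: f_def)
   hence "of_int (c j) * w j - of_int (f j) * w j = of_nat m * (of_int (c j div int m) * w j)" if "j < n" for j
    using that by (metis (no_types, lifting) add_diff_cancel_left' left_diff_distrib mult.assoc of_int_add of_int_mult of_int_of_nat_eq)
   hence "x - (\<Sum>j<n. of_int (f j) * w j) = of_nat m * (\<Sum>j<n. of_int (c j div int m) * w j)"
    unfolding c sum_subtractf[symmetric] sum_distrib_left by (intro sum.cong) auto
   hence "x - (\<Sum>j<n. of_int (f j) * w j) : mult_of m"
    unfolding mult_of_def using imageI[OF spanI] by simp
   thus ?thesis unfolding x g_def coset_eq_iff[OF add] .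
  qed
  ultimately show "EX f:F. K = g f" by blast
 qed
 moreover have "finite F" "card F = m ^ n" by (auto simp: F_def finite_PiE card_PiE)
 ultimately show "finite (coset (mult_of m) ` \<O>)" "card (coset (mult_of m) ` \<O>) = m ^ n"
  using bij_betw_finite bij_betw_same_card by fastforce+
qed

lemma powers_mod_mult_of:
 assumes m: "m > 0" and s: "s : \<O>"
 shows "EX i l. l > 0 & s ^ i * (s ^ l - 1) : mult_of m"
proof -
 have "finite ((%i. coset (mult_of m) (s ^ i)) ` UNIV)"
  by (rule finite_subset[OF _ card_mod_mult_of(1)[OF m]]) (auto intro: Int_cl s)
 hence "~ inj (%i. coset (mult_of m) (s ^ i))" using finite_imageD by fastforce
 then obtain a b where ab: "coset (mult_of m) (s ^ a) = coset (mult_of m) (s ^ b)" "a ~= b"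
  by (auto simp: inj_def)
 define i j where "i = min a b" and "j = max a b"
 have ij: "i < j" "coset (mult_of m) (s ^ j) = coset (mult_of m) (s ^ i)"
  using ab by (auto simp: i_def j_def min_def max_def)
 hence "s ^ j - s ^ i : mult_of m"
  using coset_eq_iff[OF Ideal_additive[OF mult_of_ideal]] by blast
 moreover have "s ^ j - s ^ i = s ^ i * (s ^ (j - i) - 1)"
  using ij(1) by (simp add: right_diff_distrib flip: power_add)
 ultimately show ?thesis using ij(1) by (intro exI[of _ i] exI[of _ "j - i"]) auto
qed

lemma integer_multiple:
 assumes x: "x : \<O>" "x ~= 0"
 shows "EX m::nat. m > 0 & (EX y:\<O>. of_nat m = x * y)"
proof -
 define y where "y = (\<Prod>\<sigma>\<in>G - {restrict id L}. \<sigma> x)"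
 have "(\<Prod>\<sigma>\<in>G. \<sigma> x) = x * y"
  using prod.remove[OF fin id_mem, of "%\<sigma>. \<sigma> x"] Int_L[OF x(1)] by (simp add: y_def)
 moreover have "(\<Prod>\<sigma>\<in>G. \<sigma> x) : \<int>"
 proof (rule Int_Fix[OF _ norm_mem[OF Int_L[OF x(1)]]])
  show "(\<Prod>\<sigma>\<in>G. \<sigma> x) : \<O>" by (rule Int_cl(9)) (rule Int_into[OF _ x(1)])
 qed
 ultimately obtain z where z: "x * y = of_int z" by (auto elim: Ints_cases)
 have yI: "y : \<O>" unfolding y_def by (rule Int_cl(9)) (simp add: Int_into[OF _ x(1)])
 have "y ~= 0"
  unfolding y_def using fin x(2) hom_simps(13)[OF _ Int_L[OF x(1)]] by simp
 hence "z ~= 0" using z x(2) by auto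
 thus ?thesis
 proof (cases "z > 0")
  case True
  hence "of_nat (nat z) = x * y" using z by (simp add: of_nat_nat)
  thus ?thesis using yI True by (intro exI[of _ "nat z"] conjI bexI[of _ y]) simp_all
 next
  case False
  hence "of_nat (nat (- z)) = x * (- y)" using z by (simp add: of_nat_nat)
  thus ?thesis using yI False \<open>z ~= 0\<close> by (intro exI[of _ "nat (- z)"] conjI bexI[of _ "- y"]) (auto intro: Int_cl)
 qed
qed

context
 fixes B :: "complex set"
 assumes B: "Prime B"
begin

lemma PrimeD:
 shows "Ideal B" "1 ~: B"
  "x : \<O> ==> y : \<O> ==> x * y : B ==> x : B | y : B"
 using B by (auto simp: Prime_def)

lemma Prime_power: "x : \<O> ==> x ^ k : B ==> x : B"
 by (induction k) (use PrimeD(2,3) Int_cl(7) in auto)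

lemma Prime_prod: "finite A ==> (!!a. a : A ==> f a : \<O>) ==> prod f A : B ==> EX a:A. f a : B"
proof (induction A rule: finite_induct)
 case (insert a A)
 thus ?case using PrimeD(3)[of "f a" "prod f A"] Int_cl(9)[of A f] by auto
qed (use PrimeD(2) in auto)

definition residue_char :: nat where
 "residue_char = (LEAST m. m > 0 & of_nat m : B)"

lemma residue_char: "residue_char > 0" "of_nat residue_char : B"
proof -
 obtain x where x: "x : B" "x ~= 0" using B by (auto simp: Prime_def Ideal_def)
 obtain m y where m: "m > 0" "y : \<O>" "of_nat m = x * y"
  using integer_multiple[OF IdealD(1)[OF PrimeD(1) x(1)] x(2)] by blast
 hence "of_nat m : B" using IdealD(4)[OF PrimeD(1) x(1) m(2)] by simp
 hence "residue_char > 0 & of_nat residue_char : B"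
  unfolding residue_char_def using m(1) LeastI[where P = "%m. m > 0 & of_nat m : B" and k = m] by simp
 thus "residue_char > 0" "of_nat residue_char : B" by auto
qed

lemma of_nat_mem_iff: "of_nat m : B \<longleftrightarrow> residue_char dvd m"
proof
 assume m: "of_nat m : B"
 let ?p = "residue_char"
 have "(of_nat m :: complex) = of_nat (m mod ?p) + of_nat ?p * of_nat (m div ?p)"
  by (metis mod_mult_div_eq of_nat_add of_nat_mult)
 hence "(of_nat (m mod ?p) :: complex) = of_nat m - of_nat ?p * of_nat (m div ?p)" by simp
 also have "... : B"
  by (intro IdealD(4,6)[OF PrimeD(1)] residue_char m Int_cl)
 finally have "of_nat (m mod ?p) : B" .
 moreover have "~ (m mod ?p > 0 & of_nat (m mod ?p) : B)"
  using not_less_Least[of "m mod ?p" "%m. m > 0 & of_nat m : B", folded residue_char_def]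
   mod_less_divisor[OF residue_char(1), of m] by simp
 ultimately have "~ 0 < m mod ?p" by simp
 thus "?p dvd m" by auto
next
 assume "residue_char dvd m"
 then obtain k where "m = residue_char * k" by auto
 thus "of_nat m : B" using IdealD(4)[OF PrimeD(1) residue_char(2) Int_cl(10)] by simp
qed

lemma of_int_mem_iff: "of_int m : B \<longleftrightarrow> int residue_char dvd m"
proof (cases m rule: int_cases2)
 case (nonneg k)
 thus ?thesis using of_nat_mem_iff[of k] by simp
next
 case (nonpos k)
 have "- (of_nat k) : B \<longleftrightarrow> of_nat k : B" using IdealD(7)[OF PrimeD(1)] by fastforce
 thus ?thesis using of_nat_mem_iff[of k] nonpos by simp
qed

lemma residue_char_prime: "Factorial_Ring.prime residue_char"
proof (rule prime_natI)
 have "residue_char ~= 1" using residue_char(2) PrimeD(2) by auto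
 thus "residue_char >= 2" using residue_char(1) by linarith
next
 fix a b assume "residue_char dvd a * b"
 hence "of_nat a * of_nat b : B" using of_nat_mem_iff[of "a * b"] by simp
 thus "residue_char dvd a | residue_char dvd b"
  using PrimeD(3)[OF Int_cl(10) Int_cl(10)] of_nat_mem_iff by blast
qed

lemma mult_of_subset: "mult_of residue_char <= B"
 unfolding mult_of_def using IdealD(4)[OF PrimeD(1) residue_char(2)] by auto

lemma residue_field_finite: "finite (coset B ` \<O>)"
proof -
 note addp = Ideal_additive[OF mult_of_ideal] and addB = Ideal_additive[OF PrimeD(1)]
 define rep where "rep K = (SOME x. x : \<O> & K = coset (mult_of residue_char) x)" for K
 have "coset B ` \<O> <= (%K. coset B (rep K)) ` (coset (mult_of residue_char) ` \<O>)"
 proof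
  fix M assume "M : coset B ` \<O>"
  then obtain x where x: "x : \<O>" "M = coset B x" by blast
  let ?K = "coset (mult_of residue_char) x"
  have "rep ?K : \<O> & ?K = coset (mult_of residue_char) (rep ?K)"
   unfolding rep_def by (rule someI[of _ x]) (use x in simp)
  hence "x - rep ?K : B" using coset_eq_iff[OF addp] mult_of_subset by blast
  hence "M = coset B (rep ?K)" using x coset_eq_iff[OF addB] by blast
  thus "M : (%K. coset B (rep K)) ` (coset (mult_of residue_char) ` \<O>)" using x by blast
 qed
 thus ?thesis using card_mod_mult_of(1)[OF residue_char(1)] by (meson finite_imageI finite_subset)
qed

lemma power_cong_one:
 assumes s: "s : \<O>" "s ~: B"
 shows "EX l>0. s ^ l - 1 : B"
proof -
 obtain i l where l: "l > 0" "s ^ i * (s ^ l - 1) : mult_of residue_char"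
  using powers_mod_mult_of[OF residue_char(1) s(1)] by blast
 hence "s ^ i * (s ^ l - 1) : B" using mult_of_subset by blast
 moreover have "s ^ i ~: B" using Prime_power s by blast
 ultimately show ?thesis using PrimeD(3)[OF Int_cl(7)[OF s(1)] Int_cl(4)[OF Int_cl(7)[OF s(1)] Int_cl(2)]] l(1) by blast
qed

text \<open>Residue rings are finite, so some power of \<open>s\<close> is congruent to 1.\<close>

lemma inverse_mod:
 assumes s: "s : \<O>" "s ~: B"
 shows "EX c:\<O>. c * s - 1 : B"
proof -
 obtain l where "l > 0" "s ^ l - 1 : B" using power_cong_one[OF s] by blast
 hence "s ^ (l - 1) * s - 1 : B" using power_minus_mult[of l s] by simp
 thus ?thesis using Int_cl(7)[OF s(1)] by blast
qed

text \<open>\<open>B\<close> is a finitely generated abelian group, because it contains the lattice of multiples of its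
  residue characteristic with finite index; so whatever maps \<open>B\<close> into itself is integral.\<close>

lemma stabilizer_integral:
 assumes "\<gamma> : L" "!!b. b : B ==> \<gamma> * b : B"
 shows "\<gamma> : \<O>"
proof -
 let ?p = "residue_char"
 obtain w where w: "is_int_basis w" using int_basis_exists by blast
 define \<K> where "\<K> = {K : coset (mult_of ?p) ` \<O>. K Int B ~= {}}"
 define rep where "rep K = (SOME x. x : K Int B)" for K
 have rep: "rep K : K Int B" if "K : \<K>" for K
 proof -
  have "EX x. x : K Int B" using that by (auto simp: \<K>_def)
  thus ?thesis unfolding rep_def by (rule someI_ex)
 qed
 define S where "S = (%j. of_nat ?p * w j) ` {..<n} Un rep ` \<K>"
 have finS: "finite S"
  unfolding S_def \<K>_def using card_mod_mult_of(1)[OF residue_char(1)] by simp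
 have SB: "s : B" if "s : S" for s
  using that rep w IdealD(4)[OF PrimeD(1) residue_char(2)] by (auto simp: S_def is_int_basis_def)
 have span: "b : int_span S" if b: "b : B" for b
 proof -
  let ?K = "coset (mult_of ?p) b"
  have "b : ?K" by (simp add: mem_coset_iff IdealD(2)[OF mult_of_ideal])
  hence K: "?K : \<K>" using b IdealD(1)[OF PrimeD(1)] by (auto simp: \<K>_def)
  have "rep ?K - b : mult_of ?p" using rep[OF K] by (simp add: mem_coset_iff)
  then obtain z where z: "z : \<O>" "rep ?K - b = of_nat ?p * z" by (auto simp: mult_of_def)
  obtain c :: "nat => int" where c: "z = (\<Sum>j<n. of_int (c j) * w j)"
   using w z(1) by (auto simp: is_int_basis_def)
  have "b = rep ?K + (\<Sum>j<n. of_int (- c j) * (of_nat ?p * w j))"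
   using z(2) by (simp add: c sum_negf sum_distrib_left mult_ac algebra_simps)
  moreover have "... : int_span S"
   using K by (intro int_span_add int_span_sum int_span_scale int_span_base[OF finS]) (auto simp: S_def)
  ultimately show ?thesis by simp
 qed
 have "EX s0:S. s0 ~= 0"
 proof (rule ccontr)
  assume "~ (EX s0:S. s0 ~= 0)"
  hence "int_span S <= {0}" by (auto simp: int_span_def)
  thus False using span[OF residue_char(2)] residue_char(1) by auto
 qed
 then obtain s0 where "s0 : S" "s0 ~= 0" by blast
 hence "algebraic_int \<gamma>"
  using assms(2) SB span by (intro algebraic_int_if_int_span_stable[OF finS]) auto
 thus ?thesis using assms(1) by (simp add: \<O>_def)
qed

text \<open>In the finite ring of residues modulo \<open>residue_char\<close>, localised at \<open>B\<close>, an element generating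
  a minimal nonzero ideal is annihilated by \<open>B\<close>.\<close>

lemma socle_element: "EX \<beta>:\<O>. \<beta> ~: mult_of residue_char & (ALL b:B. \<beta> * b : mult_of residue_char)"
proof -
 let ?M = "mult_of residue_char"
 note M = IdealD[OF mult_of_ideal[of residue_char]] and addM = Ideal_additive[OF mult_of_ideal[of residue_char]]
 define J where "J = {x : \<O>. EX s:\<O> - B. s * x : ?M}"
 have "1 ~: J" using mult_of_subset by (auto simp: J_def)
 define f where "f y = card ((%x. coset ?M (y * x)) ` \<O>)" for y
 define P where "P y \<longleftrightarrow> y : \<O> & y ~: J" for y
 have "P 1" using \<open>1 ~: J\<close> Int_cl(2) by (simp add: P_def)
 then obtain y where y: "P y" "!!z. P z ==> f y <= f z"
  using ex_has_least_nat[of P 1 f] by blast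
 have yI: "y : \<O>" using y(1) by (simp add: P_def)
 have yB: "y * b : J" if b: "b : B" for b
 proof (rule ccontr)
  have bI: "b : \<O>" using b IdealD(1)[OF PrimeD(1)] by blast
  assume "y * b ~: J"
  hence "P (y * b)" using yI bI by (simp add: P_def Int_cl)
  hence le: "f y <= f (y * b)" by (rule y(2))
  have sub: "(%x. coset ?M (y * b * x)) ` \<O> <= (%x. coset ?M (y * x)) ` \<O>"
   using bI by (auto simp: mult.assoc intro!: imageI Int_cl)
  have fin: "finite ((%x. coset ?M (y * x)) ` \<O>)"
   using yI by (intro finite_subset[OF _ card_mod_mult_of(1)[OF residue_char(1)]]) (auto intro: Int_cl)
  have "(%x. coset ?M (y * b * x)) ` \<O> = (%x. coset ?M (y * x)) ` \<O>"
   using card_seteq[OF fin sub] le by (simp add: f_def)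
  hence "coset ?M (y * 1) : (%x. coset ?M (y * b * x)) ` \<O>" using Int_cl(2) by blast
  then obtain c where c: "c : \<O>" "coset ?M (y * 1) = coset ?M (y * b * c)" by blast
  hence "y - y * b * c : ?M" using coset_eq_iff[OF addM] by simp
  hence "(1 - b * c) * y : ?M" by (simp add: algebra_simps)
  moreover have "1 - b * c ~: B"
  proof
   assume "1 - b * c : B"
   hence "1 - b * c + b * c : B" by (intro IdealD(3,4)[OF PrimeD(1)] b c)
   thus False using PrimeD(2) by simp
  qed
  moreover have "1 - b * c : \<O>" using bI c by (intro Int_cl)
  ultimately have "y : J" using yI by (auto simp: J_def)
  thus False using y(1) by (simp add: P_def)
 qed
 have "ALL b. b : B --> (EX s. s : \<O> & s ~: B & s * (y * b) : ?M)"
  using yB by (auto simp: J_def)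
 then obtain s where s: "!!b. b : B ==> s b : \<O> & s b ~: B & s b * (y * b) : ?M"
  by metis
 define rep where "rep K = (SOME x. x : K Int B)" for K
 define \<K> where "\<K> = {K : coset ?M ` \<O>. K Int B ~= {}}"
 have rep: "rep K : K Int B" if "K : \<K>" for K
 proof -
  have "EX x. x : K Int B" using that by (auto simp: \<K>_def)
  thus ?thesis unfolding rep_def by (rule someI_ex)
 qed
 have fin\<K>: "finite \<K>" unfolding \<K>_def using card_mod_mult_of(1)[OF residue_char(1)] by simp
 define s0 where "s0 = (\<Prod>K\<in>\<K>. s (rep K))"
 have s0: "s0 : \<O>" "s0 ~: B"
 proof -
  show "s0 : \<O>" unfolding s0_def using s rep by (intro Int_cl) auto
  show "s0 ~: B"
  proof
   assume "s0 : B"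
   hence "EX K:\<K>. s (rep K) : B"
    unfolding s0_def using s rep fin\<K> by (intro Prime_prod) auto
   thus False using s rep by auto
  qed
 qed
 have "s0 * y * b : ?M" if b: "b : B" for b
 proof -
  let ?K = "coset ?M b"
  have bI: "b : \<O>" using b IdealD(1)[OF PrimeD(1)] by blast
  have "b : ?K" by (simp add: mem_coset_iff M(2))
  hence K: "?K : \<K>" using b bI by (auto simp: \<K>_def)
  have sp: "s0 = (\<Prod>K\<in>\<K> - {?K}. s (rep K)) * s (rep ?K)"
   unfolding s0_def using prod.remove[OF fin\<K> K, of "%K. s (rep K)"] by (simp add: mult.commute)
  have "(\<Prod>K\<in>\<K> - {?K}. s (rep K)) : \<O>" using s rep by (intro Int_cl) auto
  moreover have "s (rep ?K) * (y * rep ?K) : ?M" using s[of "rep ?K"] rep[OF K] by auto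
  ultimately have "(\<Prod>K\<in>\<K> - {?K}. s (rep K)) * (s (rep ?K) * (y * rep ?K)) : ?M" by (rule M(5))
  hence 1: "s0 * y * rep ?K : ?M" by (simp add: sp mult.assoc)
  have "rep ?K - b : ?M" using rep[OF K] by (simp add: mem_coset_iff)
  hence "s0 * y * (rep ?K - b) : ?M" by (intro M(5) Int_cl s0 yI)
  hence "s0 * y * rep ?K - s0 * y * (rep ?K - b) : ?M" by (intro M(6) 1)
  thus ?thesis by (simp add: algebra_simps)
 qed
 moreover have "s0 * y ~: ?M"
 proof
  assume "s0 * y : ?M"
  hence "y : J" using s0 yI by (auto simp: J_def)
  thus False using y(1) by (simp add: P_def)
 qed
 ultimately show ?thesis using s0(1) yI by (intro bexI[of _ "s0 * y"]) (auto intro: Int_cl)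
qed

text \<open>The fractional ideal inverse to \<open>B\<close> contains some \<open>\<gamma>\<close> not stabilising \<open>B\<close>; any \<open>\<pi>\<close> in \<open>B\<close> with
  \<open>\<gamma> * \<pi>\<close> outside \<open>B\<close> generates \<open>B\<close> locally.\<close>

lemma uniformizer_exists:
 "EX \<pi>:B. EX u:\<O>. u ~: B & (ALL x:B. EX c:\<O>. u * x = c * \<pi>)"
proof -
 let ?p = "residue_char"
 obtain \<beta> where \<beta>: "\<beta> : \<O>" "\<beta> ~: mult_of ?p" "ALL b:B. \<beta> * b : mult_of ?p"
  using socle_element by blast
 define \<gamma> where "\<gamma> = \<beta> / of_nat ?p"
 have p0: "(of_nat ?p :: complex) ~= 0" using residue_char(1) by simp
 have \<gamma>L: "\<gamma> : L" unfolding \<gamma>_def using \<beta>(1) Int_L by (intro Lcl) auto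
 have \<gamma>B: "\<gamma> * b : \<O>" if b: "b : B" for b
 proof -
  have "\<beta> * b : mult_of ?p" using \<beta>(3) b by blast
  then obtain z where "z : \<O>" "\<beta> * b = of_nat ?p * z" by (auto simp: mult_of_def)
  thus ?thesis using p0 by (simp add: \<gamma>_def)
 qed
 have "\<gamma> ~: \<O>"
 proof
  assume "\<gamma> : \<O>"
  hence "of_nat ?p * \<gamma> : mult_of ?p" unfolding mult_of_def by (rule imageI)
  thus False using \<beta>(2) p0 by (simp add: \<gamma>_def)
 qed
 then obtain \<pi> where \<pi>: "\<pi> : B" "\<gamma> * \<pi> ~: B" using stabilizer_integral[OF \<gamma>L] by blast
 show ?thesis
 proof (rule bexI[of _ \<pi>], rule bexI[of _ "\<gamma> * \<pi>"], intro conjI ballI)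
  show "EX c:\<O>. \<gamma> * \<pi> * x = c * \<pi>" if "x : B" for x
   using \<gamma>B[OF that] by (intro bexI[of _ "\<gamma> * x"]) simp_all
 qed (use \<pi> \<gamma>B in simp_all)
qed

end

end

section \<open>Localization and valuations\<close>

lemma prime_power_cofactor:
 fixes p m :: nat
 assumes "Factorial_Ring.prime p" "m > 0"
 shows "EX a m'. m = p ^ a * m' & ~ p dvd m'"
proof -
 have "m ~= 0" "~ is_unit p" using assms not_prime_unit by auto
 from multiplicity_decompose'[OF this] show ?thesis by metis
qed

context galois_field
begin

text \<open>A generator of \<open>B\<close> in the localization at \<open>B\<close>: every element of \<open>B\<close> becomes a multiple of it
  after multiplication by some \<open>u\<close> outside \<open>B\<close>.\<close>

definition unif :: "complex set => complex" where
 "unif B = (SOME \<pi>. \<pi> : B & (EX u:\<O>. u ~: B & (ALL x:B. EX c:\<O>. u * x = c * \<pi>)))"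

definition loc :: "complex set => complex set" where
 "loc B = {a / s |a s. a : \<O> & s : \<O> & s ~: B}"

definition lunit :: "complex set => complex set" where
 "lunit B = {a / s |a s. a : \<O> & a ~: B & s : \<O> & s ~: B}"

text \<open>Every nonzero element of \<open>L\<close> is a power of the uniformizer times a unit of the localization. At 0
  the value is arbitrary, so statements about it single out 0, as in \<open>V\<close>, the powers of the maximal
  ideal.\<close>

definition val :: "complex set => complex => int" where
 "val B x = (THE m. EX u:lunit B. x = unif B powi m * u)"

definition V :: "complex set => int => complex set" where
 "V B N = {x : L. x = 0 | val B x >= N}"

context
 fixes B :: "complex set"
 assumes B: "Prime B"
begin

lemmas BI = IdealD[OF PrimeD(1)[OF B]]

lemma B_nonzero: "s ~: B ==> s ~= 0"
 using BI(2) by blast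

lemma B_mult: "s : \<O> ==> t : \<O> ==> s ~: B ==> t ~: B ==> s * t ~: B"
 using PrimeD(3)[OF B] by blast

lemma locI: "a : \<O> ==> s : \<O> ==> s ~: B ==> a / s : loc B"
 unfolding loc_def by blast

lemma lunitI: "a : \<O> ==> a ~: B ==> s : \<O> ==> s ~: B ==> a / s : lunit B"
 unfolding lunit_def by blast

lemma Int_loc: "a : \<O> ==> a : loc B"
 using locI[OF _ Int_cl(2) PrimeD(2)[OF B], of a] by simp

lemma Int_lunit: "a : \<O> ==> a ~: B ==> a : lunit B"
 using lunitI[OF _ _ Int_cl(2) PrimeD(2)[OF B], of a] by simp

lemma lunit_subset_loc: "u : lunit B ==> u : loc B"
 unfolding lunit_def loc_def by blast

lemma loc_ring: "csubring (loc B)"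
 unfolding csubring_def
proof (intro conjI ballI)
 show "0 : loc B" "1 : loc B" using Int_loc Int_cl(1,2) by blast+
 fix x y assume "x : loc B" "y : loc B"
 then obtain a s b t where a: "a : \<O>" "s : \<O>" "s ~: B" "x = a / s"
  and b: "b : \<O>" "t : \<O>" "t ~: B" "y = b / t"
  unfolding loc_def by blast
 have st: "s * t : \<O>" "s * t ~: B" "s ~= 0" "t ~= 0"
  using a b B_mult B_nonzero Int_cl(5) by blast+
 have "x + y = (a * t + b * s) / (s * t)" "x - y = (a * t - b * s) / (s * t)" "x * y = (a * b) / (s * t)"
  using st by (simp_all add: a b field_simps)
 moreover have "(a * t + b * s) / (s * t) : loc B" "(a * t - b * s) / (s * t) : loc B" "(a * b) / (s * t) : loc B"
  by (intro locI st Int_cl a b)+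
 ultimately show "x + y : loc B" "x - y : loc B" "x * y : loc B" by simp_all
qed

lemmas loc_cl = csubringD[OF loc_ring] csubring_uminus[OF loc_ring] csubring_power[OF loc_ring]
 csubring_sum[OF loc_ring] csubring_prod[OF loc_ring]

lemma loc_L: "x : loc B ==> x : L"
 unfolding loc_def using Int_L Lcl(13) by fastforce

lemma lunit_nonzero: "u : lunit B ==> u ~= 0"
 unfolding lunit_def using B_nonzero by auto

lemma lunit_mult: "u : lunit B ==> w : lunit B ==> u * w : lunit B"
proof -
 assume "u : lunit B" "w : lunit B"
 then obtain a s b t where a: "a : \<O>" "a ~: B" "s : \<O>" "s ~: B" "u = a / s"
  and b: "b : \<O>" "b ~: B" "t : \<O>" "t ~: B" "w = b / t"
  unfolding lunit_def by blast
 have "(a * b) / (s * t) : lunit B"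
  using a b by (intro lunitI Int_cl B_mult) auto
 thus ?thesis by (simp add: a b)
qed

lemma lunit_inverse: "u : lunit B ==> inverse u : lunit B"
proof -
 assume "u : lunit B"
 then obtain a s where a: "a : \<O>" "a ~: B" "s : \<O>" "s ~: B" "u = a / s"
  unfolding lunit_def by blast
 have "s / a : lunit B" by (rule lunitI[OF a(3,4,1,2)])
 thus ?thesis by (simp add: a)
qed

lemma lunit_one: "1 : lunit B"
 by (rule Int_lunit[OF Int_cl(2) PrimeD(2)[OF B]])

lemma unif: "unif B : B" "EX u:\<O>. u ~: B & (ALL x:B. EX c:\<O>. u * x = c * unif B)"
proof -
 have "EX \<pi>. \<pi> : B & (EX u:\<O>. u ~: B & (ALL x:B. EX c:\<O>. u * x = c * \<pi>))"
  using uniformizer_exists[OF B] by blast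
 from someI_ex[OF this, folded unif_def]
 show "unif B : B" "EX u:\<O>. u ~: B & (ALL x:B. EX c:\<O>. u * x = c * unif B)" by auto
qed

lemma unif_Int: "unif B : \<O>"
 using unif(1) BI(1) by blast

lemma loc_cases: "x : loc B ==> x : lunit B | (EX r:loc B. x = unif B * r)"
proof -
 assume "x : loc B"
 then obtain a s where a: "a : \<O>" "s : \<O>" "s ~: B" "x = a / s" unfolding loc_def by blast
 show ?thesis
 proof (cases "a : B")
  case False
  thus ?thesis using lunitI a by blast
 next
  case True
  obtain u where u: "u : \<O>" "u ~: B" "ALL x:B. EX c:\<O>. u * x = c * unif B" using unif(2) by blast
  then obtain c where c: "c : \<O>" "u * a = c * unif B" using True by blast
  have "x = unif B * (c / (u * s))"
   using c(2) B_nonzero[OF u(2)] B_nonzero[OF a(3)] by (simp add: a(4) field_simps)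
  moreover have "c / (u * s) : loc B" using c u a by (intro locI Int_cl B_mult) auto
  ultimately show ?thesis by blast
 qed
qed

lemma unif_mult_not_lunit: "r : loc B ==> unif B * r ~: lunit B"
proof
 assume "r : loc B" "unif B * r : lunit B"
 then obtain a s b t where a: "a : \<O>" "s : \<O>" "s ~: B" "r = a / s"
  and b: "b : \<O>" "b ~: B" "t : \<O>" "t ~: B" "unif B * r = b / t"
  unfolding loc_def lunit_def by blast
 have "unif B * (a * t) = b * s"
  using b(5) B_nonzero[OF b(4)] B_nonzero[OF a(3)] by (simp add: a(4) field_simps)
 moreover have "unif B * (a * t) : B" by (intro BI(4) unif Int_cl a b)
 ultimately have "b * s : B" by simp
 thus False using B_mult[of b s] a b by blast
qed

text \<open>Division by the uniformizer must stop: a power of it is divisible by \<open>p\<close> locally, since the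
  powers of an integer repeat modulo \<open>p\<close>, hence another one is divisible by \<open>x\<close>, and \<open>x\<close> is not divisible
  by a higher one.\<close>

lemma nonzero_rep_Int:
 assumes x: "x : \<O>" "x ~= 0"
 shows "EX k::nat. EX u:lunit B. x = unif B ^ k * u"
proof -
 let ?\<pi> = "unif B" and ?p = "residue_char B"
 define D where "D k \<longleftrightarrow> (EX r:loc B. x = ?\<pi> ^ k * r)" for k
 obtain m y where m: "m > 0" "y : \<O>" "of_nat m = x * y" using integer_multiple[OF x] by blast
 obtain a m' where am: "m = ?p ^ a * m'" "~ ?p dvd m'"
  using prime_power_cofactor[OF residue_char_prime[OF B] m(1)] by blast
 obtain i l where il: "l > 0" "?\<pi> ^ i * (?\<pi> ^ l - 1) : mult_of ?p"
  using powers_mod_mult_of[OF residue_char(1)[OF B] unif_Int] by blast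
 then obtain z where z: "z : \<O>" "?\<pi> ^ i * (?\<pi> ^ l - 1) = of_nat ?p * z" by (auto simp: mult_of_def)
 have \<pi>l: "?\<pi> ^ l - 1 ~: B" "?\<pi> ^ l - 1 : \<O>"
 proof
  assume "?\<pi> ^ l - 1 : B"
  moreover have "?\<pi> ^ l : B"
   using BI(4)[OF unif(1) Int_cl(7)[OF unif_Int, of "l - 1"]] il(1) by (cases l) auto
  ultimately have "?\<pi> ^ l - (?\<pi> ^ l - 1) : B" by (rule BI(6)[rotated])
  thus False using PrimeD(2)[OF B] by simp
 qed (intro Int_cl unif_Int)
 define r where "r = z / (?\<pi> ^ l - 1)"
 have r: "r : loc B" "?\<pi> ^ i = of_nat ?p * r"
  using z \<pi>l B_nonzero[OF \<pi>l(1)] by (auto simp: r_def field_simps intro!: locI)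
 have m'0: "of_nat m' ~: B" using of_nat_mem_iff[OF B] am(2) by simp
 define t where "t = y / of_nat m' * r ^ a"
 have eq: "?\<pi> ^ (i * a) = x * t"
 proof -
  have "?\<pi> ^ (i * a) = of_nat ?p ^ a * r ^ a" by (simp add: power_mult r(2) power_mult_distrib)
  also have "... = of_nat m / of_nat m' * r ^ a"
   using B_nonzero[OF m'0] by (simp add: am(1))
  finally show ?thesis by (simp add: m(3) t_def)
 qed
 have "~ D (i * a + 1)"
 proof
  assume "D (i * a + 1)"
  then obtain r' where r': "r' : loc B" "x = ?\<pi> ^ (i * a + 1) * r'" unfolding D_def by blast
  have \<pi>0: "?\<pi> ~= 0" using r' x by auto
  have "?\<pi> ^ (i * a) * 1 = ?\<pi> ^ (i * a) * (?\<pi> * (r' * t))"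
   using eq unfolding r'(2) by (simp add: mult_ac)
  moreover have "?\<pi> ^ (i * a) ~= 0" using \<pi>0 by simp
  ultimately have "?\<pi> * (r' * t) = 1" using mult_left_cancel by metis
  hence "unif B * (r' * t) : lunit B" using lunit_one by (rule ssubst)
  moreover have "r' * t : loc B"
   unfolding t_def
   by (rule loc_cl(5)[OF r'(1) loc_cl(5)[OF locI[OF m(2) Int_cl(10) m'0] loc_cl(7)[OF r(1)]]])
  ultimately show False using unif_mult_not_lunit[of "r' * t"] by blast
 qed
 define N where "N = (LEAST N. ~ D N)"
 have N: "~ D N"
  unfolding N_def using \<open>~ D (i * a + 1)\<close> by (rule LeastI)
 have N': "D k" if "k < N" for k
  using not_less_Least[of k "%N. ~ D N"] that unfolding N_def by blast
 have "D 0" unfolding D_def using Int_loc[OF x(1)] by auto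
 then obtain k where k: "N = Suc k" using N by (cases N) auto
 obtain r where r: "r : loc B" "x = ?\<pi> ^ k * r" using N'[of k] k unfolding D_def by auto
 have "r : lunit B"
 proof (rule ccontr)
  assume "r ~: lunit B"
  then obtain r' where "r' : loc B" "r = ?\<pi> * r'" using loc_cases[OF r(1)] by blast
  hence "D N" unfolding D_def k using r(2) by (intro bexI[of _ r']) (auto simp: mult.assoc)
  thus False using N by simp
 qed
 thus ?thesis using r(2) by blast
qed

lemma unif_nonzero: "unif B ~= 0"
proof
 assume 0: "unif B = 0"
 obtain k :: nat and u where "u : lunit B" "of_nat (residue_char B) = unif B ^ k * u"
  using nonzero_rep_Int[OF Int_cl(10)] residue_char(1)[OF B] by (metis of_nat_0_less_iff of_nat_eq_0_iff less_numeral_extra(3))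
 hence "of_nat (residue_char B) : lunit B" using 0 residue_char(1)[OF B] by (cases k) auto
 moreover obtain u where "u : \<O>" "u ~: B" "ALL x:B. EX c:\<O>. u * x = c * unif B" using unif(2) by blast
 hence "of_nat (residue_char B) = (0::complex)" using 0 residue_char(2)[OF B] B_nonzero by auto
 ultimately show False using lunit_nonzero by blast
qed

lemma nonzero_rep:
 assumes x: "x : L" "x ~= 0"
 shows "EX m. EX u:lunit B. x = unif B powi m * u"
proof -
 obtain d :: int where d: "d > 0" "of_int d * x : \<O>" using denominator[OF x(1)] by blast
 have d0: "of_int d ~= (0::complex)" using d(1) by simp
 obtain k u where k: "u : lunit B" "of_int d * x = unif B ^ k * u"
  using nonzero_rep_Int[OF d(2)] d0 x(2) by auto
 obtain j w where j: "w : lunit B" "of_int d = unif B ^ j * w"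
  using nonzero_rep_Int[OF Int_cl(11) d0] by blast
 have "x = (of_int d * x) / of_int d" using d0 by simp
 also have "... = (unif B ^ k * u) / (unif B ^ j * w)" unfolding k(2) by (subst j(2)) (rule refl)
 also have "... = unif B powi (int k - int j) * (u * inverse w)"
  using unif_nonzero by (simp add: power_int_diff field_simps)
 finally show ?thesis using lunit_mult[OF k(1) lunit_inverse[OF j(1)]] by blast
qed

lemma powi_lunit: "unif B powi m : lunit B ==> m = 0"
proof -
 have pos: "~ m > 0" if "unif B powi m : lunit B" for m
 proof
  assume "m > 0"
  hence "unif B powi m = unif B * unif B ^ nat (m - 1)"
   using power_int_add[of "unif B" 1 "m - 1"] unif_nonzero by (simp add: power_int_def)
  thus False using unif_mult_not_lunit[OF loc_cl(7)[OF Int_loc[OF unif_Int]]] that by metis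
 qed
 assume m: "unif B powi m : lunit B"
 hence "unif B powi (- m) : lunit B" using lunit_inverse by (simp add: power_int_minus)
 thus "m = 0" using pos[OF m] pos[of "- m"] by linarith
qed

lemma val_eqI:
 assumes u: "u : lunit B" and x: "x = unif B powi m * u"
 shows "val B x = m"
 unfolding val_def
proof (rule the_equality)
 show "EX u:lunit B. x = unif B powi m * u" using u x by blast
 fix k assume "EX u:lunit B. x = unif B powi k * u"
 then obtain w where w: "w : lunit B" "unif B powi m * u = unif B powi k * w" using x by auto
 have "unif B powi (k - m) = u * inverse w"
  using w(2) unif_nonzero lunit_nonzero[OF w(1)] by (simp add: power_int_diff field_simps)
 hence "unif B powi (k - m) : lunit B" using lunit_mult[OF u lunit_inverse[OF w(1)]] by simp
 thus "k = m" using powi_lunit by fastforce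
qed

lemma val_rep: "x : L ==> x ~= 0 ==> EX u:lunit B. x = unif B powi (val B x) * u"
 using nonzero_rep val_eqI by metis

lemma val_mult:
 assumes "x : L" "x ~= 0" "y : L" "y ~= 0"
 shows "val B (x * y) = val B x + val B y"
proof -
 obtain u w where u: "u : lunit B" "x = unif B powi (val B x) * u" and w: "w : lunit B" "y = unif B powi (val B y) * w"
  using val_rep assms by metis
 have "x * y = unif B powi (val B x + val B y) * (u * w)"
  using unif_nonzero by (subst u(2), subst w(2)) (simp add: power_int_add)
 thus ?thesis using val_eqI[OF lunit_mult[OF u(1) w(1)]] by blast
qed

lemma val_lunit: "u : lunit B ==> val B u = 0"
 using val_eqI[of u u 0] by simp

lemma val_one: "val B 1 = 0"
 by (rule val_lunit[OF lunit_one])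

lemma val_unif: "val B (unif B) = 1"
 using val_eqI[OF lunit_one, of "unif B" 1] by simp

lemma val_inverse: "x : L ==> x ~= 0 ==> val B (inverse x) = - val B x"
 using val_mult[of x "inverse x"] val_one Lcl(12)[of x] by simp

lemma val_divide: "x : L ==> x ~= 0 ==> y : L ==> y ~= 0 ==> val B (x / y) = val B x - val B y"
 using val_mult[of x "inverse y"] val_inverse[of y] Lcl(12)[of y] by (simp add: field_class.field_divide_inverse)

lemma val_power: "x : L ==> x ~= 0 ==> val B (x ^ k) = int k * val B x"
proof (induction k)
 case (Suc k)
 thus ?case using val_mult[of x "x ^ k"] Lcl(7)[of x k] by (simp add: distrib_right)
qed (simp add: val_one)

lemma val_prod: "finite A ==> (!!a. a : A ==> f a : L & f a ~= 0) ==> val B (prod f A) = (\<Sum>a\<in>A. val B (f a))"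
proof (induction A rule: finite_induct)
 case (insert a A)
 have "prod f A : L" using insert.prems by (intro Lcl(9)) simp
 thus ?case using insert val_mult[of "f a" "prod f A"] by simp
qed (simp add: val_one)

lemma val_uminus: "x : L ==> val B (- x) = val B x"
proof (cases "x = 0")
 case False
 assume x: "x : L"
 have "- 1 ~: B" using BI(7)[of "-1"] PrimeD(2)[OF B] by auto
 hence "val B (- 1) = 0" using val_lunit[OF Int_lunit] Int_cl(6)[OF Int_cl(2)] by blast
 thus ?thesis using val_mult[of "- 1" x] x False Lcl(6)[OF Lcl(2)] by simp
qed simp

lemma mem_loc_iff: "x : L ==> x ~= 0 ==> x : loc B \<longleftrightarrow> val B x >= 0"
proof -
 assume x: "x : L" "x ~= 0"
 obtain u where u: "u : lunit B" "x = unif B powi (val B x) * u" using val_rep x by blast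
 show ?thesis
 proof
  assume "val B x >= 0"
  hence "x = unif B ^ nat (val B x) * u" using u(2) by (simp add: power_int_def)
  moreover have "unif B ^ nat (val B x) * u : loc B"
   by (intro loc_cl(5,7) Int_loc unif_Int lunit_subset_loc u)
  ultimately show "x : loc B" by metis
 next
  assume xl: "x : loc B"
  show "val B x >= 0"
  proof (rule ccontr)
   assume "~ val B x >= 0"
   hence neg: "val B x < 0" by simp
   define k where "k = nat (- val B x - 1)"
   have "unif B * (unif B ^ k * x) = unif B ^ (Suc k) * x" by simp
   also have "unif B ^ Suc k = unif B powi (- val B x)"
    using neg by (simp add: k_def power_int_def Suc_nat_eq_nat_zadd1 del: power_Suc)
   also have "... * x = u" using u(2) unif_nonzero
    by (metis (no_types, opaque_lifting) add.left_inverse mult.assoc mult_1 power_int_0_right power_int_add)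
   finally have "unif B * (unif B ^ k * x) : lunit B" using u(1) by simp
   moreover have "unif B ^ k * x : loc B" by (intro loc_cl(5,7) Int_loc unif_Int xl)
   ultimately show False using unif_mult_not_lunit by blast
  qed
 qed
qed

lemma V_0: "V B 0 = loc B"
 using mem_loc_iff loc_L loc_cl(1) Lcl(1) unfolding V_def by blast

lemma V_L: "x : V B N ==> x : L" by (simp add: V_def)

lemma unif_L: "unif B : L" by (rule Int_L[OF unif_Int])

lemma powi_L: "unif B powi m : L"
 by (simp add: power_int_def Lcl(7,12) unif_L)

lemma val_powi: "val B (unif B powi m) = m"
 using val_eqI[OF lunit_one] by simp

lemma V_eq: "x : V B N \<longleftrightarrow> (EX r:loc B. x = unif B powi N * r)"
proof
 assume x: "x : V B N"
 show "EX r:loc B. x = unif B powi N * r"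
 proof (cases "x = 0")
  case True
  thus ?thesis using loc_cl(1) by auto
 next
  case False
  have "val B (x / unif B powi N) = val B x - N"
   using x False unif_nonzero by (subst val_divide) (simp_all add: V_def powi_L val_powi)
  hence "x / unif B powi N : loc B"
   using x False unif_nonzero mem_loc_iff[of "x / unif B powi N"] Lcl(13)[OF _ powi_L, of x N] by (simp add: V_def)
  thus ?thesis using unif_nonzero by (intro bexI[of _ "x / unif B powi N"]) simp_all
 qed
next
 assume "EX r:loc B. x = unif B powi N * r"
 then obtain r where r: "r : loc B" "x = unif B powi N * r" by blast
 show "x : V B N"
 proof (cases "r = 0")
  case False
  hence "val B x = N + val B r" "val B r >= 0"
   using r unif_nonzero val_mult[OF powi_L _ loc_L[OF r(1)]] mem_loc_iff[OF loc_L[OF r(1)]] by (auto simp: val_powi)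
  thus ?thesis using r Lcl(5)[OF powi_L loc_L[OF r(1)]] by (simp add: V_def)
 qed (simp add: r V_def Lcl(1))
qed

lemma V_additive: "additive (V B N)"
 unfolding additive_def
proof (intro conjI ballI)
 fix x y assume "x : V B N" "y : V B N"
 then obtain r t where r: "r : loc B" "x = unif B powi N * r" and t: "t : loc B" "y = unif B powi N * t"
  unfolding V_eq by blast
 have "x - y = unif B powi N * (r - t)" by (simp add: r t right_diff_distrib)
 thus "x - y : V B N" unfolding V_eq using loc_cl(4)[OF r(1) t(1)] by blast
qed (simp add: V_def Lcl(1))

lemmas V_cl = additiveD[OF V_additive] additive_sum[OF V_additive]

lemma V_mult: "x : V B M ==> y : V B N ==> x * y : V B (M + N)"
 unfolding V_def using val_mult[of x y] Lcl(5)[of x y] by (cases "x = 0 | y = 0") (auto simp: Lcl(1))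

lemma V_antimono: "x : V B M ==> N <= M ==> x : V B N"
 unfolding V_def by auto

lemma Int_V0: "x : \<O> ==> x : V B 0"
 unfolding V_0 by (rule Int_loc)

lemma V_mult_0: "x : V B 0 ==> y : V B N ==> x * y : V B N"
 using V_mult[of x 0 y N] by simp

lemma V_power: "x : V B N ==> x ^ k : V B (int k * N)"
proof (induction k)
 case (Suc k)
 thus ?case using V_mult[of x N "x ^ k" "int k * N"] by (simp add: distrib_right)
qed (simp add: V_def Lcl(2) val_one)

lemma mem_B_iff: "x : \<O> ==> x : B \<longleftrightarrow> x : V B 1"
proof
 assume x: "x : \<O>"
 {
  assume "x : B"
  then obtain u c where u: "u : \<O>" "u ~: B" "c : \<O>" "u * x = c * unif B" using unif(2) by blast
  have "x = unif B powi 1 * (c / u)" using u(4) B_nonzero[OF u(2)] by (simp add: field_simps)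
  moreover have "c / u : loc B" using u by (intro locI)
  ultimately show "x : V B 1" unfolding V_eq by blast
 next
  assume "x : V B 1"
  then obtain r where "r : loc B" "x = unif B * r" unfolding V_eq by auto
  hence "x ~: lunit B" using unif_mult_not_lunit by blast
  thus "x : B" using Int_lunit[OF x] by blast
 }
qed

lemma val_lt_add:
 assumes "x : L" "x ~= 0" "y : V B (val B x + 1)"
 shows "val B (x + y) = val B x" "x + y ~= 0"
proof -
 have yL: "y : L" using assms(3) by (rule V_L)
 show nz: "x + y ~= 0"
 proof
  assume "x + y = 0"
  hence "y = - x" by (simp add: eq_neg_iff_add_eq_0 add.commute)
  thus False using assms val_uminus by (simp add: V_def)
 qed
 have xV: "x : V B (val B x)" using assms by (simp add: V_def)
 have "x + y : V B (val B x)" using V_cl(4)[OF xV V_antimono[OF assms(3)]] by simp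
 hence "val B (x + y) >= val B x" using nz by (simp add: V_def)
 moreover have "~ val B (x + y) >= val B x + 1"
 proof
  assume "val B (x + y) >= val B x + 1"
  hence "x + y : V B (val B x + 1)" using Lcl(3)[OF assms(1) yL] by (simp add: V_def)
  from V_cl(2)[OF this assms(3)] have "x : V B (val B x + 1)" by simp
  thus False using assms(2) by (simp add: V_def)
 qed
 ultimately show "val B (x + y) = val B x" by simp
qed

lemma loc_residue: "x : loc B ==> EX c:\<O>. x - c : V B 1"
proof -
 assume "x : loc B"
 then obtain a s where a: "a : \<O>" "s : \<O>" "s ~: B" "x = a / s" unfolding loc_def by blast
 obtain c where c: "c : \<O>" "c * s - 1 : B" using inverse_mod[OF B a(2,3)] by blast
 have "x - a * c = (- x) * (c * s - 1)" using B_nonzero[OF a(3)] by (simp add: a(4) field_simps)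
 moreover have "(- x) * (c * s - 1) : V B 1"
 proof (rule V_mult_0)
  show "- x : V B 0" unfolding V_0 by (intro loc_cl(6)) fact
  show "c * s - 1 : V B 1" using mem_B_iff[OF BI(1)[OF c(2)]] c(2) by blast
 qed
 ultimately show ?thesis using a c by (intro bexI[of _ "a * c"]) (simp_all add: Int_cl(5))
qed

lemma val_residue_char_pos: "val B (of_nat (residue_char B)) >= 1"
 using mem_B_iff[OF Int_cl(10)] residue_char[OF B] by (simp add: V_def)

lemma Prime_maximal:
 assumes "Prime B'" "B ~= B'"
 shows "EX b:B. b ~: B'"
proof (rule ccontr)
 assume "~ (EX b:B. b ~: B')"
 hence sub: "B <= B'" by blast
 then obtain b where b: "b : B'" "b ~: B" using assms(2) by blast
 note I' = IdealD[OF PrimeD(1)[OF assms(1)]]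
 obtain c where c: "c : \<O>" "c * b - 1 : B" using inverse_mod[OF B I'(1)[OF b(1)] b(2)] by blast
 have "c * b - (c * b - 1) : B'" using I'(6)[OF I'(5)[OF c(1) b(1)]] c(2) sub by blast
 thus False using PrimeD(2)[OF assms(1)] by simp
qed

end

lemma chinese_remainder:
 assumes B: "Prime B" and S: "finite \<S>" "!!B'. B' : \<S> ==> Prime B' & B' ~= B"
 shows "EX w:\<O>. w - 1 : V B (int N) & (ALL B':\<S>. w : V B' (int N))"
proof -
 have "ALL B':\<S>. EX b. b : B' & b ~: B" using Prime_maximal[of _ B] S(2) B by blast
 then obtain b where b: "ALL B':\<S>. b B' : B' & b B' ~: B" by (rule bchoice[THEN exE])
 have bI: "b B' : \<O>" if "B' : \<S>" for B'
  using IdealD(1)[OF PrimeD(1)] S(2)[OF that] b that by blast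
 define u where "u = (\<Prod>B'\<in>\<S>. b B' ^ N)"
 have uI: "u : \<O>" unfolding u_def by (intro Int_cl(7,9) bI)
 have "u ~: B"
 proof
  assume "u : B"
  then obtain B' where "B' : \<S>" "b B' ^ N : B"
   using Prime_prod[OF B S(1), of "%B'. b B' ^ N"] Int_cl(7)[OF bI] by (auto simp: u_def)
  thus False using Prime_power[OF B bI] b by blast
 qed
 then obtain c where c: "c : \<O>" "c * u - 1 : B" using inverse_mod[OF B uI] by blast
 define w where "w = 1 - (1 - c * u) ^ N"
 have wI: "w : \<O>" unfolding w_def by (intro Int_cl c uI)
 have "1 - c * u : B" using IdealD(7)[OF PrimeD(1)[OF B] c(2)] by simp
 hence "1 - c * u : V B 1" using mem_B_iff[OF B IdealD(1)[OF PrimeD(1)[OF B]]] by blast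
 hence "- ((1 - c * u) ^ N) : V B (int N)"
  using V_cl(3)[OF B V_power[OF B]] by fastforce
 hence "w - 1 : V B (int N)" by (simp add: w_def)
 moreover have "w : V B' (int N)" if B': "B' : \<S>" for B'
 proof -
  have P: "Prime B'" using S(2) B' by blast
  have "w = (c * (\<Sum>i<N. (1 - c * u) ^ i) * (\<Prod>B''\<in>\<S> - {B'}. b B'' ^ N)) * b B' ^ N"
  proof -
   have "w = (1 - (1 - c * u)) * (\<Sum>i<N. (1 - c * u) ^ i)"
    unfolding w_def by (rule one_diff_power_eq)
   moreover have "u = b B' ^ N * (\<Prod>B''\<in>\<S> - {B'}. b B'' ^ N)"
    unfolding u_def by (rule prod.remove[OF S(1) B'])
   ultimately show ?thesis by (simp add: mult_ac)
  qed
  moreover have "... : V B' (int N)"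
  proof (rule V_mult_0[OF P])
   show "c * (\<Sum>i<N. (1 - c * u) ^ i) * (\<Prod>B''\<in>\<S> - {B'}. b B'' ^ N) : V B' 0"
    using bI by (intro Int_V0[OF P] Int_cl c uI) auto
   have "b B' : V B' 1" using mem_B_iff[OF P bI[OF B']] b B' by blast
   thus "b B' ^ N : V B' (int N)" using V_power[OF P, of "b B'" 1 N] by simp
  qed
  ultimately show ?thesis by simp
 qed
 ultimately show ?thesis using wI by blast
qed

text \<open>The automorphisms permute the primes and their valuations.\<close>

context
 fixes B :: "complex set" and \<sigma> :: "complex => complex"
 assumes B: "Prime B" and \<sigma>: "\<sigma> : G"
begin

lemma image_mem_iff: "x : L ==> \<sigma> x : \<sigma> ` B \<longleftrightarrow> x : B"
 using hom_on_inj[OF L hom[OF \<sigma>]] IdealD(1)[OF PrimeD(1)[OF B]] Int_L by (metis image_iff inj_on_image_mem_iff subsetI)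

lemma Int_preimage: "y : \<O> ==> EX x:\<O>. y = \<sigma> x"
proof -
 assume y: "y : \<O>"
 obtain \<tau> where \<tau>: "\<tau> : G" "ALL x:L. \<tau> (\<sigma> x) = x & \<sigma> (\<tau> x) = x" using inv_ex[OF \<sigma>] by blast
 thus ?thesis using Int_into[OF \<tau>(1) y] Int_L[OF y] by (intro bexI[of _ "\<tau> y"]) simp_all
qed

lemma Prime_image: "Prime (\<sigma> ` B)"
proof -
 note I = IdealD[OF PrimeD(1)[OF B]]
 have BL: "b : L" if "b : B" for b using I(1)[OF that] by (rule Int_L)
 have "Ideal (\<sigma> ` B)"
  unfolding Ideal_def
 proof (intro conjI ballI)
  show "\<sigma> ` B <= \<O>" using Int_into[OF \<sigma> I(1)] by blast
  show "0 : \<sigma> ` B" using imageI[OF I(2), of \<sigma>] by (simp add: hom_simps(2)[OF \<sigma>])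
  fix x assume "x : \<sigma> ` B"
  then obtain a where a: "a : B" "x = \<sigma> a" by blast
  {
   fix y assume "y : \<sigma> ` B"
   then obtain b where b: "b : B" "y = \<sigma> b" by blast
   show "x + y : \<sigma> ` B"
    using imageI[OF I(3)[OF a(1) b(1)], of \<sigma>] by (simp add: a b hom_simps(3)[OF \<sigma>] BL)
  next
   fix y assume "y : \<O>"
   then obtain b where b: "b : \<O>" "y = \<sigma> b" using Int_preimage by blast
   show "x * y : \<sigma> ` B"
    using imageI[OF I(4)[OF a(1) b(1)], of \<sigma>] by (simp add: a b hom_simps(4)[OF \<sigma>] BL Int_L)
  }
 qed
 moreover have "\<sigma> ` B ~= {0}"
 proof -
  have "\<sigma> (of_nat (residue_char B)) : \<sigma> ` B" using residue_char(2)[OF B] by (rule imageI)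
  moreover have "\<sigma> (of_nat (residue_char B)) ~= 0"
   using residue_char(1)[OF B] by (simp add: hom_simps(8)[OF \<sigma>])
  ultimately show ?thesis by blast
 qed
 moreover have "1 ~: \<sigma> ` B"
  using image_mem_iff[OF Lcl(2)] PrimeD(2)[OF B] by (simp add: hom_simps(1)[OF \<sigma>])
 moreover have "x : \<sigma> ` B | y : \<sigma> ` B" if xy: "x : \<O>" "y : \<O>" "x * y : \<sigma> ` B" for x y
 proof -
  obtain a b where a: "a : \<O>" "x = \<sigma> a" and b: "b : \<O>" "y = \<sigma> b"
   using Int_preimage[OF xy(1)] Int_preimage[OF xy(2)] by blast
  hence "\<sigma> (a * b) : \<sigma> ` B" using xy(3) by (simp add: hom_simps(4)[OF \<sigma>] Int_L)
  hence "a * b : B" using image_mem_iff[OF Lcl(5)[OF Int_L Int_L]] a b by blast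
  thus ?thesis using PrimeD(3)[OF B a(1) b(1)] a b by blast
 qed
 ultimately show ?thesis unfolding Prime_def by blast
qed

lemma residue_char_image: "residue_char (\<sigma> ` B) = residue_char B"
proof -
 have "(of_nat m : \<sigma> ` B) = (of_nat m : B)" for m
  using image_mem_iff[OF Lcl(10)[of m]] by (simp add: hom_simps(8)[OF \<sigma>])
 thus ?thesis
  by (simp only: residue_char_def[OF B] residue_char_def[OF Prime_image])
qed

lemma lunit_image: "u : lunit B ==> \<sigma> u : lunit (\<sigma> ` B)"
proof -
 assume "u : lunit B"
 then obtain a s where a: "a : \<O>" "a ~: B" "s : \<O>" "s ~: B" "u = a / s"
  unfolding lunit_def by blast
 have "\<sigma> a / \<sigma> s : lunit (\<sigma> ` B)"
  using a Int_into[OF \<sigma>] image_mem_iff[OF Int_L] by (intro lunitI[OF Prime_image]) auto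
 thus ?thesis using a by (simp add: hom_simps(11)[OF \<sigma>] Int_L)
qed

lemma val_image: "x : L ==> val (\<sigma> ` B) (\<sigma> x) = val B x"
proof (cases "x = 0")
 case True
 have "val B 0 = (THE m::int. False)" if "Prime B" for B
  unfolding val_def using unif_nonzero[OF that] lunit_nonzero[OF that]
  by (intro arg_cong[where f = The] ext) auto
 thus ?thesis using B Prime_image True by (simp add: hom_simps(2)[OF \<sigma>])
next
 case False
 assume x: "x : L"
 let ?B = "\<sigma> ` B"
 define f where "f y = val ?B (\<sigma> y)" for y
 have mul: "f (y * z) = f y + f z" if "y : L" "y ~= 0" "z : L" "z ~= 0" for y z
  using that val_mult[OF Prime_image into[OF \<sigma>] _ into[OF \<sigma>]]
  by (simp add: f_def hom_simps(4)[OF \<sigma>] hom_simps(13)[OF \<sigma>])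
 have unitf: "f u = 0" if "u : lunit B" for u
  unfolding f_def by (rule val_lunit[OF Prime_image lunit_image[OF that]])
 have fval: "f y = val B y * f (unif B)" if y: "y : L" "y ~= 0" for y
 proof -
  obtain u where u: "u : lunit B" "y = unif B powi (val B y) * u" using val_rep[OF B y] by blast
  have uL: "u : L" "u ~= 0" using loc_L[OF B lunit_subset_loc[OF B u(1)]] lunit_nonzero[OF B u(1)] by auto
  have pw: "f (unif B ^ k) = int k * f (unif B)" for k
   unfolding f_def hom_simps(7)[OF \<sigma> unif_L[OF B]]
   using val_power[OF Prime_image into[OF \<sigma> unif_L[OF B]]] unif_nonzero[OF B] hom_simps(13)[OF \<sigma> unif_L[OF B]] by simp
  have "f (unif B powi m) = m * f (unif B)" for m
  proof (cases m rule: int_cases2)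
   case (nonneg k)
   thus ?thesis using pw by simp
  next
   case (nonpos k)
   have "f (unif B ^ k * inverse (unif B ^ k)) = f (unif B ^ k) + f (inverse (unif B ^ k))"
    using unif_nonzero[OF B] by (intro mul Lcl unif_L[OF B]) simp_all
   moreover have "f 1 = 0" by (rule unitf[OF lunit_one[OF B]])
   ultimately have "f (inverse (unif B ^ k)) = - int k * f (unif B)"
    using pw unif_nonzero[OF B] by simp
   thus ?thesis using nonpos by (simp add: power_int_minus)
  qed
  moreover have "f y = f (unif B powi (val B y)) + f u"
   using u(2) mul[OF powi_L[OF B] _ uL] unif_nonzero[OF B] by (metis power_int_eq_0_iff)
  ultimately show ?thesis using unitf[OF u(1)] by simp
 qed
 have "EX y:\<O>. unif ?B = \<sigma> y" using Int_preimage[OF unif_Int[OF Prime_image]] .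
 then obtain y where y: "y : \<O>" "unif ?B = \<sigma> y" by blast
 have yB: "y : B" using unif(1)[OF Prime_image] image_mem_iff[OF Int_L[OF y(1)]] y(2) by simp
 have y0: "y ~= 0"
 proof
  assume "y = 0"
  hence "unif ?B = 0" using y(2) by (simp only: hom_simps(2)[OF \<sigma>])
  thus False using unif_nonzero[OF Prime_image] by contradiction
 qed
 have "f y = 1" unfolding f_def y(2)[symmetric] by (rule val_unif[OF Prime_image])
 hence "val B y * f (unif B) = 1" using fval[OF Int_L[OF y(1)] y0] by linarith
 moreover have "val B y >= 1" using mem_B_iff[OF B y(1)] yB y0 by (simp add: V_def)
 ultimately have "f (unif B) = 1"
  using zmult_eq_1_iff[of "val B y" "f (unif B)"] by simp
 thus ?thesis using fval[OF x False] by (simp add: f_def)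
qed

lemma V_image: "x : L ==> \<sigma> x : V (\<sigma> ` B) N \<longleftrightarrow> x : V B N"
 using into[OF \<sigma>] by (simp add: V_def val_image hom_simps(13)[OF \<sigma>])

end

end

section \<open>Inertia groups\<close>

lemma (in aut_group) subgroupI:
 assumes W: "W <= U" "restrict id L : W" "!!\<sigma> \<tau>. \<sigma> : W ==> \<tau> : W ==> compose L \<sigma> \<tau> : W"
 shows "aut_group L W"
proof
 show "csubfield L" by (rule L)
 show finW: "finite W" using W(1) fin by (rule finite_subset)
 show "hom_on L \<sigma>" if "\<sigma> : W" for \<sigma> using W(1) that hom by blast
 show "\<sigma> x : L" if "\<sigma> : W" "x : L" for \<sigma> x using W(1) that into by blast
 show "\<sigma> : extensional L" if "\<sigma> : W" for \<sigma> using W(1) that ext by blast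
 show "restrict id L : W" by (rule W(2))
 show "compose L \<sigma> \<tau> : W" if "\<sigma> : W" "\<tau> : W" for \<sigma> \<tau> using that by (rule W(3))
 show "EX \<tau>:W. ALL x:L. \<tau> (\<sigma> x) = x & \<sigma> (\<tau> x) = x" if \<sigma>: "\<sigma> : W" for \<sigma>
 proof -
  have \<sigma>U: "\<sigma> : U" using \<sigma> W(1) by blast
  have "inj_on (compose L \<sigma>) W"
   using bij_comp_left[OF \<sigma>U] W(1) by (auto simp: bij_betw_def intro: inj_on_subset)
  moreover have "compose L \<sigma> ` W <= W" using W(3)[OF \<sigma>] by blast
  ultimately have "compose L \<sigma> ` W = W" using endo_inj_surj[OF finW] by blast
  then obtain \<tau> where \<tau>: "\<tau> : W" "compose L \<sigma> \<tau> = restrict id L" using W(2) by (metis imageE)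
  have st: "\<sigma> (\<tau> x) = x" if "x : L" for x
   using fun_cong[OF \<tau>(2), of x] that by (simp add: comp_apply)
  have \<tau>L: "\<tau> x : L" if "x : L" for x using \<tau>(1) W(1) into that by blast
  have "\<tau> (\<sigma> x) = x" if "x : L" for x
   using inj_onD[OF hom_on_inj[OF L hom[OF \<sigma>U]] st[OF into[OF \<sigma>U that]] \<tau>L[OF into[OF \<sigma>U that]] that] .
  thus ?thesis using \<tau>(1) st by blast
 qed
qed

lemma (in aut_group) inter_subgroup:
 assumes "aut_group L W" "aut_group L W'" "W <= U"
 shows "aut_group L (W Int W')"
proof -
 interpret W: aut_group L W by fact
 interpret W': aut_group L W' by fact
 show ?thesis
  by (rule W.subgroupI) (auto intro: W.id_mem W'.id_mem W.comp_mem W'.comp_mem)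
qed

lemma (in aut_group) pointwise_stabilizer_subgroup:
 assumes "M <= L"
 shows "aut_group L {\<sigma> : U. ALL x:M. \<sigma> x = x}"
proof (rule subgroupI)
 show "restrict id L : {\<sigma> : U. ALL x:M. \<sigma> x = x}" using id_mem assms by auto
 show "compose L \<sigma> \<tau> : {\<sigma> : U. ALL x:M. \<sigma> x = x}"
  if "\<sigma> : {\<sigma> : U. ALL x:M. \<sigma> x = x}" "\<tau> : {\<sigma> : U. ALL x:M. \<sigma> x = x}" for \<sigma> \<tau>
 proof -
  have "compose L \<sigma> \<tau> x = x" if "x : M" for x
   using that \<open>\<sigma> : _\<close> \<open>\<tau> : _\<close> assms by (simp add: comp_apply subsetD)
  thus ?thesis using that comp_mem by blast
 qed
qed blast

context galois_field
begin

definition decomp :: "complex set => (complex => complex) set" where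
 "decomp B = {\<sigma> : G. \<sigma> ` B = B}"

definition inert :: "complex set => (complex => complex) set" where
 "inert B = {\<sigma> : decomp B. ALL x:\<O>. \<sigma> x - x : B}"

abbreviation "fixed U \<equiv> aut_group.Fix L U"

context
 fixes B :: "complex set"
 assumes B: "Prime B"
begin

lemmas BI6 = IdealD[OF PrimeD(1)[OF B]]

lemma B_L: "b : B ==> b : L" using BI6(1) Int_L by blast

lemma decomp_subgroup: "aut_group L (decomp B)"
proof (rule subgroupI)
 show "decomp B <= G" by (auto simp: decomp_def)
 have "restrict id L ` B = B" using B_L by force
 thus "restrict id L : decomp B" using id_mem by (simp add: decomp_def)
 fix \<sigma> \<tau> assume st: "\<sigma> : decomp B" "\<tau> : decomp B"
 have "compose L \<sigma> \<tau> ` B = \<sigma> ` \<tau> ` B"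
  unfolding image_image using B_L comp_apply by (intro image_cong) auto
 thus "compose L \<sigma> \<tau> : decomp B" using st comp_mem by (simp add: decomp_def)
qed

lemma inert_decomp: "\<sigma> : inert B ==> \<sigma> : decomp B"
 and decomp_G: "\<sigma> : decomp B ==> \<sigma> : G"
 by (auto simp: inert_def decomp_def)

lemma inert_subgroup: "aut_group L (inert B)"
proof (rule subgroupI)
 interpret D: aut_group L "decomp B" by (rule decomp_subgroup)
 show "inert B <= G" by (auto simp: inert_def decomp_def)
 show "restrict id L : inert B" using D.id_mem Int_L BI6(2) by (simp add: inert_def)
 fix \<sigma> \<tau> assume st: "\<sigma> : inert B" "\<tau> : inert B"
 have "compose L \<sigma> \<tau> x - x : B" if x: "x : \<O>" for x
 proof -
  have "\<tau> x : \<O>" using Int_into[OF decomp_G[OF inert_decomp[OF st(2)]] x] .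
  hence "(\<sigma> (\<tau> x) - \<tau> x) + (\<tau> x - x) : B" using st x by (intro BI6(3)) (auto simp: inert_def)
  thus ?thesis using Int_L[OF x] by (simp add: comp_apply)
 qed
 thus "compose L \<sigma> \<tau> : inert B" using D.comp_mem[OF inert_decomp inert_decomp] st by (simp add: inert_def)
qed

lemma val_decomp: "\<sigma> : decomp B ==> x : L ==> val B (\<sigma> x) = val B x"
 using val_image[OF B, of \<sigma> x] by (simp add: decomp_def)

lemma V_decomp: "\<sigma> : decomp B ==> x : L ==> \<sigma> x : V B N \<longleftrightarrow> x : V B N"
 using V_image[OF B, of \<sigma> x] by (simp add: decomp_def)

lemma power_cong: "x : \<O> ==> y : \<O> ==> x - y : B ==> x ^ k - y ^ k : B"
proof (induction k)
 case (Suc k)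
 have "x ^ Suc k - y ^ Suc k = x * (x ^ k - y ^ k) + (x - y) * y ^ k" by (simp add: algebra_simps)
 moreover have "x * (x ^ k - y ^ k) + (x - y) * y ^ k : B"
  using Suc by (intro BI6(3,4,5) Int_cl(7)) auto
 ultimately show ?case by simp
qed (simp add: BI6(2))

lemma freshman:
 assumes x: "x : \<O>" and y: "y : \<O>"
 shows "(x + y) ^ residue_char B - (x ^ residue_char B + y ^ residue_char B) : B"
proof -
 let ?p = "residue_char B"
 note pr = residue_char_prime[OF B]
 have p2: "?p >= 2" using pr by (rule prime_ge_2_nat)
 have "(x + y) ^ ?p = (\<Sum>k\<le>?p. of_nat (?p choose k) * x ^ k * y ^ (?p - k))" by (rule binomial_ring)
 also have "{..?p} = insert 0 (insert ?p {0<..<?p})" using p2 by auto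
 also have "(\<Sum>k\<in>.... of_nat (?p choose k) * x ^ k * y ^ (?p - k)) =
  y ^ ?p + (x ^ ?p + (\<Sum>k\<in>{0<..<?p}. of_nat (?p choose k) * x ^ k * y ^ (?p - k)))"
  using p2 by simp
 finally have eq: "(x + y) ^ ?p - (x ^ ?p + y ^ ?p) = (\<Sum>k\<in>{0<..<?p}. of_nat (?p choose k) * x ^ k * y ^ (?p - k))"
  by simp
 show ?thesis unfolding eq
 proof (rule additive_sum[OF Ideal_additive[OF PrimeD(1)[OF B]]])
  fix k assume k: "k : {0<..<?p}"
  have "?p dvd (?p choose k)" by (rule dvd_choose_prime) (use k pr in auto)
  hence "of_nat (?p choose k) : B" using of_nat_mem_iff[OF B] by blast
  thus "of_nat (?p choose k) * x ^ k * y ^ (?p - k) : B"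
   by (intro BI6(4) Int_cl(7) x y)
 qed
qed

lemma freshman_power:
 assumes x: "x : \<O>" and y: "y : \<O>"
 shows "(x - y) ^ (residue_char B ^ i) - (x ^ (residue_char B ^ i) - y ^ (residue_char B ^ i)) : B"
proof (induction i)
 case 0
 thus ?case by (simp add: BI6(2))
next
 case (Suc i)
 let ?p = "residue_char B"
 define a b where "a = x ^ (?p ^ i)" and "b = y ^ (?p ^ i)"
 have ab: "a : \<O>" "b : \<O>" unfolding a_def b_def by (intro Int_cl(7) x y)+
 have 1: "((x - y) ^ (?p ^ i)) ^ ?p - (a - b) ^ ?p : B"
  using Suc.IH unfolding a_def[symmetric] b_def[symmetric] by (intro power_cong Int_cl(4,7) x y ab)
 have "(a - b + b) ^ ?p - ((a - b) ^ ?p + b ^ ?p) : B" by (intro freshman Int_cl(4) ab)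
 hence 2: "a ^ ?p - ((a - b) ^ ?p + b ^ ?p) : B" by simp
 have "((x - y) ^ (?p ^ i)) ^ ?p - (a ^ ?p - b ^ ?p) : B"
  using BI6(6)[OF 1 2] by (simp add: algebra_simps)
 thus ?case by (simp add: a_def b_def power_mult[symmetric] mult.commute)
qed

lemma frobenius_period:
 assumes y: "y : \<O>"
 shows "EX t>0. ALL k. y ^ (residue_char B ^ (t * k)) - y : B"
proof -
 let ?p = "residue_char B"
 have "finite (range (%i. coset B (y ^ (?p ^ i))))"
  using Int_cl(7)[OF y] by (intro finite_subset[OF _ residue_field_finite[OF B]]) blast
 hence "~ inj (%i. coset B (y ^ (?p ^ i)))" using finite_imageD by fastforce
 then obtain a b where ab: "coset B (y ^ (?p ^ a)) = coset B (y ^ (?p ^ b))" "a ~= b"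
  by (auto simp: inj_def)
 define i j where "i = min a b" and "j = max a b"
 have ij: "i < j" "coset B (y ^ (?p ^ j)) = coset B (y ^ (?p ^ i))"
  using ab by (auto simp: i_def j_def min_def max_def)
 define z where "z = y ^ (?p ^ (j - i))"
 have zI: "z : \<O>" unfolding z_def by (rule Int_cl(7)[OF y])
 have "z ^ (?p ^ i) = y ^ (?p ^ j)" using ij(1) by (simp add: z_def flip: power_mult power_add)
 hence zy: "z ^ (?p ^ i) - y ^ (?p ^ i) : B"
  using ij(2) coset_eq_iff[OF Ideal_additive[OF PrimeD(1)[OF B]]] by simp
 have "(z - y) ^ (?p ^ i) : B" using BI6(3)[OF freshman_power[OF zI y, of i] zy] by simp
 hence base: "z - y : B" by (rule Prime_power[OF B Int_cl(4)[OF zI y]])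
 have "y ^ (?p ^ ((j - i) * k)) - y : B" for k
 proof (induction k)
  case (Suc k)
  have "(y ^ (?p ^ ((j - i) * k))) ^ (?p ^ (j - i)) - y ^ (?p ^ (j - i)) : B"
   by (intro power_cong Int_cl(7) y Suc.IH)
  hence "(y ^ (?p ^ ((j - i) * k))) ^ (?p ^ (j - i)) - y ^ (?p ^ (j - i)) + (z - y) : B"
   using base by (rule BI6(3))
  thus ?case by (simp add: z_def power_add mult.commute flip: power_mult)
 qed (simp add: BI6(2))
 thus ?thesis using ij(1) by (intro exI[of _ "j - i"]) simp
qed

lemma coeff_linear_factors_cong:
 assumes fin: "finite A" and fg: "!!a. a : A ==> f a : \<O> & g a : \<O> & f a - g a : B"
 shows "poly.coeff (\<Prod>a\<in>A. [:- f a, 1:]) i : \<O> & poly.coeff (\<Prod>a\<in>A. [:- g a, 1:]) i : \<O> &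
  poly.coeff (\<Prod>a\<in>A. [:- f a, 1:]) i - poly.coeff (\<Prod>a\<in>A. [:- g a, 1:]) i : B"
 using fin fg
proof (induction A arbitrary: i rule: finite_induct)
 case empty
 have "poly.coeff 1 i : \<O>" by (simp add: Int_cl(1,2))
 thus ?case by (simp add: BI6(2))
next
 case (insert a A)
 let ?P = "\<Prod>a\<in>A. [:- f a, 1:]" and ?Q = "\<Prod>a\<in>A. [:- g a, 1:]"
 have c: "poly.coeff ([:- c, 1:] * h) i = (if i = 0 then 0 else poly.coeff h (i - 1)) - c * poly.coeff h i"
  for c :: complex and h i
  by (auto simp: coeff_pCons split: nat.splits)
 have IH: "poly.coeff ?P j : \<O>" "poly.coeff ?Q j : \<O>" "poly.coeff ?P j - poly.coeff ?Q j : B" for j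
  using insert.IH[of j] insert.prems by blast+
 have a: "f a : \<O>" "g a : \<O>" "f a - g a : B" using insert.prems by blast+
 define u where "u = (if i = 0 then 0 else poly.coeff ?P (i - 1))"
 define w where "w = (if i = 0 then 0 else poly.coeff ?Q (i - 1))"
 have uw: "u : \<O>" "w : \<O>" "u - w : B"
  unfolding u_def w_def using IH by (simp_all add: Int_cl(1) BI6(2))
 have P: "poly.coeff (\<Prod>a\<in>insert a A. [:- f a, 1:]) i = u - f a * poly.coeff ?P i"
  unfolding prod.insert[OF insert.hyps] c u_def ..
 have Q: "poly.coeff (\<Prod>a\<in>insert a A. [:- g a, 1:]) i = w - g a * poly.coeff ?Q i"
  unfolding prod.insert[OF insert.hyps] c w_def ..
 have "(u - f a * poly.coeff ?P i) - (w - g a * poly.coeff ?Q i) =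
  (u - w) - (f a * (poly.coeff ?P i - poly.coeff ?Q i) + (f a - g a) * poly.coeff ?Q i)"
  by (simp add: algebra_simps)
 moreover have "... : B" by (intro BI6(6) BI6(3) BI6(4)[OF a(3)] BI6(5)[OF a(1)] uw IH)
 ultimately have "(u - f a * poly.coeff ?P i) - (w - g a * poly.coeff ?Q i) : B" by (simp only:)
 moreover have "u - f a * poly.coeff ?P i : \<O>" "w - g a * poly.coeff ?Q i : \<O>"
  by (intro Int_cl(4,5) uw IH a)+
 ultimately show ?case unfolding P Q by simp
qed

text \<open>For \<open>\<sigma>\<close> in a group of inertia, \<open>X - \<sigma> y\<close> and \<open>X - y\<close> agree modulo \<open>B\<close>. With \<open>card U = p ^ a * m'\<close>
  one coefficient of the product is an invariant congruent to a unit times \<open>y ^ (p ^ a)\<close>,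
  and the Frobenius map permutes the residues.\<close>

lemma residue_fixed:
 assumes U: "aut_group L U" "U <= inert B" and y: "y : \<O>"
 shows "EX c:\<O>. c : fixed U & y - c : B"
proof -
 interpret U: aut_group L U by fact
 let ?p = "residue_char B" and ?m = "card U"
 note pr = residue_char_prime[OF B]
 have ringFix: "csubring U.Fix" by (rule csubfieldD(1)[OF U.Fix_subfield])
 obtain a m' where am: "?m = ?p ^ a * m'" "~ ?p dvd m'"
  using prime_power_cofactor[OF pr U.card_pos] by blast
 have m'0: "m' > 0" using am U.card_pos by (auto intro: Nat.gr0I)
 hence le: "?p ^ a <= ?m" using am(1) by simp
 define c0 where "c0 = poly.coeff (U.cpoly y) (?m - ?p ^ a)"
 define b where "b = ?m choose (?p ^ a)"
 have bB: "of_nat b ~: B"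
 proof -
  have "multiplicity ?p b = multiplicity ?p m'" unfolding b_def am(1) by (rule const_p_fac[OF m'0 pr])
  also have "... = 0" using am(2) by (rule not_dvd_imp_multiplicity_0)
  finally have "multiplicity ?p b = 0" .
  moreover have "b ~= 0" using le by (simp add: b_def)
  ultimately have "~ ?p dvd b" using multiplicity_eq_zero_iff[of b ?p] not_prime_unit pr by blast
  thus ?thesis using of_nat_mem_iff[OF B] by blast
 qed
 have c0Fix: "c0 : U.Fix" unfolding c0_def by (rule U.cpoly_coeff[OF Int_L[OF y]])
 have "poly.coeff (\<Prod>\<sigma>\<in>U. [:- \<sigma> y, 1:]) (?m - ?p ^ a) : \<O> &
  poly.coeff (\<Prod>\<sigma>\<in>U. [:- y, 1:]) (?m - ?p ^ a) : \<O> &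
  poly.coeff (\<Prod>\<sigma>\<in>U. [:- \<sigma> y, 1:]) (?m - ?p ^ a) - poly.coeff (\<Prod>\<sigma>\<in>U. [:- y, 1:]) (?m - ?p ^ a) : B"
 proof (rule coeff_linear_factors_cong[where f = "%\<sigma>. \<sigma> y" and g = "%_. y", OF U.fin])
  fix \<sigma> assume "\<sigma> : U"
  thus "\<sigma> y : \<O> & y : \<O> & \<sigma> y - y : B"
   using U(2) y U.Int_into[of \<sigma>, OF _ y] by (auto simp: inert_def)
 qed
 hence c0: "c0 : \<O>" "c0 - poly.coeff ([:- y, 1:] ^ ?m) (?m - ?p ^ a) : B"
  unfolding c0_def U.cpoly_def prod_constant by blast+
 have "poly.coeff ([:- y, 1:] ^ ?m) (?m - ?p ^ a) = of_nat b * (- y) ^ (?p ^ a)"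
  using le binomial_symmetric[OF le] by (simp add: coeff_linear_poly_power b_def)
 with c0(2) have c0b: "c0 - of_nat b * (- y) ^ (?p ^ a) : B" by simp
 obtain l where l: "l > 0" "of_nat b ^ l - 1 : B" using power_cong_one[OF B Int_cl(10) bB] by blast
 define d where "d = (of_nat (b ^ (l - 1)) :: complex)"
 have dI: "d : \<O>" "d : U.Fix" unfolding d_def by (rule Int_cl(10), rule csubring_of_nat[OF ringFix])
 have db: "d * of_nat b - 1 : B" using l power_minus_mult[of l "of_nat b :: complex"] by (simp add: d_def)
 let ?y = "(- y) ^ (?p ^ a)"
 have yI: "- y : \<O>" by (rule Int_cl(6)[OF y])
 have c1: "?y - d * c0 : B"
 proof -
  have "?y - d * c0 = - ((d * of_nat b - 1) * ?y) - d * (c0 - of_nat b * ?y)" by (simp add: algebra_simps)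
  moreover have "... : B"
   by (intro BI6(6) BI6(7) BI6(4)[OF db] BI6(5)[OF dI(1)] c0b Int_cl(7) yI)
  ultimately show ?thesis by simp
 qed
 obtain t where t: "t > 0" "!!k. (- y) ^ (?p ^ (t * k)) - (- y) : B" using frobenius_period[OF yI] by blast
 define c where "c = (d * c0) ^ (?p ^ (t * a - a))"
 have "a + (t * a - a) = t * a" using t(1) by (cases t) simp_all
 hence "?p ^ a * ?p ^ (t * a - a) = ?p ^ (t * a)" by (simp only: power_add[symmetric])
 hence "?y ^ (?p ^ (t * a - a)) = (- y) ^ (?p ^ (t * a))" by (simp only: power_mult[symmetric])
 moreover have "?y ^ (?p ^ (t * a - a)) - c : B"
  unfolding c_def by (rule power_cong[OF Int_cl(7)[OF yI] Int_cl(5)[OF dI(1) c0(1)] c1])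
 ultimately have "(- y) ^ (?p ^ (t * a)) - c : B" by (simp only:)
 from BI6(6)[OF this t(2)[of a]] have "- c - y : B" by simp
 hence "y - (- c) : B" using BI6(7)[of "- c - y"] by (simp add: add.commute)
 moreover have "- c : \<O>" "- c : U.Fix"
  unfolding c_def
  by (intro Int_cl(6,7,5) dI c0, intro csubring_uminus csubring_power csubringD(5) ringFix dI c0Fix)
 ultimately show ?thesis by blast
qed

text \<open>The residue of \<open>x / g\<close> has an invariant representative.\<close>

lemma leading_term:
 assumes U: "aut_group L U" "U <= inert B" and g: "g : L" "g ~= 0" and x: "x : V B (val B g)"
 shows "EX c:\<O>. c : fixed U & x - c * g : V B (val B g + 1)"
proof -
 have "x / g : V B 0"
  using x g by (auto simp: V_def val_divide[OF B] Lcl(13) Lcl(1))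
 then obtain y where y: "y : \<O>" "x / g - y : V B 1"
  using loc_residue[OF B] unfolding V_0[OF B] by blast
 obtain c where c: "c : \<O>" "c : fixed U" "y - c : B" using residue_fixed[OF U y(1)] by blast
 have "y - c : V B 1" using mem_B_iff[OF B BI6(1)[OF c(3)]] c(3) by blast
 from V_cl(4)[OF B y(2) this] have "x / g - c : V B 1" by simp
 moreover have "g : V B (val B g)" using g by (simp add: V_def)
 ultimately have "(x / g - c) * g : V B (1 + val B g)" by (rule V_mult[OF B])
 moreover have "(x / g - c) * g = x - c * g" using g(2) by (simp add: left_diff_distrib)
 ultimately show ?thesis using c by (auto simp: add.commute)
qed

lemma norm_unif:
 assumes U: "aut_group L U" "U <= decomp B"
 shows "(\<Prod>\<sigma>\<in>U. \<sigma> (unif B)) : fixed U" "(\<Prod>\<sigma>\<in>U. \<sigma> (unif B)) ~= 0"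
  "(\<Prod>\<sigma>\<in>U. \<sigma> (unif B)) : \<O>" "val B (\<Prod>\<sigma>\<in>U. \<sigma> (unif B)) = int (card U)"
proof -
 interpret U: aut_group L U by fact
 note \<pi> = unif_L[OF B] unif_nonzero[OF B]
 show "(\<Prod>\<sigma>\<in>U. \<sigma> (unif B)) : U.Fix" by (rule U.norm_mem[OF \<pi>(1)])
 have nz: "\<sigma> (unif B) : L & \<sigma> (unif B) ~= 0" if "\<sigma> : U" for \<sigma>
  using U.into[OF that \<pi>(1)] U.hom_simps(13)[OF that \<pi>(1)] \<pi>(2) by simp
 thus "(\<Prod>\<sigma>\<in>U. \<sigma> (unif B)) ~= 0" using U.fin by simp
 show "(\<Prod>\<sigma>\<in>U. \<sigma> (unif B)) : \<O>"
  by (rule Int_cl(9)) (rule U.Int_into[OF _ unif_Int[OF B]])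
 have "val B (\<Prod>\<sigma>\<in>U. \<sigma> (unif B)) = (\<Sum>\<sigma>\<in>U. val B (\<sigma> (unif B)))"
  by (rule val_prod[OF B U.fin nz])
 also have "... = (\<Sum>\<sigma>\<in>U. 1)"
  using U(2) val_decomp[OF _ \<pi>(1)] val_unif[OF B] by (intro sum.cong refl) (simp add: subset_iff)
 finally show "val B (\<Prod>\<sigma>\<in>U. \<sigma> (unif B)) = int (card U)" by simp
qed

text \<open>If the least positive value \<open>e\<close> on the fixed field were smaller than \<open>card U\<close>, some nonzero
  combination of the automorphisms in \<open>U\<close> would kill \<open>1, \<pi>, \<dots>, \<pi> ^ (e - 1)\<close>, hence by successive
  approximation all integers, against the independence of characters.\<close>

lemma val_fixed_dvd:
 assumes U: "aut_group L U" "U <= inert B" and x: "x : fixed U" "x ~= 0"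
 shows "int (card U) dvd val B x"
proof -
 interpret U: aut_group L U by fact
 let ?\<pi> = "unif B"
 note \<pi> = unif_L[OF B] unif_nonzero[OF B]
 have UD: "U <= decomp B" using U(2) inert_decomp by blast
 have FixL: "z : L" if "z : U.Fix" for z using that U.Fix_subset by blast
 note F = csubringD[OF csubfieldD(1)[OF U.Fix_subfield]]
 define P where "P k \<longleftrightarrow> k > 0 & (EX z:U.Fix. z ~= 0 & val B z = int k)" for k
 have "P (card U)" unfolding P_def using U.card_pos norm_unif[OF U(1) UD] by blast
 define e where "e = (LEAST k. P k)"
 have Pe: "P e" unfolding e_def using \<open>P (card U)\<close> by (rule LeastI)
 have e_min: "~ P k" if "k < e" for k using not_less_Least that unfolding e_def by blast
 obtain w where w: "w : U.Fix" "w ~= 0" "val B w = int e" and e0: "e > 0" using Pe unfolding P_def by blast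
 have e_le: "e <= card U" using \<open>P (card U)\<close> e_min by (metis linorder_not_le)
 have e_dvd: "int e dvd val B z" if z: "z : U.Fix" "z ~= 0" for z
 proof (rule ccontr)
  assume nd: "~ int e dvd val B z"
  define q where "q = val B z div int e"
  define z' where "z' = z / w powi q"
  have wq: "w powi q : U.Fix" "w powi q ~= 0"
   using w csubring_power[OF csubfieldD(1)[OF U.Fix_subfield]] csubfieldD(2)[OF U.Fix_subfield]
   by (simp_all add: power_int_def)
  have valw: "val B (w powi q) = q * int e"
  proof (cases q rule: int_cases2)
   case (nonneg k)
   thus ?thesis using val_power[OF B FixL[OF w(1)] w(2)] w(3) by simp
  next
   case (nonpos k)
   have "val B (inverse (w ^ k)) = - val B (w ^ k)"
    using w by (intro val_inverse[OF B] Lcl(7) FixL) simp_all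
   thus ?thesis using nonpos val_power[OF B FixL[OF w(1)] w(2)] w(3) by (simp add: power_int_minus)
  qed
  have "val B z' = val B z - val B (w powi q)"
   unfolding z'_def by (rule val_divide[OF B FixL[OF z(1)] z(2) FixL[OF wq(1)] wq(2)])
  hence "val B z' = val B z mod int e"
   unfolding valw by (simp add: q_def minus_div_mult_eq_mod)
  moreover have "val B z mod int e > 0"
   using nd e0 by (metis dvd_eq_mod_eq_0 le_less of_nat_0_less_iff pos_mod_sign)
  moreover have "z' : U.Fix" unfolding z'_def by (rule csubfieldD(3)[OF U.Fix_subfield z(1) wq(1)])
  moreover have "z' ~= 0" unfolding z'_def using z wq by simp
  ultimately have "P (nat (val B z mod int e))" unfolding P_def by auto
  moreover have "nat (val B z mod int e) < e" using e0 pos_mod_bound[of "int e" "val B z"] by linarith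
  ultimately show False using e_min by blast
 qed
 have "card U <= e"
 proof (rule ccontr)
  assume "~ card U <= e"
  hence "EX c. (ALL \<sigma>:U. c \<sigma> : L) & (EX \<sigma>:U. c \<sigma> ~= 0) & (ALL j<e. (\<Sum>\<sigma>\<in>U. c \<sigma> * \<sigma> (?\<pi> ^ j)) = 0)"
   using U.into Lcl(7)[OF \<pi>(1)] by (intro homogeneous_system_nonzero_solution[OF L U.fin]) auto
  then obtain c where c: "ALL \<sigma>:U. c \<sigma> : L" "EX \<sigma>:U. c \<sigma> ~= 0"
   "ALL j<e. (\<Sum>\<sigma>\<in>U. c \<sigma> * \<sigma> (?\<pi> ^ j)) = 0" by blast
  define \<Lambda> where "\<Lambda> x = (\<Sum>\<sigma>\<in>U. c \<sigma> * \<sigma> x)" for x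
  have step: "EX z:V B (int j + 1). \<Lambda> x = \<Lambda> z" if x: "x : V B (int j)" for x j
  proof -
   define g where "g = w ^ (j div e) * ?\<pi> ^ (j mod e)"
   have gL: "g : L" "g ~= 0" unfolding g_def using w(2) \<pi> FixL[OF w(1)] by (simp_all add: Lcl(5,7))
   have "val B g = int (j div e) * int e + int (j mod e)"
    unfolding g_def using w \<pi> FixL[OF w(1)]
    by (simp add: val_mult[OF B] val_power[OF B] Lcl(7) val_unif[OF B])
   also have "... = int j" by (metis div_mult_mod_eq of_nat_add of_nat_mult)
   finally have vg: "val B g = int j" .
   obtain d where d: "d : \<O>" "d : U.Fix" "x - d * g : V B (int j + 1)"
    using leading_term[OF U gL, of x] x vg by auto
   have dw: "d * w ^ (j div e) : U.Fix"
    by (intro F(5) d csubring_power[OF csubfieldD(1)[OF U.Fix_subfield]] w)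
   have "\<Lambda> (d * g) = d * w ^ (j div e) * \<Lambda> (?\<pi> ^ (j mod e))"
   proof -
    have "\<sigma> (d * g) = d * w ^ (j div e) * \<sigma> (?\<pi> ^ (j mod e))" if "\<sigma> : U" for \<sigma>
    proof -
     have "\<sigma> (d * g) = \<sigma> (d * w ^ (j div e)) * \<sigma> (?\<pi> ^ (j mod e))"
      unfolding g_def mult.assoc[symmetric] by (rule U.hom_simps(4)[OF that FixL[OF dw] Lcl(7)[OF \<pi>(1)]])
     thus ?thesis using dw that by (simp add: U.Fix_def)
    qed
    thus ?thesis unfolding \<Lambda>_def sum_distrib_left by (intro sum.cong) (auto simp: mult_ac)
   qed
   also have "\<Lambda> (?\<pi> ^ (j mod e)) = 0" using c(3) e0 by (simp add: \<Lambda>_def)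
   finally have "\<Lambda> (d * g) = 0" by simp
   moreover have "\<Lambda> x = \<Lambda> (x - d * g) + \<Lambda> (d * g)"
   proof -
    have sx: "\<sigma> x = \<sigma> (x - d * g) + \<sigma> (d * g)" if "\<sigma> : U" for \<sigma>
     using U.hom_simps(3)[OF that V_L[OF B d(3)] Lcl(5)[OF Int_L[OF d(1)] gL(1)]] by simp
    have "c \<sigma> * \<sigma> x = c \<sigma> * \<sigma> (x - d * g) + c \<sigma> * \<sigma> (d * g)" if "\<sigma> : U" for \<sigma>
     by (subst sx[OF that]) (rule distrib_left)
    thus ?thesis unfolding \<Lambda>_def sum.distrib[symmetric] by (intro sum.cong refl)
   qed
   ultimately have "\<Lambda> x = \<Lambda> (x - d * g)" by simp
   thus ?thesis using d(3) by blast
  qed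
  have approx: "EX z:V B (int N). \<Lambda> x = \<Lambda> z" if x: "x : V B 0" for x N
  proof (induction N)
   case 0
   show ?case using x by (intro bexI[of _ x]) simp_all
  next
   case (Suc N)
   then obtain z where z: "z : V B (int N)" "\<Lambda> x = \<Lambda> z" by blast
   obtain z' where z': "z' : V B (int N + 1)" "\<Lambda> z = \<Lambda> z'" using step[OF z(1)] by blast
   have "z' : V B (int (Suc N))" using z'(1) by (simp add: add.commute)
   thus ?case using z(2) z'(2) by (intro bexI[of _ z']) simp_all
  qed
  define M where "M = (\<Sum>\<sigma>\<in>U. nat \<bar>val B (c \<sigma>)\<bar>)"
  have cM: "c \<sigma> : V B (- int M)" if "\<sigma> : U" for \<sigma>
  proof -
   have "nat \<bar>val B (c \<sigma>)\<bar> <= M" unfolding M_def using that U.fin by (intro member_le_sum) auto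
   thus ?thesis using c(1) that by (auto simp: V_def)
  qed
  have \<Lambda>V: "\<Lambda> z : V B (int N - int M)" if z: "z : V B (int N)" for z N
   unfolding \<Lambda>_def
  proof (rule V_cl(5)[OF B])
   fix \<sigma> assume \<sigma>: "\<sigma> : U"
   have "\<sigma> z : V B (int N)" using V_decomp[OF _ V_L[OF B z]] \<sigma> UD z by blast
   thus "c \<sigma> * \<sigma> z : V B (int N - int M)" using V_mult[OF B cM[OF \<sigma>]] by fastforce
  qed
  have zero: "\<Lambda> x = 0" if x: "x : \<O>" for x
  proof (rule ccontr)
   assume nz: "\<Lambda> x ~= 0"
   define N where "N = nat (\<bar>val B (\<Lambda> x)\<bar> + int M + 1)"
   obtain z where "z : V B (int N)" "\<Lambda> x = \<Lambda> z" using approx[OF Int_V0[OF B x]] by blast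
   hence "\<Lambda> x : V B (int N - int M)" using \<Lambda>V by simp
   hence "val B (\<Lambda> x) >= int N - int M" using nz by (simp add: V_def)
   thus False by (simp add: N_def)
  qed
  have "c \<sigma> : {0}" if \<sigma>: "\<sigma> : U" for \<sigma>
  proof (rule characters_independent_mod_prime[where R = L and B = "{0}" and M = \<O> and mul = "(*)" and ?m1.0 = 1 and \<Phi> = U and u = c and \<phi> = \<sigma>])
   show "EX x:\<O>. \<sigma> x - \<tau> x ~: {0}" if "\<sigma> : U" "\<tau> : U" "\<sigma> ~= \<tau>" for \<sigma> \<tau>
   proof (rule ccontr)
    assume "~ (EX x:\<O>. \<sigma> x - \<tau> x ~: {0})"
    hence agree: "\<sigma> x = \<tau> x" if "x : \<O>" for x using that by auto
    have "\<sigma> x = \<tau> x" if x: "x : L" for x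
    proof -
     obtain d :: int where d: "d > 0" "of_int d * x : \<O>" using denominator[OF x] by blast
     have "of_int d * \<sigma> x = of_int d * \<tau> x"
      using agree[OF d(2)] x \<open>\<sigma> : U\<close> \<open>\<tau> : U\<close> by (simp add: U.hom_simps Lcl(11))
     thus ?thesis using d(1) by simp
    qed
    thus False using U.ext_eqI that by blast
   qed
   show "(\<Sum>\<phi>\<in>U. c \<phi> * \<phi> x) : {0}" if "x : \<O>" for x using zero[OF that] by (simp add: \<Lambda>_def)
   show "\<phi> x : L" if "\<phi> : U" "x : \<O>" for \<phi> x using U.into Int_L that by blast
   show "\<phi> (x * y) = \<phi> x * \<phi> y" if "\<phi> : U" "x : \<O>" "y : \<O>" for \<phi> x y
    using U.hom_simps(4) Int_L that by blast
   show "\<phi> 1 = 1" if "\<phi> : U" for \<phi> using U.hom_simps(1)[OF that] .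
  qed (use LR U.fin c(1) Int_cl(2,5) \<sigma> in auto)
  thus False using c(2) by auto
 qed
 thus ?thesis using e_le e_dvd x by simp
qed

end

end

lemma coeff_synthetic_div:
 assumes R: "csubring R" and q: "!!i. poly.coeff q i : R" and c: "c : R"
 shows "poly.coeff (synthetic_div q c) i : R"
 using q
proof (induction q arbitrary: i)
 case 0
 thus ?case by (simp add: csubringD(1)[OF R])
next
 case (pCons a p)
 have p: "poly.coeff p j : R" for j using pCons.prems[of "Suc j"] by simp
 have "poly p c : R"
  unfolding poly_altdef by (intro csubring_sum[OF R] csubringD(5)[OF R] csubring_power[OF R] p c)
 moreover have "poly.coeff (synthetic_div p c) j : R" for j using pCons.IH p by blast
 ultimately show ?case by (simp add: coeff_pCons split: nat.splits)
qed

lemma factor_distinct_roots: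
 assumes R: "csubring R" and fin: "finite A" and inj: "inj_on r A"
  and r: "!!a. a : A ==> r a : R" and q: "!!i. poly.coeff q i : R"
  and root: "!!a. a : A ==> poly q (r a) = 0"
 shows "EX Q. (ALL i. poly.coeff Q i : R) & q = (\<Prod>a\<in>A. [:- r a, 1:]) * Q"
 using fin inj r root
proof (induction A rule: finite_induct)
 case empty
 show ?case using q by auto
next
 case (insert a A)
 obtain Q where Q: "ALL i. poly.coeff Q i : R" "q = (\<Prod>a\<in>A. [:- r a, 1:]) * Q"
  using insert.IH insert.prems by (auto simp: inj_on_def)
 have "poly (\<Prod>a\<in>A. [:- r a, 1:]) (r a) ~= 0"
 proof
  assume "poly (\<Prod>a\<in>A. [:- r a, 1:]) (r a) = 0"
  then obtain b where "b : A" "r a - r b = 0"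
   unfolding poly_prod prod_zero_iff[OF insert.hyps(1)] by auto
  thus False using insert.prems(1) insert.hyps(2) by (auto simp: inj_on_def)
 qed
 moreover have "poly q (r a) = 0" using insert.prems(3) by blast
 ultimately have "poly Q (r a) = 0" unfolding Q(2) poly_mult by simp
 hence "Q = [:- r a, 1:] * synthetic_div Q (r a)"
  using synthetic_div_correct'[of "r a" Q] by simp
 hence "q = (\<Prod>a\<in>insert a A. [:- r a, 1:]) * synthetic_div Q (r a)"
  unfolding prod.insert[OF insert.hyps] using Q(2) by (metis mult.assoc mult.commute)
 moreover have "ALL i. poly.coeff (synthetic_div Q (r a)) i : R"
  using coeff_synthetic_div[OF R, of Q "r a"] Q(1) insert.prems(2) by blast
 ultimately show ?case by blast
qed

context galois_field
begin

context
 fixes B :: "complex set"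
 assumes B: "Prime B"
begin

lemma inert_unif_inj: "inj_on (%\<sigma>. \<sigma> (unif B)) (inert B)"
proof -
 interpret I: aut_group L "inert B" by (rule inert_subgroup[OF B])
 note \<pi> = unif_L[OF B] unif_nonzero[OF B]
 have id: "\<sigma> = restrict id L" if \<sigma>: "\<sigma> : inert B" "\<sigma> (unif B) = unif B" for \<sigma>
 proof -
  define U where "U = {\<tau> : inert B. ALL x:{unif B}. \<tau> x = x}"
  have U: "aut_group L U" unfolding U_def using \<pi> by (intro I.pointwise_stabilizer_subgroup) simp
  interpret U: aut_group L U by (rule U)
  have "unif B : U.Fix" using \<pi> by (simp add: U.Fix_def) (simp add: U_def)
  moreover have "U <= inert B" by (auto simp: U_def)
  ultimately have "int (card U) dvd val B (unif B)" using val_fixed_dvd[OF B U _ _ \<pi>(2)] by blast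
  hence "card U = 1" by (simp add: val_unif[OF B])
  then obtain \<rho> where "U = {\<rho>}" by (rule card_1_singletonE)
  moreover have "\<sigma> : U" using \<sigma> by (simp add: U_def)
  ultimately show ?thesis using U.id_mem by blast
 qed
 show ?thesis
 proof (rule inj_onI)
  fix \<sigma> \<tau> assume st: "\<sigma> : inert B" "\<tau> : inert B" "\<sigma> (unif B) = \<tau> (unif B)"
  obtain \<rho> where \<rho>: "\<rho> : inert B" "ALL x:L. \<rho> (\<tau> x) = x & \<tau> (\<rho> x) = x" using I.inv_ex[OF st(2)] by blast
  have "compose L \<rho> \<sigma> = restrict id L"
   using \<rho> st(3) \<pi> by (intro id I.comp_mem \<rho>(1) st(1)) (simp add: comp_apply)
  hence "\<rho> (\<sigma> x) = x" if "x : L" for x using that by (metis comp_apply restrict_apply' id_apply)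
  hence "\<sigma> x = \<tau> x" if "x : L" for x using \<rho>(2) I.into[OF st(1) that] that by metis
  thus "\<sigma> = \<tau>" by (rule I.ext_eqI[OF st(1,2)])
 qed
qed

text \<open>The powers of the uniformizer are a basis over the inertia field. The values of invariants are
  multiples of the group order, so the terms have distinct values and cannot cancel: an element
  of the localization has coefficients there.\<close>

lemma uniformizer_expansion:
 assumes x: "x : loc B"
 shows "EX c. (ALL j<card (inert B). c j : loc B & c j : fixed (inert B)) & x = (\<Sum>j<card (inert B). c j * unif B ^ j)"
proof -
 interpret I: aut_group L "inert B" by (rule inert_subgroup[OF B])
 let ?e = "card (inert B)" and ?\<pi> = "unif B"
 note \<pi> = unif_L[OF B] unif_nonzero[OF B]
 obtain c where c: "ALL j<?e. c j : I.Fix" "x = (\<Sum>j<?e. c j * ?\<pi> ^ j)"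
  using I.power_coordinates[OF \<pi>(1) inert_unif_inj loc_L[OF B x]] by blast
 have cL: "c j : L" if "j < ?e" for j using c(1) that I.Fix_subset by blast
 define J where "J = {j. j < ?e & c j ~= 0}"
 define f where "f j = c j * ?\<pi> ^ j" for j
 have f: "f j : L" "f j ~= 0" "val B (f j) = val B (c j) + int j" if "j : J" for j
  using that \<pi> cL val_mult[OF B cL _ Lcl(7)[OF \<pi>(1)], of j j] val_power[OF B \<pi>] val_unif[OF B]
  by (simp_all add: J_def f_def Lcl(5,7))
 have mod: "int ?e dvd val B (c j)" if "j : J" for j
  using that c(1) val_fixed_dvd[OF B inert_subgroup[OF B] subset_refl] by (simp add: J_def)
 have "c j : loc B" if j: "j < ?e" for j
 proof (rule ccontr)
  assume nl: "c j ~: loc B"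
  hence c0: "c j ~= 0" using loc_cl(1)[OF B] by auto
  hence jJ: "j : J" using j by (simp add: J_def)
  have "val B (c j) < 0" using mem_loc_iff[OF B cL[OF j] c0] nl by simp
  moreover obtain k where k: "val B (c j) = int ?e * k" using mod[OF jJ] by blast
  ultimately have "k <= - 1" by (simp add: mult_less_0_iff)
  hence "int ?e * k <= int ?e * (- 1)" by (intro mult_left_mono) simp_all
  hence "val B (c j) <= - int ?e" using k by simp
  hence neg: "val B (f j) < 0" using f(3)[OF jJ] j by simp
  have finJ: "finite J" by (simp add: J_def)
  have "Min ((%k. val B (f k)) ` J) : (%k. val B (f k)) ` J"
   using finJ jJ by (intro Min_in) auto
  then obtain i where i0: "i : J" "Min ((%k. val B (f k)) ` J) = val B (f i)" by blast
  have i: "i : J" "!!k. k : J ==> val B (f i) <= val B (f k)"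
   using i0 finJ by (auto simp flip: i0(2))
  have strict: "val B (f k) >= val B (f i) + 1" if k: "k : J - {i}" for k
  proof -
   have "val B (f k) ~= val B (f i)"
   proof
    assume "val B (f k) = val B (f i)"
    hence "int k - int i = val B (c i) - val B (c k)" using f(3)[of i] f(3)[of k] i(1) k by simp
    hence "int ?e dvd int k - int i" using mod[of i] mod[of k] i(1) k by (metis DiffD1 dvd_diff)
    moreover have "\<bar>int k - int i\<bar> < int ?e" using i(1) k by (auto simp: J_def)
    ultimately have "int k - int i = 0" using zdvd_not_zless[of "\<bar>int k - int i\<bar>" "int ?e"] by (cases "int k - int i = 0") auto
    thus False using k by simp
   qed
   thus ?thesis using i(2)[of k] k by simp
  qed
  have "x = (\<Sum>k\<in>J. f k)"
   unfolding c(2) f_def by (rule sum.mono_neutral_right) (auto simp: J_def)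
  also have "... = f i + (\<Sum>k\<in>J - {i}. f k)" by (rule sum.remove[OF finJ i(1)])
  finally have xs: "x = f i + (\<Sum>k\<in>J - {i}. f k)" .
  have "(\<Sum>k\<in>J - {i}. f k) : V B (val B (f i) + 1)"
   using strict f(1) by (intro V_cl(5)[OF B]) (auto simp: V_def)
  from val_lt_add[OF B f(1)[OF i(1)] f(2)[OF i(1)] this]
  have "val B x = val B (f i)" "x ~= 0" unfolding xs by auto
  moreover have "val B (f i) < 0" using i(2)[OF jJ] neg by simp
  ultimately show False using mem_loc_iff[OF B loc_L[OF B x]] x by simp
 qed
 thus ?thesis using c by blast
qed

text \<open>Every integer is approximated by a polynomial in the uniformizer whose coefficients are
  invariant under inertia, so the uniformizer moves as much as any integer.\<close>

lemma inert_cong_iff: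
 assumes \<sigma>: "\<sigma> : inert B"
 shows "(ALL x:\<O>. \<sigma> x - x : V B (int N)) \<longleftrightarrow> \<sigma> (unif B) - unif B : V B (int N)"
proof
 show "ALL x:\<O>. \<sigma> x - x : V B (int N) ==> \<sigma> (unif B) - unif B : V B (int N)"
  using unif_Int[OF B] by blast
 interpret I: aut_group L "inert B" by (rule inert_subgroup[OF B])
 note \<pi> = unif_L[OF B] unif_nonzero[OF B]
 let ?\<pi> = "unif B"
 assume a: "\<sigma> ?\<pi> - ?\<pi> : V B (int N)"
 have sD: "\<sigma> : decomp B" by (rule inert_decomp[OF B \<sigma>])
 have pow: "\<sigma> (?\<pi> ^ k) - ?\<pi> ^ k : V B (int N)" for k
 proof -
  have "\<sigma> (?\<pi> ^ k) - ?\<pi> ^ k = (\<sigma> ?\<pi> - ?\<pi>) * (\<Sum>i<k. (\<sigma> ?\<pi>) ^ i * ?\<pi> ^ (k - Suc i))"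
   using power_diff_sumr2[of "\<sigma> ?\<pi>" k ?\<pi>] I.hom_simps(7)[OF \<sigma> \<pi>(1)] by (simp add: mult_ac)
  moreover have "(\<Sum>i<k. (\<sigma> ?\<pi>) ^ i * ?\<pi> ^ (k - Suc i)) : V B 0"
   by (rule Int_V0[OF B]) (intro Int_cl(8,5,7) I.Int_into[OF \<sigma> unif_Int[OF B]] unif_Int[OF B])
  ultimately show ?thesis using V_mult[OF B a, of _ 0] by fastforce
 qed
 have "ALL x:V B (int k). \<sigma> x - x : V B (int N)" if "k <= N" for k
  using that
 proof (induction "N - k" arbitrary: k)
  case 0
  hence "k = N" by simp
  thus ?case using V_decomp[OF B sD V_L[OF B]] V_cl(2)[OF B] by blast
 next
  case (Suc m)
  show ?case
  proof
   fix x assume x: "x : V B (int k)"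
   have pk: "?\<pi> ^ k : L" "?\<pi> ^ k ~= 0" "val B (?\<pi> ^ k) = int k"
    using \<pi> val_power[OF B \<pi>] val_unif[OF B] by (simp_all add: Lcl(7))
   obtain c where c: "c : \<O>" "c : I.Fix" "x - c * ?\<pi> ^ k : V B (int k + 1)"
    using leading_term[OF B inert_subgroup[OF B] subset_refl pk(1,2), of x] x pk(3) by auto
   have "\<sigma> (x - c * ?\<pi> ^ k) - (x - c * ?\<pi> ^ k) : V B (int N)"
    using Suc.hyps(1)[of "Suc k"] Suc.hyps(2) c(3) by (simp add: add.commute)
   moreover have "\<sigma> (c * ?\<pi> ^ k) - c * ?\<pi> ^ k : V B (int N)"
   proof -
    have "\<sigma> (c * ?\<pi> ^ k) = c * \<sigma> (?\<pi> ^ k)"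
     using I.hom_simps(4)[OF \<sigma> Int_L[OF c(1)] pk(1)] c(2) \<sigma> by (simp add: I.Fix_def)
    hence "\<sigma> (c * ?\<pi> ^ k) - c * ?\<pi> ^ k = c * (\<sigma> (?\<pi> ^ k) - ?\<pi> ^ k)" by (simp add: right_diff_distrib)
    thus ?thesis using V_mult_0[OF B Int_V0[OF B c(1)] pow] by simp
   qed
   ultimately have "(\<sigma> (x - c * ?\<pi> ^ k) - (x - c * ?\<pi> ^ k)) + (\<sigma> (c * ?\<pi> ^ k) - c * ?\<pi> ^ k) : V B (int N)"
    by (rule V_cl(4)[OF B])
   moreover have "\<sigma> (x - c * ?\<pi> ^ k) = \<sigma> x - \<sigma> (c * ?\<pi> ^ k)"
    by (rule I.hom_simps(5)[OF \<sigma> V_L[OF B x] Lcl(5)[OF Int_L[OF c(1)] pk(1)]])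
   ultimately show "\<sigma> x - x : V B (int N)" by simp
  qed
 qed
 from this[of 0] show "ALL x:\<O>. \<sigma> x - x : V B (int N)" using Int_V0[OF B] by simp
qed

text \<open>Serre's formula for passing to a quotient. With \<open>f\<close> the polynomial of the conjugates of
  \<open>\<pi>\<close> under \<open>U\<close> and \<open>g\<close> expressing \<open>\<omega>\<close> through \<open>\<pi>\<close>, the coefficients of \<open>s f - f\<close> are divisible by
  \<open>s \<omega> - \<omega>\<close>, while \<open>s f\<close> divides \<open>g - s \<omega>\<close>; evaluate both at \<open>\<pi>\<close>.\<close>

lemma val_quotient_different:
 assumes U: "aut_group L U" "U <= inert B" and s: "s : inert B" "s ~: U"
  and w: "\<omega> : fixed U" "\<omega> : \<O>" "\<omega> ~= 0" "val B \<omega> = int (card U)"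
 shows "s \<omega> ~= \<omega>" and "val B (s \<omega> - \<omega>) = (\<Sum>h\<in>U. val B (s (h (unif B)) - unif B))"
proof -
 interpret U: aut_group L U by fact
 interpret I: aut_group L "inert B" by (rule inert_subgroup[OF B])
 let ?\<pi> = "unif B" and ?e = "card (inert B)"
 note \<pi> = unif_L[OF B] unif_nonzero[OF B]
 have sD: "s : decomp B" by (rule inert_decomp[OF B s(1)])
 have wL: "\<omega> : L" by (rule Int_L[OF w(2)])
 have sh: "compose L s h : inert B" if "h : U" for h using I.comp_mem[OF s(1)] U(2) that by blast
 define r where "r h = s (h ?\<pi>)" for h
 have r_comp: "r h = compose L s h ?\<pi>" for h by (simp add: r_def comp_apply[OF \<pi>(1)])
 have rI: "r h : \<O>" if "h : U" for h
  unfolding r_comp by (rule I.Int_into[OF sh[OF that] unif_Int[OF B]])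
 have rne: "r h ~= ?\<pi>" if h: "h : U" for h
 proof
  assume "r h = ?\<pi>"
  hence eq: "compose L s h = restrict id L"
   using inj_onD[OF inert_unif_inj _ sh[OF h] I.id_mem] \<pi>(1) unfolding r_comp by simp
  obtain h' where h': "h' : U" "ALL x:L. h' (h x) = x & h (h' x) = x" using U.inv_ex[OF h] by blast
  have "s x = h' x" if x: "x : L" for x
  proof -
   have "s (h (h' x)) = h' x" using fun_cong[OF eq, of "h' x"] U.into[OF h'(1) x] by (simp add: comp_apply)
   thus ?thesis using h'(2) x by simp
  qed
  hence "s = h'" using I.ext_eqI[OF s(1)] h'(1) U(2) by blast
  thus False using s(2) h'(1) by simp
 qed
 define b where "b = (\<Prod>h\<in>U. ?\<pi> - r h)"
 have dL: "?\<pi> - r h : L & ?\<pi> - r h ~= 0" if "h : U" for h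
  using rne[OF that] Lcl(4)[OF \<pi>(1) Int_L[OF rI[OF that]]] by simp
 have b0: "b ~= 0" unfolding b_def using dL U.fin by (simp add: prod_zero_iff)
 have bL: "b : L" unfolding b_def by (rule Lcl(9)) (use dL in blast)
 have valb: "val B b = (\<Sum>h\<in>U. val B (r h - ?\<pi>))"
 proof -
  have "val B (?\<pi> - r h) = val B (r h - ?\<pi>)" if "h : U" for h
   using val_uminus[OF B Lcl(4)[OF \<pi>(1) Int_L[OF rI[OF that]]]] by simp
  thus ?thesis unfolding b_def using val_prod[OF B U.fin dL] by simp
 qed
 \<comment> \<open>invariants of \<open>U\<close> are power series in \<open>\<omega>\<close> over the inertia field\<close>
 have move: "s x - x : V B (int N)" if sw: "s \<omega> - \<omega> : V B (int N)" and x: "x : U.Fix" "x : V B 0" for x N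
 proof -
  have swp: "s (\<omega> ^ k) - \<omega> ^ k : V B (int N)" for k
  proof -
   have "s (\<omega> ^ k) - \<omega> ^ k = (s \<omega> - \<omega>) * (\<Sum>i<k. (s \<omega>) ^ i * \<omega> ^ (k - Suc i))"
    using power_diff_sumr2[of "s \<omega>" k \<omega>] I.hom_simps(7)[OF s(1) wL] by (simp add: mult_ac)
   moreover have "(\<Sum>i<k. (s \<omega>) ^ i * \<omega> ^ (k - Suc i)) : V B 0"
    by (rule Int_V0[OF B]) (intro Int_cl(8,5,7) I.Int_into[OF s(1) w(2)] w(2))
   ultimately show ?thesis using V_mult[OF B sw, of _ 0] by fastforce
  qed
  have claim: "ALL x:U.Fix Int V B (int k * int (card U)). s x - x : V B (int N)" if "k <= N" for k
   using that
  proof (induction "N - k" arbitrary: k)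
   case 0
   show ?case
   proof
    fix x assume x: "x : U.Fix Int V B (int k * int (card U))"
    have "int N <= int k * int (card U)"
     using 0 U.card_pos by (simp flip: of_nat_mult)
    hence "x : V B (int N)" using x V_antimono[OF B] by blast
    thus "s x - x : V B (int N)" using V_decomp[OF B sD V_L[OF B]] V_cl(2)[OF B] by blast
   qed
  next
   case (Suc m)
   show ?case
   proof
    fix x assume x: "x : U.Fix Int V B (int k * int (card U))"
    have wk: "\<omega> ^ k : L" "\<omega> ^ k ~= 0" "val B (\<omega> ^ k) = int k * int (card U)"
     using wL w val_power[OF B wL] by (simp_all add: Lcl(7))
    obtain c where c: "c : \<O>" "c : I.Fix" "x - c * \<omega> ^ k : V B (int k * int (card U) + 1)"
     using leading_term[OF B inert_subgroup[OF B] subset_refl wk(1,2), of x] x wk(3) by auto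
    have cU: "c : U.Fix" using c(2) U(2) by (auto simp: I.Fix_def U.Fix_def)
    have xU: "x - c * \<omega> ^ k : U.Fix"
     using x w cU csubring_power[OF csubfieldD(1)[OF U.Fix_subfield]] by (intro csubringD(4,5)[OF csubfieldD(1)[OF U.Fix_subfield]]) auto
    have "x - c * \<omega> ^ k : V B (int (Suc k) * int (card U))"
    proof (cases "x - c * \<omega> ^ k = 0")
     case False
     obtain q where q: "val B (x - c * \<omega> ^ k) = int (card U) * q"
      using val_fixed_dvd[OF B U xU False] by blast
     have "int (card U) * q >= int k * int (card U) + 1" using c(3) False q by (simp add: V_def)
     hence "int (card U) * int k < int (card U) * q" by (simp add: mult.commute)
     hence "int k < q" using U.card_pos by simp
     hence "int (card U) * (int k + 1) <= int (card U) * q" by (intro mult_left_mono) auto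
     thus ?thesis using V_L[OF B c(3)] q by (simp add: V_def mult.commute algebra_simps)
    qed (simp only: V_cl(1)[OF B])
    hence "s (x - c * \<omega> ^ k) - (x - c * \<omega> ^ k) : V B (int N)"
     using Suc.hyps(1)[of "Suc k"] Suc.hyps(2) xU by simp
    moreover have "s (c * \<omega> ^ k) - c * \<omega> ^ k : V B (int N)"
    proof -
     have "s (c * \<omega> ^ k) = c * s (\<omega> ^ k)"
      using I.hom_simps(4)[OF s(1) Int_L[OF c(1)] wk(1)] c(2) s(1) by (simp add: I.Fix_def)
     hence "s (c * \<omega> ^ k) - c * \<omega> ^ k = c * (s (\<omega> ^ k) - \<omega> ^ k)" by (simp add: right_diff_distrib)
     thus ?thesis using V_mult_0[OF B Int_V0[OF B c(1)] swp] by simp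
    qed
    ultimately have "(s (x - c * \<omega> ^ k) - (x - c * \<omega> ^ k)) + (s (c * \<omega> ^ k) - c * \<omega> ^ k) : V B (int N)"
     by (rule V_cl(4)[OF B])
    moreover have "s (x - c * \<omega> ^ k) = s x - s (c * \<omega> ^ k)"
     using x by (intro I.hom_simps(5)[OF s(1)] Lcl(5)[OF Int_L[OF c(1)] wk(1)]) (simp add: U.Fix_def)
    ultimately show "s x - x : V B (int N)" by simp
   qed
  qed
  show ?thesis using claim[of 0] x by simp
 qed
 have b_move: "b : V B (int N)" if sw: "s \<omega> - \<omega> : V B (int N)" for N
 proof -
  let ?f = "U.cpoly ?\<pi>"
  define F where "F = (\<Prod>h\<in>U. [:- r h, 1:])"
  have Fc: "poly.coeff F i = s (poly.coeff ?f i)" for i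
   unfolding F_def U.cpoly_def r_def
   by (rule hom_on_coeff_linear_factors(2)[OF L I.hom[OF s(1)], symmetric]) (rule U.into[OF _ \<pi>(1)])
  have fI: "poly.coeff ?f i : \<O>" for i
   unfolding U.cpoly_def
   using coeff_linear_factors_cong[OF B U.fin, of "%\<sigma>. \<sigma> ?\<pi>" "%\<sigma>. \<sigma> ?\<pi>"]
    U.Int_into[OF _ unif_Int[OF B]] IdealD(2)[OF PrimeD(1)[OF B]] by simp
  have degF: "Polynomial.degree F = card U" unfolding F_def by (subst degree_prod_eq_sum_degree) auto
  have "b = poly F ?\<pi>" by (simp add: b_def F_def poly_prod)
  also have "... = poly F ?\<pi> - poly ?f ?\<pi>" using U.cpoly_self[OF \<pi>(1)] by simp
  also have "... = (\<Sum>i\<le>card U. (s (poly.coeff ?f i) - poly.coeff ?f i) * ?\<pi> ^ i)"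
   by (simp add: poly_altdef degF U.cpoly_degree Fc left_diff_distrib sum_subtractf)
  also have "... : V B (int N)"
  proof (rule V_cl(5)[OF B])
   fix i
   have "s (poly.coeff ?f i) - poly.coeff ?f i : V B (int N)"
    by (rule move[OF sw U.cpoly_coeff[OF \<pi>(1)] Int_V0[OF B fI]])
   from V_mult[OF B this Int_V0[OF B Int_cl(7)[OF unif_Int[OF B]]]]
   show "(s (poly.coeff ?f i) - poly.coeff ?f i) * ?\<pi> ^ i : V B (int N)" by simp
  qed
  finally show ?thesis .
 qed
 show sw: "s \<omega> ~= \<omega>"
 proof
  assume "s \<omega> = \<omega>"
  hence "b : V B (int (nat (val B b + 1)))" using V_cl(1)[OF B] by (intro b_move) simp
  thus False using b0 by (simp add: V_def split: if_splits)
 qed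
 define a where "a = s \<omega> - \<omega>"
 have aI: "a : \<O>" unfolding a_def by (intro Int_cl(4) I.Int_into[OF s(1) w(2)] w(2))
 have a0: "a ~= 0" using sw by (simp add: a_def)
 have a_pos: "val B a >= 0" using Int_V0[OF B aI] a0 by (simp add: V_def)
 have "b : V B (int (nat (val B a)))"
  using Int_L[OF aI] a_pos by (intro b_move) (simp add: V_def a_def)
 hence le1: "val B a <= val B b" using b0 a_pos by (simp add: V_def)
 obtain c where c: "ALL j<?e. c j : loc B & c j : I.Fix" "\<omega> = (\<Sum>j<?e. c j * ?\<pi> ^ j)"
  using uniformizer_expansion[OF Int_loc[OF B w(2)]] by blast
 define g where "g = (\<Sum>j<?e. Polynomial.monom (c j) j)"
 define q where "q = g - [:s \<omega>:]"
 have gc: "poly.coeff g i = (if i < ?e then c i else 0)" for i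
  by (simp add: g_def coeff_sum)
 have gF: "poly.coeff g i : I.Fix" for i
  using c(1) csubringD(1)[OF csubfieldD(1)[OF I.Fix_subfield]] by (simp add: gc)
 have geval: "poly g ?\<pi> = \<omega>" by (simp add: g_def poly_sum poly_monom c(2))
 have gL: "poly.coeff g i : L" for i using gF[of i] by (simp add: I.Fix_def)
 have qR: "poly.coeff q i : loc B" for i
 proof -
  have "poly.coeff g i : loc B" using c(1) loc_cl(1)[OF B] by (simp add: gc)
  moreover have "poly.coeff [:s \<omega>:] i : loc B"
   using Int_loc[OF B I.Int_into[OF s(1) w(2)]] loc_cl(1)[OF B] by (simp add: coeff_pCons split: nat.splits)
  ultimately show ?thesis unfolding q_def coeff_diff by (rule loc_cl(4)[OF B])
 qed
 have root: "poly q (r h) = 0" if h: "h : U" for h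
 proof -
  have "r h = compose L s h ?\<pi>" by (rule r_comp)
  hence "poly g (r h) = compose L s h (poly g ?\<pi>)"
  proof -
   have "compose L s h (poly.coeff g i) = poly.coeff g i" for i
    using gF[of i] sh[OF h] unfolding I.Fix_def by blast
   thus ?thesis
    using hom_on_poly_eval[OF L I.hom[OF sh[OF h]] gL \<pi>(1)] r_comp[of h] by (simp add: poly_altdef)
  qed
  also have "... = s \<omega>"
  proof -
   have "h \<omega> = \<omega>" using w(1) h unfolding U.Fix_def by blast
   thus ?thesis using wL by (simp add: geval comp_apply)
  qed
  finally show ?thesis by (simp add: q_def)
 qed
 have rinj: "inj_on r U"
 proof (rule inj_onI)
  fix h h' assume h: "h : U" "h' : U" "r h = r h'"
  hence "compose L s h = compose L s h'"
   using inj_onD[OF inert_unif_inj _ sh[OF h(1)] sh[OF h(2)]] unfolding r_comp by simp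
  thus "h = h'"
   using I.bij_comp_left[OF s(1)] h U(2) by (auto simp: bij_betw_def inj_on_def)
 qed
 have "EX Q. (ALL i. poly.coeff Q i : loc B) & q = (\<Prod>h\<in>U. [:- r h, 1:]) * Q"
  by (rule factor_distinct_roots[OF loc_ring[OF B] U.fin rinj Int_loc[OF B rI] qR root])
 then obtain Q where Q: "ALL i. poly.coeff Q i : loc B" "q = (\<Prod>h\<in>U. [:- r h, 1:]) * Q" by blast
 have "- a = poly q ?\<pi>" by (simp add: q_def geval a_def)
 also have "... = b * poly Q ?\<pi>" unfolding Q(2) by (simp add: b_def poly_prod)
 finally have ab: "- a = b * poly Q ?\<pi>" .
 have QV: "poly Q ?\<pi> : V B 0"
  unfolding V_0[OF B] poly_altdef
  by (rule loc_cl(8)[OF B], rule loc_cl(5)[OF B Q(1)[rule_format] loc_cl(7)[OF B Int_loc[OF B unif_Int[OF B]]]])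
 have "b : V B (val B b)" using bL by (simp add: V_def)
 from V_mult[OF B this QV] have "- a : V B (val B b)" unfolding ab by simp
 hence "val B b <= val B (- a)" using a0 by (simp add: V_def)
 hence "val B b <= val B a" using val_uminus[OF B Int_L[OF aI]] by simp
 thus "val B (s \<omega> - \<omega>) = (\<Sum>h\<in>U. val B (s (h ?\<pi>) - ?\<pi>))"
  using le1 valb by (simp add: a_def r_def)
qed

end

end

section \<open>Cosets and independence of conjugates\<close>

context aut_group
begin

text \<open>The Galois correspondence for equal fixed fields: a primitive element is a root of the polynomial
  of its conjugates under the smaller group.\<close>

lemma subgroup_eqI:
 assumes W: "aut_group L W" "W <= U" and Fix: "aut_group.Fix L W = Fix"
 shows "W = U"
proof
 interpret W: aut_group L W by fact
 show "W <= U" by fact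
 show "U <= W"
 proof
  fix \<sigma> assume \<sigma>: "\<sigma> : U"
  obtain \<alpha> where \<alpha>: "\<alpha> : L" "inj_on (%\<sigma>. \<sigma> \<alpha>) U" using primitive_element_exists by blast
  have c: "poly.coeff (W.cpoly \<alpha>) i : L" "\<sigma> (poly.coeff (W.cpoly \<alpha>) i) = poly.coeff (W.cpoly \<alpha>) i" for i
   using W.cpoly_coeff[OF \<alpha>(1), of i] \<sigma> unfolding Fix Fix_def by blast+
  have "\<sigma> (poly (W.cpoly \<alpha>) \<alpha>) = poly (W.cpoly \<alpha>) (\<sigma> \<alpha>)"
   using hom_on_poly_eval[OF L hom[OF \<sigma>] c(1) \<alpha>(1)] c(2) by (simp add: poly_altdef)
  hence "poly (W.cpoly \<alpha>) (\<sigma> \<alpha>) = 0"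
   using W.cpoly_self[OF \<alpha>(1)] by (simp add: hom_simps(2)[OF \<sigma>])
  then obtain \<tau> where "\<tau> : W" "\<sigma> \<alpha> = \<tau> \<alpha>" using W.cpoly_zeros by blast
  thus "\<sigma> : W" using inj_onD[OF \<alpha>(2)] \<sigma> W(2) by blast
 qed
qed

lemma coset_fiber:
 assumes W: "aut_group L W" "W <= U" and \<sigma>: "\<sigma> : U"
 shows "{\<tau> : U. compose L \<tau> ` W = compose L \<sigma> ` W} = compose L \<sigma> ` W"
proof (intro equalityI subsetI)
 interpret W: aut_group L W by fact
 {
  fix \<tau> assume t: "\<tau> : {\<tau> : U. compose L \<tau> ` W = compose L \<sigma> ` W}"
  have "compose L \<tau> (restrict id L) = \<tau>"
   using t by (intro ext_eqI comp_mem id_mem) (auto simp: comp_apply)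
  moreover have "compose L \<tau> (restrict id L) : compose L \<tau> ` W" by (rule imageI[OF W.id_mem])
  ultimately show "\<tau> : compose L \<sigma> ` W" using t by simp
 }
 fix \<tau> assume "\<tau> : compose L \<sigma> ` W"
 then obtain h where h: "h : W" "\<tau> = compose L \<sigma> h" by blast
 have hU: "h : U" using h(1) W(2) by blast
 have tU: "\<tau> : U" unfolding h(2) by (rule comp_mem[OF \<sigma> hU])
 have "compose L \<tau> g = compose L \<sigma> (compose L h g)" if g: "g : W" for g
 proof (rule ext_eqI)
  have gU: "g : U" using g W(2) by blast
  show "compose L \<tau> g : U" "compose L \<sigma> (compose L h g) : U" by (intro comp_mem tU gU \<sigma> hU)+
  show "compose L \<tau> g x = compose L \<sigma> (compose L h g) x" if "x : L" for x
   using that into[OF gU that] by (simp add: comp_apply h(2))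
 qed
 hence "compose L \<tau> ` W = compose L \<sigma> ` compose L h ` W" unfolding image_image by (rule image_cong[OF refl])
 also have "compose L h ` W = W" using W.bij_comp_left[OF h(1)] by (simp add: bij_betw_def)
 finally show "\<tau> : {\<tau> : U. compose L \<tau> ` W = compose L \<sigma> ` W}" using tU by simp
qed

lemma card_cosets:
 assumes W: "aut_group L W" "W <= U"
 shows "card U = card ((%\<sigma>. compose L \<sigma> ` W) ` U) * card W"
proof -
 let ?f = "%\<sigma>. compose L \<sigma> ` W"
 have cf: "card (?f \<sigma>) = card W" if \<sigma>: "\<sigma> : U" for \<sigma>
  using bij_comp_left[OF \<sigma>] W(2) by (intro card_image) (auto simp: bij_betw_def intro: inj_on_subset)
 have "card U = (\<Sum>\<sigma>\<in>U. 1)" by simp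
 also have "... = (\<Sum>K\<in>?f ` U. \<Sum>\<sigma>\<in>{\<tau> : U. ?f \<tau> = K}. 1)" by (rule sum.image_gen[OF fin])
 also have "... = (\<Sum>K\<in>?f ` U. card W)" using coset_fiber[OF W] cf by (intro sum.cong refl) auto
 finally show ?thesis by simp
qed

lemma subgroup_of_prime_order:
 assumes W: "aut_group L W" "W <= U" and q: "Factorial_Ring.prime (card U)"
 shows "W = {restrict id L} | W = U"
proof -
 interpret W: aut_group L W by fact
 have "card W = 1 | card W = card U"
  using card_cosets[OF W] q unfolding prime_nat_iff by (metis dvd_triv_right)
 thus ?thesis
 proof
  assume "card W = 1"
  then obtain a where "W = {a}" by (rule card_1_singletonE)
  thus ?thesis using W.id_mem by blast
 next
  assume "card W = card U"
  thus ?thesis using card_subset_eq[OF fin W(2)] by blast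
 qed
qed

end

context galois_field
begin

lemma int_basis_index:
 assumes w: "is_int_basis w" and u: "!!j. j < n ==> u j : \<O>"
 shows "EX m::int. dm u = dm w * of_int m"
proof -
 have "ALL j:{..<n}. EX c::nat => int. u j = (\<Sum>k<n. of_int (c k) * w k)"
  using w u by (simp add: is_int_basis_def)
 then obtain c :: "nat => nat => int" where c: "ALL j:{..<n}. u j = (\<Sum>k<n. of_int (c j k) * w k)"
  by (rule bchoice[THEN exE])
 have wL: "w j : L" if "j < n" for j using w that Int_L by (simp add: is_int_basis_def)
 have "dm u = dm w * Determinant.det (mat n n (%(i, j). of_int (c j i)))"
  using c by (intro dm_base_change[OF wL]) (auto simp: Fix_Rats)
 moreover have "Determinant.det (mat n n (%(i, j). of_int (c j i))) : (\<int> :: complex set)"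
  by (rule csubring_det[OF _ mat_carrier]) (auto simp: csubring_def)
 ultimately show ?thesis by (auto elim!: Ints_cases)
qed

lemma enum_eqD: "i < n ==> j < n ==> enum i = enum j ==> i = j"
 using enum by (auto simp: bij_betw_def inj_on_def)

context
 fixes B :: "complex set"
 assumes B: "Prime B"
begin

lemmas BI8 = IdealD[OF PrimeD(1)[OF B]]

lemma val_zero_iff: "x : \<O> ==> x ~: B ==> val B x = 0"
 by (rule val_lunit[OF B Int_lunit[OF B]])

text \<open>The discriminant of any family is a multiple of that of an integral basis.\<close>

lemma dm_basis_not_mem:
 assumes w: "is_int_basis w" and u: "!!j. j < n ==> u j : \<O>" and dm: "dm u ~: B"
 shows "dm w ~: B"
proof
 assume "dm w : B"
 obtain m :: int where "dm u = dm w * of_int m" using int_basis_index[of w u, OF w u] by blast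
 hence "dm u : B" using BI8(4)[OF \<open>dm w : B\<close> Int_cl(11)] by simp
 thus False using dm by contradiction
qed

lemma cofactor_Int:
 assumes A: "A : carrier_mat m m" "!!i j. i < m ==> j < m ==> A $$ (i, j) : \<O>"
 shows "i < m ==> j < m ==> cofactor A i j : \<O>"
 unfolding cofactor_def
proof (intro Int_cl(5) Int_cl(7))
 assume ij: "i < m" "j < m"
 show "Determinant.det (mat_delete A i j) : \<O>"
  by (rule csubring_det[OF Int_ring mat_delete_carrier[OF A(1)]]) (use A ij in \<open>auto simp: mat_delete_def\<close>)
 show "- 1 : \<O>" using Int_cl(11)[of "- 1"] by simp
qed

text \<open>Expanding along a new last column turns the determinant into a linear combination of the
  automorphisms, evaluated at the new entry, whose last coefficient is the old determinant; by
  independence of characters modulo \<open>B\<close> it is nonzero modulo \<open>B\<close> somewhere.\<close>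

lemma independent_conjugates:
 assumes "!!i. i < m ==> s i : G"
  and "!!i j. i < m ==> j < m ==> i ~= j ==> EX x:\<O>. s i x - s j x ~: B"
 shows "EX x. (ALL j<m. x j : \<O>) & Determinant.det (mat m m (%(i, j). s i (x j))) ~: B"
 using assms
proof (induction m)
 case 0
 have "Determinant.det (mat 0 0 f) ~: B" for f using PrimeD(2)[OF B] det_dim_zero[OF mat_carrier, of f] by metis
 thus ?case using Int_cl(1) by blast
next
 case (Suc m)
 note sG = Suc.prems(1)
 have "EX x. (ALL j<m. x j : \<O>) & Determinant.det (mat m m (%(i, j). s i (x j))) ~: B"
 proof (rule Suc.IH)
  show "s i : G" if "i < m" for i using sG that by simp
  show "EX x:\<O>. s i x - s j x ~: B" if "i < m" "j < m" "i ~= j" for i j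
   using Suc.prems(2)[OF _ _ that(3)] that by simp
 qed
 then obtain x where x: "ALL j<m. x j : \<O>" "Determinant.det (mat m m (%(i, j). s i (x j))) ~: B"
  by blast
 define A where "A z = mat (Suc m) (Suc m) (%(i, j). s i (if j < m then x j else z))" for z
 have Ac: "A z : carrier_mat (Suc m) (Suc m)" for z by (simp add: A_def)
 define u where "u i = cofactor (A 0) i m" for i
 have AI: "A 0 $$ (i, j) : \<O>" if "i < Suc m" "j < Suc m" for i j
 proof -
  have "(if j < m then x j else 0) : \<O>" using x(1) Int_cl(1) by simp
  from Int_into[OF sG[OF that(1)] this] show ?thesis using that by (simp add: A_def)
 qed
 have uI: "u i : \<O>" if "i < Suc m" for i
  unfolding u_def by (rule cofactor_Int[OF Ac AI]) (use that in simp_all)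
 have "mat_delete (A 0) m m = mat m m (%(i, j). s i (x j))"
  by (rule eq_matI) (auto simp: mat_delete_def A_def)
 hence um: "u m ~: B" using x(2) by (simp add: u_def cofactor_def)
 have cof: "cofactor (A z) i m = u i" if "i < Suc m" for z i
 proof -
  have "mat_delete (A z) i m = mat_delete (A 0) i m"
   by (rule eq_matI) (auto simp: mat_delete_def A_def)
  thus ?thesis by (simp add: u_def cofactor_def)
 qed
 have det: "Determinant.det (A z) = (\<Sum>i<Suc m. u i * s i z)" for z
  unfolding laplace_expansion_column[OF Ac lessI]
  by (rule sum.cong[OF refl]) (use cof in \<open>simp add: A_def\<close>)
 have inj: "inj_on s {..<Suc m}"
 proof (rule inj_onI, rule ccontr)
  fix i j assume "i : {..<Suc m}" "j : {..<Suc m}" "s i = s j" "i ~= j"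
  thus False using Suc.prems(2)[of i j] BI8(2) by auto
 qed
 define v where "v \<phi> = u (the_inv_into {..<Suc m} s \<phi>)" for \<phi>
 have v: "v (s i) = u i" if "i < Suc m" for i
  using the_inv_into_f_f[OF inj, of i] that by (simp add: v_def)
 have "EX z:\<O>. Determinant.det (A z) ~: B"
 proof (rule ccontr)
  assume n: "~ (EX z:\<O>. Determinant.det (A z) ~: B)"
  have "v (s m) : B"
  proof (rule characters_independent_mod_prime[where R = \<O> and M = \<O> and mul = "(*)" and ?m1.0 = 1 and \<Phi> = "s ` {..<Suc m}"
    and u = v and \<phi> = "s m"])
   show "csubring \<O>" by (rule Int_ring)
   show "x : B ==> y : B ==> x - y : B" "x : B ==> y : \<O> ==> x * y : B" for x y
    by (rule BI8(6,4), assumption+)+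
   show "x : \<O> ==> y : \<O> ==> x * y : B ==> x : B | y : B" for x y
    by (rule PrimeD(3)[OF B])
   show "1 : \<O>" by (rule Int_cl(2))
   show "x : \<O> ==> y : \<O> ==> x * y : \<O>" for x y by (rule Int_cl(5))
   show "finite (s ` {..<Suc m})" by simp
   fix \<phi> assume "\<phi> : s ` {..<Suc m}"
   then obtain i where i: "i < Suc m" "\<phi> = s i" by auto
   note \<phi> = sG[OF i(1), folded i(2)]
   show "x : \<O> ==> \<phi> x : \<O>" for x by (rule Int_into[OF \<phi>])
   show "x : \<O> ==> y : \<O> ==> \<phi> (x * y) = \<phi> x * \<phi> y" for x y
    by (rule hom_simps(4)[OF \<phi> Int_L Int_L])
   show "\<phi> 1 = 1" by (rule hom_simps(1)[OF \<phi>])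
   show "v \<phi> : \<O>" using uI[OF i(1)] v[OF i(1)] i(2) by simp
   show "EX x:\<O>. \<phi> x - \<psi> x ~: B" if "\<psi> : s ` {..<Suc m}" "\<phi> ~= \<psi>" for \<psi>
    using that i Suc.prems(2) by fastforce
  next
   fix z assume z: "z : \<O>"
   have "(\<Sum>\<phi>\<in>s ` {..<Suc m}. v \<phi> * \<phi> z) = (\<Sum>i<Suc m. v (s i) * s i z)"
    by (rule sum.reindex[OF inj, unfolded o_def])
   also have "... = Determinant.det (A z)" unfolding det by (rule sum.cong[OF refl]) (simp add: v)
   finally show "(\<Sum>\<phi>\<in>s ` {..<Suc m}. v \<phi> * \<phi> z) : B" using n z by auto
  qed simp
  thus False using um v[of m] by simp
 qed
 then obtain z where z: "z : \<O>" "Determinant.det (A z) ~: B" by blast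
 thus ?case using x(1) by (intro exI[of _ "%j. if j < m then x j else z"]) (simp add: A_def)
qed

text \<open>By Cramer's rule, a system solvable modulo \<open>B\<close> with a determinant prime to \<open>B\<close> has only the
  zero solution modulo \<open>B\<close>.\<close>

lemma conjugate_system_zero:
 assumes s: "!!i. i < m ==> s i : G" and x: "!!j. j < m ==> x j : \<O>"
  and det: "Determinant.det (mat m m (%(i, j). s i (x j))) ~: B"
  and d: "!!j. j < m ==> d j : \<O>" and sys: "!!i. i < m ==> (\<Sum>j<m. s i (x j) * d j) : B"
  and k: "k < m"
 shows "d k : B"
proof -
 define A where "A = mat m m (%(i, j). s i (x j))"
 let ?b = "A *\<^sub>v vec m d" and ?R = "replace_col A (A *\<^sub>v vec m d) k"
 have A: "A : carrier_mat m m" by (simp add: A_def)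
 have R: "?R : carrier_mat m m" by (simp add: A_def replace_col_def)
 have b: "?b $ i : B" if "i < m" for i
  using sys[OF that] that by (simp add: A_def scalar_prod_def atLeast0LessThan)
 have RI: "?R $$ (i, j) : \<O>" if "i < m" "j < m" for i j
  using that b[THEN BI8(1)] Int_into[OF s x] by (auto simp: replace_col_def A_def)
 have dI: "Determinant.det A : \<O>"
  by (rule csubring_det[OF Int_ring A]) (use Int_into[OF s x] in \<open>simp add: A_def\<close>)
 have "Determinant.det ?R : B"
  unfolding laplace_expansion_column[OF R k]
 proof (rule additive_sum[OF Ideal_additive[OF PrimeD(1)[OF B]]])
  fix i assume "i : {..<m}"
  hence i: "i < m" by simp
  have "?R $$ (i, k) = ?b $ i" using i k by (simp add: replace_col_def A_def)
  thus "?R $$ (i, k) * cofactor ?R i k : B" using BI8(4)[OF b[OF i] cofactor_Int[OF R RI i k]] by simp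
 qed
 hence "d k * Determinant.det A : B" using cramer_lemma_mat[OF A _ k, of "vec m d"] k by simp
 thus ?thesis using PrimeD(3)[OF B d[OF k] dI] det by (auto simp: A_def)
qed

text \<open>Automorphisms agreeing modulo \<open>B\<close> differ by an element of the inertia group.\<close>

lemma unramified_dm:
 assumes inert: "inert B = {restrict id L}" and w: "is_int_basis w"
 shows "dm w ~: B"
proof -
 have "EX x:\<O>. enum i x - enum j x ~: B" if ij: "i < n" "j < n" "i ~= j" for i j
 proof (rule ccontr)
  assume "~ (EX x:\<O>. enum i x - enum j x ~: B)"
  hence eq: "enum i x - enum j x : B" if "x : \<O>" for x using that by blast
  note e = enum_mem[OF ij(1)] enum_mem[OF ij(2)]
  obtain \<tau> where \<tau>: "\<tau> : G" "ALL x:L. \<tau> (enum j x) = x & enum j (\<tau> x) = x" using inv_ex[OF e(2)] by blast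
  define \<delta> where "\<delta> = compose L (enum i) \<tau>"
  have \<delta>: "\<delta> : G" unfolding \<delta>_def by (rule comp_mem[OF e(1) \<tau>(1)])
  have d: "\<delta> y - y : B" if y: "y : \<O>" for y
   using eq[OF Int_into[OF \<tau>(1) y]] \<tau>(2) Int_L[OF y] by (simp add: \<delta>_def comp_apply)
  have "\<delta> b : B" if "b : B" for b using BI8(3)[OF d[OF BI8(1)[OF that]] that] by simp
  hence "\<delta> ` B = B" using Prime_maximal[OF Prime_image[OF B \<delta>] B] by blast
  hence "\<delta> = restrict id L" using \<delta> d inert by (auto simp: inert_def decomp_def)
  hence "enum i (\<tau> y) = y" if "y : L" for y using comp_apply[OF that, of "enum i" \<tau>] that by (simp add: \<delta>_def)
  hence "enum i x = enum j x" if x: "x : L" for x using \<tau>(2) x into[OF e(2) x] by metis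
  thus False using ext_eqI[OF e] enum_eqD ij by blast
 qed
 then obtain x where "ALL j<n. x j : \<O>" "Determinant.det (mat n n (%(i, j). enum i (x j))) ~: B"
  using independent_conjugates[of n enum] enum_mem by blast
 thus ?thesis using dm_basis_not_mem[OF w, of x] by (auto simp: dm_def)
qed

end

end

section \<open>Norms of ideals and primes above a rational prime\<close>

lemma additive_absorb: "additive M ==> x - y : M ==> x : M \<longleftrightarrow> y : M"
 using additiveD(2,4)[of M "x - y" y] additiveD(2)[of M x "x - y"] by auto

context galois_field
begin

text \<open>For an ideal this is \<open>ideal_norm\<close>, with the cosets taken among complex numbers.\<close>

definition inorm :: "complex set => nat" where
 "inorm I = card (coset I ` \<O>)"

text \<open>An ideal \<open>I\<close> becomes principal modulo \<open>I P\<close>: an element \<open>a\<close> of minimal valuation at \<open>P\<close>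
  generates \<open>I\<close> locally at \<open>P\<close>, and a denominator prime to \<open>P\<close> is invertible modulo \<open>P\<close>.\<close>

lemma generator_mod_step:
 assumes I: "Ideal I" and P: "Prime P" and a: "a : I" "a ~= 0" and IV: "!!x. x : I ==> x : V P (val P a)"
  and M: "additive M" and IM: "!!x b. x : I ==> b : P ==> x * b : M" and x: "x : I"
 shows "EX c:\<O>. x - c * a : M"
proof (cases "x = 0")
 case True
 thus ?thesis using additiveD(1)[OF M] Int_cl(1) by (intro bexI[of _ 0]) auto
next
 case False
 note xL = Int_L[OF IdealD(1)[OF I x]] and aL = Int_L[OF IdealD(1)[OF I a(1)]]
 have "val P x >= val P a" using IV[OF x] False by (simp add: V_def)
 hence "x / a : loc P"
  using mem_loc_iff[OF P, of "x / a"] val_divide[OF P xL False aL a(2)] Lcl(13)[OF xL aL] False a(2) by simp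
 then obtain b s where b: "b : \<O>" "s : \<O>" "s ~: P" "x / a = b / s" by (auto simp: loc_def)
 obtain t where t: "t : \<O>" "t * s - 1 : P" using inverse_mod[OF P b(2,3)] by blast
 have "s ~= 0" using b(3) B_nonzero[OF P] by blast
 hence "b * a = s * x" using b(4) a(2) by (simp add: field_simps)
 hence "x - t * b * a = x * - (t * s - 1)" by (simp add: algebra_simps)
 moreover have "x * - (t * s - 1) : M" by (rule IM[OF x IdealD(7)[OF PrimeD(1)[OF P] t(2)]])
 ultimately show ?thesis using Int_cl(5)[OF t(1) b(1)] by (intro bexI[of _ "t * b"]) simp_all
qed

lemma coset_rep:
 assumes "additive I"
 shows "EX r. ALL K:coset I ` \<O>. r K : \<O> & K = coset I (r K)"
 by (rule bchoice) auto

lemma inorm_step: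
 assumes I: "Ideal I" and P: "Prime P" and a: "a : I" "a ~= 0" and IV: "!!x. x : I ==> x : V P (val P a)"
  and M: "additive M" and IM: "!!x b. x : I ==> b : P ==> x * b : M"
  and MI: "M <= I" and MV: "!!x. x : M ==> x : V P (val P a + 1)" and fin: "finite (coset I ` \<O>)"
 shows "finite (coset M ` \<O>)" "inorm M = inorm I * inorm P"
proof -
 note addI = Ideal_additive[OF I] and addP = Ideal_additive[OF PrimeD(1)[OF P]]
 obtain r where r: "ALL K:coset I ` \<O>. r K : \<O> & K = coset I (r K)" using coset_rep[OF addI] by blast
 obtain s where s: "ALL K:coset P ` \<O>. s K : \<O> & K = coset P (s K)" using coset_rep[OF addP] by blast
 note aI = IdealD(1)[OF I a(1)]
 define f where "f = (%(K, C). coset M (r K + s C * a))"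
 have sa: "s C * a : I" if "C : coset P ` \<O>" for C using s[rule_format, OF that] IdealD(5)[OF I _ a(1)] by simp
 have "bij_betw f (coset I ` \<O> \<times> coset P ` \<O>) (coset M ` \<O>)"
  unfolding bij_betw_def
 proof
  have "K = K' & C = C'" if K: "K : coset I ` \<O>" "K' : coset I ` \<O>"
   and C: "C : coset P ` \<O>" "C' : coset P ` \<O>" and f: "f (K, C) = f (K', C')" for K C K' C'
  proof -
   have "(r K + s C * a) - (r K' + s C' * a) : M" using f by (simp add: f_def coset_eq_iff[OF M])
   hence e: "(r K - r K') - (s C' * a - s C * a) : M" by (simp add: algebra_simps)
   have "r K - r K' : I" using additive_absorb[OF addI, of "r K - r K'"] IdealD(6)[OF I sa[OF C(2)] sa[OF C(1)]] e MI by blast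
   hence eq: "K = K'" using r[rule_format, OF K(1)] r[rule_format, OF K(2)] coset_eq_iff[OF addI, of "r K" "r K'"] by simp
   have m: "(s C' - s C) * a : M" using additiveD(3)[OF M e] eq by (simp add: algebra_simps)
   have d: "s C' - s C : \<O>" using s[rule_format, OF C(1)] s[rule_format, OF C(2)] by (intro Int_cl(4)) simp_all
   have "s C' - s C : P"
   proof (cases "s C' - s C = 0")
    case False
    hence "val P ((s C' - s C) * a) >= val P a + 1" using MV[OF m] a(2) by (simp add: V_def)
    hence "s C' - s C : V P 1"
     using val_mult[OF P Int_L[OF d] False Int_L[OF aI] a(2)] Int_L[OF d] by (simp add: V_def)
    thus ?thesis using mem_B_iff[OF P d] by blast
   qed (use IdealD(2)[OF PrimeD(1)[OF P]] in simp)
   thus ?thesis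
    using s[rule_format, OF C(1)] s[rule_format, OF C(2)] coset_eq_iff[OF addP, of "s C'" "s C"] eq by simp
  qed
  note inj = this
  show "inj_on f (coset I ` \<O> \<times> coset P ` \<O>)"
  proof (rule inj_onI)
   fix y z assume y: "y : coset I ` \<O> \<times> coset P ` \<O>" "z : coset I ` \<O> \<times> coset P ` \<O>" "f y = f z"
   have "fst y = fst z & snd y = snd z"
    by (rule inj) (use y in \<open>simp_all only: mem_Times_iff prod.collapse\<close>)
   thus "y = z" by (simp only: prod_eq_iff)
  qed
  show "f ` (coset I ` \<O> \<times> coset P ` \<O>) = coset M ` \<O>"
  proof (intro equalityI subsetI)
   fix Y assume "Y : f ` (coset I ` \<O> \<times> coset P ` \<O>)"
   then obtain K C where KC: "K : coset I ` \<O>" "C : coset P ` \<O>" "Y = coset M (r K + s C * a)"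
    by (auto simp: f_def)
   have "r K : \<O>" "s C : \<O>" using r[rule_format, OF KC(1)] s[rule_format, OF KC(2)] by simp_all
   hence "r K + s C * a : \<O>" by (intro Int_cl(3,5) aI)
   thus "Y : coset M ` \<O>" using KC(3) by blast
  next
   fix Y assume "Y : coset M ` \<O>"
   then obtain x where x: "x : \<O>" "Y = coset M x" by blast
   let ?K = "coset I x"
   have K: "?K : coset I ` \<O>" using x by blast
   hence "x - r ?K : I" using r[rule_format, OF K] coset_eq_iff[OF addI, of x "r ?K"] by simp
   then obtain c where c: "c : \<O>" "x - r ?K - c * a : M"
    using generator_mod_step[OF I P a IV M IM] by blast
   let ?C = "coset P c"
   have C: "?C : coset P ` \<O>" using c by blast
   hence "c - s ?C : P" using s[rule_format, OF C] coset_eq_iff[OF addP, of c "s ?C"] by simp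
   hence "a * (c - s ?C) : M" by (rule IM[OF a(1)])
   hence "(x - r ?K - c * a) + a * (c - s ?C) : M" using additiveD(4)[OF M c(2)] by blast
   hence "x - (r ?K + s ?C * a) : M" by (simp add: algebra_simps)
   hence "Y = f (?K, ?C)" using x(2) coset_eq_iff[OF M] by (simp add: f_def)
   thus "Y : f ` (coset I ` \<O> \<times> coset P ` \<O>)" using K C by blast
  qed
 qed
 note bij = this
 show "finite (coset M ` \<O>)" using bij_betw_finite[OF bij] fin residue_field_finite[OF P] by blast
 show "inorm M = inorm I * inorm P"
  using bij_betw_same_card[OF bij] by (simp only: inorm_def card_cartesian_product)
qed

lemma coset_whole: "coset \<O> ` \<O> = {\<O>}"
proof -
 have add: "additive \<O>" using Int_cl by (simp add: additive_def)
 have "coset \<O> x = \<O>" if "x : \<O>" for x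
 proof (intro equalityI subsetI)
  fix y assume "y : coset \<O> x"
  thus "y : \<O>" using additive_absorb[OF add, of y x] that by (simp add: mem_coset_iff)
 qed (use Int_cl(4) that in \<open>simp add: mem_coset_iff\<close>)
 thus ?thesis using Int_cl(1) by auto
qed

lemma V_Ideal:
 assumes "!!P. P : \<S> ==> Prime P"
 shows "Ideal {x : \<O>. ALL P:\<S>. x : V P (e P)}"
proof -
 have "x * y : V P (e P)" if "P : \<S>" "x : V P (e P)" "y : \<O>" for x y P
  using V_mult_0[OF assms[OF that(1)] Int_V0[OF assms[OF that(1)] that(3)] that(2)] by (simp add: mult.commute)
 thus ?thesis unfolding Ideal_def using V_cl(1,4)[OF assms] Int_cl(1,3,5) by blast
qed

text \<open>The norm of an intersection of prime powers, built up one factor at a time; the element of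
  minimal valuation required for a step is provided by the Chinese remainder theorem.\<close>

lemma inorm_inter_prime_powers:
 assumes S: "finite \<S>" "!!P. P : \<S> ==> Prime P"
 shows "finite (coset {x : \<O>. ALL P:\<S>. x : V P (int (e P))} ` \<O>) &
  inorm {x : \<O>. ALL P:\<S>. x : V P (int (e P))} = (\<Prod>P\<in>\<S>. inorm P ^ e P)"
proof (induction "sum e \<S>" arbitrary: e)
 case 0
 hence e0: "e P = 0" if "P : \<S>" for P using S(1) that by simp
 hence "{x : \<O>. ALL P:\<S>. x : V P (int (e P))} = \<O>" using Int_V0 S(2) by auto
 thus ?case using e0 by (simp add: coset_whole inorm_def)
next
 case (Suc m)
 hence "sum e \<S> ~= 0" by simp
 then obtain P where P: "P : \<S>" "e P > 0" using sum.neutral[of \<S> e] by fastforce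
 note PP = S(2)[OF P(1)]
 define d where "d = e(P := e P - 1)"
 have sd: "sum d \<S> = m"
  using sum.remove[OF S(1) P(1), of e] sum.remove[OF S(1) P(1), of d] Suc(2) P(2) by (simp add: d_def)
 let ?I = "%e. {x : \<O>. ALL P:\<S>. x : V P (int (e P))}"
 have IH: "finite (coset (?I d) ` \<O>)" "inorm (?I d) = (\<Prod>P\<in>\<S>. inorm P ^ d P)" using Suc(1)[of d] sd by simp_all
 define N where "N = Suc (sum e \<S>)"
 obtain w where w: "w : \<O>" "w - 1 : V P (int N)" "ALL Q:\<S> - {P}. w : V Q (int N)"
  using chinese_remainder[OF PP, of "\<S> - {P}" N] S by auto
 have "w - 1 : V P 1" by (rule V_antimono[OF PP w(2)]) (unfold N_def, linarith)
 hence "w - 1 : P" using mem_B_iff[OF PP Int_cl(4)[OF w(1) Int_cl(2)]] by blast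
 hence wP: "w ~: P" using IdealD(6)[OF PrimeD(1)[OF PP], of w "w - 1"] PrimeD(2)[OF PP] by auto
 have w0: "w ~= 0" "val P w = 0" using B_nonzero[OF PP wP] val_zero_iff[OF PP w(1) wP] by simp_all
 let ?\<pi> = "unif P"
 note p = unif_L[OF PP] unif_nonzero[OF PP] val_unif[OF PP]
 define a where "a = w * ?\<pi> ^ d P"
 have pI: "?\<pi> ^ d P : \<O>" by (intro Int_cl(7) unif_Int[OF PP])
 have aO: "a : \<O>" "a ~= 0" using w(1) w0 p(2) pI by (simp_all add: a_def Int_cl(5))
 have va: "val P a = int (d P)"
  using val_mult[OF PP Int_L[OF w(1)] w0(1) Int_L[OF pI]] val_power[OF PP p(1,2)] w0 p by (simp add: a_def)
 have "a : V Q (int (d Q))" if Q: "Q : \<S>" for Q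
 proof (cases "Q = P")
  case True
  thus ?thesis using va aO Int_L by (simp add: V_def)
 next
  case False
  hence "a : V Q (int N)"
   using w(3) V_mult_0[OF S(2)[OF Q] Int_V0[OF S(2)[OF Q] pI], of w] Q by (simp add: a_def mult.commute)
  moreover have "d Q <= N" using False member_le_sum[OF Q, of e] S(1) by (simp add: d_def N_def)
  ultimately show ?thesis using V_antimono[OF S(2)[OF Q]] by simp
 qed
 hence aI: "a : ?I d" using aO by blast
 have I: "Ideal (?I f)" for f by (rule V_Ideal[OF S(2)])
 have le: "d Q <= e Q" for Q by (simp add: d_def)
 have min: "x : V P (val P a)" if "x : ?I d" for x using that P(1) va by auto
 have mul: "x * b : ?I e" if x: "x : ?I d" and b: "b : P" for x b
 proof -
  have bI: "b : \<O>" by (rule IdealD(1)[OF PrimeD(1)[OF PP] b])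
  have "x * b : V Q (int (e Q))" if Q: "Q : \<S>" for Q
  proof (cases "Q = P")
   case True
   have "x : V P (int (d P))" "b : V P 1" using x P(1) b mem_B_iff[OF PP bI] by blast+
   hence "x * b : V P (int (d P) + 1)" by (rule V_mult[OF PP])
   moreover have "int (d P) + 1 = int (e P)" using P(2) by (simp add: d_def)
   ultimately show ?thesis using True by simp
  next
   case False
   hence "d Q = e Q" by (simp add: d_def)
   moreover have "x : V Q (int (d Q))" using x Q by blast
   ultimately have "b * x : V Q (int (e Q))" using V_mult_0[OF S(2)[OF Q] Int_V0[OF S(2)[OF Q] bI]] by simp
   thus ?thesis by (simp only: mult.commute)
  qed
  thus ?thesis using x Int_cl(5)[OF _ bI] by blast
 qed
 have "x : V Q (int (d Q))" if "Q : \<S>" "x : V Q (int (e Q))" for x Q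
  using V_antimono[OF S(2)[OF that(1)] that(2)] le by simp
 hence sub: "?I e <= ?I d" by blast
 have gt: "x : V P (val P a + 1)" if "x : ?I e" for x
 proof -
  have "x : V P (int (e P))" using that P(1) by blast
  moreover have "int (e P) = val P a + 1" unfolding va using P(2) by (simp add: d_def)
  ultimately show ?thesis by simp
 qed
 note inorm_step[OF I PP aI aO(2) min Ideal_additive[OF I] mul sub gt IH(1)]
 moreover have "(\<Prod>P\<in>\<S>. inorm P ^ e P) = (\<Prod>P\<in>\<S>. inorm P ^ d P) * inorm P"
 proof -
  have "(\<Prod>Q\<in>\<S> - {P}. inorm Q ^ e Q) = (\<Prod>Q\<in>\<S> - {P}. inorm Q ^ d Q)" by (rule prod.cong) (auto simp: d_def)
  moreover have "inorm P ^ e P = inorm P ^ d P * inorm P" using P(2) by (cases "e P") (simp_all add: d_def)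
  ultimately show ?thesis
   using prod.remove[OF S(1) P(1), of "%P. inorm P ^ e P"] prod.remove[OF S(1) P(1), of "%P. inorm P ^ d P"] by simp
 qed
 ultimately show ?case using IH(2) by simp
qed

text \<open>Only finitely many ideals contain a given positive integer, so an ideal containing it and
  maximal among the proper ones exists.\<close>

lemma prime_containing:
 assumes J: "Ideal J" "1 ~: J" and m: "m > 0" "of_nat m : J"
 shows "EX P. Prime P & J <= P"
proof -
 define \<I> where "\<I> = {I. Ideal I & 1 ~: I & J <= I}"
 let ?M = "mult_of m"
 have sub: "?M <= I" if I: "I : \<I>" for I
  using I m(2) IdealD(4)[of I "of_nat m"] by (auto simp: \<I>_def mult_of_def)
 have "inj_on (%I. coset ?M ` I) \<I>"
 proof (rule inj_onI)
  have *: "I <= I'" if I: "I : \<I>" "I' : \<I>" and eq: "coset ?M ` I = coset ?M ` I'" for I I'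
  proof
   fix x assume "x : I"
   then obtain y where y: "y : I'" "coset ?M x = coset ?M y" using eq by blast
   hence "x - y : I'" using coset_eq_iff[OF Ideal_additive[OF mult_of_ideal]] sub[OF I(2)] by blast
   thus "x : I'" using additive_absorb[OF Ideal_additive, of I' x y] y(1) I(2) by (auto simp: \<I>_def)
  qed
  show "I = I'" if "I : \<I>" "I' : \<I>" "coset ?M ` I = coset ?M ` I'" for I I'
   using *[OF that(1,2,3)] *[OF that(2,1) that(3)[symmetric]] by blast
 qed
 moreover have "(%I. coset ?M ` I) ` \<I> <= Pow (coset ?M ` \<O>)" by (auto simp: \<I>_def dest: IdealD(1))
 ultimately have "finite \<I>" using card_mod_mult_of(1)[OF m(1)] by (meson finite_Pow_iff inj_on_finite)
 then obtain P where P: "P : \<I>" "!!I. I : \<I> ==> P <= I ==> P = I"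
  using finite_has_maximal[of \<I>] J by (auto simp: \<I>_def)
 have PI: "Ideal P" "1 ~: P" "J <= P" using P(1) by (auto simp: \<I>_def)
 note PD = IdealD[OF PI(1)]
 have "x : P | y : P" if x: "x : \<O>" and y: "y : \<O>" and xy: "x * y : P" for x y
 proof (rule ccontr)
  assume n: "~ (x : P | y : P)"
  define Q where "Q = {a + x * z |a z. a : P & z : \<O>}"
  have QI: "a + x * z : Q" if "a : P" "z : \<O>" for a z using that by (auto simp: Q_def)
  have "Ideal Q"
   unfolding Ideal_def
  proof (intro conjI ballI)
   show "Q <= \<O>" unfolding Q_def using PD(1) x Int_cl(3,5) by blast
   show "0 : Q" using QI[OF PD(2) Int_cl(1)] by simp
   fix s t assume s: "s : Q"
   then obtain a z where a: "a : P" "z : \<O>" "s = a + x * z" by (auto simp: Q_def)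
   {
    assume "t : Q"
    then obtain b v where b: "b : P" "v : \<O>" "t = b + x * v" by (auto simp: Q_def)
    show "s + t : Q" using QI[OF PD(3)[OF a(1) b(1)] Int_cl(3)[OF a(2) b(2)]] a(3) b(3) by (simp add: algebra_simps)
   next
    assume t: "t : \<O>"
    show "s * t : Q" using QI[OF PD(4)[OF a(1) t] Int_cl(5)[OF a(2) t]] a(3) by (simp add: algebra_simps)
   }
  qed
  moreover have "P <= Q" using QI[OF _ Int_cl(1)] by force
  moreover have "x : Q" using QI[OF PD(2) Int_cl(2)] by simp
  ultimately have "1 : Q" using P(2)[of Q] PI(3) n by (auto simp: \<I>_def)
  then obtain a z where a: "a : P" "z : \<O>" "1 = a + x * z" by (auto simp: Q_def)
  have "y = a * y + x * y * z" using a(3) by (metis (no_types) distrib_right mult.commute mult.left_commute mult.right_neutral mult.assoc)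
  moreover have "a * y + x * y * z : P" by (intro PD(3) PD(4) a y xy)
  ultimately show False using n by simp
 qed
 moreover have "P ~= {0}" using m PI(3) by auto
 ultimately show ?thesis using PI unfolding Prime_def by blast
qed

text \<open>The denominators of \<open>x / m\<close> form an ideal containing \<open>m\<close>; the conditions keep it out of every
  prime ideal, so it contains 1.\<close>

lemma mult_of_conv_val:
 assumes m: "m > 0"
 shows "mult_of m = {x : \<O>. ALL P:{P. Prime P & of_nat m : P}. x : V P (val P (of_nat m))}"
proof (intro equalityI subsetI)
 let ?m = "of_nat m :: complex"
 have m0: "?m ~= 0" "?m : L" "?m : \<O>" using m Lcl(10) Int_cl(10) by simp_all
 {
  fix x assume "x : mult_of m"
  then obtain y where y: "y : \<O>" "x = ?m * y" by (auto simp: mult_of_def)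
  have "x : V P (val P ?m)" if P: "Prime P" for P
   using V_mult_0[OF P Int_V0[OF P y(1)], of ?m "val P ?m"] m0 y(2) by (simp add: V_def mult.commute)
  thus "x : {x : \<O>. ALL P:{P. Prime P & ?m : P}. x : V P (val P ?m)}"
   using y m0 Int_cl(5) by blast
 }
 fix x assume x: "x : {x : \<O>. ALL P:{P. Prime P & ?m : P}. x : V P (val P ?m)}"
 hence xI: "x : \<O>" by blast
 define J where "J = {s : \<O>. s * x : mult_of m}"
 note M = IdealD[OF mult_of_ideal[of m]]
 have mm: "?m * s : mult_of m" if "s : \<O>" for s using that by (auto simp: mult_of_def)
 have J: "Ideal J"
  unfolding Ideal_def J_def using M(2,3) M(4) Int_cl(1,3,5)
  by (auto simp: distrib_right) (metis mult.assoc mult.commute)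
 have mJ: "?m : J" using m0 mm xI by (auto simp: J_def)
 have "1 : J"
 proof (rule ccontr)
  assume "1 ~: J"
  then obtain P where P: "Prime P" "J <= P" using prime_containing[OF J _ m mJ] by blast
  hence "x : V P (val P ?m)" using x mJ by blast
  hence "x / ?m : loc P"
   using mem_loc_iff[OF P(1), of "x / ?m"] val_divide[OF P(1) _ _ m0(2,1), of x] Lcl(13)[OF Int_L[OF xI] m0(2)] m0 loc_cl(1)[OF P(1)]
   by (cases "x = 0") (auto simp: V_def)
  then obtain b s where b: "b : \<O>" "s : \<O>" "s ~: P" "x / ?m = b / s" by (auto simp: loc_def)
  have "s ~= 0" using b(3) B_nonzero[OF P(1)] by blast
  hence "s * x = ?m * b" using b(4) m0(1) by (simp add: field_simps)
  hence "s : J" using b mm by (auto simp: J_def)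
  thus False using b(3) P(2) by blast
 qed
 thus "x : mult_of m" by (simp add: J_def)
qed

lemma image_inverse:
 assumes "U <= G" "aut_group L U" "u : U" and B: "Prime B"
 shows "EX v:U. (ALL x:L. v (u x) = x & u (v x) = x) & u ` v ` B = B"
proof -
 obtain v where v: "v : U" "ALL x:L. v (u x) = x & u (v x) = x" using aut_group.inv_ex[OF assms(2,3)] by blast
 have "(%x. u (v x)) ` B = (%x. x) ` B"
  using v(2) Int_L IdealD(1)[OF PrimeD(1)[OF B]] by (intro image_cong) auto
 thus ?thesis using v by (intro bexI[of _ v]) (auto simp: image_image)
qed

text \<open>Transitivity: an element congruent to 1 modulo all conjugates of \<open>B\<close> and divisible by \<open>B'\<close>
  would have a norm in \<open>B'\<close> but not in \<open>B\<close>.\<close>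

lemma conjugate_primes:
 assumes U: "aut_group L U" "U <= G" and B: "Prime B" and B': "Prime B'"
  and eq: "B Int aut_group.Fix L U = B' Int aut_group.Fix L U"
 shows "EX u:U. u ` B = B'"
proof (rule ccontr)
 assume n: "~ (EX u:U. u ` B = B')"
 interpret U: aut_group L U by fact
 have "EX w:\<O>. w - 1 : V B' (int 1) & (ALL Q:(%u. u ` B) ` U. w : V Q (int 1))"
 proof (rule chinese_remainder[OF B'])
  show "finite ((%u. u ` B) ` U)" using U.fin by blast
  show "Prime Q & Q ~= B'" if "Q : (%u. u ` B) ` U" for Q using that n U(2) Prime_image[OF B] by blast
 qed
 then obtain w where w: "w : \<O>" "w - 1 : V B' 1" "ALL u:U. w : V (u ` B) 1" by auto
 define z where "z = 1 - w"
 have z: "z : \<O>" using w(1) Int_cl(2,4) by (simp add: z_def)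
 have zB: "z : B'" using mem_B_iff[OF B' z] V_cl(3)[OF B' w(2)] by (simp add: z_def)
 have zi: "u z : \<O>" if "u : U" for u using Int_into[OF _ z] that U(2) by blast
 have "(\<Prod>u\<in>U. u z) = restrict id L z * (\<Prod>u\<in>U - {restrict id L}. u z)" by (rule prod.remove[OF U.fin U.id_mem])
 also have "... : B'"
  using Int_L[OF z] zB IdealD(4)[OF PrimeD(1)[OF B'] zB Int_cl(9)[of "U - {restrict id L}" "%u. u z"]] zi by simp
 finally have "(\<Prod>u\<in>U. u z) : B" using U.norm_mem[OF Int_L[OF z]] eq by blast
 then obtain u where u: "u : U" "u z : B" using Prime_prod[OF B U.fin, of "%u. u z"] zi by blast
 then obtain v where v: "v : U" "u ` v ` B = B" using image_inverse[OF U(2,1) u(1) B] by blast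
 have uG: "u : G" "v : G" using u(1) v(1) U(2) by blast+
 have "u w : V (u ` v ` B) 1" using V_image[OF Prime_image[OF B uG(2)] uG(1) Int_L[OF w(1)]] w(3) v(1) by blast
 hence "u w : B" using mem_B_iff[OF B Int_into[OF uG(1) w(1)]] v(2) by simp
 hence "u z + u w : B" by (rule IdealD(3)[OF PrimeD(1)[OF B] u(2)])
 thus False
  using PrimeD(2)[OF B] hom_simps(5)[OF uG(1), of 1 w] Lcl(2) Int_L[OF w(1)] hom_simps(1)[OF uG(1)] by (simp add: z_def)
qed

lemma Prime_Rats:
 assumes B: "Prime B"
 shows "B Int \<rat> = of_int ` {m. int (residue_char B) dvd m}"
proof (intro equalityI subsetI)
 fix x assume x: "x : B Int \<rat>"
 hence "algebraic_int x" using IdealD(1)[OF PrimeD(1)[OF B]] by (auto simp: \<O>_def)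
 hence "x : \<int>" using x rational_algebraic_int_is_int by blast
 thus "x : of_int ` {m. int (residue_char B) dvd m}" using x of_int_mem_iff[OF B] by (auto elim!: Ints_cases)
qed (use of_int_mem_iff[OF B] in auto)

definition primes_over :: "nat => complex set set" where
 "primes_over p = {P. Prime P & residue_char P = p}"

lemma primes_over_orbit:
 assumes B: "Prime B"
 shows "primes_over (residue_char B) = (%\<sigma>. \<sigma> ` B) ` G"
proof (intro equalityI subsetI)
 fix P assume P: "P : primes_over (residue_char B)"
 hence PP: "Prime P" and c: "residue_char P = residue_char B" by (simp_all add: primes_over_def)
 have "B Int Fix = P Int Fix" unfolding Fix_Rats Prime_Rats[OF B] Prime_Rats[OF PP] c ..
 from conjugate_primes[OF aut_group_axioms order_refl B PP this]
 obtain \<sigma> where "\<sigma> : G" "\<sigma> ` B = P" by blast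
 thus "P : (%\<sigma>. \<sigma> ` B) ` G" by blast
next
 fix P assume "P : (%\<sigma>. \<sigma> ` B) ` G"
 then obtain \<sigma> where "\<sigma> : G" "P = \<sigma> ` B" by blast
 thus "P : primes_over (residue_char B)"
  using Prime_image[OF B, of \<sigma>] residue_char_image[OF B, of \<sigma>] unfolding primes_over_def by simp
qed

lemma primes_over_conv:
 assumes "Factorial_Ring.prime p"
 shows "primes_over p = {P. Prime P & of_nat p : P}"
proof -
 have "residue_char P = p \<longleftrightarrow> of_nat p : P" if P: "Prime P" for P
  unfolding of_nat_mem_iff[OF P] using primes_dvd_imp_eq[OF residue_char_prime[OF P] assms] dvd_refl by metis
 thus ?thesis unfolding primes_over_def by blast
qed

lemma primes_over_nonempty: "Factorial_Ring.prime p ==> primes_over p ~= {}"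
proof -
 assume p: "Factorial_Ring.prime p"
 have "1 ~: mult_of p"
 proof
  assume "1 : mult_of p"
  then obtain y where y: "y : \<O>" "1 = of_nat p * y" by (auto simp: mult_of_def)
  have p0: "of_nat p ~= (0::complex)" using p by auto
  hence e: "y = inverse (of_nat p)" using y(2) by (simp add: field_simps)
  hence "y : \<int>" using y(1) by (intro rational_algebraic_int_is_int) (auto simp: \<O>_def)
  then obtain k where "y = of_int k" by (auto elim: Ints_cases)
  hence "of_int (int p * k) = (1::complex)" using y(2) by simp
  hence "int p * k = 1" by (simp only: of_int_eq_1_iff)
  hence "int p dvd 1" by (metis dvd_triv_left)
  thus False using p by auto
 qed
 moreover have "of_nat p : mult_of p" using Int_cl(2) by (force simp: mult_of_def)
 ultimately show ?thesis
  using prime_containing[OF mult_of_ideal, of p p] p prime_gt_0_nat[OF p] unfolding primes_over_conv[OF p] by blast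
qed

lemma inorm_image:
 assumes B: "Prime B" and \<sigma>: "\<sigma> : G"
 shows "inorm (\<sigma> ` B) = inorm B"
proof -
 have BL: "B <= L" using IdealD(1)[OF PrimeD(1)[OF B]] Int_L by blast
 have c: "coset (\<sigma> ` B) (\<sigma> x) = \<sigma> ` coset B x" if x: "x : \<O>" for x
  unfolding coset_def image_image using BL Int_L[OF x] by (intro image_cong refl) (auto simp: hom_simps(3)[OF \<sigma>])
 have "coset (\<sigma> ` B) ` \<O> = (%x. coset (\<sigma> ` B) (\<sigma> x)) ` \<O>"
  using Int_preimage[OF B \<sigma>] Int_into[OF \<sigma>] by (auto simp: image_iff)
 also have "... = image \<sigma> ` coset B ` \<O>" using c by (auto simp: image_iff)
 finally have eq: "coset (\<sigma> ` B) ` \<O> = image \<sigma> ` coset B ` \<O>" .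
 have "coset B x <= L" if "x : \<O>" for x using BL Int_L[OF that] Lcl(3) by (auto simp: coset_def)
 hence "inj_on (image \<sigma>) (coset B ` \<O>)"
  using inj_on_image_eq_iff[OF hom_on_inj[OF L hom[OF \<sigma>]]] by (fastforce intro: inj_onI)
 thus ?thesis by (simp add: inorm_def eq card_image)
qed

lemma inorm_gt_1: "Prime B ==> inorm B > 1"
proof -
 assume B: "Prime B"
 have "coset B 0 ~= coset B 1"
  using coset_eq_iff[OF Ideal_additive[OF PrimeD(1)[OF B]], of 0 1] PrimeD(2)[OF B] IdealD(7)[OF PrimeD(1)[OF B], of "-1"] by auto
 hence "card {coset B 0, coset B 1} = 2" by simp
 moreover have "card {coset B 0, coset B 1} <= inorm B"
  unfolding inorm_def using Int_cl(1,2) by (intro card_mono residue_field_finite[OF B]) auto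
 ultimately show ?thesis by linarith
qed

text \<open>The primes over \<open>p\<close> are the conjugates of \<open>B\<close>, each counted as often as the decomposition group
  has elements.\<close>

lemma sum_orbit:
 fixes F :: "complex set => real"
 assumes B: "Prime B"
 shows "(\<Sum>\<sigma>\<in>G. F (\<sigma> ` B)) = real (card (decomp B)) * (\<Sum>P\<in>primes_over (residue_char B). F P)"
proof -
 have fib: "{\<tau> : G. \<tau> ` B = \<sigma> ` B} = compose L \<sigma> ` decomp B" if \<sigma>: "\<sigma> : G" for \<sigma>
 proof (intro equalityI subsetI)
  have BL: "B <= L" using IdealD(1)[OF PrimeD(1)[OF B]] Int_L by blast
  {
   fix \<tau> assume t: "\<tau> : {\<tau> : G. \<tau> ` B = \<sigma> ` B}"
   obtain \<rho> where r: "\<rho> : G" "ALL x:L. \<rho> (\<sigma> x) = x & \<sigma> (\<rho> x) = x" using inv_ex[OF \<sigma>] by blast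
   have c: "compose L \<rho> \<tau> : G" using t r(1) by (intro comp_mem) auto
   have "compose L \<rho> \<tau> ` B = (%x. \<rho> (\<tau> x)) ` B" using BL by (intro image_cong refl) (auto simp: comp_apply)
   also have "... = \<rho> ` \<sigma> ` B" using t by (simp add: image_image[symmetric])
   also have "... = (%x. x) ` B" unfolding image_image using BL r(2) by (intro image_cong refl) auto
   finally have d: "compose L \<rho> \<tau> : decomp B" using c by (simp add: decomp_def)
   have "\<tau> = compose L \<sigma> (compose L \<rho> \<tau>)"
    using t r(2) into by (intro ext_eqI comp_mem \<sigma> c) (auto simp: comp_apply)
   thus "\<tau> : compose L \<sigma> ` decomp B" using d by (rule image_eqI)
  next
   fix \<tau> assume "\<tau> : compose L \<sigma> ` decomp B"
   then obtain d where d: "d : G" "d ` B = B" "\<tau> = compose L \<sigma> d" by (auto simp: decomp_def)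
   have "\<tau> ` B = (%x. \<sigma> (d x)) ` B" unfolding d(3) using BL by (intro image_cong refl) (auto simp: comp_apply)
   also have "... = \<sigma> ` d ` B" by (simp add: image_image)
   finally show "\<tau> : {\<tau> : G. \<tau> ` B = \<sigma> ` B}" using d comp_mem[OF \<sigma> d(1)] by simp
  }
 qed
 have cf: "card {\<tau> : G. \<tau> ` B = P} = card (decomp B)" if "P : (%\<sigma>. \<sigma> ` B) ` G" for P
 proof -
  obtain \<sigma> where \<sigma>: "\<sigma> : G" "P = \<sigma> ` B" using \<open>P : _\<close> by blast
  have "decomp B <= G" by (auto simp: decomp_def)
  hence "inj_on (compose L \<sigma>) (decomp B)"
   using bij_comp_left[OF \<sigma>(1)] inj_on_subset unfolding bij_betw_def by blast
  thus ?thesis using fib[OF \<sigma>(1)] \<sigma>(2) by (simp add: card_image)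
 qed
 have "(\<Sum>\<sigma>\<in>G. F (\<sigma> ` B)) = (\<Sum>P\<in>(%\<sigma>. \<sigma> ` B) ` G. \<Sum>\<sigma>\<in>{\<tau> : G. \<tau> ` B = P}. F (\<sigma> ` B))"
  by (rule sum.image_gen[OF fin])
 also have "... = (\<Sum>P\<in>(%\<sigma>. \<sigma> ` B) ` G. real (card (decomp B)) * F P)"
  using cf by (intro sum.cong refl) simp
 finally show ?thesis by (simp add: primes_over_orbit[OF B] sum_distrib_left)
qed

text \<open>The identity \<open>e f g = n\<close>: \<open>p\<close> generates the product of the powers of its \<open>g\<close> conjugate prime
  divisors with exponent its valuation, and its norm is \<open>p ^ n\<close>.\<close>

lemma residue_char_power:
 assumes B: "Prime B"
 defines "S \<equiv> primes_over (residue_char B)"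
 shows "residue_char B ^ n = (inorm B ^ nat (val B (of_nat (residue_char B)))) ^ card S"
  and "n = card (decomp B) * card S" and "finite S" and "card S > 0"
  and "!!P. P : S ==> inorm P = inorm B"
proof -
 let ?p = "residue_char B"
 let ?v = "val B (of_nat ?p)"
 note p = residue_char_prime[OF B]
 show fS: "finite S" unfolding S_def primes_over_orbit[OF B] using fin by blast
 have SP: "Prime P & inorm P = inorm B & val P (of_nat ?p) = int (nat ?v)" if PS: "P : S" for P
 proof -
  obtain \<sigma> where \<sigma>: "\<sigma> : G" "P = \<sigma> ` B" using PS unfolding S_def primes_over_orbit[OF B] by blast
  have "val (\<sigma> ` B) (\<sigma> (of_nat ?p)) = val B (of_nat ?p)" by (rule val_image[OF B \<sigma>(1) Lcl(10)])
  thus ?thesis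
   using \<sigma> Prime_image[OF B] inorm_image[OF B] val_residue_char_pos[OF B] by (simp add: hom_simps(8)[OF \<sigma>(1)])
 qed
 thus "P : S ==> inorm P = inorm B" for P by blast
 have "mult_of ?p = {x : \<O>. ALL P:S. x : V P (int (nat ?v))}"
  using mult_of_conv_val[OF prime_gt_0_nat[OF p]] SP unfolding S_def primes_over_conv[OF p, symmetric] by auto
 hence "?p ^ n = (\<Prod>P\<in>S. inorm P ^ nat ?v)"
  using card_mod_mult_of(2)[OF prime_gt_0_nat[OF p]] inorm_inter_prime_powers[OF fS, of "%_. nat ?v"] SP by (auto simp: inorm_def)
 also have "... = (inorm B ^ nat ?v) ^ card S" using SP by (simp add: prod_constant)
 finally show "?p ^ n = (inorm B ^ nat ?v) ^ card S" .
 have "real n = real (card (decomp B) * card S)" using sum_orbit[OF B, of "%_. 1"] by (simp add: S_def)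
 thus "n = card (decomp B) * card S" by (simp only: of_nat_eq_iff)
 show "card S > 0" using fS B by (auto simp: card_gt_0_iff primes_over_def S_def)
qed

text \<open>The inertia index is the ramification index. The \<open>r\<close> cosets of the inertia group in the
  decomposition group are independent modulo \<open>B\<close>, so the residue field has at least \<open>p ^ r\<close>
  elements, which by \<open>e f g = n\<close> bounds the valuation of \<open>p\<close> by the order of the inertia group; this
  order divides the valuation since \<open>p\<close> is invariant.\<close>

lemma val_residue_char:
 assumes B: "Prime B"
 shows "val B (of_nat (residue_char B)) = int (card (inert B))"
proof -
 interpret D: aut_group L "decomp B" by (rule decomp_subgroup[OF B])
 interpret I: aut_group L "inert B" by (rule inert_subgroup[OF B])
 note BI = IdealD[OF PrimeD(1)[OF B]]
 let ?p = "residue_char B" and ?v = "val B (of_nat (residue_char B))"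
 note p = residue_char_prime[OF B]
 have W: "aut_group L (inert B)" "inert B <= decomp B" by (rule inert_subgroup[OF B]) (auto simp: inert_def)
 have DG: "\<sigma> : G" if "\<sigma> : decomp B" for \<sigma> using that by (simp add: decomp_def)
 let ?f = "%\<sigma>. compose L \<sigma> ` inert B"
 define r where "r = card (?f ` decomp B)"
 have card: "card (decomp B) = r * card (inert B)" unfolding r_def by (rule D.card_cosets[OF W])
 have "finite (?f ` decomp B)" by (rule finite_imageI[OF D.fin])
 then obtain h where h: "bij_betw h {0..<r} (?f ` decomp B)" unfolding r_def using ex_bij_betw_nat_finite by blast
 have "ALL i:{..<r}. EX \<sigma>. \<sigma> : decomp B & ?f \<sigma> = h i" using bij_betwE[OF h] by fastforce
 then obtain s where s: "ALL i:{..<r}. s i : decomp B & ?f (s i) = h i" by (rule bchoice[THEN exE])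
 have sD: "s i : decomp B" if "i < r" for i using s that by simp
 have sG: "s i : G" if "i < r" for i by (rule DG[OF sD[OF that]])
 have dist: "EX x:\<O>. s i x - s j x ~: B" if ij: "i < r" "j < r" "i ~= j" for i j
 proof (rule ccontr)
  assume n: "~ (EX x:\<O>. s i x - s j x ~: B)"
  obtain \<rho> where \<rho>: "\<rho> : decomp B" "ALL x:L. \<rho> (s j x) = x & s j (\<rho> x) = x" using D.inv_ex[OF sD[OF ij(2)]] by blast
  define d where "d = compose L \<rho> (s i)"
  have d: "d : decomp B" unfolding d_def by (rule D.comp_mem[OF \<rho>(1) sD[OF ij(1)]])
  have "d x - x : B" if x: "x : \<O>" for x
  proof -
   note xL = Int_L[OF x]
   have "\<rho> (s i x - s j x) : \<rho> ` B" using n x by blast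
   moreover have "\<rho> (s i x - s j x) = d x - x"
    using hom_simps(5)[OF DG[OF \<rho>(1)] into[OF sG[OF ij(1)] xL] into[OF sG[OF ij(2)] xL]] \<rho>(2) xL
    by (simp add: d_def comp_apply)
   ultimately show ?thesis using \<rho>(1) by (simp add: decomp_def)
  qed
  hence dI: "d : inert B" using d by (simp add: inert_def)
  have "s i = compose L (s j) d"
  proof (rule D.ext_eqI[OF sD[OF ij(1)] D.comp_mem[OF sD[OF ij(2)] d]])
   show "s i x = compose L (s j) d x" if x: "x : L" for x
    using \<rho>(2) into[OF sG[OF ij(1)] x] x by (simp add: d_def comp_apply)
  qed
  hence "s i : ?f (s j)" using dI by blast
  hence "s i : {\<tau> : decomp B. ?f \<tau> = ?f (s j)}" by (simp only: D.coset_fiber[OF W sD[OF ij(2)]])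
  hence "?f (s i) = ?f (s j)" by blast
  hence "h i = h j" using s ij by simp
  thus False using inj_onD[OF bij_betw_imp_inj_on[OF h], of i j] ij by simp
 qed
 obtain x where x: "ALL j<r. x j : \<O>" "Determinant.det (mat r r (%(i, j). s i (x j))) ~: B"
  using independent_conjugates[OF B, of r s] sG dist by blast
 have xI: "x j : \<O>" if "j < r" for j using x(1) that by blast
 define y where "y c = (\<Sum>j<r. of_nat (c j) * x j)" for c :: "nat => nat"
 have "inj_on (%c. coset B (y c)) (PiE {..<r} (%_. {..<?p}))"
 proof (rule inj_onI)
  fix b c assume bc: "b : PiE {..<r} (%_. {..<?p})" "c : PiE {..<r} (%_. {..<?p})" "coset B (y b) = coset B (y c)"
  define d where "d j = int (b j) - int (c j)" for j
  have yd: "(\<Sum>j<r. x j * of_int (d j)) : B"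
   using bc(3) coset_eq_iff[OF Ideal_additive[OF PrimeD(1)[OF B]], of "y b" "y c"]
   by (simp add: y_def d_def sum_subtractf[symmetric] algebra_simps)
  have sys: "(\<Sum>j<r. s i (x j) * of_int (d j)) : B" if i: "i < r" for i
  proof -
   have "s i (\<Sum>j<r. x j * of_int (d j)) = (\<Sum>j<r. s i (x j * of_int (d j)))"
    by (rule hom_on_sum[OF L hom[OF sG[OF i]]]) (simp add: Lcl(5,11) Int_L xI)
   also have "... = (\<Sum>j<r. s i (x j) * of_int (d j))"
    by (rule sum.cong[OF refl]) (use xI Int_L Lcl(11) in \<open>simp add: hom_simps(4,9)[OF sG[OF i]]\<close>)
   finally have e: "s i (\<Sum>j<r. x j * of_int (d j)) = (\<Sum>j<r. s i (x j) * of_int (d j))" .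
   have "s i (\<Sum>j<r. x j * of_int (d j)) : s i ` B" by (rule imageI[OF yd])
   thus ?thesis using sD[OF i] unfolding e by (simp add: decomp_def)
  qed
  have "b j = c j" if j: "j < r" for j
  proof -
   have "(of_int (d j) :: complex) : B"
    by (rule conjugate_system_zero[OF B sG xI x(2) Int_cl(11) sys j])
   hence "int ?p dvd d j" using of_int_mem_iff[OF B] by blast
   moreover have "b j < ?p" "c j < ?p" using bc(1,2) j by (auto dest: PiE_mem)
   hence "\<bar>d j\<bar> < int ?p" by (simp add: d_def)
   ultimately have "d j = 0" using zdvd_not_zless[of "\<bar>d j\<bar>" "int ?p"] by auto
   thus ?thesis by (simp add: d_def)
  qed
  thus "b = c" by (intro PiE_ext[OF bc(1,2)]) simp
 qed
 moreover have "(%c. coset B (y c)) ` PiE {..<r} (%_. {..<?p}) <= coset B ` \<O>"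
 proof (rule image_subsetI)
  fix c
  have "of_nat (c j) * x j : \<O>" if "j : {..<r}" for j
   using Int_cl(5)[OF Int_cl(10) xI] that by simp
  hence "y c : \<O>" unfolding y_def by (rule Int_cl(8))
  thus "coset B (y c) : coset B ` \<O>" by (rule imageI)
 qed
 ultimately have "card (PiE {..<r} (%_. {..<?p})) <= inorm B"
  unfolding inorm_def using residue_field_finite[OF B] card_inj_on_le by blast
 hence pN: "?p ^ r <= inorm B" by (simp add: card_PiE)
 note R = residue_char_power[OF B]
 have p2: "?p >= 2" by (rule prime_ge_2_nat[OF p])
 have "?p ^ (r * nat ?v * card (primes_over ?p)) <= ?p ^ n"
  unfolding R(1) power_mult by (intro power_mono pN) simp_all
 hence "r * nat ?v * card (primes_over ?p) <= n" using p2 by (simp add: power_le_imp_le_exp)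
 hence "r * nat ?v <= r * card (inert B)" using R(4) unfolding R(2) card by simp
 moreover have "r > 0" using card D.card_pos by (cases r) auto
 ultimately have "?v <= int (card (inert B))" by simp
 moreover have "int (card (inert B)) dvd ?v"
  using p2 Lcl(10) by (intro val_fixed_dvd[OF B W(1) subset_refl]) (auto simp: I.Fix_def I.hom_simps(8))
 hence "int (card (inert B)) <= ?v" using val_residue_char_pos[OF B] by (intro zdvd_imp_le) auto
 ultimately show ?thesis by simp
qed

lemma sum_primes_over:
 fixes F :: "complex set => real"
 assumes B: "Prime B"
 shows "(\<Sum>P\<in>primes_over (residue_char B). F P * ln (real (inorm P))) =
  ln (real (residue_char B)) / real (card (inert B)) * (\<Sum>\<sigma>\<in>G. F (\<sigma> ` B))"
proof -
 let ?p = "residue_char B" and ?e = "card (inert B)"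
 let ?S = "primes_over ?p" and ?N = "ln (real (inorm B))"
 note R = residue_char_power[OF B]
 have "ln (real ?p ^ n) = ln ((real (inorm B) ^ ?e) ^ card ?S)"
  using R(1) unfolding val_residue_char[OF B] nat_int by (metis of_nat_power)
 hence "real n * ln (real ?p) = real (card ?S) * (real ?e * ?N)"
  using inorm_gt_1[OF B] residue_char[OF B] by (simp add: ln_realpow)
 moreover have "real n = real (card (decomp B)) * real (card ?S)" using R(2) by (metis of_nat_mult)
 ultimately have "real (card (decomp B)) * ln (real ?p) = real ?e * ?N" using R(4) by simp
 hence N: "?N = real (card (decomp B)) * ln (real ?p) / real ?e"
  using aut_group.card_pos[OF inert_subgroup[OF B]] by (simp add: field_simps)
 have "(\<Sum>P\<in>?S. F P * ln (real (inorm P))) = (\<Sum>P\<in>?S. F P) * ?N"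
  unfolding sum_distrib_right using R(5) by (intro sum.cong refl) simp
 also have "... = ln (real ?p) / real ?e * (real (card (decomp B)) * (\<Sum>P\<in>?S. F P))" by (simp add: N)
 finally show ?thesis by (simp only: sum_orbit[OF B])
qed

end

section \<open>Discriminants and ramification in a tower\<close>

context galois_field
begin

context
 fixes B :: "complex set"
 assumes B: "Prime B"
begin

lemma sum_pairs_symmetric:
 fixes f :: "nat => nat => int"
 assumes "!!i j. f i j = f j i"
 shows "2 * (\<Sum>j<m. \<Sum>i<j. f i j) = (\<Sum>j<m. \<Sum>i\<in>{..<m} - {j}. f i j)"
proof (induction m)
 case (Suc m)
 have "(\<Sum>j<Suc m. \<Sum>i\<in>{..<Suc m} - {j}. f i j) = (\<Sum>j<m. \<Sum>i\<in>{..<Suc m} - {j}. f i j) + (\<Sum>i<m. f i m)"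
 proof -
  have "{..<Suc m} - {m} = {..<m}" by auto
  thus ?thesis by simp
 qed
 also have "(\<Sum>j<m. \<Sum>i\<in>{..<Suc m} - {j}. f i j) = (\<Sum>j<m. f m j + (\<Sum>i\<in>{..<m} - {j}. f i j))"
 proof (rule sum.cong[OF refl])
  fix j assume "j : {..<m}"
  hence "{..<Suc m} - {j} = insert m ({..<m} - {j})" by auto
  thus "(\<Sum>i\<in>{..<Suc m} - {j}. f i j) = f m j + (\<Sum>i\<in>{..<m} - {j}. f i j)" by simp
 qed
 also have "... = (\<Sum>j<m. f j m) + 2 * (\<Sum>j<m. \<Sum>i<j. f i j)"
  using assms[of m] Suc.IH by (simp add: sum.distrib)
 finally show ?case by simp
qed simp

text \<open>In the totally ramified case the powers of a uniformizer are a local basis.\<close>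

lemma ramified_dm:
 assumes inert: "inert B = G" and w: "is_int_basis w"
 shows "2 * val B (dm w) = int n * (\<Sum>\<gamma>\<in>G - {restrict id L}. val B (\<gamma> (unif B) - unif B))"
proof -
 let ?\<pi> = "unif B"
 note \<pi> = unif_L[OF B] unif_nonzero[OF B]
 have GD: "\<sigma> : decomp B" if "\<sigma> : G" for \<sigma> using that inert inert_decomp[OF B] by blast
 have wI: "w j : \<O>" if "j < n" for j using w that by (simp add: is_int_basis_def)
 have wL: "w j : L" if "j < n" for j by (rule Int_L[OF wI[OF that]])
 have dw: "dm w ~= 0" "dm w : \<O>" using w dm_mem_Int[OF wI] by (simp_all add: is_int_basis_def)
 define d where "d = dm (%j. ?\<pi> ^ j)"
 have dI: "d : \<O>" unfolding d_def by (rule dm_mem_Int) (rule Int_cl(7)[OF unif_Int[OF B]])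
 have ne: "enum j ?\<pi> - enum i ?\<pi> ~= 0" if "i < j" "j < n" for i j
  using inj_onD[OF inert_unif_inj[OF B], of "enum j" "enum i"] inert enum_mem that enum_eqD[of j i] by auto
 have d0: "d ~= 0" unfolding d_def dm_powers[OF \<pi>(1)] using ne by (simp add: prod_zero_iff)
 obtain m :: int where m: "d = dm w * of_int m"
  using int_basis_index[OF w, of "%j. ?\<pi> ^ j"] Int_cl(7)[OF unif_Int[OF B]] unfolding d_def by blast
 have "ALL j:{..<n}. EX c. (ALL i<n. c i : loc B & c i : Fix) & w j = (\<Sum>i<n. c i * ?\<pi> ^ i)"
  using uniformizer_expansion[OF B Int_loc[OF B wI]] unfolding inert by blast
 then obtain c where c: "ALL j:{..<n}. (ALL i<n. c j i : loc B & c j i : Fix) & w j = (\<Sum>i<n. c j i * ?\<pi> ^ i)"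
  by (rule bchoice[THEN exE])
 define C where "C = Determinant.det (mat n n (%(i, j). c j i))"
 have wd: "dm w = d * C"
  unfolding d_def C_def using c Lcl(7)[OF \<pi>(1)] by (intro dm_base_change) auto
 have CR: "C : loc B"
  unfolding C_def using c by (intro csubring_det[OF loc_ring[OF B] mat_carrier]) simp
 have C0: "C ~= 0" "C : L" using wd dw(1) loc_L[OF B CR] by auto
 have m0: "of_int m ~= (0::complex)" using m d0 by auto
 have "val B d = val B (dm w) + val B (of_int m)"
  unfolding m by (rule val_mult[OF B Int_L[OF dw(2)] dw(1) Lcl(11) m0])
 moreover have "val B (of_int m) >= 0" using Int_V0[OF B Int_cl(11), of m] m0 by (simp add: V_def)
 moreover have "val B (dm w) = val B d + val B C"
  unfolding wd by (rule val_mult[OF B Int_L[OF dI] d0 C0(2,1)])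
 moreover have "val B C >= 0" using mem_loc_iff[OF B C0(2,1)] CR by blast
 ultimately have eq: "val B (dm w) = val B d" by linarith
 define f where "f i j = val B (enum j ?\<pi> - enum i ?\<pi>)" for i j
 have eL: "enum i ?\<pi> : L" if "i < n" for i by (rule into[OF enum_mem[OF that] \<pi>(1)])
 have diffL: "enum j ?\<pi> - enum i ?\<pi> : L & enum j ?\<pi> - enum i ?\<pi> ~= 0" if "i < j" "j < n" for i j
  using ne[OF that] Lcl(4)[OF eL eL, of j i] that by simp
 have "val B d = (\<Sum>j<n. val B (\<Prod>i<j. enum j ?\<pi> - enum i ?\<pi>))"
  unfolding d_def dm_powers[OF \<pi>(1)] using diffL
  by (intro val_prod[OF B]) (auto intro: Lcl(9) simp: prod_zero_iff)
 also have "... = (\<Sum>j<n. \<Sum>i<j. f i j)"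
  unfolding f_def using diffL by (intro sum.cong refl val_prod[OF B]) auto
 finally have "2 * val B d = 2 * (\<Sum>j<n. \<Sum>i<j. f i j)" by simp
 also have "... = 2 * (\<Sum>j<n. \<Sum>i<j. if i < n & j < n then f i j else 0)"
  by (intro arg_cong2[of _ _ _ _ "(*)"] refl sum.cong) auto
 also have "... = (\<Sum>j<n. \<Sum>i\<in>{..<n} - {j}. if i < n & j < n then f i j else 0)"
 proof (rule sum_pairs_symmetric)
  fix i j
  show "(if i < n & j < n then f i j else 0) = (if j < n & i < n then f j i else 0)"
   using val_uminus[OF B Lcl(4)[OF eL eL], of i j] by (auto simp: f_def)
 qed
 also have "... = (\<Sum>j<n. \<Sum>\<gamma>\<in>G - {restrict id L}. val B (\<gamma> ?\<pi> - ?\<pi>))"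
 proof (rule sum.cong[OF refl])
  fix j assume "j : {..<n}"
  hence j: "j < n" by simp
  have ej: "enum j : G" by (rule enum_mem[OF j])
  have "(\<Sum>i\<in>{..<n} - {j}. if i < n & j < n then f i j else 0) = (\<Sum>i\<in>{..<n} - {j}. val B (enum i ?\<pi> - enum j ?\<pi>))"
   using val_uminus[OF B Lcl(4)[OF eL eL], of j] j by (intro sum.cong refl) (auto simp: f_def)
  also have "... = (\<Sum>\<sigma>\<in>G - {enum j}. val B (\<sigma> ?\<pi> - enum j ?\<pi>))"
  proof (rule sum.reindex_bij_betw[where h = enum and g = "%\<sigma>. val B (\<sigma> ?\<pi> - enum j ?\<pi>)"])
   have "inj_on enum {..<n}" "enum ` {..<n} = G" using enum by (auto simp: bij_betw_def)
   thus "bij_betw enum ({..<n} - {j}) (G - {enum j})"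
    using j by (auto simp: bij_betw_def inj_on_def image_iff)
  qed
  also have "... = (\<Sum>\<gamma>\<in>G - {restrict id L}. val B (\<gamma> ?\<pi> - ?\<pi>))"
  proof (rule sum.reindex_bij_betw[where h = "compose L (enum j)", symmetric, THEN trans])
   have b: "bij_betw (compose L (enum j)) G G" by (rule bij_comp_left[OF ej])
   have e: "compose L (enum j) (restrict id L) = enum j"
    by (rule ext_eqI[OF comp_mem[OF ej id_mem] ej]) (simp add: comp_apply)
   show "bij_betw (compose L (enum j)) (G - {restrict id L}) (G - {enum j})"
    using bij_betw_DiffI[OF b, of "{restrict id L}" "{enum j}"] id_mem ej e by (simp add: bij_betw_def)
   show "(\<Sum>\<gamma>\<in>G - {restrict id L}. val B (compose L (enum j) \<gamma> ?\<pi> - enum j ?\<pi>)) =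
    (\<Sum>\<gamma>\<in>G - {restrict id L}. val B (\<gamma> ?\<pi> - ?\<pi>))"
   proof (rule sum.cong[OF refl])
    fix \<gamma> assume "\<gamma> : G - {restrict id L}"
    hence \<gamma>L: "\<gamma> ?\<pi> : L" using into \<pi>(1) by blast
    have "compose L (enum j) \<gamma> ?\<pi> - enum j ?\<pi> = enum j (\<gamma> ?\<pi> - ?\<pi>)"
     using hom_simps(5)[OF ej \<gamma>L \<pi>(1)] \<pi>(1) by (simp add: comp_apply)
    thus "val B (compose L (enum j) \<gamma> ?\<pi> - enum j ?\<pi>) = val B (\<gamma> ?\<pi> - ?\<pi>)"
     using val_decomp[OF B GD[OF ej] Lcl(4)[OF \<gamma>L \<pi>(1)]] by simp
   qed
  qed
  finally show "(\<Sum>i\<in>{..<n} - {j}. if i < n & j < n then f i j else 0) = (\<Sum>\<gamma>\<in>G - {restrict id L}. val B (\<gamma> ?\<pi> - ?\<pi>))" .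
 qed
 finally show ?thesis by (simp add: eq)
qed

end

end

text \<open>Both fields are Galois over the rationals, so the primes of \<open>k\<close> are governed by \<open>\<Gamma>\<close> in the same
  way as those of \<open>L\<close> by \<open>G\<close>, and ramification in \<open>L\<close> over \<open>k\<close> is read off by comparison.\<close>

locale tower = big: galois_field L G + small: galois_field k \<Gamma> for L G k \<Gamma> +
 assumes sub: "k <= L"
begin

abbreviation res :: "(complex => complex) => complex => complex" where
 "res \<sigma> \<equiv> restrict \<sigma> k"

definition H :: "(complex => complex) set" where
 "H = {\<sigma> : G. ALL x:k. \<sigma> x = x}"

lemma small_ints: "small.\<O> = big.\<O> Int k"
 using sub by (auto simp: small.\<O>_def big.\<O>_def)

lemma H_subgroup: "aut_group L H"
 unfolding H_def by (rule big.pointwise_stabilizer_subgroup[OF sub])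

lemma H_G: "\<sigma> : H ==> \<sigma> : G" by (simp add: H_def)

lemma maps_small: "\<sigma> : G ==> x : k ==> \<sigma> x : k"
proof -
 assume \<sigma>: "\<sigma> : G" and x: "x : k"
 have xL: "x : L" using sub x by blast
 have c: "poly.coeff (small.cpoly x) i : \<rat>" for i
  using small.cpoly_coeff[OF x] small.Fix_Rats by simp
 have "\<sigma> (poly (small.cpoly x) x) = poly (small.cpoly x) (\<sigma> x)"
  using hom_on_poly_eval[OF big.L big.hom[OF \<sigma>] big.Rats_L[OF c] xL] big.hom_simps(12)[OF \<sigma> c]
  by (simp add: poly_altdef)
 hence "poly (small.cpoly x) (\<sigma> x) = 0"
  using small.cpoly_self[OF x] by (simp add: big.hom_simps(2)[OF \<sigma>])
 thus "\<sigma> x : k" using small.cpoly_zeros small.into x by metis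
qed

lemma res_mem: "\<sigma> : G ==> res \<sigma> : \<Gamma>"
proof -
 assume \<sigma>: "\<sigma> : G"
 obtain \<tau> where \<tau>: "\<tau> : G" "ALL x:L. \<tau> (\<sigma> x) = x & \<sigma> (\<tau> x) = x" using big.inv_ex[OF \<sigma>] by blast
 show "res \<sigma> : \<Gamma>"
 proof (rule small.full)
  show "hom_on k (res \<sigma>)"
   using big.hom[OF \<sigma>] sub small.Lcl(2,3,5) unfolding hom_on_def by (auto simp: subset_iff)
  show "bij_betw (res \<sigma>) k k"
  proof (rule bij_betwI[where g = \<tau>])
   show "res \<sigma> : k \<rightarrow> k" "\<tau> : k \<rightarrow> k" using maps_small \<sigma> \<tau>(1) by auto
   show "\<tau> (res \<sigma> x) = x" "res \<sigma> (\<tau> x) = x" if "x : k" for x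
    using that \<tau> maps_small[OF \<tau>(1) that] sub by auto
  qed
 qed simp
qed

lemma res_comp: "\<sigma> : G ==> \<tau> : G ==> res (compose L \<sigma> \<tau>) = compose k (res \<sigma>) (res \<tau>)"
 using sub maps_small by (auto simp: compose_def fun_eq_iff restrict_def)

text \<open>The image of restriction has the rationals as fixed field.\<close>

lemma res_surj: "res ` G = \<Gamma>"
proof (rule small.subgroup_eqI)
 show sub\<Gamma>: "res ` G <= \<Gamma>" using res_mem by blast
 show "aut_group k (res ` G)"
 proof (rule small.subgroupI[OF sub\<Gamma>])
  have "res (restrict id L) = restrict id k" using sub by (auto simp: fun_eq_iff restrict_def)
  thus "restrict id k : res ` G" using big.id_mem by (metis imageI)
  show "compose k \<sigma> \<tau> : res ` G" if st: "\<sigma> : res ` G" "\<tau> : res ` G" for \<sigma> \<tau>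
  proof -
   obtain s t where "s : G" "\<sigma> = res s" "t : G" "\<tau> = res t" using st by blast
   thus ?thesis using res_comp[of s t] big.comp_mem[of s t] by (metis imageI)
  qed
 qed
 then interpret W: aut_group k "res ` G" .
 show "W.Fix = small.Fix"
  unfolding small.Fix_Rats
 proof (intro equalityI subsetI)
  fix x assume "x : W.Fix"
  hence x: "x : k" "!!\<sigma>. \<sigma> : G ==> res \<sigma> x = x" by (auto simp: W.Fix_def)
  hence "x : big.Fix" using sub by (auto simp: big.Fix_def)
  thus "x : \<rat>" by (simp add: big.Fix_Rats)
 next
  fix x :: complex assume "x : \<rat>"
  thus "x : W.Fix" using csubfield_Rats[OF W.Fix_subfield] by blast
 qed
qed

lemma res_fiber:
 assumes S: "aut_group L S" "S <= G" and \<sigma>: "\<sigma> : S"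
 shows "{\<tau> : S. res \<tau> = res \<sigma>} = compose L \<sigma> ` (S Int H)"
proof -
 interpret S: aut_group L S by fact
 have SG: "\<tau> : G" if "\<tau> : S" for \<tau> using that S(2) by blast
 show ?thesis
 proof (intro equalityI subsetI)
  fix \<tau> assume "\<tau> : {\<tau> : S. res \<tau> = res \<sigma>}"
  hence \<tau>: "\<tau> : S" "res \<tau> = res \<sigma>" by auto
  obtain \<rho> where \<rho>: "\<rho> : S" "ALL x:L. \<rho> (\<sigma> x) = x & \<sigma> (\<rho> x) = x" using S.inv_ex[OF \<sigma>] by blast
  define h where "h = compose L \<rho> \<tau>"
  have hS: "h : S" unfolding h_def by (rule S.comp_mem[OF \<rho>(1) \<tau>(1)])
  have "h x = x" if x: "x : k" for x
  proof -
   have xL: "x : L" using x sub by blast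
   have "\<tau> x = \<sigma> x" using fun_cong[OF \<tau>(2), of x] x by simp
   thus ?thesis using \<rho>(2) xL by (simp add: h_def big.comp_apply)
  qed
  hence "h : S Int H" using hS SG by (simp add: H_def)
  moreover have "\<tau> = compose L \<sigma> h"
  proof (rule S.ext_eqI[OF \<tau>(1) S.comp_mem[OF \<sigma> hS]])
   fix x assume x: "x : L"
   thus "\<tau> x = compose L \<sigma> h x" using \<rho>(2) S.into[OF \<tau>(1) x] by (simp add: h_def big.comp_apply)
  qed
  ultimately show "\<tau> : compose L \<sigma> ` (S Int H)" by blast
 next
  fix \<tau> assume "\<tau> : compose L \<sigma> ` (S Int H)"
  then obtain h where h: "h : S" "h : H" "\<tau> = compose L \<sigma> h" by blast
  have "res \<tau> x = res \<sigma> x" for x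
   using h(2) sub by (auto simp: h(3) H_def restrict_def compose_def subset_iff)
  thus "\<tau> : {\<tau> : S. res \<tau> = res \<sigma>}" using S.comp_mem[OF \<sigma> h(1)] h(3) by auto
 qed
qed

lemma sum_res_fibers:
 fixes f :: "(complex => complex) => 'a::comm_monoid_add"
 assumes S: "aut_group L S" "S <= G" and \<sigma>: "\<sigma> : S"
 shows "(\<Sum>\<tau>\<in>{\<tau> : S. res \<tau> = res \<sigma>}. f \<tau>) = (\<Sum>h\<in>S Int H. f (compose L \<sigma> h))"
proof -
 have "inj_on (compose L \<sigma>) (S Int H)"
  using big.bij_comp_left[of \<sigma>] S(2) \<sigma> by (auto simp: bij_betw_def intro: inj_on_subset)
 thus ?thesis unfolding res_fiber[OF assms] by (simp add: sum.reindex)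
qed

lemma card_res:
 assumes S: "aut_group L S" "S <= G"
 shows "card S = card (res ` S) * card (S Int H)"
proof -
 interpret S: aut_group L S by fact
 have "card S = (\<Sum>\<sigma>\<in>S. 1)" by simp
 also have "... = (\<Sum>\<gamma>\<in>res ` S. \<Sum>\<tau>\<in>{\<tau> : S. res \<tau> = \<gamma>}. 1)" by (rule sum.image_gen[OF S.fin])
 also have "... = (\<Sum>\<gamma>\<in>res ` S. card (S Int H))"
 proof (rule sum.cong[OF refl])
  fix \<gamma> assume "\<gamma> : res ` S"
  then obtain \<sigma> where \<sigma>: "\<sigma> : S" "\<gamma> = res \<sigma>" by blast
  show "(\<Sum>\<tau>\<in>{\<tau> : S. res \<tau> = \<gamma>}. 1) = card (S Int H)"
   unfolding \<sigma>(2) sum_res_fibers[OF S \<sigma>(1)] by simp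
 qed
 finally show ?thesis by simp
qed

lemma card_G: "card G = card \<Gamma> * card H"
proof -
 have "G Int H = H" by (auto simp: H_def)
 thus ?thesis using card_res[OF big.aut_group_axioms subset_refl] res_surj by simp
qed

context
 fixes B :: "complex set"
 assumes B: "big.Prime B"
begin

lemmas BI = big.IdealD[OF big.PrimeD(1)[OF B]]

lemma Prime_below: "small.Prime (B Int k)"
 unfolding small.Prime_def small.Ideal_def
proof (intro conjI ballI impI)
 show "B Int k <= small.\<O>" using BI(1) small_ints by blast
 show "0 : B Int k" using BI(2) small.Lcl(1) by blast
 show "x + y : B Int k" if "x : B Int k" "y : B Int k" for x y
  using that BI(3) small.Lcl(3) by blast
 show "x * y : B Int k" if "x : B Int k" "y : small.\<O>" for x y
  using that BI(4) small.Lcl(5) small_ints by blast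
 show "1 ~: B Int k" using big.PrimeD(2)[OF B] by blast
 have "of_nat (big.residue_char B) : B Int k" using big.residue_char(2)[OF B] small.Lcl(10) by blast
 thus "B Int k ~= {0}" using big.residue_char(1)[OF B] by (metis less_numeral_extra(3) of_nat_eq_0_iff singletonD)
 show "x : B Int k | y : B Int k" if "x : small.\<O>" "y : small.\<O>" "x * y : B Int k" for x y
  using that big.PrimeD(3)[OF B, of x y] small_ints by blast
qed

lemma residue_char_below: "small.residue_char (B Int k) = big.residue_char B"
proof -
 have "of_nat m : B Int k \<longleftrightarrow> of_nat m : B" for m using small.Lcl(10) by blast
 thus ?thesis by (simp only: small.residue_char_def[OF Prime_below] big.residue_char_def[OF B])
qed

lemma lunit_below: "u : small.lunit (B Int k) ==> u : big.lunit B"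
proof -
 assume "u : small.lunit (B Int k)"
 then obtain a s where "a : small.\<O>" "a ~: B Int k" "s : small.\<O>" "s ~: B Int k" "u = a / s"
  unfolding small.lunit_def by blast
 thus "u : big.lunit B" unfolding small_ints using big.lunitI[OF B, of a s] by blast
qed

lemma val_below:
 assumes x: "x : k" "x ~= 0"
 shows "big.val B x = big.val B (small.unif (B Int k)) * small.val (B Int k) x"
proof -
 let ?P = "B Int k"
 let ?w = "small.unif ?P"
 note w = small.unif_L[OF Prime_below] small.unif_nonzero[OF Prime_below]
 have wL: "?w : L" using w(1) sub by blast
 obtain u where u: "u : small.lunit ?P" "x = ?w powi (small.val ?P x) * u"
  using small.val_rep[OF Prime_below x] by blast
 have uB: "u : big.lunit B" by (rule lunit_below[OF u(1)])
 have powi: "big.val B (?w powi m) = big.val B ?w * m" and powiL: "?w powi m : L" for m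
 proof -
  have 1: "?w ^ j : L" "?w ^ j ~= 0" "big.val B (?w ^ j) = int j * big.val B ?w" for j
   using big.Lcl(7)[OF wL] w(2) big.val_power[OF B wL w(2)] by auto
  show "big.val B (?w powi m) = big.val B ?w * m"
  proof (cases m rule: int_cases2)
   case (nonneg j)
   thus ?thesis using 1 by (simp add: mult.commute)
  next
   case (nonpos j)
   thus ?thesis using 1 big.val_inverse[OF B 1(1,2)] by (simp add: power_int_minus mult.commute)
  qed
  show "?w powi m : L" using big.Lcl(7,12) wL by (simp add: power_int_def)
 qed
 have "big.val B x = big.val B (?w powi (small.val ?P x)) + big.val B u"
  using u(2) w(2) big.val_mult[OF B powiL _ big.loc_L[OF B big.lunit_subset_loc[OF B uB]] big.lunit_nonzero[OF B uB], of "small.val ?P x"]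
  by (metis power_int_eq_0_iff)
 thus ?thesis using powi big.val_lunit[OF B uB] by simp
qed

lemma inert_H_subgroup: "aut_group L (big.inert B Int H)"
 by (rule big.inter_subgroup[OF big.inert_subgroup[OF B] H_subgroup]) (auto simp: big.inert_def big.decomp_def)

lemma inert_G: "big.inert B <= G" by (auto simp: big.inert_def big.decomp_def)

lemma res_inert_subset: "res ` big.inert B <= small.inert (B Int k)"
proof
 interpret I: aut_group L "big.inert B" by (rule big.inert_subgroup[OF B])
 fix \<gamma> assume "\<gamma> : res ` big.inert B"
 then obtain \<sigma> where \<sigma>: "\<sigma> : big.inert B" "\<gamma> = res \<sigma>" by blast
 have stable: "\<sigma> b : B Int k" if "\<sigma> : big.inert B" "b : B Int k" for \<sigma> b
 proof -
  have "\<sigma> b : \<sigma> ` B" using that by blast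
  hence "\<sigma> b : B" using that by (simp add: big.inert_def big.decomp_def)
  thus ?thesis using maps_small that inert_G by blast
 qed
 obtain \<tau> where \<tau>: "\<tau> : big.inert B" "ALL x:L. \<tau> (\<sigma> x) = x & \<sigma> (\<tau> x) = x" using I.inv_ex[OF \<sigma>(1)] by blast
 have "res \<sigma> ` (B Int k) = B Int k"
 proof (intro equalityI subsetI)
  fix y assume "y : res \<sigma> ` (B Int k)"
  thus "y : B Int k" using stable[OF \<sigma>(1)] by auto
 next
  fix y assume y: "y : B Int k"
  hence "\<sigma> (\<tau> y) = y" using \<tau>(2) sub by blast
  thus "y : res \<sigma> ` (B Int k)" using stable[OF \<tau>(1) y] by (intro rev_image_eqI[of "\<tau> y"]) auto
 qed
 moreover have "res \<sigma> x - x : B Int k" if x: "x : small.\<O>" for x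
 proof -
  have xk: "x : k" "x : big.\<O>" using x small_ints by auto
  hence "\<sigma> x - x : B" using \<sigma>(1) by (simp add: big.inert_def)
  moreover have "\<sigma> x - x : k" using maps_small \<sigma>(1) inert_G xk(1) small.Lcl(4) by blast
  ultimately show ?thesis using xk(1) by simp
 qed
 ultimately show "\<gamma> : small.inert (B Int k)"
  using res_mem \<sigma> inert_G by (auto simp: small.inert_def small.decomp_def)
qed

text \<open>Multiplicativity of ramification indices, read off from the three cases in which an inertia
  group measures them.\<close>

lemma ramification_below:
 shows "res ` big.inert B = small.inert (B Int k)"
  and "big.val B (small.unif (B Int k)) = int (card (big.inert B Int H))"
  and "card (big.inert B) = card (small.inert (B Int k)) * card (big.inert B Int H)"
proof -
 let ?P = "B Int k"
 interpret SI: aut_group k "small.inert ?P" by (rule small.inert_subgroup[OF Prime_below])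
 interpret IH: aut_group L "big.inert B Int H" by (rule inert_H_subgroup)
 let ?p = "of_nat (big.residue_char B) :: complex"
 let ?a = "big.val B (small.unif ?P)" and ?c = "card (res ` big.inert B)"
  and ?h = "card (big.inert B Int H)" and ?j = "card (small.inert ?P)"
 note w = small.unif_L[OF Prime_below] small.unif_nonzero[OF Prime_below]
 have card: "card (big.inert B) = ?c * ?h" by (rule card_res[OF big.inert_subgroup[OF B] inert_G])
 have "big.val B ?p = ?a * small.val ?P ?p"
  using val_below[of ?p] small.Lcl(10) big.residue_char(1)[OF B] by simp
 also have "small.val ?P ?p = int ?j"
  using small.val_residue_char[OF Prime_below] by (simp add: residue_char_below)
 finally have aj: "int (?c * ?h) = ?a * int ?j" using big.val_residue_char[OF B] card by simp
 have "small.unif ?P : IH.Fix" using w(1) sub unfolding IH.Fix_def by (auto simp: H_def)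
 hence "int ?h dvd ?a" using w(2) by (intro big.val_fixed_dvd[OF B inert_H_subgroup]) auto
 then obtain b where b: "?a = int ?h * b" by blast
 have "small.unif ?P : B" using small.unif(1)[OF Prime_below] by blast
 hence apos: "?a >= 1" using big.mem_B_iff[OF B BI(1)] w(2) unfolding big.V_def by blast
 hence "0 < int ?h * b" using b by simp
 hence "b > 0" using IH.card_pos by (simp add: zero_less_mult_iff)
 have "int ?h * int ?c = int ?h * (b * int ?j)" using aj b by (simp add: mult_ac)
 hence cb: "int ?c = b * int ?j" using IH.card_pos by simp
 have le: "?c <= ?j" by (rule card_mono[OF SI.fin res_inert_subset])
 have "b = 1"
 proof (rule ccontr)
  assume "b ~= 1"
  hence "2 <= b" using \<open>b > 0\<close> by simp
  hence "2 * int ?j <= b * int ?j" by (intro mult_right_mono) simp_all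
  thus False using cb le SI.card_pos by linarith
 qed
 hence eq: "?c = ?j" "?a = int ?h" using cb b by simp_all
 show "res ` big.inert B = small.inert ?P" by (rule card_subset_eq[OF SI.fin res_inert_subset eq(1)])
 show "?a = int ?h" by (rule eq(2))
 show "card (big.inert B) = ?j * ?h" using card eq(1) by simp
qed

text \<open>A group of prime order has only trivial subgroups. If the inertia group in \<open>k\<close> is trivial, both
  sides vanish. If it is \<open>\<Gamma>\<close>, powers of a uniformizer of \<open>k\<close> compute the left side, and Serre's formula
  expresses the result by the elements of the inertia group outside \<open>H\<close>.\<close>

theorem val_discriminant:
 assumes q: "Factorial_Ring.prime (card \<Gamma>)" and w: "small.is_int_basis w"
 shows "2 * big.val B (small.dm w) =
  int (card \<Gamma>) * (\<Sum>s\<in>big.inert B - H. big.val B (s (big.unif B) - big.unif B))"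
proof -
 let ?P = "B Int k"
 interpret I: aut_group L "big.inert B" by (rule big.inert_subgroup[OF B])
 have wI: "w j : small.\<O>" if "j < card \<Gamma>" for j using w that by (simp add: small.is_int_basis_def)
 have dm: "small.dm w : small.\<O>" "small.dm w ~= 0"
  using small.dm_mem_Int[OF wI] w by (simp_all add: small.is_int_basis_def)
 have "small.inert ?P = {restrict id k} | small.inert ?P = \<Gamma>"
  by (rule small.subgroup_of_prime_order[OF small.inert_subgroup[OF Prime_below] _ q])
   (auto simp: small.inert_def small.decomp_def)
 thus ?thesis
 proof
  assume triv: "small.inert ?P = {restrict id k}"
  have "s : H" if s: "s : big.inert B" for s
  proof -
   have "res s = restrict id k" using s ramification_below(1) triv by blast
   have "s x = x" if "x : k" for x using that fun_cong[OF \<open>res s = restrict id k\<close>, of x] by simp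
   thus ?thesis using s inert_G by (auto simp: H_def)
  qed
  hence "big.inert B - H = {}" by blast
  moreover have "small.dm w ~: B"
   using small.unramified_dm[OF Prime_below triv w] dm(1) small_ints by blast
  hence "big.val B (small.dm w) = 0"
   using dm(1) small_ints by (intro big.val_zero_iff[OF B]) blast+
  ultimately show ?thesis by (metis mult_zero_right sum.empty)
 next
  assume tot: "small.inert ?P = \<Gamma>"
  let ?w = "small.unif ?P" and ?h = "card (big.inert B Int H)"
  note wk = small.unif_L[OF Prime_below] small.unif_nonzero[OF Prime_below]
  have dk: "small.dm w : k" by (rule small.Int_L[OF dm(1)])
  define i where "i s = big.val B (s (big.unif B) - big.unif B)" for s
  have img: "res ` (big.inert B - H) = \<Gamma> - {restrict id k}"
  proof (intro equalityI subsetI)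
   fix \<gamma> assume "\<gamma> : res ` (big.inert B - H)"
   then obtain s where s: "s : big.inert B" "s ~: H" "\<gamma> = res s" by blast
   have "\<gamma> ~= restrict id k"
   proof
    assume "\<gamma> = restrict id k"
    hence "res s = restrict id k" using s(3) by simp
    have "s x = x" if "x : k" for x using that fun_cong[OF \<open>res s = restrict id k\<close>, of x] by simp
    thus False using s inert_G by (auto simp: H_def)
   qed
   thus "\<gamma> : \<Gamma> - {restrict id k}" using res_mem s inert_G by blast
  next
   fix \<gamma> assume \<gamma>: "\<gamma> : \<Gamma> - {restrict id k}"
   then obtain s where s: "s : big.inert B" "\<gamma> = res s" using ramification_below(1) tot by blast
   have "s ~: H"
   proof
    assume "s : H"
    hence "res s = restrict id k" by (auto simp: H_def fun_eq_iff restrict_def)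
    thus False using \<gamma> s(2) by simp
   qed
   thus "\<gamma> : res ` (big.inert B - H)" using s by blast
  qed
  have "(\<Sum>s\<in>big.inert B - H. i s) = (\<Sum>\<gamma>\<in>\<Gamma> - {restrict id k}. \<Sum>s\<in>{s : big.inert B - H. res s = \<gamma>}. i s)"
   using sum.image_gen[of "big.inert B - H" i res] I.fin img by simp
  also have "... = (\<Sum>\<gamma>\<in>\<Gamma> - {restrict id k}. big.val B (\<gamma> ?w - ?w))"
  proof (rule sum.cong[OF refl])
   fix \<gamma> assume "\<gamma> : \<Gamma> - {restrict id k}"
   hence "\<gamma> : res ` (big.inert B - H)" using img by simp
   then obtain s where s: "s : big.inert B" "s ~: H" "\<gamma> = res s" by blast
   have "{t : big.inert B - H. res t = \<gamma>} = {t : big.inert B. res t = res s}"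
   proof -
    have "t ~: H" if "t : big.inert B" "res t = res s" for t
    proof
     assume "t : H"
     hence "s x = x" if "x : k" for x
      using fun_cong[OF \<open>res t = res s\<close>, of x] that by (simp add: H_def)
     thus False using s inert_G by (auto simp: H_def)
    qed
    thus ?thesis using s(3) by blast
   qed
   hence "(\<Sum>t\<in>{t : big.inert B - H. res t = \<gamma>}. i t) = (\<Sum>h\<in>big.inert B Int H. i (compose L s h))"
    using sum_res_fibers[OF big.inert_subgroup[OF B] inert_G s(1), of i] by simp
   also have "... = (\<Sum>h\<in>big.inert B Int H. big.val B (s (h (big.unif B)) - big.unif B))"
    by (simp add: i_def big.comp_apply big.unif_L[OF B])
   also have "... = big.val B (s ?w - ?w)"
   proof (rule big.val_quotient_different(2)[OF B inert_H_subgroup _ s(1), symmetric])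
    interpret IH: aut_group L "big.inert B Int H" by (rule inert_H_subgroup)
    show "?w : IH.Fix" using wk(1) sub unfolding IH.Fix_def by (auto simp: H_def)
    show "?w : big.\<O>" using small.unif_Int[OF Prime_below] small_ints by blast
    show "big.val B ?w = int (card (big.inert B Int H))" by (rule ramification_below(2))
   qed (use s wk in auto)
   also have "s ?w = \<gamma> ?w" using s(3) wk(1) by simp
   finally show "(\<Sum>t\<in>{t : big.inert B - H. res t = \<gamma>}. i t) = big.val B (\<gamma> ?w - ?w)" .
  qed
  also have "... = (\<Sum>\<gamma>\<in>\<Gamma> - {restrict id k}. int ?h * small.val ?P (\<gamma> ?w - ?w))"
  proof (rule sum.cong[OF refl])
   fix \<gamma> assume \<gamma>: "\<gamma> : \<Gamma> - {restrict id k}"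
   have "\<gamma> ?w ~= ?w"
    using inj_onD[OF small.inert_unif_inj[OF Prime_below], of \<gamma> "restrict id k"] \<gamma> tot small.id_mem wk(1) by auto
   moreover have "\<gamma> ?w - ?w : k" using \<gamma> small.into wk(1) small.Lcl(4) by blast
   ultimately show "big.val B (\<gamma> ?w - ?w) = int ?h * small.val ?P (\<gamma> ?w - ?w)"
    using val_below[of "\<gamma> ?w - ?w"] ramification_below(2) by simp
  qed
  also have "... = int ?h * (\<Sum>\<gamma>\<in>\<Gamma> - {restrict id k}. small.val ?P (\<gamma> ?w - ?w))" by (simp add: sum_distrib_left)
  finally have "int (card \<Gamma>) * (\<Sum>s\<in>big.inert B - H. i s) =
   int ?h * (int (card \<Gamma>) * (\<Sum>\<gamma>\<in>\<Gamma> - {restrict id k}. small.val ?P (\<gamma> ?w - ?w)))" by simp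
  also have "... = int ?h * (2 * small.val ?P (small.dm w))"
   using small.ramified_dm[OF Prime_below tot w] by simp
  also have "... = 2 * big.val B (small.dm w)"
   using val_below[OF dk dm(2)] ramification_below(2) by simp
  finally show ?thesis by (simp add: i_def)
 qed
qed

end

end

section \<open>Galois groups and rings of integers as algebraic structures\<close>

abbreviation \<CC> :: "complex ring" where "\<CC> \<equiv> class_ring"

lemma ring_C: "ring \<CC>" and cring_C: "cring \<CC>"
 using class_field[where 'a = complex] by (simp_all add: field.is_ring domain.axioms(1) field.axioms(1))

lemma subfield_iff_csubfield: "subfield L \<CC> \<longleftrightarrow> csubfield L"
proof
 have inv: "m_inv \<CC> x = inverse x" if "x ~= 0" for x
  using monoid.inv_unique'[OF ring.is_monoid[OF ring_C], of x "inverse x"] that by simp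
 have min: "a_inv \<CC> x = - x" for x
  using abelian_group.minus_equality[OF ring.is_abelian_group[OF ring_C], of "- x" x] by simp
 {
  assume L: "subfield L \<CC>"
  note r = subringE[OF subfieldE(1)[OF L]]
  have "x - y : L" if "x : L" "y : L" for x y using r(7)[OF that(1) r(5)[OF that(2)]] by (simp add: min)
  moreover have "inverse x : L" if "x : L" for x
   using ring.subfield_m_inv(1)[OF ring_C L, of x] that r(2) by (cases "x = 0") (auto simp: inv)
  ultimately show "csubfield L" using r(2,3,6,7) by (auto simp: csubfield_def csubring_def)
 next
  assume L: "csubfield L"
  have "subring L \<CC>"
   using L by (intro ring.subringI[OF ring_C])
    (auto simp: min csubfield_def csubring_def csubring_uminus)
  thus "subfield L \<CC>"
   using L by (intro field.subfieldI'[OF class_field]) (auto simp: inv csubfield_def)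
 }
qed

lemma ring_hom_iff:
 "\<sigma> : Ring.ring_hom (field_ring L) (\<CC>\<lparr>carrier := M\<rparr>) \<longleftrightarrow> (ALL x:L. \<sigma> x : M) & hom_on L \<sigma>"
 by (auto simp: Ring.ring_hom_def hom_on_def)

lemma gal_carrier:
 "carrier (gal_group L M) = {\<sigma> : extensional L. bij_betw \<sigma> L L & hom_on L \<sigma> & (ALL x:M. \<sigma> x = x)}"
 unfolding gal_group_def using ring_hom_iff[of _ L L] by (auto simp: Bij_def bij_betw_def)

lemma gal_mult:
 "\<sigma> : carrier (gal_group L M) ==> \<tau> : carrier (gal_group L M) ==>
  \<sigma> \<otimes>\<^bsub>gal_group L M\<^esub> \<tau> = compose L \<sigma> \<tau>"
 by (simp add: gal_group_def BijGroup_def)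

lemma gal_one: "\<one>\<^bsub>gal_group L M\<^esub> = restrict id L"
 by (auto simp: gal_group_def BijGroup_def)

lemma aut_group_gal:
 assumes L: "csubfield L" and M: "M <= L" and fin: "finite (carrier (gal_group L M))"
 shows "aut_group L (carrier (gal_group L M))"
proof
 fix \<sigma> assume \<sigma>: "\<sigma> : carrier (gal_group L M)"
 hence b: "bij_betw \<sigma> L L" and h: "hom_on L \<sigma>" and f: "ALL x:M. \<sigma> x = x" by (auto simp: gal_carrier)
 show "hom_on L \<sigma>" by fact
 show "\<sigma> : extensional L" using \<sigma> by (simp add: gal_carrier)
 show "\<sigma> x : L" if "x : L" for x using b that by (auto simp: bij_betw_def)
 define \<tau> where "\<tau> = restrict (inv_into L \<sigma>) L"
 have t: "\<tau> (\<sigma> x) = x" "\<sigma> (\<tau> x) = x" "\<tau> x : L" "\<sigma> x : L" if "x : L" for x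
  using that bij_betw_inv_into_left[OF b that] bij_betw_inv_into_right[OF b that] b bij_betw_inv_into[OF b]
  by (auto simp: \<tau>_def bij_betw_def)
 have L1: "1 : L" using csubringD(2)[OF csubfieldD(1)[OF L]] .
 have "hom_on L \<tau>"
  unfolding hom_on_def
 proof (intro conjI ballI)
  show "\<tau> 1 = 1" using t(1)[OF L1] h by (simp add: hom_on_def)
  fix x y assume x: "x : L" and y: "y : L"
  have "x + y = \<sigma> (\<tau> x + \<tau> y)" "x * y = \<sigma> (\<tau> x * \<tau> y)" using h x y t by (simp_all add: hom_on_def)
  moreover have "\<tau> x + \<tau> y : L" "\<tau> x * \<tau> y : L"
   using csubringD(3,5)[OF csubfieldD(1)[OF L]] t(3) x y by simp_all
  ultimately show "\<tau> (x + y) = \<tau> x + \<tau> y" "\<tau> (x * y) = \<tau> x * \<tau> y" using t(1) by metis+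
 qed
 moreover have "bij_betw \<tau> L L" unfolding \<tau>_def bij_betw_restrict_eq by (rule bij_betw_inv_into[OF b])
 moreover have "\<tau> x = x" if "x : M" for x using t(1)[of x] f that M by auto
 moreover have "\<tau> : extensional L" by (simp add: \<tau>_def)
 ultimately have "\<tau> : carrier (gal_group L M)" unfolding gal_carrier by blast
 thus "EX \<tau>:carrier (gal_group L M). ALL x:L. \<tau> (\<sigma> x) = x & \<sigma> (\<tau> x) = x"
  by (rule bexI[rotated]) (simp add: t(1,2))
 show "compose L \<sigma> \<tau> : carrier (gal_group L M)" if \<tau>: "\<tau> : carrier (gal_group L M)" for \<tau>
 proof -
  have t: "bij_betw \<tau> L L" "hom_on L \<tau>" "!!x. x : M ==> \<tau> x = x" using \<tau> by (simp_all add: gal_carrier)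
  have tL: "\<tau> x : L" if "x : L" for x using t(1) that by (auto simp: bij_betw_def)
  have "bij_betw (compose L \<sigma> \<tau>) L L" by (rule bij_betw_compose[OF t(1) b])
  moreover have "hom_on L (compose L \<sigma> \<tau>)"
   unfolding hom_on_def using csubringD(3,5)[OF csubfieldD(1)[OF L]] L1 h t(2) tL by (simp add: hom_on_def compose_def)
  moreover have "compose L \<sigma> \<tau> x = x" if "x : M" for x using that M t(3) f by (auto simp: compose_def)
  ultimately show ?thesis by (simp add: gal_carrier)
 qed
next
 have "bij_betw (restrict id L) L L" by simp
 thus "restrict id L : carrier (gal_group L M)"
  using M csubringD(2,3,5)[OF csubfieldD(1)[OF L]] by (auto simp: gal_carrier hom_on_def)
qed (use L fin in simp_all)

lemma group_gal:
 assumes L: "csubfield L" "M <= L" "finite (carrier (gal_group L M))"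
 shows "group (gal_group L M)"
proof -
 interpret aut_group L "carrier (gal_group L M)" by (rule aut_group_gal[OF L])
 show ?thesis
 proof (rule groupI)
  show "EX \<tau>:carrier (gal_group L M). \<tau> \<otimes>\<^bsub>gal_group L M\<^esub> \<sigma> = \<one>\<^bsub>gal_group L M\<^esub>" if \<sigma>: "\<sigma> : carrier (gal_group L M)" for \<sigma>
  proof -
   obtain \<tau> where t: "\<tau> : carrier (gal_group L M)" "ALL x:L. \<tau> (\<sigma> x) = x & \<sigma> (\<tau> x) = x" using inv_ex[OF \<sigma>] by blast
   have "compose L \<tau> \<sigma> = restrict id L" using t(2) by (auto simp: compose_def)
   thus ?thesis using t(1) \<sigma> by (intro bexI[of _ \<tau>]) (simp_all add: gal_mult gal_one)
  qed
  show "\<sigma> \<otimes>\<^bsub>gal_group L M\<^esub> \<tau> \<otimes>\<^bsub>gal_group L M\<^esub> \<rho> = \<sigma> \<otimes>\<^bsub>gal_group L M\<^esub> (\<tau> \<otimes>\<^bsub>gal_group L M\<^esub> \<rho>)"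
   if "\<sigma> : carrier (gal_group L M)" "\<tau> : carrier (gal_group L M)" "\<rho> : carrier (gal_group L M)" for \<sigma> \<tau> \<rho>
   using that into[OF that(3)] by (simp add: gal_mult comp_mem) (auto simp: compose_def)
  show "\<one>\<^bsub>gal_group L M\<^esub> \<otimes>\<^bsub>gal_group L M\<^esub> \<sigma> = \<sigma>" if \<sigma>: "\<sigma> : carrier (gal_group L M)" for \<sigma>
   using \<sigma> id_mem by (simp only: gal_one gal_mult) (rule ext_eqI[OF comp_mem], auto simp: comp_apply into)
 qed (simp_all add: gal_mult gal_one comp_mem id_mem)
qed

subsection \<open>Finite extensions\<close>

lemma combine_conv_sum:
 "ring.combine \<CC> Ks Us = (\<Sum>j<length Us. (if j < length Ks then Ks ! j else 0) * Us ! j)"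
proof (induction Us arbitrary: Ks)
 case Nil
 thus ?case by (cases Ks) (simp_all add: ring.combine.simps[OF ring_C])
next
 case (Cons u Us)
 thus ?case
  by (cases Ks) (auto simp: ring.combine.simps[OF ring_C] sum.lessThan_Suc_shift simp del: sum.lessThan_Suc intro!: sum.cong)
qed

lemma Span_conv_sum:
 assumes K: "csubfield K"
 shows "ring.Span \<CC> K Us = {\<Sum>j<length Us. c j * Us ! j |c. ALL j<length Us. c j : K}"
proof -
 have "ring.Span \<CC> K Us = {ring.combine \<CC> Ks Us |Ks. set Ks <= K}"
  using K by (intro ring.Span_eq_combine_set[OF ring_C]) (simp_all add: subfield_iff_csubfield)
 also have "... = {\<Sum>j<length Us. c j * Us ! j |c. ALL j<length Us. c j : K}"
 proof (intro equalityI subsetI; elim CollectE exE conjE)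
  fix x Ks assume "x = ring.combine \<CC> Ks Us" "set Ks <= K"
  thus "x : {\<Sum>j<length Us. c j * Us ! j |c. ALL j<length Us. c j : K}"
   using csubringD(1)[OF csubfieldD(1)[OF K]] by (intro CollectI exI[of _ "%j. if j < length Ks then Ks ! j else 0"])
    (auto simp: combine_conv_sum)
 next
  fix x c assume x: "x = (\<Sum>j<length Us. c j * Us ! j)" "ALL j<length Us. c j : K"
  have "x = ring.combine \<CC> (map c [0..<length Us]) Us" by (simp add: combine_conv_sum x(1))
  thus "x : {ring.combine \<CC> Ks Us |Ks. set Ks <= K}"
   using x(2) by (intro CollectI exI[of _ "map c [0..<length Us]"]) auto
 qed
 finally show ?thesis .
qed

lemma finite_field_extD:
 assumes "finite_field_ext L M"
 shows "csubfield L" "csubfield M" "M <= L"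
  "EX Us. set Us <= L & L = {\<Sum>j<length Us. c j * Us ! j |c. ALL j<length Us. c j : M}"
proof -
 have M: "subfield M \<CC>" using assms by (simp add: finite_field_ext_def)
 show "csubfield L" "csubfield M" "M <= L" using assms by (simp_all add: finite_field_ext_def subfield_iff_csubfield)
 obtain m where m: "ring.dimension \<CC> m M L"
  using assms ring.finite_dimension_def[OF ring_C] by (auto simp: finite_field_ext_def)
 from ring.exists_base[OF ring_C M m] obtain Us where Us: "ring.Span \<CC> M Us = L" by blast
 have M0: "0 : M" "1 : M" using csubringD(1,2)[OF csubfieldD(1)[OF \<open>csubfield M\<close>]] .
 have L: "L = {\<Sum>j<length Us. c j * Us ! j |c. ALL j<length Us. c j : M}" using Span_conv_sum[OF \<open>csubfield M\<close>] Us by simp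
 have "Us ! i : L" if "i < length Us" for i
 proof -
  have "Us ! i = (\<Sum>j<length Us. (if j = i then 1 else 0) * Us ! j)"
   using that by (simp add: if_distrib[of "%x. x * _"] sum.delta' cong: if_cong)
  thus ?thesis using M0 by (subst L) (intro CollectI exI[of _ "%j. if j = i then 1 else 0"], auto)
 qed
 hence "set Us <= L" by (auto simp: in_set_conv_nth)
 thus "EX Us. set Us <= L & L = {\<Sum>j<length Us. c j * Us ! j |c. ALL j<length Us. c j : M}" using L by blast
qed

lemma algebraic_if_finite_field_ext:
 assumes LM: "finite_field_ext L M" and x: "x : L"
 shows "EX f. f ~= 0 & (ALL i. poly.coeff f i : M) & poly f x = 0"
proof -
 note D = finite_field_extD[OF LM]
 obtain Us where Us: "set Us <= L" "L = {\<Sum>j<length Us. c j * Us ! j |c. ALL j<length Us. c j : M}" using D(4) by blast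
 let ?m = "length Us"
 have "ALL i. EX c. x ^ i = (\<Sum>j<?m. c j * Us ! j) & (ALL j<?m. c j : M)"
 proof
  fix i
  have "x ^ i : L" by (rule csubring_power[OF csubfieldD(1)[OF D(1)] x])
  thus "EX c. x ^ i = (\<Sum>j<?m. c j * Us ! j) & (ALL j<?m. c j : M)" using Us(2) by blast
 qed
 then obtain a where a: "ALL i. x ^ i = (\<Sum>j<?m. a i j * Us ! j) & (ALL j<?m. a i j : M)" by (rule choice[THEN exE])
 have "EX c. (ALL i:{..?m}. c i : M) & (EX i:{..?m}. c i ~= 0) & (ALL j<?m. (\<Sum>i\<in>{..?m}. c i * a i j) = 0)"
  using a by (intro homogeneous_system_nonzero_solution[OF D(2)]) auto
 then obtain c where c: "ALL i:{..?m}. c i : M" "EX i:{..?m}. c i ~= 0" "ALL j<?m. (\<Sum>i\<in>{..?m}. c i * a i j) = 0" by blast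
 define f where "f = (\<Sum>i\<le>?m. Polynomial.monom (c i) i)"
 have cf: "poly.coeff f i = (if i <= ?m then c i else 0)" for i
  by (simp add: f_def coeff_sum if_distrib cong: if_cong)
 have "poly f x = (\<Sum>i\<le>?m. c i * (\<Sum>j<?m. a i j * Us ! j))" using a by (simp add: f_def poly_sum poly_monom)
 also have "... = (\<Sum>j<?m. \<Sum>i\<le>?m. c i * (a i j * Us ! j))" unfolding sum_distrib_left by (rule sum.swap)
 also have "... = (\<Sum>j<?m. (\<Sum>i\<le>?m. c i * a i j) * Us ! j)" by (simp add: sum_distrib_right mult.assoc)
 also have "... = 0" using c(3) by simp
 finally have "poly f x = 0" .
 moreover have "f ~= 0" using c(2) cf by (metis atMost_iff coeff_0)
 moreover have "poly.coeff f i : M" for i using cf c(1) csubringD(1)[OF csubfieldD(1)[OF D(2)]] by simp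
 ultimately show ?thesis by blast
qed

lemma finite_gal:
 assumes LM: "finite_field_ext L M"
 shows "finite (carrier (gal_group L M))"
proof -
 note D = finite_field_extD[OF LM]
 obtain Us where Us: "set Us <= L" "L = {\<Sum>j<length Us. c j * Us ! j |c. ALL j<length Us. c j : M}" using D(4) by blast
 have "ALL x:L. EX f. f ~= 0 & (ALL i. poly.coeff f i : M) & poly f x = 0" using algebraic_if_finite_field_ext[OF LM] by blast
 then obtain f where f: "ALL x:L. f x ~= 0 & (ALL i. poly.coeff (f x) i : M) & poly (f x) x = 0" by (rule bchoice[THEN exE])
 define R where "R = (\<Union>x\<in>set Us. {y. poly (f x) y = 0})"
 have "finite R" unfolding R_def using f Us(1) by (intro finite_UN_I poly_roots_finite) auto
 have "(%\<sigma>. map \<sigma> Us) ` carrier (gal_group L M) <= {xs. set xs <= R & length xs = length Us}"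
 proof clarsimp
  fix \<sigma> x assume \<sigma>: "\<sigma> : carrier (gal_group L M)" and x: "x : set Us"
  have h: "hom_on L \<sigma>" and fx: "ALL x:M. \<sigma> x = x" using \<sigma> by (auto simp: gal_carrier)
  have xL: "x : L" using x Us(1) by blast
  have "\<sigma> (poly (f x) x) = poly (f x) (\<sigma> x)"
   using hom_on_poly_eval[OF D(1) h, of "f x" x] f xL D(3) fx by (auto simp: poly_altdef)
  hence "poly (f x) (\<sigma> x) = 0" using f xL hom_on_zero[OF D(1) h] by simp
  thus "\<sigma> x : R" using x by (auto simp: R_def)
 qed
 hence "finite ((%\<sigma>. map \<sigma> Us) ` carrier (gal_group L M))"
  using finite_lists_length_eq[OF \<open>finite R\<close>] by (rule finite_subset)
 moreover have "inj_on (%\<sigma>. map \<sigma> Us) (carrier (gal_group L M))"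
 proof (rule inj_onI)
  fix \<sigma> \<tau> assume \<sigma>: "\<sigma> : carrier (gal_group L M)" and \<tau>: "\<tau> : carrier (gal_group L M)" and eq: "map \<sigma> Us = map \<tau> Us"
  have e: "\<sigma> u = \<tau> u" if "u : set Us" for u using eq that by (simp add: map_eq_conv)
  show "\<sigma> = \<tau>"
  proof (rule extensionalityI[of _ L])
   fix x assume "x : L"
   then obtain c where c: "x = (\<Sum>j<length Us. c j * Us ! j)" "ALL j<length Us. c j : M" using Us(2) by blast
   have "\<rho> x = (\<Sum>j<length Us. c j * \<rho> (Us ! j))" if "\<rho> : carrier (gal_group L M)" for \<rho>
   proof -
    have h: "hom_on L \<rho>" and fx: "ALL x:M. \<rho> x = x" using that by (auto simp: gal_carrier)
    have m: "c j : L" "Us ! j : L" if "j < length Us" for j using c(2) D(3) Us(1) that by auto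
    have "\<rho> x = (\<Sum>j<length Us. \<rho> (c j * Us ! j))"
     unfolding c(1) using m csubringD(5)[OF csubfieldD(1)[OF D(1)]] by (intro hom_on_sum[OF D(1) h]) simp
    also have "... = (\<Sum>j<length Us. c j * \<rho> (Us ! j))"
     using m fx c(2) by (intro sum.cong refl) (simp add: hom_on_mult[OF D(1) h])
    finally show ?thesis .
   qed
   from this[OF \<sigma>] this[OF \<tau>] show "\<sigma> x = \<tau> x" using e by simp
  qed (use \<sigma> \<tau> in \<open>auto simp: gal_carrier\<close>)
 qed
 ultimately show ?thesis by (rule finite_imageD)
qed

lemma aut_group_galois_ext:
 assumes "galois_ext L M"
 shows "aut_group L (carrier (gal_group L M))" "aut_group.Fix L (carrier (gal_group L M)) = M"
proof -
 have LM: "finite_field_ext L M" using assms by (simp add: galois_ext_def)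
 note D = finite_field_extD[OF LM]
 show A: "aut_group L (carrier (gal_group L M))" by (rule aut_group_gal[OF D(1,3) finite_gal[OF LM]])
 show "aut_group.Fix L (carrier (gal_group L M)) = M"
  using assms unfolding aut_group.Fix_def[OF A] by (simp add: galois_ext_def)
qed

lemma galois_field_if_galois_ext:
 assumes "galois_ext L \<rat>"
 shows "galois_field L (carrier (gal_group L \<rat>))"
proof -
 note A = aut_group_galois_ext[OF assms]
 show ?thesis
  unfolding galois_field_def galois_field_axioms_def
  using A hom_on_Rats[OF aut_group.L[OF A(1)]] by (auto simp: gal_carrier)
qed

context galois_field
begin

lemma card_eq_field_degree:
 assumes k: "subfield L \<CC>"
 shows "field_degree L \<rat> = n"
proof -
 have Q: "subfield \<rat> \<CC>" by (simp add: subfield_iff_csubfield csubfield_Rats_self)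
 obtain w where w: "is_int_basis w" using int_basis_exists by blast
 hence wI: "!!j. j < n ==> w j : \<O>" "dm w ~= 0" by (auto simp: is_int_basis_def)
 have wL: "!!j. j < n ==> w j : L" using wI(1) Int_L by blast
 let ?Us = "map w [0..<n]"
 have "ring.independent \<CC> \<rat> ?Us"
 proof (rule ring.trivial_combine_imp_independent[OF ring_C Q])
  fix Ks assume Ks: "set Ks <= \<rat>" "ring.combine \<CC> Ks ?Us = \<zero>\<^bsub>\<CC>\<^esub>"
  define c where "c j = (if j < length Ks then Ks ! j else 0)" for j
  have c: "c j : \<rat>" for j using Ks(1) by (auto simp: c_def)
  have s: "(\<Sum>j<n. c j * w j) = 0" using Ks(2) by (simp add: combine_conv_sum c_def)
  have "c j = 0" if "j < n" for j
  proof (rule nonsingular_system_unique[OF _ _ that])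
   show "Determinant.det (mat n n (%(i, j). enum i (w j))) ~= 0" using wI(2) by (simp add: dm_def)
   fix i assume "i < n"
   note e = enum_mem[OF this]
   have "enum i (\<Sum>j<n. c j * w j) = (\<Sum>j<n. enum i (c j * w j))"
    using c wL by (intro hom_on_sum[OF L hom[OF e]] Lcl(5)[OF Rats_L]) auto
   also have "... = (\<Sum>j<n. enum i (w j) * c j)"
    using c wL Rats_L by (intro sum.cong refl) (simp add: hom_simps(4,12)[OF e])
   finally show "(\<Sum>j<n. enum i (w j) * c j) = 0" by (simp add: s hom_simps(2)[OF e])
  qed
  thus "set (take (length ?Us) Ks) <= {\<zero>\<^bsub>\<CC>\<^esub>}"
   by (auto simp: in_set_conv_nth c_def split: if_splits) (metis)
 qed simp
 moreover have "ring.Span \<CC> \<rat> ?Us = L"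
 proof -
  have "(\<Sum>j<n. c j * w j) : L" if "ALL j<n. c j : \<rat>" for c
   using that wL by (intro Lcl(8) Lcl(5)[OF Rats_L]) auto
  moreover have "EX c. (ALL j<n. c j : \<rat>) & x = (\<Sum>j<n. c j * w j)" if x: "x : L" for x
   using coordinates_in_Fix[OF enum _ wL x] wI(2) Fix_Rats by (simp add: dm_def)
  ultimately show ?thesis by (subst Span_conv_sum[OF csubfield_Rats_self]) auto
 qed
 ultimately have "ring.dimension \<CC> n \<rat> L" using ring.dimension_independent[OF ring_C, of \<rat> ?Us] by simp
 thus ?thesis using ring.dimI[OF ring_C Q] by (simp add: field_degree_def over_def)
qed

end

subsection \<open>Ideals of the ring of integers\<close>

lemma roi_simps [simp]:
 "carrier (ring_of_integers L) = {x : L. algebraic_int x}" "x \<otimes>\<^bsub>ring_of_integers L\<^esub> y = x * y"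
 "x \<oplus>\<^bsub>ring_of_integers L\<^esub> y = x + y" "\<one>\<^bsub>ring_of_integers L\<^esub> = 1" "\<zero>\<^bsub>ring_of_integers L\<^esub> = 0"
 by (simp_all add: ring_of_integers_def)

lemma cring_roi:
 assumes L: "csubfield L"
 shows "cring (ring_of_integers L)"
proof -
 have min: "a_inv \<CC> x = - x" for x
  using abelian_group.minus_equality[OF ring.is_abelian_group[OF ring_C], of "- x" x] by simp
 have "subring {x : L. algebraic_int x} \<CC>"
  using csubringD[OF csubfieldD(1)[OF L]] csubring_uminus[OF csubfieldD(1)[OF L]]
   csubringD[OF csubring_algebraic_int] csubring_uminus[OF csubring_algebraic_int]
  by (intro ring.subringI[OF ring_C]) (simp_all add: min)
 hence "subcring {x : L. algebraic_int x} \<CC>" by (rule cring.subcringI'[OF cring_C])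
 thus ?thesis
  unfolding ring_of_integers_def by (subst (asm) ring.subcring_iff[OF ring_C]) simp_all
qed

lemma ideal_roi_iff:
 assumes L: "csubfield L"
 shows "ideal I (ring_of_integers L) \<longleftrightarrow> I <= {x : L. algebraic_int x} & 0 : I &
  (ALL x:I. ALL y:I. x + y : I) & (ALL x:I. ALL y:{x : L. algebraic_int x}. x * y : I)"
proof
 let ?R = "ring_of_integers L"
 assume I: "ideal I ?R"
 note s = additive_subgroup.a_subset[OF ideal.axioms(1)[OF I]] additive_subgroup.zero_closed[OF ideal.axioms(1)[OF I]]
  additive_subgroup.a_closed[OF ideal.axioms(1)[OF I]] ideal.I_r_closed[OF I]
 show "I <= {x : L. algebraic_int x} & 0 : I &
  (ALL x:I. ALL y:I. x + y : I) & (ALL x:I. ALL y:{x : L. algebraic_int x}. x * y : I)"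
  using s by simp
next
 let ?R = "ring_of_integers L"
 assume *: "I <= {x : L. algebraic_int x} & 0 : I &
  (ALL x:I. ALL y:I. x + y : I) & (ALL x:I. ALL y:{x : L. algebraic_int x}. x * y : I)"
 interpret R: cring ?R by (rule cring_roi[OF L])
 have m1: "- 1 : {x : L. algebraic_int x}"
  using csubring_uminus[OF csubfieldD(1)[OF L] csubringD(2)[OF csubfieldD(1)[OF L]]]
   csubring_uminus[OF csubring_algebraic_int csubringD(2)[OF csubring_algebraic_int]] by simp
 have um: "- x : I" if "x : I" for x
 proof -
  have "x * - 1 : I" using * that m1 by blast
  thus ?thesis by simp
 qed
 have neg: "\<ominus>\<^bsub>?R\<^esub> x = - x" if "x : I" for x
  using R.minus_equality[of "- x" x] that um[OF that] * by auto
 show "ideal I ?R"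
 proof (rule idealI[OF R.ring_axioms])
  show "subgroup I (add_monoid ?R)"
   using * um neg by (intro R.add.subgroupI) (auto simp: a_inv_def[symmetric])
  show "x \<otimes>\<^bsub>?R\<^esub> a : I" "a \<otimes>\<^bsub>?R\<^esub> x : I" if "a : I" "x : carrier ?R" for a x
   using * that by (auto simp: mult.commute[of x])
 qed
qed

context galois_field
begin

lemma roi_carrier: "{x : L. algebraic_int x} = \<O>" by (simp add: \<O>_def)

lemma ideal_iff_Ideal: "ideal I (ring_of_integers L) \<longleftrightarrow> Ideal I"
 unfolding ideal_roi_iff[OF L] roi_carrier Ideal_def ..

lemma primes_of_eq: "primes_of L = {P. Prime P}"
proof -
 have "\<O> = P \<longleftrightarrow> 1 : P" if "Ideal P" for P
  using IdealD(1,5)[OF that] Int_cl(2) by (metis (no_types) IdealD(4)[OF that] mult_1 subsetI subset_antisym)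
 thus ?thesis
  unfolding primes_of_def primeideal_def primeideal_axioms_def Prime_def
  using cring_roi[OF L] by (auto simp: ideal_iff_Ideal roi_carrier)
qed

lemma ideal_norm_eq: "ideal_norm L I = inorm I"
proof -
 have "a_rcosets\<^bsub>ring_of_integers L\<^esub> I = coset I ` \<O>"
  by (auto simp: A_RCOSETS_def RCOSETS_def r_coset_def coset_def roi_carrier image_def)
 thus ?thesis by (simp add: ideal_norm_def Coset.order_def FactRing_def inorm_def)
qed

interpretation R: cring "ring_of_integers L" by (rule cring_roi[OF L])

interpretation M: comm_monoid "ideals_set (ring_of_integers L)"
 by (rule R.ideals_set_is_comm_monoid)

lemma ideals_set_carrier: "carrier (ideals_set (ring_of_integers L)) = {I. Ideal I}"
 by (simp add: ideals_set_def ideal_iff_Ideal)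

abbreviation iprod :: "complex set => complex set => complex set" where
 "iprod I J \<equiv> ideal_prod (ring_of_integers L) I J"

lemma ideals_set_mult: "I \<otimes>\<^bsub>ideals_set (ring_of_integers L)\<^esub> J = iprod I J"
 and ideals_set_one: "\<one>\<^bsub>ideals_set (ring_of_integers L)\<^esub> = \<O>"
 by (simp_all add: ideals_set_def roi_carrier)

lemma iprod_Ideal: "Ideal I ==> Ideal J ==> Ideal (iprod I J)"
 using R.ideal_prod_is_ideal by (simp add: ideal_iff_Ideal)

lemma iprodI: "x : I ==> y : J ==> x * y : iprod I J"
 using ideal_prod.prod[of x I y J "ring_of_integers L"] by simp

lemma iprod_subset:
 assumes "additive M" and "!!x y. x : I ==> y : J ==> x * y : M"
 shows "iprod I J <= M"
proof
 fix z assume "z : iprod I J"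
 thus "z : M" by induction (use assms additiveD(4) in auto)
qed

lemma V_inter_Ideal: "Prime B ==> Ideal {x : \<O>. x : V B N}"
 using V_Ideal[of "{B}" "%_. N"] by simp

lemma ideal_power_V:
 assumes B: "Prime B"
 shows "ideal_power L B j = {x : \<O>. x : V B (int j)}"
proof (induction j)
 case 0
 thus ?case using Int_V0[OF B] by (auto simp: ideal_power_def ideals_set_one)
next
 case (Suc j)
 let ?I = "{x : \<O>. x : V B (int j)}" and ?J = "{x : \<O>. x : V B (int (Suc j))}"
 have I: "Ideal ?I" and J: "Ideal ?J" by (rule V_inter_Ideal[OF B])+
 have step: "ideal_power L B (Suc j) = iprod ?I B"
  using Suc by (simp add: ideal_power_def ideals_set_mult)
 have "x * y : ?J" if "x : ?I" "y : B" for x y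
 proof -
  have y: "y : \<O>" by (rule IdealD(1)[OF PrimeD(1)[OF B] that(2)])
  hence "x * y : V B (int j + 1)" using that mem_B_iff[OF B y] by (intro V_mult[OF B]) auto
  thus ?thesis using that(1) Int_cl(5)[OF _ y] by (simp add: add.commute)
 qed
 hence le: "iprod ?I B <= ?J" by (rule iprod_subset[OF Ideal_additive[OF J]])
 have "x : iprod ?I B" if x: "x : ?J" for x
 proof -
  define a where "a = unif B ^ j"
  have a: "a : \<O>" "a ~= 0" "val B a = int j"
   using Int_cl(7)[OF unif_Int[OF B]] unif_nonzero[OF B] val_power[OF B unif_L[OF B] unif_nonzero[OF B]] val_unif[OF B]
   by (simp_all add: a_def)
  have aI: "a : ?I" using a Int_L[OF a(1)] by (simp add: V_def)
  have add: "additive (iprod ?I B)" by (rule Ideal_additive[OF iprod_Ideal[OF I PrimeD(1)[OF B]]])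
  have xI: "x : ?I" using x V_antimono[OF B, of x "int (Suc j)" "int j"] by simp
  have "y : V B (val B a)" if "y : ?I" for y using that a(3) by simp
  from generator_mod_step[OF I B aI a(2) this add iprodI xI]
  obtain c where c: "c : \<O>" "x - c * a : iprod ?I B" by blast
  have "x - (x - c * a) : ?J" by (rule IdealD(6)[OF J x]) (use c(2) le in blast)
  hence ca: "c * a : V B (int (Suc j))" by simp
  have "c : B"
  proof (cases "c = 0")
   case False
   hence "val B c >= 1" using ca val_mult[OF B Int_L[OF c(1)] False Int_L[OF a(1)] a(2)] a by (simp add: V_def)
   thus ?thesis using mem_B_iff[OF B c(1)] Int_L[OF c(1)] by (simp add: V_def)
  qed (use IdealD(2)[OF PrimeD(1)[OF B]] in simp)
  hence "a * c : iprod ?I B" by (rule iprodI[OF aI])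
  thus ?thesis using additiveD(4)[OF add c(2), of "a * c"] by (simp add: mult.commute)
 qed
 thus ?case using step le by blast
qed

lemma inorm_iprod:
 assumes I: "Ideal I" "I ~= {0}" "finite (coset I ` \<O>)" and P: "Prime P"
 shows "Ideal (iprod I P)" "iprod I P ~= {0}" "finite (coset (iprod I P) ` \<O>)"
  "inorm (iprod I P) = inorm I * inorm P"
proof -
 show M: "Ideal (iprod I P)" by (rule iprod_Ideal[OF I(1) PrimeD(1)[OF P]])
 have pos: "val P x >= 0" if "x : I" "x ~= 0" for x
  using Int_V0[OF P IdealD(1)[OF I(1) that(1)]] that(2) by (simp add: V_def)
 obtain b where "b : I" "b ~= 0" using I(2) IdealD(2)[OF I(1)] by blast
 then obtain a where a: "a : I" "a ~= 0" "!!x. x : I ==> x ~= 0 ==> nat (val P a) <= nat (val P x)"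
  using ex_has_least_nat[of "%x. x : I & x ~= 0" b "%x. nat (val P x)"] by blast
 have IV: "x : V P (val P a)" if "x : I" for x
  using a(3)[OF that] pos[OF that] pos[OF a(1,2)] Int_L[OF IdealD(1)[OF I(1) that]] by (auto simp: V_def)
 note add = Ideal_additive[OF M]
 have MI: "iprod I P <= I"
  using IdealD(4)[OF I(1)] IdealD(1)[OF PrimeD(1)[OF P]] by (intro iprod_subset[OF Ideal_additive[OF I(1)]]) blast
 have MV: "iprod I P <= V P (val P a + 1)"
 proof (rule iprod_subset[OF V_additive[OF P]])
  fix x y assume "x : I" "y : P"
  hence "y : V P 1" using mem_B_iff[OF P IdealD(1)[OF PrimeD(1)[OF P]]] by blast
  thus "x * y : V P (val P a + 1)" by (rule V_mult[OF P IV[OF \<open>x : I\<close>]])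
 qed
 have "a * unif P : iprod I P" by (rule iprodI[OF a(1) unif(1)[OF P]])
 moreover have "a * unif P ~= 0" using a(2) unif_nonzero[OF P] by simp
 ultimately show "iprod I P ~= {0}" by blast
 have MV': "x : V P (val P a + 1)" if "x : iprod I P" for x using MV that by (rule subsetD)
 show "finite (coset (iprod I P) ` \<O>)"
  by (rule inorm_step(1)[OF I(1) P a(1,2) IV add iprodI MI MV' I(3)])
 show "inorm (iprod I P) = inorm I * inorm P"
  by (rule inorm_step(2)[OF I(1) P a(1,2) IV add iprodI MI MV' I(3)])
qed

lemma inorm_prod_prime_powers:
 assumes S: "finite \<S>" "!!P. P : \<S> ==> Prime P"
 shows "inorm (\<Otimes>\<^bsub>ideals_set (ring_of_integers L)\<^esub>P\<in>\<S>. ideal_power L P (e P)) = (\<Prod>P\<in>\<S>. inorm P ^ e P)"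
proof -
 let ?good = "%I. Ideal I & I ~= {0} & finite (coset I ` \<O>)"
 have pow: "ideal_power L P j : carrier (ideals_set (ring_of_integers L))" if "Prime P" for P j
  unfolding ideal_power_V[OF that] ideals_set_carrier using V_inter_Ideal[OF that] by simp
 have step: "?good (iprod I (ideal_power L P j)) & inorm (iprod I (ideal_power L P j)) = inorm I * inorm P ^ j"
  if I: "?good I" and P: "Prime P" for I P j
 proof (induction j)
  case 0
  have "iprod I \<O> = I"
   using M.r_one[of I] I by (simp add: ideals_set_mult ideals_set_one ideals_set_carrier)
  thus ?case using I by (simp add: ideal_power_def ideals_set_one)
 next
  case (Suc j)
  have "ideal_power L P (Suc j) = iprod (ideal_power L P j) P" by (simp add: ideal_power_def ideals_set_mult)
  hence "iprod I (ideal_power L P (Suc j)) = iprod (iprod I (ideal_power L P j)) P"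
   using M.m_assoc[of I "ideal_power L P j" P] I PrimeD(1)[OF P] pow[OF P, of j] by (simp add: ideals_set_mult ideals_set_carrier)
  thus ?case using inorm_iprod[OF _ _ _ P] Suc by simp
 qed
 have "?good (\<Otimes>\<^bsub>ideals_set (ring_of_integers L)\<^esub>P\<in>\<S>. ideal_power L P (e P)) &
   inorm (\<Otimes>\<^bsub>ideals_set (ring_of_integers L)\<^esub>P\<in>\<S>. ideal_power L P (e P)) = (\<Prod>P\<in>\<S>. inorm P ^ e P)"
  using S
 proof (induction \<S> rule: finite_induct)
  case empty
  have "Ideal \<O>" using Int_cl(1,3,5) by (simp add: Ideal_def)
  moreover have "\<O> ~= {0}" using Int_cl(2) by auto
  ultimately show ?case by (simp add: ideals_set_one coset_whole inorm_def)
 next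
  case (insert P \<S>)
  let ?J = "\<Otimes>\<^bsub>ideals_set (ring_of_integers L)\<^esub>P\<in>\<S>. ideal_power L P (e P)"
  have P: "Prime P" by (rule insert.prems) simp
  have pr: "Prime Q" if "Q : \<S>" for Q by (rule insert.prems) (simp add: that)
  have "?good ?J & inorm ?J = (\<Prod>P\<in>\<S>. inorm P ^ e P)" by (rule insert.IH[OF pr])
  hence IH: "?good ?J" "inorm ?J = (\<Prod>P\<in>\<S>. inorm P ^ e P)" by blast+
  have "(\<Otimes>\<^bsub>ideals_set (ring_of_integers L)\<^esub>P\<in>insert P \<S>. ideal_power L P (e P)) =
    ideal_power L P (e P) \<otimes>\<^bsub>ideals_set (ring_of_integers L)\<^esub> ?J"
   by (rule M.finprod_insert[OF insert.hyps]) (use pow pr P in blast)+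
  also have "... = iprod ?J (ideal_power L P (e P))"
   unfolding ideals_set_mult[symmetric] using IH(1) by (intro M.m_comm pow[OF P]) (simp add: ideals_set_carrier)
  finally show ?case using step[OF IH(1) P, of "e P"] IH(2) insert.hyps by (simp add: mult.commute)
 qed
 thus ?thesis by blast
qed

lemma ln_ideal_norm_conductor:
 assumes c: "is_artin_conductor E L \<theta> I"
 shows "EX e. (ALL P. Prime P --> of_nat (e P) = conductor_exponent E L \<theta> P) & finite {P. Prime P & e P ~= 0} &
  ideal_norm L I > 0 & ln (real (ideal_norm L I)) = (\<Sum>P\<in>{P. Prime P & e P ~= 0}. real (e P) * ln (real (inorm P)))"
proof -
 have "{P : primes_of L. e P ~= 0} = {P. Prime P & e P ~= 0}" for e :: "complex set => nat" by (simp add: primes_of_eq)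
 from c[unfolded is_artin_conductor_def this] obtain e :: "complex set => nat"
  where e0: "ALL P:primes_of L. of_nat (e P) = conductor_exponent E L \<theta> P" and e2: "finite {P. Prime P & e P ~= 0}"
  and e3: "I = (\<Otimes>\<^bsub>ideals_set (ring_of_integers L)\<^esub>P\<in>{P. Prime P & e P ~= 0}. ideal_power L P (e P))"
  by (elim exE conjE)
 have e1: "ALL P. Prime P --> of_nat (e P) = conductor_exponent E L \<theta> P" using e0 by (simp add: primes_of_eq)
 note e = e1 e2 e3
 have N: "ideal_norm L I = (\<Prod>P\<in>{P. Prime P & e P ~= 0}. inorm P ^ e P)"
  unfolding ideal_norm_eq e(3) by (rule inorm_prod_prime_powers[OF e(2)]) blast
 have pos: "inorm P ^ e P > 0" if "P : {P. Prime P & e P ~= 0}" for P using inorm_gt_1[of P] that by simp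
 have "ln (real (ideal_norm L I)) = (\<Sum>P\<in>{P. Prime P & e P ~= 0}. ln (real (inorm P ^ e P)))"
  unfolding N of_nat_prod using pos e(2) by (intro ln_prod) (auto simp flip: of_nat_power)
 also have "... = (\<Sum>P\<in>{P. Prime P & e P ~= 0}. real (e P) * ln (real (inorm P)))"
  using inorm_gt_1 by (intro sum.cong refl) (auto simp: ln_realpow)
 finally have ln: "ln (real (ideal_norm L I)) = (\<Sum>P\<in>{P. Prime P & e P ~= 0}. real (e P) * ln (real (inorm P)))" .
 have "ideal_norm L I > 0" unfolding N using pos by (intro prod_pos) blast
 with e(1,2) ln show ?thesis by blast
qed

end

subsection \<open>The rational field\<close>

lemma galois_field_Rats: "galois_field \<rat> {restrict id \<rat>}"
proof -
 have comp: "compose \<rat> (restrict id \<rat>) (restrict id \<rat>) = (restrict id \<rat> :: complex => complex)" by (auto simp: compose_def)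
 have aut: "aut_group \<rat> {restrict id \<rat>}"
  using comp by unfold_locales (auto simp: csubfield_Rats_self hom_on_def)
 show ?thesis
  unfolding galois_field_def galois_field_axioms_def
 proof (intro conjI allI impI aut)
  fix \<sigma> assume "hom_on \<rat> \<sigma>" "\<sigma> : extensional \<rat>"
  hence "\<sigma> = restrict id \<rat>"
   using hom_on_Rats[OF csubfield_Rats_self] by (intro extensionalityI[of _ \<rat>]) auto
  thus "\<sigma> : {restrict id \<rat>}" by simp
 qed (simp add: aut_group.Fix_def[OF aut])
qed

abbreviation "QPrime p \<equiv> (of_int ` {m. int p dvd m} :: complex set)"

context galois_field
begin

lemma primes_above_Rats:
 assumes "p > 0"
 shows "primes_above L \<rat> (QPrime p) = primes_over p"
proof -
 have "QPrime r = QPrime p \<longleftrightarrow> r = p" if "r > 0" for r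
 proof
  assume eq: "QPrime r = QPrime p"
  have "{m. int r dvd m} = {m. int p dvd m}" by (rule inj_image_eq_iff[THEN iffD1, OF _ eq]) (simp add: inj_def)
  thus "r = p" by (metis dvd_refl dvd_antisym int_dvd_int_iff mem_Collect_eq)
 qed simp
 hence "B Int \<rat> = QPrime p \<longleftrightarrow> residue_char B = p" if "Prime B" for B
  using residue_char(1)[OF that] by (simp add: Prime_Rats[OF that])
 thus ?thesis unfolding primes_above_def primes_over_def primes_of_eq by blast
qed

end

lemma ln_rational_conductor:
 assumes c: "is_rational_artin_conductor E \<chi> f"
 shows "f > 0" "EX e. (ALL p. Factorial_Ring.prime p --> of_nat (e p) = conductor_exponent E \<rat> \<chi> (QPrime p)) &
  finite {p. Factorial_Ring.prime p & e p ~= 0} &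
  ln (real f) = (\<Sum>p\<in>{p. Factorial_Ring.prime p & e p ~= 0}. real (e p) * ln (real p))"
proof -
 interpret Q: galois_field \<rat> "{restrict id \<rat>}" by (rule galois_field_Rats)
 show f: "f > 0" using c by (simp add: is_rational_artin_conductor_def)
 have "PIdl\<^bsub>ring_of_integers \<rat>\<^esub> (of_nat f) = Q.mult_of f"
  by (auto simp: cgenideal_def Q.mult_of_def Q.roi_carrier mult.commute)
 hence "ideal_norm \<rat> (PIdl\<^bsub>ring_of_integers \<rat>\<^esub> (of_nat f)) = f"
  using Q.card_mod_mult_of(2)[OF f] by (simp add: Q.ideal_norm_eq Q.inorm_def)
 note norm = this
 have "is_artin_conductor E \<rat> \<chi> (PIdl\<^bsub>ring_of_integers \<rat>\<^esub> (of_nat f))"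
  using c by (simp only: is_rational_artin_conductor_def)
 from Q.ln_ideal_norm_conductor[OF this, unfolded norm]
 obtain e where e: "ALL P. Q.Prime P --> of_nat (e P) = conductor_exponent E \<rat> \<chi> P" "finite {P. Q.Prime P & e P ~= 0}"
  "ln (real f) = (\<Sum>P\<in>{P. Q.Prime P & e P ~= 0}. real (e P) * ln (real (Q.inorm P)))"
  by (elim exE conjE)
 have Z: "Q.\<O> = of_int ` UNIV" using rational_algebraic_int_is_int by (auto simp: Q.\<O>_def Ints_def)
 have P: "P = QPrime (Q.residue_char P)" if "Q.Prime P" for P
 proof -
  have "P <= \<rat>" using Q.IdealD(1)[OF Q.PrimeD(1)[OF that]] by (auto simp: Q.\<O>_def)
  thus ?thesis using Q.Prime_Rats[OF that] by (simp add: Int_absorb2)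
 qed
 have M: "Q.mult_of p = QPrime p" for p
 proof -
  have "{m. int p dvd m} = range ((*) (int p))" unfolding dvd_def by blast
  thus ?thesis unfolding Q.mult_of_def Z by (simp only: image_image of_int_mult of_int_of_nat_eq)
 qed
 have N: "Q.inorm (QPrime p) = p" if "p > 0" for p
  using Q.card_mod_mult_of(2)[OF that] unfolding M by (simp add: Q.inorm_def)
 have QP: "Q.Prime (QPrime p) & Q.residue_char (QPrime p) = p" if p: "Factorial_Ring.prime p" for p
 proof -
  obtain P where "Q.Prime P" "Q.residue_char P = p" using Q.primes_over_nonempty[OF p] by (auto simp: Q.primes_over_def)
  thus ?thesis using P[of P] by metis
 qed
 have bij: "bij_betw QPrime {p. Factorial_Ring.prime p & e (QPrime p) ~= 0} {P. Q.Prime P & e P ~= 0}"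
 proof (rule bij_betw_byWitness[of _ Q.residue_char])
  show "Q.residue_char ` {P. Q.Prime P & e P ~= 0} <= {p. Factorial_Ring.prime p & e (QPrime p) ~= 0}"
   using Q.residue_char_prime P by fastforce
 qed (use QP P in auto)
 have "ln (real f) = (\<Sum>p\<in>{p. Factorial_Ring.prime p & e (QPrime p) ~= 0}. real (e (QPrime p)) * ln (real (Q.inorm (QPrime p))))"
  unfolding e(3) by (rule sum.reindex_bij_betw[OF bij, symmetric])
 also have "... = (\<Sum>p\<in>{p. Factorial_Ring.prime p & e (QPrime p) ~= 0}. real (e (QPrime p)) * ln (real p))"
  by (intro sum.cong refl) (simp add: N prime_gt_0_nat)
 finally show "EX e. (ALL p. Factorial_Ring.prime p --> of_nat (e p) = conductor_exponent E \<rat> \<chi> (QPrime p)) &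
  finite {p. Factorial_Ring.prime p & e p ~= 0} &
  ln (real f) = (\<Sum>p\<in>{p. Factorial_Ring.prime p & e p ~= 0}. real (e p) * ln (real p))"
  using e(1) QP bij_betw_finite[OF bij] e(2) by (intro exI[of _ "%p. e (QPrime p)"]) auto
qed

section \<open>Characters\<close>

abbreviation mtrace :: "nat => complex mat => complex" where
 "mtrace n A \<equiv> \<Sum>i<n. A $$ (i, i)"

lemma mtrace_commute:
 assumes "A : carrier_mat n n" "B : carrier_mat n n"
 shows "mtrace n (A * B) = mtrace n (B * A)"
proof -
 have "mtrace n (A * B) = (\<Sum>i<n. \<Sum>j<n. A $$ (i, j) * B $$ (j, i))"
  using assms by (intro sum.cong refl) (auto simp: scalar_prod_def atLeast0LessThan)
 also have "... = (\<Sum>j<n. \<Sum>i<n. B $$ (j, i) * A $$ (i, j))" by (subst sum.swap) (simp add: mult.commute)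
 also have "... = mtrace n (B * A)"
  using assms by (intro sum.cong refl) (auto simp: scalar_prod_def atLeast0LessThan)
 finally show ?thesis .
qed

text \<open>The trace of a matrix of finite order is a sum of roots of unity.\<close>

lemma norm_mtrace_finite_order:
 assumes A: "A : carrier_mat n n" and m: "m > 0" "A ^\<^sub>m m = 1\<^sub>m n"
 shows "norm (mtrace n A) <= real n"
proof -
 obtain es where es: "char_poly A = (\<Prod>a\<leftarrow>es. [:- a, 1:])" "length es = n"
  using char_poly_factorized[OF A] by blast
 obtain T P Q where T: "schur_decomposition A es = (T, P, Q)" by (cases "schur_decomposition A es")
 from schur_decomposition[OF A es(1) T] have w: "similar_mat_wit A T P Q" and d: "diag_mat T = es" by blast+
 note D = similar_mat_witD2[OF A w]
 have "mtrace n A = mtrace n (P * (T * Q))" using D(3) assoc_mult_mat[OF D(6,5,7)] by simp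
 also have "... = mtrace n (T * Q * P)" by (rule mtrace_commute[OF D(6) mult_carrier_mat[OF D(5,7)]])
 also have "T * Q * P = T" using assoc_mult_mat[OF D(5,7,6)] D(2) right_mult_one_mat[OF D(5)] by simp
 finally have tr: "mtrace n A = mtrace n T" .
 have "norm (T $$ (i, i)) = 1" if i: "i < n" for i
 proof -
  have Ti: "T $$ (i, i) = es ! i" using d i D(5) by (auto simp: diag_mat_def)
  have "poly (char_poly A) (es ! i) = 0"
   unfolding es(1) poly_prod_list using i es(2) by (intro prod_list_zero_iff[THEN iffD2]) (force simp: image_iff in_set_conv_nth)
  hence "eigenvalue A (es ! i)" using eigenvalue_root_char_poly[OF A] by simp
  then obtain v where v: "eigenvector A v (es ! i)" by (auto simp: eigenvalue_def)
  have vc: "v : carrier_vec n" "v ~= 0\<^sub>v n" using v A by (auto simp: eigenvector_def)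
  have "(1\<^sub>m n) *\<^sub>v v = (es ! i) ^ m \<cdot>\<^sub>v v" using eigenvector_pow[OF A v, of m] m(2) by simp
  hence e: "v = (es ! i) ^ m \<cdot>\<^sub>v v" using vc by simp
  have "EX j<n. vec_index v j ~= 0"
  proof (rule ccontr)
   assume "~ (EX j<n. vec_index v j ~= 0)"
   hence "v = 0\<^sub>v n" using vc(1) by (intro eq_vecI) auto
   thus False using vc(2) by contradiction
  qed
  then obtain j where j: "j < n" "vec_index v j ~= 0" by blast
  have "vec_index ((es ! i) ^ m \<cdot>\<^sub>v v) j = (es ! i) ^ m * vec_index v j" using j(1) vc(1) by simp
  hence "1 * vec_index v j = (es ! i) ^ m * vec_index v j" unfolding e[symmetric] mult_1 .
  hence "(es ! i) ^ m = 1" using mult_right_cancel[OF j(2)] by metis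
  thus ?thesis unfolding Ti using m(1) power_eq_1_iff by blast
 qed
 hence "norm (mtrace n T) <= (\<Sum>i<n. 1)" by (intro sum_norm_le) simp
 thus ?thesis by (simp add: tr)
qed

lemma Irr_props:
 assumes G: "group G" and \<chi>: "\<chi> : Irr G"
 shows "EX d>0. \<chi> \<one>\<^bsub>G\<^esub> = of_nat d &
  (finite (carrier G) --> (ALL g:carrier G. norm (\<chi> g) <= real d)) &
  (ALL x:carrier G. ALL g:carrier G. \<chi> (inv\<^bsub>G\<^esub> x \<otimes>\<^bsub>G\<^esub> g \<otimes>\<^bsub>G\<^esub> x) = \<chi> g)"
proof -
 obtain n \<rho> where \<rho>: "n > 0" "\<rho> : hom G (GL n)" and c: "\<chi> = restrict (%g. mtrace n (\<rho> g)) (carrier G)"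
  using \<chi> by (auto simp: Irr_def irreducible_rep_def)
 interpret G: group G by fact
 have GL: "group (GL n)" using ring.is_monoid[OF ring_mat] by (rule monoid.units_group)
 have m: "\<rho> (x \<otimes>\<^bsub>G\<^esub> y) = \<rho> x * \<rho> y" if "x : carrier G" "y : carrier G" for x y
  using hom_mult[OF \<rho>(2) that] by (simp add: units_of_def ring_mat_simps)
 have one: "\<rho> \<one>\<^bsub>G\<^esub> = 1\<^sub>m n"
  using hom_one[OF \<rho>(2) G GL] by (simp add: units_of_def ring_mat_simps)
 have cr: "\<rho> x : carrier_mat n n" if "x : carrier G" for x
  using hom_in_carrier[OF \<rho>(2) that] by (simp add: units_of_def Units_def ring_mat_simps)
 have "\<chi> \<one>\<^bsub>G\<^esub> = of_nat n" by (simp add: c one)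
 moreover have "\<chi> (inv\<^bsub>G\<^esub> x \<otimes>\<^bsub>G\<^esub> g \<otimes>\<^bsub>G\<^esub> x) = \<chi> g" if x: "x : carrier G" and g: "g : carrier G" for x g
 proof -
  have "mtrace n (\<rho> (inv\<^bsub>G\<^esub> x \<otimes>\<^bsub>G\<^esub> g \<otimes>\<^bsub>G\<^esub> x)) = mtrace n (\<rho> (inv\<^bsub>G\<^esub> x \<otimes>\<^bsub>G\<^esub> g) * \<rho> x)" using x g by (simp add: m)
  also have "... = mtrace n (\<rho> x * \<rho> (inv\<^bsub>G\<^esub> x \<otimes>\<^bsub>G\<^esub> g))" using x g by (intro mtrace_commute cr) auto
  also have "\<rho> x * \<rho> (inv\<^bsub>G\<^esub> x \<otimes>\<^bsub>G\<^esub> g) = \<rho> g" using x g by (simp add: m[symmetric] G.m_assoc[symmetric])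
  finally show ?thesis using x g by (simp add: c)
 qed
 moreover have "norm (\<chi> g) <= real n" if fin: "finite (carrier G)" and g: "g : carrier G" for g
 proof -
  have pow: "\<rho> (g [^]\<^bsub>G\<^esub> j) = \<rho> g ^\<^sub>m j" for j :: nat
   by (induction j) (use g cr[OF g] in \<open>auto simp: m one\<close>)
  have "\<rho> g ^\<^sub>m Coset.order G = 1\<^sub>m n" using pow[of "Coset.order G"] G.pow_order_eq_1[OF g] one by simp
  moreover have "Coset.order G > 0" using fin G.order_gt_0_iff_finite by simp
  ultimately show ?thesis using norm_mtrace_finite_order[OF cr[OF g]] g by (simp add: c)
 qed
 ultimately show ?thesis using \<rho>(1) by blast
qed

section \<open>The discriminant\<close>

lemma independent_family_bound:
 fixes u v :: "nat => complex"
 assumes span: "!!i. i < a ==> EX c::nat => int. u i = (\<Sum>j<b. of_int (c j) * v j)"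
  and ind: "!!c::nat => int. (\<Sum>i<a. of_int (c i) * u i) = 0 ==> ALL i<a. c i = 0"
 shows "a <= b"
proof (rule ccontr)
 assume "~ a <= b"
 hence ba: "b < card {..<a}" by simp
 have "ALL i:{..<a}. EX c::nat => int. u i = (\<Sum>j<b. of_int (c j) * v j)" using span by blast
 then obtain m :: "nat => nat => int" where m: "ALL i:{..<a}. u i = (\<Sum>j<b. of_int (m i j) * v j)" by (rule bchoice[THEN exE])
 have "EX c :: nat => complex. (ALL i:{..<a}. c i : \<rat>) & (EX i:{..<a}. c i ~= 0) & (ALL j<b. (\<Sum>i<a. c i * of_int (m i j)) = 0)"
  by (rule homogeneous_system_nonzero_solution[OF csubfield_Rats_self _ ba]) auto
 then obtain c :: "nat => complex" where c: "ALL i:{..<a}. c i : \<rat>" "EX i:{..<a}. c i ~= 0" "ALL j<b. (\<Sum>i<a. c i * of_int (m i j)) = 0" by blast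
 obtain d :: int where d: "d > 0" "ALL i:{..<a}. of_int d * c i : \<int>"
  using common_denominator[of "{..<a}" c] c(1) by auto
 hence "ALL i:{..<a}. EX z::int. of_int d * c i = of_int z" by (auto elim: Ints_cases)
 then obtain z :: "nat => int" where z: "ALL i:{..<a}. of_int d * c i = of_int (z i)" by (rule bchoice[THEN exE])
 have "(\<Sum>i<a. of_int (z i) * u i) = (\<Sum>i<a. \<Sum>j<b. of_int d * c i * (of_int (m i j) * v j))"
  using z m by (intro sum.cong refl) (simp add: sum_distrib_left)
 also have "... = (\<Sum>j<b. of_int d * (\<Sum>i<a. c i * of_int (m i j)) * v j)"
  by (subst sum.swap) (simp add: sum_distrib_left sum_distrib_right mult.assoc)
 also have "... = 0" using c(3) by simp
 finally have "ALL i<a. z i = 0" by (rule ind)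
 thus False using c(2) d(1) z by auto
qed

context galois_field
begin

text \<open>A conjugate of an element is a root of its characteristic polynomial over the rationals.\<close>

lemma embeddings_eq: "embeddings L = G"
proof (intro equalityI subsetI)
 fix \<sigma> assume "\<sigma> : embeddings L"
 hence h: "hom_on L \<sigma>" and e: "\<sigma> : extensional L" by (auto simp: embeddings_def Ring.ring_hom_def hom_on_def)
 have orb: "EX \<tau>:G. \<sigma> x = \<tau> x" if x: "x : L" for x
 proof (rule cpoly_zeros)
  have q: "poly.coeff (cpoly x) i : \<rat>" for i using cpoly_coeff[OF x] Fix_Rats by simp
  have "\<sigma> (poly (cpoly x) x) = poly (cpoly x) (\<sigma> x)"
   using hom_on_poly_eval[OF L h Rats_L[OF q] x] hom_on_Rats[OF L h q] by (simp add: poly_altdef)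
  thus "poly (cpoly x) (\<sigma> x) = 0" using cpoly_self[OF x] hom_on_zero[OF L h] by simp
 qed
 have sL: "\<sigma> x : L" if "x : L" for x using orb[OF that] into[OF _ that] by auto
 have "y : \<sigma> ` L" if y: "y : L" for y
 proof -
  let ?R = "(%\<tau>. \<tau> y) ` G"
  have RL: "?R <= L" using into y by blast
  have "\<sigma> z : ?R" if "z : ?R" for z
  proof -
   obtain \<tau> where t: "\<tau> : G" "z = \<tau> y" using \<open>z : ?R\<close> by blast
   have "z : L" using into[OF t(1) y] t(2) by simp
   then obtain \<rho> where r: "\<rho> : G" "\<sigma> z = \<rho> z" using orb by blast
   have "\<sigma> z = compose L \<rho> \<tau> y" using r t y by (simp add: comp_apply)
   thus ?thesis using comp_mem[OF r(1) t(1)] by (rule image_eqI)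
  qed
  hence "\<sigma> ` ?R = ?R"
   using fin inj_on_subset[OF hom_on_inj[OF L h] RL] by (intro endo_inj_surj) auto
  moreover have "y : ?R" using id_mem y by (force intro: image_eqI[of _ _ "restrict id L"])
  ultimately show ?thesis using RL by blast
 qed
 hence "bij_betw \<sigma> L L" using hom_on_inj[OF L h] sL by (auto simp: bij_betw_def)
 thus "\<sigma> : G" by (rule full[OF h _ e])
next
 fix \<sigma> assume \<sigma>: "\<sigma> : G"
 thus "\<sigma> : embeddings L" using hom[OF \<sigma>] ext[OF \<sigma>] by (auto simp: embeddings_def Ring.ring_hom_def hom_on_def)
qed

lemma gal_group_Rats: "carrier (gal_group L \<rat>) = G"
proof (intro equalityI subsetI)
 fix \<sigma> assume "\<sigma> : carrier (gal_group L \<rat>)"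
 thus "\<sigma> : G" by (auto simp: gal_carrier intro: full)
next
 fix \<sigma> assume \<sigma>: "\<sigma> : G"
 obtain \<tau> where t: "\<tau> : G" "ALL x:L. \<tau> (\<sigma> x) = x & \<sigma> (\<tau> x) = x" using inv_ex[OF \<sigma>] by blast
 have "bij_betw \<sigma> L L"
  using t into[OF \<sigma>] into[OF t(1)] by (intro bij_betw_byWitness[of _ \<tau>]) auto
 thus "\<sigma> : carrier (gal_group L \<rat>)" using hom[OF \<sigma>] ext[OF \<sigma>] hom_simps(12)[OF \<sigma>] by (simp add: gal_carrier)
qed

lemma discriminant_eq:
 assumes w: "is_int_basis w"
 shows "of_int (discriminant L) = (dm w)\<^sup>2"
proof -
 have wI: "!!j. j < n ==> w j : \<O>" "dm w ~= 0" and ws: "!!x. x : \<O> ==> EX c::nat => int. x = (\<Sum>j<n. of_int (c j) * w j)"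
  using w by (auto simp: is_int_basis_def)
 obtain d :: int where d: "(dm w)\<^sup>2 = of_int d" using dm_square_int[of w, OF wI(1)] by (auto elim: Ints_cases)
 have wind: "ALL i<n. c i = 0" if "(\<Sum>i<n. of_int (c i) * w i) = 0" for c :: "nat => int"
  using int_basis_unique[OF w, of c "%_. 0"] that by simp
 have eq: "x = d" if b: "integral_basis L us" and s: "distinct ss" "set ss = embeddings L"
  and x: "of_int x = (Determinant.det (mat (length ss) (length us) (%(i, j). (ss ! i) (us ! j))))\<^sup>2" for us ss x
 proof -
  let ?u = "%j. us ! j"
  have uI: "?u j : \<O>" if "j < length us" for j using b that by (auto simp: integral_basis_def roi_carrier)
  have us: "EX! c :: int list. length c = length us & y = (\<Sum>i<length us. of_int (c ! i) * us ! i)" if "y : \<O>" for y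
   using b that by (simp add: integral_basis_def roi_carrier)
  have usp: "EX c::nat => int. y = (\<Sum>j<length us. of_int (c j) * ?u j)" if "y : \<O>" for y
   
  proof -
   from ex1_implies_ex[OF us[OF that]] obtain l :: "int list" where "y = (\<Sum>i<length us. of_int (l ! i) * us ! i)" by blast
   thus ?thesis by (intro exI[of _ "%j. l ! j"])
  qed
  have uind: "ALL i<length us. c i = 0" if 0: "(\<Sum>i<length us. of_int (c i) * ?u i) = 0" for c :: "nat => int"
  proof -
   obtain l :: "int list" where l: "!!l'. length l' = length us ==> 0 = (\<Sum>i<length us. of_int (l' ! i) * us ! i) ==> l' = l"
    using us[OF Int_cl(1)] unfolding Ex1_def by blast
   have "map c [0..<length us] = l" by (rule l) (simp_all add: 0)
   moreover have "map (%_. 0) [0..<length us] = l" by (rule l) simp_all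
   ultimately have "map c [0..<length us] = map (%_. 0) [0..<length us]" by simp
   thus ?thesis by (simp add: map_eq_conv)
  qed
  have len: "length us = n"
   using independent_family_bound[where a = "length us" and u = ?u and b = n and v = w, OF ws[OF uI] uind]
    independent_family_bound[where a = n and u = w and b = "length us" and v = ?u, OF usp[OF wI(1)] wind] by simp
  have lens: "length ss = n" using distinct_card[OF s(1)] s(2) by (simp add: embeddings_eq)
  obtain m :: int where m: "dm ?u = dm w * of_int m" using int_basis_index[of w ?u, OF w] uI len by auto
  have "ALL j:{..<n}. EX c::nat => int. w j = (\<Sum>k<n. of_int (c k) * ?u k)" using usp wI(1) len by auto
  then obtain c :: "nat => nat => int" where c: "ALL j:{..<n}. w j = (\<Sum>k<n. of_int (c j k) * ?u k)"
   by (rule bchoice[THEN exE])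
  have "dm w = dm ?u * Determinant.det (mat n n (%(i, j). of_int (c j i)))"
   using c uI Int_L len by (intro dm_base_change) (auto simp: Fix_Rats)
  moreover have "Determinant.det (mat n n (%(i, j). of_int (c j i))) : (\<int> :: complex set)"
   by (rule csubring_det[OF _ mat_carrier]) (auto simp: csubring_def)
  ultimately obtain m' :: int where "dm w = dm ?u * of_int m'" by (auto elim!: Ints_cases)
  hence "of_int (m * m') = (1 :: complex)" using m wI(2) by simp
  hence "m * m' = 1" by (simp only: of_int_eq_1_iff)
  hence "m = 1 | m = - 1" by (auto simp: zmult_eq_1_iff)
  hence "m\<^sup>2 = 1" by auto
  from arg_cong[OF this, of of_int] have "(of_int m)\<^sup>2 = (1 :: complex)" by simp
  hence u2: "(dm ?u)\<^sup>2 = (dm w)\<^sup>2" unfolding m power_mult_distrib by (simp only: mult_1_right)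
  have "bij_betw (%i. ss ! i) {..<n} G"
   by (rule bij_betw_nth[OF s(1)]) (simp_all add: lens s(2) embeddings_eq)
  from x[unfolded len lens dm_square_enum[OF this, of ?u]] have "of_int x = (of_int d :: complex)"
   unfolding u2 d .
  thus ?thesis by (simp only: of_int_eq_iff)
 qed
 obtain ss where ss: "distinct ss" "set ss = G" using finite_distinct_list[OF fin] by blast
 let ?us = "map w [0..<n]"
 have lens: "length ss = n" using distinct_card[OF ss(1)] ss(2) by simp
 have bas: "integral_basis L ?us"
  unfolding integral_basis_def roi_simps roi_carrier
 proof (intro conjI ballI)
  show "set ?us <= \<O>" using wI(1) by auto
  fix x assume "x : \<O>"
  then obtain c :: "nat => int" where c: "x = (\<Sum>j<n. of_int (c j) * w j)" using ws by blast
  show "EX! c :: int list. length c = length ?us & x = (\<Sum>i<length ?us. of_int (c ! i) * ?us ! i)"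
  proof (rule ex1I[of _ "map c [0..<n]"])
   fix l :: "int list" assume l: "length l = length ?us & x = (\<Sum>i<length ?us. of_int (l ! i) * ?us ! i)"
   hence "x = (\<Sum>j<n. of_int (l ! j) * ?us ! j)" by (simp only: length_map length_upt diff_zero)
   also have "... = (\<Sum>j<n. of_int (l ! j) * w j)" by (rule sum.cong) simp_all
   finally have "(\<Sum>j<n. of_int (l ! j) * w j) = (\<Sum>j<n. of_int (c j) * w j)" unfolding c by (rule sym)
   note eq = this
   have "l ! j = c j" if "j < n" for j by (rule int_basis_unique[OF w eq that])
   moreover have "length l = n" using conjunct1[OF l] by simp
   ultimately show "l = map c [0..<n]" by (intro nth_equalityI) simp_all
  next
   have "x = (\<Sum>i<n. of_int (map c [0..<n] ! i) * ?us ! i)" unfolding c by (rule sum.cong) simp_all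
   thus "length (map c [0..<n]) = length ?us & x = (\<Sum>i<length ?us. of_int (map c [0..<n] ! i) * ?us ! i)"
    by (simp only: length_map length_upt diff_zero)
  qed
 qed
 have "bij_betw (%i. ss ! i) {..<n} G" by (rule bij_betw_nth[OF ss(1)]) (simp_all add: lens ss(2))
 note e = dm_square_enum[OF this, of w]
 have "mat n n (%(i, j). (ss ! i) (?us ! j)) = mat n n (%(i, j). (ss ! i) (w j))" by (intro eq_matI) auto
 hence det: "of_int d = (Determinant.det (mat (length ss) (length ?us) (%(i, j). (ss ! i) (?us ! j))))\<^sup>2"
  unfolding lens length_map length_upt diff_zero d[symmetric] e[symmetric] by (simp only:)
 have "discriminant L = d"
  unfolding discriminant_def
 proof (rule the_equality)
  show "EX ws ss. integral_basis L ws & distinct ss & set ss = embeddings L &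
   of_int d = (Determinant.det (mat (length ss) (length ws) (%(i, j). (ss ! i) (ws ! j))))\<^sup>2"
   by (rule exI[of _ ?us], rule exI[of _ ss], intro conjI bas ss(1) det) (simp only: ss(2) embeddings_eq)
  fix x assume "EX ws ss. integral_basis L ws & distinct ss & set ss = embeddings L &
   of_int x = (Determinant.det (mat (length ss) (length ws) (%(i, j). (ss ! i) (ws ! j))))\<^sup>2"
  thus "x = d" by (elim exE conjE) (rule eq)
 qed
 thus ?thesis using d by simp
qed

end

section \<open>Conductor exponents\<close>

context galois_field
begin

definition lower_index :: "complex set => (complex => complex) => int" where
 "lower_index B \<sigma> = val B (\<sigma> (unif B) - unif B)"

definition cond_sum :: "(complex => complex) set => ((complex => complex) => complex) => complex set => complex" where
 "cond_sum U \<chi> B = (\<Sum>\<sigma>\<in>inert B Int U. of_int (lower_index B \<sigma>) * (\<chi> (restrict id L) - \<chi> \<sigma>))"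

lemma lower_index_iff:
 assumes B: "Prime B" and \<sigma>: "\<sigma> : inert B" "\<sigma> ~= restrict id L"
 shows "(ALL x:\<O>. \<sigma> x - x : V B (int N)) \<longleftrightarrow> int N <= lower_index B \<sigma>"
  and "lower_index B \<sigma> >= 1"
proof -
 note id = aut_group.id_mem[OF inert_subgroup[OF B]]
 have \<sigma>G: "\<sigma> : G" using \<sigma>(1) by (simp add: inert_def decomp_def)
 have ne: "\<sigma> (unif B) - unif B ~= 0"
  using inj_onD[OF inert_unif_inj[OF B] _ \<sigma>(1) id] \<sigma>(2) unif_L[OF B] by auto
 have L: "\<sigma> (unif B) - unif B : L" using Lcl(4)[OF into[OF \<sigma>G unif_L[OF B]] unif_L[OF B]] .
 show iff: "(ALL x:\<O>. \<sigma> x - x : V B (int N)) \<longleftrightarrow> int N <= lower_index B \<sigma>" for N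
  unfolding inert_cong_iff[OF B \<sigma>(1)] using ne L by (simp add: V_def lower_index_def)
 have "ALL x:\<O>. \<sigma> x - x : V B (int 1)"
 proof
  fix x assume x: "x : \<O>"
  have "\<sigma> x - x : B" using \<sigma>(1) x unfolding inert_def by blast
  thus "\<sigma> x - x : V B (int 1)"
   unfolding of_nat_1 using mem_B_iff[OF B Int_cl(4)[OF Int_into[OF \<sigma>G x] x]] by blast
 qed
 from iff[THEN iffD1, OF this] show "lower_index B \<sigma> >= 1" by (simp only: of_nat_1)
qed

lemma ramification_group_eq:
 assumes B: "Prime B" and U: "carrier (gal_group L M) = U" "U <= G"
 shows "ramification_group L M B j = {\<sigma> : inert B Int U. \<sigma> = restrict id L | int (Suc j) <= lower_index B \<sigma>}"
proof -
 have 1: "\<sigma> : ramification_group L M B j \<longleftrightarrow>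
   \<sigma> : inert B Int U & (ALL x:\<O>. \<sigma> x - x : V B (int (Suc j)))" for \<sigma>
 proof -
  have int: "\<sigma> x - x : \<O>" if "\<sigma> : U" "x : \<O>" for x
   by (rule Int_cl(4)[OF Int_into[OF subsetD[OF U(2) that(1)] that(2)] that(2)])
  have B1: "\<sigma> x - x : B" if "\<sigma> : U" "x : \<O>" "\<sigma> x - x : V B (int (Suc j))" for x
  proof -
   have "\<sigma> x - x : V B 1" by (rule V_antimono[OF B that(3)]) simp
   thus ?thesis using mem_B_iff[OF B int[OF that(1,2)]] by blast
  qed
  show ?thesis
   unfolding ramification_group_def U(1) roi_simps roi_carrier ideal_power_V[OF B] inert_def decomp_def Suc_eq_plus1[symmetric]
   using int B1 U(2) by blast
 qed
 have 2: "(ALL x:\<O>. restrict id L x - x : V B (int (Suc j)))" using Int_L V_cl(1)[OF B] by simp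
 show ?thesis
 proof (intro equalityI subsetI)
  fix \<sigma> assume "\<sigma> : ramification_group L M B j"
  thus "\<sigma> : {\<sigma> : inert B Int U. \<sigma> = restrict id L | int (Suc j) <= lower_index B \<sigma>}"
   using 1 lower_index_iff(1)[OF B, of \<sigma> "Suc j"] by blast
 next
  fix \<sigma> assume s: "\<sigma> : {\<sigma> : inert B Int U. \<sigma> = restrict id L | int (Suc j) <= lower_index B \<sigma>}"
  hence "ALL x:\<O>. \<sigma> x - x : V B (int (Suc j))"
   using 2 lower_index_iff(1)[OF B, of \<sigma> "Suc j"] by blast
  thus "\<sigma> : ramification_group L M B j" using 1 s by blast
 qed
qed

text \<open>Summing the defining series over the group first: \<open>\<sigma>\<close> lies in exactly \<open>lower_index B \<sigma>\<close> of
  the ramification groups.\<close>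

lemma conductor_exponent_eq:
 assumes P: "primes_above L M P ~= {}" and U: "carrier (gal_group L M) = U" "U <= G"
 shows "EX B. Prime B & B Int M = P &
  conductor_exponent L M \<chi> P = cond_sum U \<chi> B / of_nat (card (inert B Int U))"
proof -
 define B where "B = (SOME B. B : primes_above L M P)"
 have "B : primes_above L M P" unfolding B_def using P by (metis all_not_in_conv someI_ex)
 hence B: "Prime B" and BM: "B Int M = P" by (auto simp: primes_above_def primes_of_eq)
 let ?D = "inert B Int U" and ?R = "ramification_group L M B" and ?id = "restrict id L"
 note R = ramification_group_eq[OF B U]
 have fin: "finite ?D" using fin U(2) by (auto intro: finite_subset)
 have R0: "?R 0 = ?D"
 proof -
  have "\<sigma> = ?id | int (Suc 0) <= lower_index B \<sigma>" if "\<sigma> : ?D" for \<sigma>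
   using lower_index_iff(2)[OF B, of \<sigma>] that by auto
  thus ?thesis unfolding R by blast
 qed
 define t where "t \<sigma> j = (if \<sigma> : ?R j then \<chi> ?id - \<chi> \<sigma> else 0)" for \<sigma> j
 have t: "t \<sigma> sums (of_int (lower_index B \<sigma>) * (\<chi> ?id - \<chi> \<sigma>))" if \<sigma>: "\<sigma> : ?D" for \<sigma>
 proof (cases "\<sigma> = ?id")
  case True
  hence "t \<sigma> = (%_. 0)" by (auto simp: t_def)
  thus ?thesis using True by simp
 next
  case False
  have "t \<sigma> = (%j. if j : {..<nat (lower_index B \<sigma>)} then \<chi> ?id - \<chi> \<sigma> else 0)"
  proof
   fix j
   have "\<sigma> : ?R j \<longleftrightarrow> j : {..<nat (lower_index B \<sigma>)}"
    unfolding R using \<sigma> False by (simp only: mem_Collect_eq lessThan_iff simp_thms) linarith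
   thus "t \<sigma> j = (if j : {..<nat (lower_index B \<sigma>)} then \<chi> ?id - \<chi> \<sigma> else 0)" by (simp only: t_def)
  qed
  moreover have "of_nat (nat (lower_index B \<sigma>)) = (of_int (lower_index B \<sigma>) :: complex)"
   using lower_index_iff(2)[OF B _ False] \<sigma> by (subst of_int_of_nat_eq[symmetric]) simp
  ultimately show ?thesis
   using sums_If_finite_set[of "{..<nat (lower_index B \<sigma>)}" "%_. \<chi> ?id - \<chi> \<sigma>"] by simp
 qed
 have "of_nat (card (?R j)) * \<chi> ?id - (\<Sum>\<sigma>\<in>?R j. \<chi> \<sigma>) = (\<Sum>\<sigma>\<in>?D. t \<sigma> j)" for j
 proof -
  have "?R j <= ?D" unfolding R by blast
  hence "(\<Sum>\<sigma>\<in>?D. t \<sigma> j) = (\<Sum>\<sigma>\<in>?R j. \<chi> ?id - \<chi> \<sigma>)"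
   unfolding t_def by (simp add: sum.inter_restrict[OF fin, symmetric] Int_absorb1)
  thus ?thesis by (simp add: sum_subtractf)
 qed
 hence "(%j. of_nat (card (?R j)) * \<chi> ?id - (\<Sum>\<sigma>\<in>?R j. \<chi> \<sigma>)) sums cond_sum U \<chi> B"
  unfolding cond_sum_def using t by (simp only:) (intro sums_sum, blast)
 from sums_unique[OF this, symmetric] have "conductor_exponent L M \<chi> P = cond_sum U \<chi> B / of_nat (card ?D)"
  unfolding conductor_exponent_def Let_def B_def[symmetric] gal_one R0 by (simp only:)
 thus ?thesis using B BM by blast
qed

subsection \<open>Conjugation\<close>

lemma group_G: "group (gal_group L \<rat>)"
 using Fix_Rats Fix_subset fin gal_group_Rats by (intro group_gal[OF L]) simp_all

interpretation GG: group "gal_group L \<rat>" by (rule group_G)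

abbreviation ginv :: "(complex => complex) => complex => complex" where
 "ginv x \<equiv> inv\<^bsub>gal_group L \<rat>\<^esub> x"

abbreviation cj :: "(complex => complex) => (complex => complex) => complex => complex" where
 "cj x g \<equiv> ginv x \<otimes>\<^bsub>gal_group L \<rat>\<^esub> g \<otimes>\<^bsub>gal_group L \<rat>\<^esub> x"

lemma G_mult: "x : G ==> y : G ==> x \<otimes>\<^bsub>gal_group L \<rat>\<^esub> y = compose L x y"
 using gal_mult[of x L \<rat> y] by (simp add: gal_group_Rats)

lemma ginv_G: "x : G ==> ginv x : G"
 using GG.inv_closed[of x] by (simp add: gal_group_Rats)

lemma ginv_apply:
 assumes x: "x : G" and z: "z : L"
 shows "ginv x (x z) = z" "x (ginv x z) = z"
 using fun_cong[OF GG.l_inv[of x], of z] fun_cong[OF GG.r_inv[of x], of z] x z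
 by (simp_all add: gal_group_Rats G_mult ginv_G gal_one comp_apply)

lemma cj_G: "x : G ==> g : G ==> cj x g : G"
 by (simp add: G_mult ginv_G comp_mem)

lemma cj_apply: "x : G ==> g : G ==> z : L ==> cj x g z = ginv x (g (x z))"
 by (simp add: G_mult ginv_G comp_mem comp_apply into)

lemma cj_cancel:
 assumes x: "x : G" and g: "g : G"
 shows "cj (ginv x) (cj x g) = g" "cj x (cj (ginv x) g) = g"
proof -
 note x' = ginv_G[OF x]
 have i: "ginv (ginv x) = x" using GG.inv_inv[of x] x by (simp add: gal_group_Rats)
 have a: "ginv x (x z) = z" "x (ginv x z) = z" if "z : L" for z using ginv_apply[OF x that] .
 show "cj (ginv x) (cj x g) = g"
 proof (rule ext_eqI[OF cj_G[OF x' cj_G[OF x g]] g])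
  fix z assume z: "z : L"
  have "cj (ginv x) (cj x g) z = ginv (ginv x) (cj x g (ginv x z))" by (rule cj_apply[OF x' cj_G[OF x g] z])
  also have "... = x (ginv x (g (x (ginv x z))))" unfolding cj_apply[OF x g into[OF x' z]] i ..
  finally show "cj (ginv x) (cj x g) z = g z" by (simp only: a z into[OF g z])
 qed
 show "cj x (cj (ginv x) g) = g"
 proof (rule ext_eqI[OF cj_G[OF x cj_G[OF x' g]] g])
  fix z assume z: "z : L"
  have "cj x (cj (ginv x) g) z = ginv x (cj (ginv x) g (x z))" by (rule cj_apply[OF x cj_G[OF x' g] z])
  also have "cj (ginv x) g (x z) = ginv (ginv x) (g (ginv x (x z)))" by (rule cj_apply[OF x' g into[OF x z]])
  also have "... = x (g (ginv x (x z)))" unfolding i ..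
  finally show "cj x (cj (ginv x) g) z = g z" by (simp only: a z into[OF g z])
 qed
qed

lemma cj_id: "x : G ==> cj x (restrict id L) = restrict id L"
 using GG.r_one GG.l_inv by (simp add: gal_one[symmetric, of L \<rat>] gal_group_Rats ginv_G)

lemma ginv_image:
 assumes "x : G" "B <= L"
 shows "ginv x ` x ` B = B" "x ` ginv x ` B = B"
 using assms ginv_apply by (force simp: image_image)+

lemma Prime_L: "Prime B ==> B <= L"
 using IdealD(1)[OF PrimeD(1)] Int_L by blast

lemma cj_inert:
 assumes B: "Prime B" and x: "x : G" and g: "g : inert (x ` B)"
 shows "cj x g : inert B"
proof -
 have gG: "g : G" and gB: "g ` x ` B = x ` B" and gi: "!!z. z : \<O> ==> g z - z : x ` B"
  using g by (auto simp: inert_def decomp_def)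
 have "cj x g ` B = (%z. ginv x (g (x z))) ` B"
  using Prime_L[OF B] cj_apply[OF x gG] by (intro image_cong refl) blast
 also have "... = ginv x ` g ` x ` B" by (simp only: image_image)
 also have "... = B" using gB ginv_image(1)[OF x Prime_L[OF B]] by simp
 finally have 1: "cj x g ` B = B" .
 have "cj x g z - z : B" if z: "z : \<O>" for z
 proof -
  have zL: "z : L" "x z : L" "g (x z) : L" using Int_L[OF z] into[OF x] into[OF gG] by blast+
  obtain b where b: "b : B" "g (x z) - x z = x b" using gi[OF Int_into[OF x z]] by blast
  have "cj x g z - z = ginv x (g (x z) - x z)"
   using zL by (simp add: cj_apply[OF x gG] hom_simps(5)[OF ginv_G[OF x]] ginv_apply(1)[OF x])
  also have "... = b" unfolding b(2) using ginv_apply(1)[OF x] b(1) Prime_L[OF B] by blast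
  finally show ?thesis using b(1) by simp
 qed
 thus ?thesis using cj_G[OF x gG] 1 by (simp add: inert_def decomp_def)
qed

lemma cj_lower_index:
 assumes B: "Prime B" and x: "x : G" and g: "g : inert (x ` B)" "g ~= restrict id L"
 shows "lower_index B (cj x g) = lower_index (x ` B) g"
proof -
 have gG: "g : G" using g by (auto simp: inert_def decomp_def)
 note c = cj_inert[OF B x g(1)] and B' = Prime_image[OF B x]
 have ne: "cj x g ~= restrict id L"
 proof
  assume "cj x g = restrict id L"
  hence "cj (ginv x) (cj x g) = restrict id L" by (simp only: cj_id[OF ginv_G[OF x]])
  thus False using g(2) cj_cancel(1)[OF x gG] by simp
 qed
 have "cj x g z - z : V B N \<longleftrightarrow> g (x z) - x z : V (x ` B) N" if z: "z : \<O>" for z N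
 proof -
  have zL: "z : L" "x z : L" "g (x z) : L" using Int_L[OF z] into[OF x] into[OF gG] by blast+
  have cL: "cj x g z : L" by (rule into[OF cj_G[OF x gG] zL(1)])
  have "x (cj x g z - z) = g (x z) - x z"
   using zL cL by (simp add: hom_simps(5)[OF x]) (simp add: cj_apply[OF x gG] ginv_apply(2)[OF x])
  thus ?thesis using V_image[OF B x Lcl(4)[OF cL zL(1)], of N] by simp
 qed
 hence "(ALL z:\<O>. cj x g z - z : V B N) \<longleftrightarrow> (ALL z:\<O>. g z - z : V (x ` B) N)" for N
  using Int_preimage[OF B x] Int_into[OF x] by metis
 hence "int N <= lower_index B (cj x g) \<longleftrightarrow> int N <= lower_index (x ` B) g" for N
  using lower_index_iff(1)[OF B c ne] lower_index_iff(1)[OF B' g] by simp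
 from this[of "nat (lower_index B (cj x g))"] this[of "nat (lower_index (x ` B) g)"] show ?thesis
  using lower_index_iff(2)[OF B c ne] lower_index_iff(2)[OF B' g] by simp
qed

lemma cond_sum_conj:
 assumes B: "Prime B" and x: "x : G" and U: "U <= G" "!!g. g : U ==> cj x g : U" "!!g. g : U ==> cj (ginv x) g : U"
 shows "cond_sum U \<theta> B = (\<Sum>g\<in>inert (x ` B) Int U. of_int (lower_index (x ` B) g) * (\<theta> (restrict id L) - \<theta> (cj x g)))"
  and "card (inert B Int U) = card (inert (x ` B) Int U)"
proof -
 have bij: "bij_betw (cj x) (inert (x ` B) Int U) (inert B Int U)"
 proof (rule bij_betw_byWitness[of _ "cj (ginv x)"])
  have UG: "g : G" if "g : U" for g using that U(1) by blast
  show "ALL g:inert (x ` B) Int U. cj (ginv x) (cj x g) = g" "ALL g:inert B Int U. cj x (cj (ginv x) g) = g"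
   by (rule ballI, rule cj_cancel[OF x UG], blast)+
  show "cj x ` (inert (x ` B) Int U) <= inert B Int U" using cj_inert[OF B x] U(2) by blast
  have "cj (ginv x) g : inert (x ` B)" if "g : inert B" for g
   using cj_inert[OF Prime_image[OF B x] ginv_G[OF x], of g] that ginv_image(1)[OF x Prime_L[OF B]] by simp
  thus "cj (ginv x) ` (inert B Int U) <= inert (x ` B) Int U" using U(3) by blast
 qed
 show "card (inert B Int U) = card (inert (x ` B) Int U)" using bij_betw_same_card[OF bij] by simp
 have "cond_sum U \<theta> B = (\<Sum>g\<in>inert (x ` B) Int U. of_int (lower_index B (cj x g)) * (\<theta> (restrict id L) - \<theta> (cj x g)))"
  unfolding cond_sum_def by (rule sum.reindex_bij_betw[OF bij, symmetric])
 also have "... = (\<Sum>g\<in>inert (x ` B) Int U. of_int (lower_index (x ` B) g) * (\<theta> (restrict id L) - \<theta> (cj x g)))"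
 proof (rule sum.cong[OF refl])
  fix g assume "g : inert (x ` B) Int U"
  thus "of_int (lower_index B (cj x g)) * (\<theta> (restrict id L) - \<theta> (cj x g)) =
    of_int (lower_index (x ` B) g) * (\<theta> (restrict id L) - \<theta> (cj x g))"
   by (cases "g = restrict id L") (simp_all add: cj_id[OF x] cj_lower_index[OF B x])
 qed
 finally show "cond_sum U \<theta> B = (\<Sum>g\<in>inert (x ` B) Int U. of_int (lower_index (x ` B) g) * (\<theta> (restrict id L) - \<theta> (cj x g)))" .
qed

lemma val_of_int:
 assumes B: "Prime B" and m: "m ~= 0"
 shows "val B (of_int m) = int (multiplicity (residue_char B) (nat \<bar>m\<bar>)) * int (card (inert B))"
proof -
 let ?p = "residue_char B" and ?m = "nat \<bar>m\<bar>"
 have m0: "?m ~= 0" using m by simp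
 obtain r where r: "?m = ?p ^ multiplicity ?p ?m * r" "~ ?p dvd r"
  using multiplicity_decompose'[of ?m ?p] m0 residue_char_prime[OF B] not_prime_unit by metis
 have r0: "r ~= 0" using r(2) by (intro notI) simp
 have p0: "(of_nat ?p :: complex) ~= 0" "(of_nat ?p ^ multiplicity ?p ?m :: complex) ~= 0" using residue_char(1)[OF B] by simp_all
 have "val B (of_nat r) = 0"
  using r(2) of_nat_mem_iff[OF B, of r] by (intro val_zero_iff[OF B Int_cl(10)]) simp
 hence "val B (of_nat ?m) = int (multiplicity ?p ?m) * val B (of_nat ?p)"
  using val_mult[OF B Lcl(7)[OF Lcl(10)] p0(2) Lcl(10), of r] val_power[OF B Lcl(10) p0(1)] r0
  by (subst r(1)) simp
 moreover have "val B (of_int m) = val B (of_nat ?m)"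
 proof (cases "m >= 0")
  case False
  hence m': "of_int m = (- of_nat ?m :: complex)" by simp
  show ?thesis unfolding m' by (rule val_uminus[OF B Lcl(10)])
 qed simp
 ultimately show ?thesis using val_residue_char[OF B] by simp
qed

end

context tower
begin

text \<open>The automorphisms of \<open>L\<close> act on the fixed field \<open>E\<close> of \<open>H\<close>, and those acting trivially on \<open>k\<close>
  act trivially on \<open>E\<close>; so a primitive element of \<open>k\<close> is a primitive element of \<open>E\<close>.\<close>

lemma Fix_H: "aut_group.Fix L H = k"
proof
 interpret H: aut_group L H by (rule H_subgroup)
 show kF: "k <= H.Fix" unfolding H.Fix_def using sub by (auto simp: H_def)
 define E where "E = H.Fix"
 have EL: "E <= L" using H.Fix_subset by (simp add: E_def)
 have E: "csubfield E" unfolding E_def by (rule H.Fix_subfield)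
 have mE: "\<sigma> x : E" if s: "\<sigma> : G" and x: "x : E" for \<sigma> x
 proof -
  have xL: "x : L" using x EL by blast
  obtain \<tau> where t: "\<tau> : G" "ALL x:L. \<tau> (\<sigma> x) = x & \<sigma> (\<tau> x) = x" using big.inv_ex[OF s] by blast
  have "h (\<sigma> x) = \<sigma> x" if h: "h : H" for h
  proof -
   have hG: "h : G" by (rule H_G[OF h])
   define g where "g = compose L \<tau> (compose L h \<sigma>)"
   have gG: "g : G" unfolding g_def by (intro big.comp_mem t hG s)
   have g: "g z = \<tau> (h (\<sigma> z))" if "z : L" for z using that by (simp add: g_def big.comp_apply)
   have "g y = y" if y: "y : k" for y
   proof -
    have "h (\<sigma> y) = \<sigma> y" using h maps_small[OF s y] by (simp add: H_def)
    thus ?thesis using g t(2) y sub by auto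
   qed
   hence "g : H" using gG by (simp add: H_def)
   hence "g x = x" using x unfolding E_def H.Fix_def by blast
   hence "\<sigma> (\<tau> (h (\<sigma> x))) = \<sigma> x" using g[OF xL] by simp
   thus ?thesis using t(2) big.into[OF hG big.into[OF s xL]] by simp
  qed
  thus ?thesis using big.into[OF s xL] by (simp add: E_def H.Fix_def)
 qed
 define W where "W = (%\<sigma>. restrict \<sigma> E) ` G"
 have W: "aut_group E W"
 proof
  show "finite W" using big.fin by (simp add: W_def)
  show "restrict id E : W"
   unfolding W_def using EL by (intro image_eqI[OF _ big.id_mem]) (auto simp: fun_eq_iff restrict_def)
  fix \<rho> assume "\<rho> : W"
  then obtain \<sigma> where s: "\<sigma> : G" "\<rho> = restrict \<sigma> E" by (auto simp: W_def)
  show "hom_on E \<rho>"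
   using big.hom[OF s(1)] EL csubringD[OF csubfieldD(1)[OF E]] unfolding hom_on_def s(2) by (simp add: subset_iff)
  show "\<rho> x : E" if "x : E" for x using mE[OF s(1) that] that s(2) by simp
  show "\<rho> : extensional E" using s(2) by simp
  show "compose E \<rho> \<rho>' : W" if r': "\<rho>' : W" for \<rho>'
  proof -
   obtain \<sigma>' where s': "\<sigma>' : G" "\<rho>' = restrict \<sigma>' E" using r' unfolding W_def by blast
   have "compose E \<rho> \<rho>' = restrict (compose L \<sigma> \<sigma>') E"
    using EL mE[OF s'(1)] by (auto simp: fun_eq_iff compose_def restrict_def s(2) s'(2))
   thus ?thesis unfolding W_def using big.comp_mem[OF s(1) s'(1)] by (rule image_eqI)
  qed
  obtain \<tau> where t: "\<tau> : G" "ALL x:L. \<tau> (\<sigma> x) = x & \<sigma> (\<tau> x) = x" using big.inv_ex[OF s(1)] by blast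
  have "restrict \<tau> E : W" using t(1) unfolding W_def by blast
  moreover have "restrict \<tau> E (\<rho> x) = x & \<rho> (restrict \<tau> E x) = x" if "x : E" for x
  proof -
   have "\<tau> (\<sigma> x) = x" "\<sigma> (\<tau> x) = x" using t(2) that EL by blast+
   thus ?thesis using that mE[OF s(1) that] mE[OF t(1) that] by (simp add: s(2))
  qed
  ultimately show "EX \<tau>:W. ALL x:E. \<tau> (\<rho> x) = x & \<rho> (\<tau> x) = x" by blast
 qed (rule E)
 interpret W: aut_group E W by (rule W)
 have WQ: "W.Fix = \<rat>"
 proof -
  have "x : big.Fix" if "x : W.Fix" for x
  proof -
   have xE: "x : E" and fx: "ALL \<rho>:W. \<rho> x = x" using that unfolding W.Fix_def by blast+
   have "\<sigma> x = x" if "\<sigma> : G" for \<sigma>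
   proof -
    have "restrict \<sigma> E x = x" using fx that unfolding W_def by blast
    thus ?thesis using xE by simp
   qed
   thus ?thesis using xE EL unfolding big.Fix_def by blast
  qed
  thus ?thesis using csubfield_Rats[OF W.Fix_subfield] big.Fix_Rats by blast
 qed
 have kE: "k <= E" using kF by (simp add: E_def)
 obtain \<beta> where b: "\<beta> : k" "inj_on (%\<sigma>. \<sigma> \<beta>) \<Gamma>" using small.primitive_element_exists by blast
 have bE: "\<beta> : E" using b(1) kE by blast
 have "inj_on (%\<rho>. \<rho> \<beta>) W"
 proof (rule inj_onI)
  fix \<rho> \<rho>' assume "\<rho> : W" "\<rho>' : W" and eq: "\<rho> \<beta> = \<rho>' \<beta>"
  then obtain \<sigma> \<sigma>' where s: "\<sigma> : G" "\<rho> = restrict \<sigma> E" and s': "\<sigma>' : G" "\<rho>' = restrict \<sigma>' E" by (auto simp: W_def)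
  have "res \<sigma> = res \<sigma>'"
   using inj_onD[OF b(2) _ res_mem[OF s(1)] res_mem[OF s'(1)]] eq b(1) bE by (simp add: s(2) s'(2))
  hence "\<sigma> : compose L \<sigma>' ` (G Int H)"
   using res_fiber[OF big.aut_group_axioms subset_refl s'(1)] s(1) by blast
  then obtain h where h: "h : H" "\<sigma> = compose L \<sigma>' h" by blast
  have "\<sigma> x = \<sigma>' x" if "x : E" for x using that h EL by (auto simp: big.comp_apply E_def H.Fix_def)
  thus "\<rho> = \<rho>'" by (auto simp: s(2) s'(2) restrict_def fun_eq_iff)
 qed
 note prim = this
 show "H.Fix <= k"
 proof
  fix x assume "x : H.Fix"
  hence "x : E" by (simp add: E_def)
  from W.power_coordinates[OF bE prim this] obtain c
   where c: "ALL j<card W. c j : \<rat>" "x = (\<Sum>j<card W. c j * \<beta> ^ j)" unfolding WQ by blast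
  show "x : k" unfolding c(2)
   by (rule small.Lcl(8), rule small.Lcl(5)[OF small.Rats_L small.Lcl(7)[OF b(1)]]) (use c(1) in simp)
 qed
qed

abbreviation "vD p \<equiv> multiplicity p (nat \<bar>discriminant k\<bar>)"

definition conj_avg :: "(complex set => 'a::field_char_0) => complex set => 'a" where
 "conj_avg F P = (\<Sum>\<gamma>\<in>\<Gamma>. F (\<gamma> ` P)) / of_nat (card (small.inert P))"

lemma gal_group_small: "carrier (gal_group L k) = H"
proof -
 have "carrier (gal_group L k) = {\<sigma> : carrier (gal_group L \<rat>). ALL x:k. \<sigma> x = x}"
  using small.Rats_L by (auto simp: gal_carrier)
 thus ?thesis by (simp add: big.gal_group_Rats H_def)
qed

lemma ginv_cancel_small: "x : G ==> z : k ==> big.ginv x (x z) = z"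
 using sub by (intro big.ginv_apply) auto

lemma cj_H: "x : G ==> h : H ==> big.cj x h : H"
 using sub maps_small by (auto simp: H_def big.cj_G big.cj_apply ginv_cancel_small)

lemma H_if_cj_H: "x : G ==> g : G ==> big.cj x g : H ==> g : H"
 using cj_H[OF big.ginv_G, of x "big.cj x g"] by (simp add: big.cj_cancel)

lemma H_subset: "H <= G" using H_G by blast

text \<open>The sum does not depend on the prime of \<open>L\<close> chosen over the prime of \<open>k\<close>: any two are conjugate
  under \<open>H\<close>, and \<open>\<theta>\<close> is a class function.\<close>

lemma conductor_small:
 assumes B: "big.Prime B" and \<theta>: "!!x h. x : H ==> h : H ==> \<theta> (big.cj x h) = \<theta> h"
 shows "conductor_exponent L k \<theta> (B Int k) = big.cond_sum H \<theta> B / of_nat (card (big.inert B Int H))"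
proof -
 have "primes_above L k (B Int k) ~= {}" using B by (auto simp: primes_above_def big.primes_of_eq)
 from big.conductor_exponent_eq[OF this gal_group_small H_subset]
 obtain B0 where B0: "big.Prime B0" "B0 Int k = B Int k"
  "conductor_exponent L k \<theta> (B Int k) = big.cond_sum H \<theta> B0 / of_nat (card (big.inert B0 Int H))" by blast
 have "B Int aut_group.Fix L H = B0 Int aut_group.Fix L H" using B0(2) by (simp add: Fix_H)
 from big.conjugate_primes[OF H_subgroup H_subset B B0(1) this]
 obtain h where h: "h : H" "h ` B = B0" by blast
 note hG = H_G[OF h(1)]
 have c: "big.cond_sum H \<theta> B = (\<Sum>g\<in>big.inert (h ` B) Int H. of_int (big.lower_index (h ` B) g) * (\<theta> (restrict id L) - \<theta> (big.cj h g)))"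
  "card (big.inert B Int H) = card (big.inert (h ` B) Int H)"
  using big.cond_sum_conj[OF B hG H_subset cj_H[OF hG] cj_H[OF big.ginv_G[OF hG]]] by blast+
 have "big.cond_sum H \<theta> B = big.cond_sum H \<theta> B0"
  unfolding c(1) unfolding h(2) unfolding big.cond_sum_def using \<theta>[OF h(1)] by (intro sum.cong refl) simp
 thus ?thesis using B0(3) c(2) h(2) by simp
qed

lemma discriminant_valuation:
 assumes B: "big.Prime B" and q: "Factorial_Ring.prime (card \<Gamma>)"
 shows "int (card \<Gamma>) * (\<Sum>s\<in>big.inert B - H. big.lower_index B s) =
  int (vD (big.residue_char B)) * int (card (big.inert B))"
  and "discriminant k ~= 0"
proof -
 obtain w where w: "small.is_int_basis w" using small.int_basis_exists by blast
 have dm: "small.dm w ~= 0" "small.dm w : L"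
  using w small.Int_L[OF small.dm_mem_Int[of w]] sub by (auto simp: small.is_int_basis_def)
 note D = small.discriminant_eq[OF w]
 show D0: "discriminant k ~= 0"
 proof
  assume "discriminant k = 0"
  hence "(small.dm w)\<^sup>2 = 0" using D by simp
  thus False using dm(1) by simp
 qed
 have "2 * big.val B (small.dm w) = big.val B (of_int (discriminant k))"
  unfolding D using big.val_power[OF B dm(2,1), of 2] by simp
 thus "int (card \<Gamma>) * (\<Sum>s\<in>big.inert B - H. big.lower_index B s) =
  int (vD (big.residue_char B)) * int (card (big.inert B))"
  using val_discriminant[OF B q w] big.val_of_int[OF B D0] by (simp add: big.lower_index_def)
qed

context
 fixes B :: "complex set" and \<theta> :: "(complex => complex) => complex"
 assumes B: "big.Prime B" and \<theta>: "!!x h. x : H ==> h : H ==> \<theta> (big.cj x h) = \<theta> h"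
begin

text \<open>Every element of \<open>\<Gamma>\<close> is the restriction of \<open>card H\<close> elements of \<open>G\<close>.\<close>

lemma sum_conductors_small:
 "(\<Sum>x\<in>G. big.cond_sum H \<theta> (x ` B)) =
  of_nat (card H) * of_nat (card (big.inert B Int H)) * (\<Sum>\<gamma>\<in>\<Gamma>. conductor_exponent L k \<theta> (\<gamma> ` (B Int k)))"
proof -
 let ?f = "%\<gamma>. conductor_exponent L k \<theta> (\<gamma> ` (B Int k))"
 interpret H: aut_group L H by (rule H_subgroup)
 have hpos: "card (big.inert B Int H) > 0" by (rule aut_group.card_pos[OF inert_H_subgroup[OF B]])
 have 1: "big.cond_sum H \<theta> (x ` B) = of_nat (card (big.inert B Int H)) * ?f (res x)" if x: "x : G" for x
 proof -
  have "x ` B Int k = res x ` (B Int k)"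
  proof (intro equalityI subsetI)
   fix y assume "y : x ` B Int k"
   then obtain b where b: "b : B" "y = x b" "y : k" by blast
   have "b = big.ginv x y" using b big.ginv_apply(1)[OF x] big.Prime_L[OF B] by auto
   hence "b : k" using maps_small[OF big.ginv_G[OF x] b(3)] by simp
   thus "y : res x ` (B Int k)" using b by (intro image_eqI[of _ _ b]) auto
  qed (use maps_small[OF x] in auto)
  note e = this
  have c: "conductor_exponent L k \<theta> (x ` B Int k) = big.cond_sum H \<theta> (x ` B) / of_nat (card (big.inert (x ` B) Int H))"
   by (rule conductor_small[OF big.Prime_image[OF B x] \<theta>])
  have h: "card (big.inert (x ` B) Int H) = card (big.inert B Int H)"
   by (rule big.cond_sum_conj(2)[OF B x H_subset cj_H[OF x] cj_H[OF big.ginv_G[OF x]], symmetric])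
  show ?thesis using hpos c unfolding e h by simp
 qed
 have "(\<Sum>x\<in>G. ?f (res x)) = (\<Sum>\<gamma>\<in>res ` G. \<Sum>x\<in>{x : G. res x = \<gamma>}. ?f (res x))"
  by (rule sum.image_gen[OF big.fin])
 also have "... = (\<Sum>\<gamma>\<in>res ` G. of_nat (card H) * ?f \<gamma>)"
 proof (rule sum.cong[OF refl])
  fix \<gamma> assume "\<gamma> : res ` G"
  then obtain s where s: "s : G" "\<gamma> = res s" by blast
  have "G Int H = H" using H_subset by blast
  hence "(\<Sum>x\<in>{x : G. res x = \<gamma>}. 1 :: nat) = card H"
   using sum_res_fibers[OF big.aut_group_axioms subset_refl s(1), of "%_. 1 :: nat"] s(2) by simp
  thus "(\<Sum>x\<in>{x : G. res x = \<gamma>}. ?f (res x)) = of_nat (card H) * ?f \<gamma>" by simp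
 qed
 finally have "(\<Sum>x\<in>G. ?f (res x)) = of_nat (card H) * (\<Sum>\<gamma>\<in>\<Gamma>. ?f \<gamma>)" by (simp add: res_surj sum_distrib_left)
 moreover have "(\<Sum>x\<in>G. big.cond_sum H \<theta> (x ` B)) = of_nat (card (big.inert B Int H)) * (\<Sum>x\<in>G. ?f (res x))"
  unfolding sum_distrib_left using 1 by (intro sum.cong refl) blast
 ultimately show ?thesis by (simp add: mult_ac)
qed

end

lemma conductor_rational:
 assumes p: "Factorial_Ring.prime p"
 shows "EX B. big.Prime B & big.residue_char B = p &
  conductor_exponent L \<rat> \<chi> (QPrime p) = big.cond_sum G \<chi> B / of_nat (card (big.inert B Int G))"
proof -
 have "primes_above L \<rat> (QPrime p) ~= {}"
  using big.primes_above_Rats[OF prime_gt_0_nat[OF p]] big.primes_over_nonempty[OF p] by simp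
 from big.conductor_exponent_eq[OF this big.gal_group_Rats subset_refl]
 obtain B where B: "big.Prime B" "B Int \<rat> = QPrime p"
  "conductor_exponent L \<rat> \<chi> (QPrime p) = big.cond_sum G \<chi> B / of_nat (card (big.inert B Int G))" by blast
 have "big.residue_char B = p"
  using B(1,2) big.primes_above_Rats[OF prime_gt_0_nat[OF p]]
  by (auto simp: primes_above_def big.primes_of_eq big.primes_over_def)
 thus ?thesis using B(1,3) by blast
qed

text \<open>For an induced character the part of the inertia group outside \<open>H\<close> contributes the
  discriminant of \<open>k\<close> and the part inside \<open>H\<close> the conductors of \<open>\<theta>\<close> at the conjugate primes.\<close>

lemma conductor_induced:
 assumes p: "Factorial_Ring.prime p" and q: "Factorial_Ring.prime (card \<Gamma>)"
  and \<theta>: "!!x h. x : H ==> h : H ==> \<theta> (big.cj x h) = \<theta> h"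
  and \<chi>: "\<chi> = Ind (gal_group L \<rat>) H \<theta>"
 shows "\<chi> (restrict id L) = of_nat (card \<Gamma>) * \<theta> (restrict id L)"
  and "EX P. small.Prime P & small.residue_char P = p & conductor_exponent L \<rat> \<chi> (QPrime p) =
   \<theta> (restrict id L) * of_nat (vD p) +
   conj_avg (conductor_exponent L k \<theta>) P"
proof -
 interpret H: aut_group L H by (rule H_subgroup)
 let ?id = "restrict id L" and ?h = "card H"
 have h0: "of_nat ?h ~= (0 :: complex)" using H.card_pos by simp
 have Ind: "\<chi> g = (\<Sum>x\<in>{x : G. big.cj x g : H}. \<theta> (big.cj x g)) / of_nat ?h" if "g : G" for g
  using that unfolding \<chi> Ind_def by (simp add: big.gal_group_Rats)
 have Ind_H: "\<chi> g = (\<Sum>x\<in>G. \<theta> (big.cj x g)) / of_nat ?h" if "g : H" for g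
 proof -
  have e: "{x : G. big.cj x g : H} = G" using cj_H that by blast
  show ?thesis using Ind[OF H_G[OF that]] unfolding e .
 qed
 have Ind_0: "\<chi> g = 0" if "g : G" "g ~: H" for g
 proof -
  have e: "{x : G. big.cj x g : H} = {}" using H_if_cj_H that by blast
  show ?thesis using Ind[OF that(1)] unfolding e by simp
 qed
 have "\<chi> ?id = of_nat (card G) * \<theta> ?id / of_nat ?h"
  using Ind_H[OF H.id_mem] by (simp add: big.cj_id)
 thus id: "\<chi> ?id = of_nat (card \<Gamma>) * \<theta> ?id" using h0 by (simp add: card_G)
 obtain B where B: "big.Prime B" "big.residue_char B = p"
  "conductor_exponent L \<rat> \<chi> (QPrime p) = big.cond_sum G \<chi> B / of_nat (card (big.inert B Int G))"
  using conductor_rational[OF p] by blast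
 note pB = B(2)
 let ?I = "big.inert B" and ?P = "B Int k" and ?i = "%s. of_int (big.lower_index B s) :: complex"
 interpret I: aut_group L ?I by (rule big.inert_subgroup[OF B(1)])
 have IG: "?I <= G" by (rule inert_G[OF B(1)])
 note e = ramification_below(3)[OF B(1)]
 have sc: "(\<Sum>x\<in>G. big.cond_sum H \<theta> (x ` B)) =
  of_nat ?h * of_nat (card (?I Int H)) * (\<Sum>\<gamma>\<in>\<Gamma>. conductor_exponent L k \<theta> (\<gamma> ` ?P))"
  by (rule sum_conductors_small[OF B(1) \<theta>])
 have "(\<Sum>s\<in>?I - H. ?i s * (\<chi> ?id - \<chi> s)) = (\<Sum>s\<in>?I - H. ?i s * (of_nat (card \<Gamma>) * \<theta> ?id))"
  using Ind_0 IG by (intro sum.cong refl) (auto simp: id)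
 also have "... = of_int (int (card \<Gamma>) * (\<Sum>s\<in>?I - H. big.lower_index B s)) * \<theta> ?id"
  by (simp add: sum_distrib_left sum_distrib_right mult_ac)
 also have "... = \<theta> ?id * of_nat (vD p) * of_nat (card ?I)"
  unfolding discriminant_valuation(1)[OF B(1) q] pB by simp
 finally have out: "(\<Sum>s\<in>?I - H. ?i s * (\<chi> ?id - \<chi> s)) = \<theta> ?id * of_nat (vD p) * of_nat (card ?I)" .
 have "(\<Sum>s\<in>?I Int H. ?i s * (\<chi> ?id - \<chi> s)) = (\<Sum>s\<in>?I Int H. \<Sum>x\<in>G. ?i s * (\<theta> ?id - \<theta> (big.cj x s)) / of_nat ?h)"
 proof (rule sum.cong[OF refl])
  fix s assume s: "s : ?I Int H"
  have "\<chi> ?id - \<chi> s = (\<Sum>x\<in>G. \<theta> ?id - \<theta> (big.cj x s)) / of_nat ?h"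
   using Ind_H[OF H.id_mem] Ind_H[of s] s by (simp add: big.cj_id sum_subtractf diff_divide_distrib)
  thus "?i s * (\<chi> ?id - \<chi> s) = (\<Sum>x\<in>G. ?i s * (\<theta> ?id - \<theta> (big.cj x s)) / of_nat ?h)"
   by (simp add: sum_distrib_left sum_divide_distrib)
 qed
 also have "... = (\<Sum>x\<in>G. big.cond_sum H \<theta> (big.ginv x ` B)) / of_nat ?h"
  unfolding sum_divide_distrib
 proof (subst sum.swap, rule sum.cong[OF refl])
  fix x assume x: "x : G"
  note xB = big.Prime_image[OF B(1) big.ginv_G[OF x]] and xx = big.ginv_image(2)[OF x big.Prime_L[OF B(1)]]
  have "big.cond_sum H \<theta> (big.ginv x ` B) = (\<Sum>s\<in>?I Int H. ?i s * (\<theta> ?id - \<theta> (big.cj x s)))"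
   using big.cond_sum_conj(1)[OF xB x H_subset cj_H[OF x] cj_H[OF big.ginv_G[OF x]], of \<theta>] unfolding xx by blast
  thus "(\<Sum>s\<in>?I Int H. ?i s * (\<theta> ?id - \<theta> (big.cj x s)) / of_nat ?h) = big.cond_sum H \<theta> (big.ginv x ` B) / of_nat ?h"
   by (simp add: sum_divide_distrib)
 qed
 also have "(\<Sum>x\<in>G. big.cond_sum H \<theta> (big.ginv x ` B)) = (\<Sum>x\<in>G. big.cond_sum H \<theta> (x ` B))"
  using group.inv_inv[OF big.group_G] unfolding big.gal_group_Rats
  by (intro sum.reindex_bij_witness[of _ big.ginv big.ginv]) (simp_all add: big.ginv_G)
 also have "... / of_nat ?h = of_nat (card (?I Int H)) * (\<Sum>\<gamma>\<in>\<Gamma>. conductor_exponent L k \<theta> (\<gamma> ` ?P))"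
  unfolding sc using h0 by simp
 finally have ins: "(\<Sum>s\<in>?I Int H. ?i s * (\<chi> ?id - \<chi> s)) =
  of_nat (card (?I Int H)) * (\<Sum>\<gamma>\<in>\<Gamma>. conductor_exponent L k \<theta> (\<gamma> ` ?P))" .
 have "big.cond_sum G \<chi> B = (\<Sum>s\<in>?I - H. ?i s * (\<chi> ?id - \<chi> s)) + (\<Sum>s\<in>?I Int H. ?i s * (\<chi> ?id - \<chi> s))"
  unfolding big.cond_sum_def Int_absorb2[OF IG]
  by (subst sum.Int_Diff[OF I.fin, of _ H]) (rule add.commute)
 hence "conductor_exponent L \<rat> \<chi> (QPrime p) = \<theta> ?id * of_nat (vD p) +
   conj_avg (conductor_exponent L k \<theta>) ?P"
  unfolding B(3) Int_absorb2[OF IG] out ins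
  using e I.card_pos aut_group.card_pos[OF inert_H_subgroup[OF B(1)]] by (simp add: add_divide_distrib conj_avg_def)
 thus "EX P. small.Prime P & small.residue_char P = p & conductor_exponent L \<rat> \<chi> (QPrime p) =
   \<theta> ?id * of_nat (vD p) +
   conj_avg (conductor_exponent L k \<theta>) P"
  using Prime_below[OF B(1)] residue_char_below[OF B(1)] pB by blast
qed

text \<open>For a restricted character every \<open>\<chi> 1 - Re (\<chi> s)\<close> is at most \<open>2 \<chi> 1\<close>, which is at most
  the contribution \<open>q \<chi> 1\<close> of the induced case.\<close>

lemma conductor_restricted:
 assumes p: "Factorial_Ring.prime p" and q: "Factorial_Ring.prime (card \<Gamma>)"
  and \<chi>: "\<chi> (restrict id L) = of_nat d" "!!g. g : G ==> norm (\<chi> g) <= real d"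
  and \<theta>: "!!x h. x : H ==> h : H ==> \<theta> (big.cj x h) = \<theta> h" and eq: "!!h. h : H ==> \<theta> h = \<chi> h"
  and pos: "!!P. small.Prime P ==> Re (conductor_exponent L k \<theta> P) >= 0"
 shows "EX P. small.Prime P & small.residue_char P = p & Re (conductor_exponent L \<rat> \<chi> (QPrime p)) \<le>
   real d * real (vD p) +
   conj_avg (%P. Re (conductor_exponent L k \<theta> P)) P"
proof -
 interpret H: aut_group L H by (rule H_subgroup)
 let ?id = "restrict id L"
 obtain B where B: "big.Prime B" "big.residue_char B = p"
  "conductor_exponent L \<rat> \<chi> (QPrime p) = big.cond_sum G \<chi> B / of_nat (card (big.inert B Int G))"
  using conductor_rational[OF p] by blast
 note pB = B(2)
 let ?I = "big.inert B" and ?P = "B Int k" and ?i = "%s. of_int (big.lower_index B s) :: real"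
 let ?m = "real (vD p)" and ?f = "%P. Re (conductor_exponent L k \<theta> P)"
 interpret I: aut_group L ?I by (rule big.inert_subgroup[OF B(1)])
 have IG: "?I <= G" by (rule inert_G[OF B(1)])
 note e = ramification_below(3)[OF B(1)]
 have q2: "real (card \<Gamma>) >= 2" using prime_ge_2_nat[OF q] by simp
 have i0: "?i s >= 0" if "s : ?I - H" for s
  using big.lower_index_iff(2)[OF B(1), of s] that H.id_mem by fastforce
 have "(\<Sum>s\<in>?I - H. ?i s * (real d - Re (\<chi> s))) <= (\<Sum>s\<in>?I - H. ?i s * (2 * real d))"
 proof (intro sum_mono mult_left_mono i0)
  fix s assume "s : ?I - H"
  hence "norm (\<chi> s) <= real d" using \<chi>(2) IG by blast
  thus "real d - Re (\<chi> s) <= 2 * real d" using abs_Re_le_cmod[of "\<chi> s"] by linarith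
 qed
 also have "... <= (\<Sum>s\<in>?I - H. ?i s * (real (card \<Gamma>) * real d))"
  using i0 q2 by (intro sum_mono mult_left_mono mult_right_mono) simp_all
 also have "... = real_of_int (int (card \<Gamma>) * (\<Sum>s\<in>?I - H. big.lower_index B s)) * real d"
  by (simp add: sum_distrib_left sum_distrib_right mult_ac)
 also have "... = real d * ?m * real (card ?I)"
  unfolding discriminant_valuation(1)[OF B(1) q] pB by simp
 finally have out: "(\<Sum>s\<in>?I - H. ?i s * (real d - Re (\<chi> s))) <= real d * ?m * real (card ?I)" .
 have hpos: "card (?I Int H) > 0" by (rule aut_group.card_pos[OF inert_H_subgroup[OF B(1)]])
 have cs: "conductor_exponent L k \<theta> ?P = big.cond_sum H \<theta> B / of_nat (card (?I Int H))"
  by (rule conductor_small[OF B(1) \<theta>])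
 have le: "?f ?P <= (\<Sum>\<gamma>\<in>\<Gamma>. ?f (\<gamma> ` ?P))"
 proof -
  have e: "restrict id k ` ?P = ?P" by auto
  have "?f (restrict id k ` ?P) <= (\<Sum>\<gamma>\<in>\<Gamma>. ?f (\<gamma> ` ?P))"
  proof (rule member_le_sum[OF small.id_mem _ small.fin])
   show "0 <= ?f (\<gamma> ` ?P)" if "\<gamma> : \<Gamma> - {restrict id k}" for \<gamma>
    using that by (intro pos small.Prime_image[OF Prime_below[OF B(1)]]) simp
  qed
  thus ?thesis unfolding e .
 qed
 have "(\<Sum>s\<in>?I Int H. ?i s * (real d - Re (\<chi> s))) = Re (big.cond_sum H \<theta> B)"
  unfolding big.cond_sum_def using eq H.id_mem \<chi>(1) by (auto intro!: sum.cong)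
 also have "... = real (card (?I Int H)) * ?f ?P"
  unfolding cs Re_divide_of_nat using hpos by simp
 also have "... <= real (card (?I Int H)) * (\<Sum>\<gamma>\<in>\<Gamma>. ?f (\<gamma> ` ?P))"
  by (rule mult_left_mono[OF le]) simp
 finally have ins: "(\<Sum>s\<in>?I Int H. ?i s * (real d - Re (\<chi> s))) <= real (card (?I Int H)) * (\<Sum>\<gamma>\<in>\<Gamma>. ?f (\<gamma> ` ?P))" .
 have "Re (big.cond_sum G \<chi> B) = (\<Sum>s\<in>?I - H. ?i s * (real d - Re (\<chi> s))) + (\<Sum>s\<in>?I Int H. ?i s * (real d - Re (\<chi> s)))"
  unfolding big.cond_sum_def Int_absorb2[OF IG] \<chi>(1)
  by (subst sum.Int_Diff[OF I.fin, of _ H]) simp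
 hence "Re (big.cond_sum G \<chi> B) <= real d * ?m * real (card ?I) + real (card (?I Int H)) * (\<Sum>\<gamma>\<in>\<Gamma>. ?f (\<gamma> ` ?P))"
  using out ins by linarith
 hence "Re (big.cond_sum G \<chi> B) / real (card ?I) \<le>
   (real d * ?m * real (card ?I) + real (card (?I Int H)) * (\<Sum>\<gamma>\<in>\<Gamma>. ?f (\<gamma> ` ?P))) / real (card ?I)"
  by (intro divide_right_mono) simp_all
 also have "... = real d * ?m + conj_avg ?f ?P"
  using e I.card_pos hpos by (simp add: add_divide_distrib conj_avg_def)
 finally have "Re (conductor_exponent L \<rat> \<chi> (QPrime p)) <= real d * ?m + conj_avg ?f ?P"
  unfolding B(3) Int_absorb2[OF IG] by (simp add: Re_divide_of_nat)
 thus ?thesis using Prime_below[OF B(1)] residue_char_below[OF B(1)] pB by blast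
qed

text \<open>Summation over all primes of the local expression common to the two cases.\<close>

lemma sum_local_conductors:
 fixes b :: "complex set => nat" and \<P> :: "nat => complex set" and d :: real
 assumes D: "discriminant k ~= 0" "prime_factors (nat \<bar>discriminant k\<bar>) <= T"
  and T: "finite T" "!!p. p : T ==> Factorial_Ring.prime p"
  and S: "small.residue_char ` {P. small.Prime P & b P ~= 0} <= T"
  and P: "!!p. p : T ==> small.Prime (\<P> p) & small.residue_char (\<P> p) = p"
 shows "(\<Sum>p\<in>T. (d * real (vD p) + conj_avg (%P. real (b P)) (\<P> p)) * ln (real p)) =
  d * ln \<bar>real_of_int (discriminant k)\<bar> + (\<Sum>P\<in>{P. small.Prime P & b P ~= 0}. real (b P) * ln (real (small.inorm P)))"
proof -
 let ?D = "nat \<bar>discriminant k\<bar>" and ?S = "{P. small.Prime P & b P ~= 0}"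
 let ?F = "%P. real (b P) * ln (real (small.inorm P))"
 have D0: "?D ~= 0" using D by simp
 have "real ?D = real (\<Prod>p\<in>prime_factors ?D. p ^ vD p)" using prod_prime_factors[OF D0] by simp
 hence "ln (real ?D) = (\<Sum>p\<in>prime_factors ?D. ln (real (p ^ vD p)))"
  unfolding of_nat_prod by (simp only:) (rule ln_prod, auto simp: prime_gt_0_nat in_prime_factors_iff)
 also have "... = (\<Sum>p\<in>prime_factors ?D. real (vD p) * ln (real p))"
  by (intro sum.cong refl) (simp add: ln_realpow prime_gt_0_nat in_prime_factors_iff)
 also have "... = (\<Sum>p\<in>T. real (vD p) * ln (real p))"
 proof (rule sum.mono_neutral_left[OF T(1) D(2)])
  show "ALL p:T - prime_factors ?D. real (vD p) * ln (real p) = 0"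
  proof
   fix p assume p: "p : T - prime_factors ?D"
   hence "~ p dvd ?D" using T(2) D0 in_prime_factors_iff[of p ?D] by blast
   hence "vD p = 0" by (rule not_dvd_imp_multiplicity_0)
   thus "real (vD p) * ln (real p) = 0" by (simp only: of_nat_0 mult_zero_left)
  qed
 qed
 finally have lnD: "ln (real ?D) = (\<Sum>p\<in>T. real (vD p) * ln (real p))" .
 have fin: "finite (small.primes_over p)" if "p : T" for p
  using P[OF that] small.primes_over_orbit[of "\<P> p"] small.fin by simp
 have "(\<Sum>p\<in>T. conj_avg (%P. real (b P)) (\<P> p) * ln (real p)) = (\<Sum>p\<in>T. \<Sum>P\<in>small.primes_over p. ?F P)"
 proof (rule sum.cong[OF refl])
  fix p assume "p : T"
  hence c: "small.Prime (\<P> p)" "small.residue_char (\<P> p) = p" using P by blast+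
  show "conj_avg (%P. real (b P)) (\<P> p) * ln (real p) = (\<Sum>P\<in>small.primes_over p. ?F P)"
   using small.sum_primes_over[OF c(1), of "%P. real (b P)"] unfolding c(2) by (simp add: conj_avg_def)
 qed
 also have "... = (\<Sum>P\<in>(\<Union>p\<in>T. small.primes_over p). ?F P)"
  by (rule sum.UNION_disjoint[symmetric, OF T(1)]) (use fin in blast, unfold small.primes_over_def, blast)
 also have "... = (\<Sum>P\<in>?S. ?F P)"
 proof (rule sum.mono_neutral_right)
  show "finite (\<Union>p\<in>T. small.primes_over p)" by (rule finite_UN_I[OF T(1) fin])
  show "?S <= (\<Union>p\<in>T. small.primes_over p)" using S unfolding small.primes_over_def by blast
  show "ALL P:(\<Union>p\<in>T. small.primes_over p) - ?S. ?F P = 0" unfolding small.primes_over_def by auto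
 qed
 finally have "(\<Sum>p\<in>T. conj_avg (%P. real (b P)) (\<P> p) * ln (real p)) = (\<Sum>P\<in>?S. ?F P)" .
 moreover have "real ?D = \<bar>real_of_int (discriminant k)\<bar>" by simp
 ultimately show ?thesis
  using lnD by (simp add: distrib_right sum.distrib sum_distrib_left mult.assoc)
qed

end

section \<open>Unramified towers over a Galois field are Galois\<close>

subsection \<open>Extension of automorphisms\<close>

context aut_group
begin

text \<open>A polynomial of degree less than \<open>card U\<close> vanishing at all conjugates of \<open>\<alpha>\<close> is zero.\<close>

lemma power_coordinates_unique:
 assumes \<alpha>: "\<alpha> : L" "inj_on (%\<sigma>. \<sigma> \<alpha>) U" and c: "!!j. j < card U ==> c j : Fix"
  and 0: "(\<Sum>j<card U. c j * \<alpha> ^ j) = 0" and j: "j < card U"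
 shows "c j = 0"
proof -
 define p where "p = (\<Sum>j<card U. Polynomial.monom (c j) j)"
 have cp: "poly.coeff p i = (if i < card U then c i else 0)" for i
  by (simp add: p_def coeff_sum if_distrib cong: if_cong)
 have root: "poly p (\<sigma> \<alpha>) = 0" if s: "\<sigma> : U" for \<sigma>
 proof -
  have cL: "c j : L" "\<sigma> (c j) = c j" if "j < card U" for j using c[OF that] s unfolding Fix_def by blast+
  have "\<sigma> (\<Sum>j<card U. c j * \<alpha> ^ j) = (\<Sum>j<card U. \<sigma> (c j * \<alpha> ^ j))"
   using cL(1) Lcl(5)[OF _ Lcl(7)[OF \<alpha>(1)]] by (intro hom_on_sum[OF L hom[OF s]]) simp
  also have "... = (\<Sum>j<card U. c j * \<sigma> \<alpha> ^ j)"
   using cL \<alpha>(1) by (intro sum.cong refl) (simp add: hom_simps(4,7)[OF s] Lcl(7))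
  finally show ?thesis using 0 hom_simps(2)[OF s] by (simp add: p_def poly_sum poly_monom)
 qed
 have "p = 0"
 proof (rule ccontr)
  assume p: "p ~= 0"
  have "card U = card ((%\<sigma>. \<sigma> \<alpha>) ` U)" using card_image[OF \<alpha>(2)] by simp
  also have "... <= card {x. poly p x = 0}" using root by (intro card_mono poly_roots_finite[OF p]) blast
  also have "... <= Polynomial.degree p" by (rule card_poly_roots_bound[OF p])
  finally have "card U <= Polynomial.degree p" .
  hence "poly.coeff p (Polynomial.degree p) = 0" by (simp add: cp)
  thus False using p by simp
 qed
 thus ?thesis using cp[of j] j by simp
qed

text \<open>With \<open>L = F(\<alpha>)\<close> and \<open>\<beta>\<close> a root of the conjugated minimal polynomial, the extension sends
  \<open>\<alpha>\<close> to \<open>\<beta>\<close>. It commutes with multiplication by \<open>\<alpha>\<close> because \<open>\<beta>\<close> satisfies the conjugated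
  relation, and is therefore multiplicative.\<close>

lemma extend_hom:
 assumes \<sigma>: "hom_on Fix \<sigma>" "!!x. x : Fix ==> \<sigma> x : Fix"
 shows "EX \<tau>. hom_on L \<tau> & (ALL x:Fix. \<tau> x = \<sigma> x)"
proof -
 let ?m = "card U"
 note FF = Fix_subfield and FR = csubfieldD(1)[OF Fix_subfield]
 note Fcl = csubringD[OF FR] csubring_uminus[OF FR]
 note s_add = hom_on_add[OF FF \<sigma>(1)] and s_mult = hom_on_mult[OF FF \<sigma>(1)] and s_diff = hom_on_diff[OF FF \<sigma>(1)]
  and s_zero = hom_on_zero[OF FF \<sigma>(1)]
 obtain \<alpha> where \<alpha>: "\<alpha> : L" "inj_on (%\<sigma>. \<sigma> \<alpha>) U" using primitive_element_exists by blast
 define f where "f = poly.coeff (cpoly \<alpha>)"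
 have fF: "f i : Fix" for i unfolding f_def by (rule cpoly_coeff[OF \<alpha>(1)])
 have fm: "f ?m = 1" using cpoly_monic[of \<alpha>] by (simp add: f_def cpoly_degree)
 have split: "{..?m} = insert ?m {..<?m}" by auto
 have "(\<Sum>j\<le>?m. f j * \<alpha> ^ j) = 0" using cpoly_self[OF \<alpha>(1)] by (simp add: poly_altdef f_def cpoly_degree)
 hence am: "\<alpha> ^ ?m = - (\<Sum>j<?m. f j * \<alpha> ^ j)" by (simp add: split fm add_eq_0_iff)
 define g where "g = (\<Sum>j\<le>?m. Polynomial.monom (\<sigma> (f j)) j)"
 have cg: "poly.coeff g i = (if i <= ?m then \<sigma> (f i) else 0)" for i
  by (simp add: g_def coeff_sum if_distrib cong: if_cong)
 have s1: "\<sigma> 1 = 1" using \<sigma>(1) by (simp add: hom_on_def)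
 have "Polynomial.degree g ~= 0"
  using le_degree[of g ?m] card_pos by (auto simp: cg fm s1)
 hence "~ constant (poly g)" by (simp add: constant_degree)
 then obtain \<beta> where "poly g \<beta> = 0" using fundamental_theorem_of_algebra by blast
 hence "(\<Sum>j\<le>?m. \<sigma> (f j) * \<beta> ^ j) = 0" by (simp add: g_def poly_sum poly_monom)
 hence bm: "\<beta> ^ ?m = - (\<Sum>j<?m. \<sigma> (f j) * \<beta> ^ j)" by (simp add: split fm s1 add_eq_0_iff)
 define C where "C x = (SOME c. (ALL j. c j : Fix) & x = (\<Sum>j<?m. c j * \<alpha> ^ j))" for x
 have C: "C x j : Fix" "x = (\<Sum>j<?m. C x j * \<alpha> ^ j)" if x: "x : L" for x j
 proof -
  obtain c where c: "ALL j<?m. c j : Fix" "x = (\<Sum>j<?m. c j * \<alpha> ^ j)" using power_coordinates[OF \<alpha> x] by blast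
  have "EX c. (ALL j. c j : Fix) & x = (\<Sum>j<?m. c j * \<alpha> ^ j)"
   using c Fcl(1) by (intro exI[of _ "%j. if j < ?m then c j else 0"]) auto
  from someI_ex[OF this] show "C x j : Fix" "x = (\<Sum>j<?m. C x j * \<alpha> ^ j)" unfolding C_def by blast+
 qed
 have Cu: "C x j = c j" if x: "x = (\<Sum>j<?m. c j * \<alpha> ^ j)" "!!j. c j : Fix" and j: "j < ?m" for x c j
 proof -
  have xL: "x : L" unfolding x(1) using x(2) Fix_subset by (intro Lcl(8) Lcl(5)[OF _ Lcl(7)[OF \<alpha>(1)]]) blast
  have "(\<Sum>j<?m. (C x j - c j) * \<alpha> ^ j) = 0" using C(2)[OF xL] x(1) by (simp add: left_diff_distrib sum_subtractf)
  from power_coordinates_unique[OF \<alpha> _ this j] show ?thesis using Fcl(4)[OF C(1)[OF xL] x(2)] by simp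
 qed
 define \<tau> where "\<tau> x = (\<Sum>j<?m. \<sigma> (C x j) * \<beta> ^ j)" for x
 have \<tau>: "\<tau> (\<Sum>j<?m. c j * \<alpha> ^ j) = (\<Sum>j<?m. \<sigma> (c j) * \<beta> ^ j)" if "!!j. c j : Fix" for c
  unfolding \<tau>_def using Cu[OF refl that] by simp
 have add: "\<tau> (x + y) = \<tau> x + \<tau> y" if x: "x : L" and y: "y : L" for x y
 proof -
  have "x + y = (\<Sum>j<?m. (C x j + C y j) * \<alpha> ^ j)" using C(2)[OF x] C(2)[OF y] by (simp add: distrib_right sum.distrib)
  hence "\<tau> (x + y) = (\<Sum>j<?m. \<sigma> (C x j + C y j) * \<beta> ^ j)" using \<tau>[OF Fcl(3)[OF C(1)[OF x] C(1)[OF y]]] by simp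
  thus ?thesis by (simp add: s_add C(1)[OF x] C(1)[OF y] distrib_right sum.distrib \<tau>_def)
 qed
 have scal: "\<tau> (d * x) = \<sigma> d * \<tau> x" if d: "d : Fix" and x: "x : L" for d x
 proof -
  have "d * x = (\<Sum>j<?m. (d * C x j) * \<alpha> ^ j)" using C(2)[OF x] by (metis (no_types, lifting) mult.assoc sum.cong sum_distrib_left)
  hence "\<tau> (d * x) = (\<Sum>j<?m. \<sigma> (d * C x j) * \<beta> ^ j)" using \<tau>[OF Fcl(5)[OF d C(1)[OF x]]] by simp
  thus ?thesis by (simp add: s_mult d C(1)[OF x] \<tau>_def sum_distrib_left mult.assoc)
 qed
 have shift: "\<tau> (\<alpha> * x) = \<beta> * \<tau> x" if x: "x : L" for x
 proof -
  define c where "c j = (if j = 0 then 0 else C x (j - 1)) - C x (?m - 1) * f j" for j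
  have cF: "c j : Fix" for j unfolding c_def using C(1)[OF x] fF Fcl(1) by (intro Fcl(4) Fcl(5)) auto
  have rec: "(\<Sum>j<?m. (if j = 0 then 0 else h (j - 1)) * z ^ j) + h (?m - 1) * z ^ ?m = z * (\<Sum>j<?m. h j * z ^ j)"
   for h :: "nat => complex" and z
  proof -
   obtain m where m: "?m = Suc m" using card_pos by (cases ?m) auto
   have "(\<Sum>j<?m. (if j = 0 then 0 else h (j - 1)) * z ^ j) = (\<Sum>j<m. h j * z ^ Suc j)"
    unfolding m by (subst sum.lessThan_Suc_shift) simp
   thus ?thesis by (simp add: m sum_distrib_left distrib_left mult_ac)
  qed
  have lin: "(\<Sum>j<?m. (a j - b * u j) * z ^ j) = (\<Sum>j<?m. a j * z ^ j) - b * (\<Sum>j<?m. u j * z ^ j)"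
   for a u :: "nat => complex" and b z
   by (simp add: left_diff_distrib sum_subtractf sum_distrib_left mult.assoc)
  have "\<alpha> * x = \<alpha> * (\<Sum>j<?m. C x j * \<alpha> ^ j)" using C(2)[OF x] by simp
  also have "... = (\<Sum>j<?m. c j * \<alpha> ^ j)" unfolding rec[symmetric] am c_def lin by simp
  finally have "\<tau> (\<alpha> * x) = (\<Sum>j<?m. \<sigma> (c j) * \<beta> ^ j)" using \<tau>[OF cF] by simp
  also have "\<sigma> (c j) = (if j = 0 then 0 else \<sigma> (C x (j - 1))) - \<sigma> (C x (?m - 1)) * \<sigma> (f j)" for j
   unfolding c_def using C(1)[OF x] fF Fcl(1) by (subst s_diff) (auto intro: Fcl(5) simp: s_mult s_zero)
  hence "(\<Sum>j<?m. \<sigma> (c j) * \<beta> ^ j) =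
    (\<Sum>j<?m. ((if j = 0 then 0 else \<sigma> (C x (j - 1))) - \<sigma> (C x (?m - 1)) * \<sigma> (f j)) * \<beta> ^ j)" by simp
  also have "... = \<beta> * \<tau> x"
   unfolding \<tau>_def rec[of "%j. \<sigma> (C x j)", symmetric] bm lin by simp
  finally show ?thesis .
 qed
 have pow: "\<tau> (\<alpha> ^ i * x) = \<beta> ^ i * \<tau> x" if x: "x : L" for i x
 proof (induction i)
  case (Suc i)
  have "\<alpha> ^ i * x : L" by (rule Lcl(5)[OF Lcl(7)[OF \<alpha>(1)] x])
  from shift[OF this] show ?case by (simp add: Suc mult.assoc)
 qed simp
 have sum: "\<tau> (\<Sum>j<k. h j) = (\<Sum>j<k. \<tau> (h j))" if "!!j. h j : L" for h and k :: nat
 proof (induction k)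
  case 0
  show ?case using \<tau>[of "%_. 0"] Fcl(1) by (simp add: s_zero)
 next
  case (Suc k)
  have "(\<Sum>j<k. h j) : L" using that by (intro Lcl(8))
  thus ?case using add[OF _ that[of k]] Suc by simp
 qed
 have mult: "\<tau> (y * x) = \<tau> y * \<tau> x" if x: "x : L" and y: "y : L" for x y
 proof -
  have hL: "C y j * (\<alpha> ^ j * x) : L" for j
   using C(1)[OF y] Fix_subset by (intro Lcl(5)[OF _ Lcl(5)[OF Lcl(7)[OF \<alpha>(1)] x]]) blast
  have "y * x = (\<Sum>j<?m. C y j * (\<alpha> ^ j * x))"
   by (subst C(2)[OF y]) (simp add: sum_distrib_right mult.assoc)
  hence "\<tau> (y * x) = (\<Sum>j<?m. \<tau> (C y j * (\<alpha> ^ j * x)))" using sum[OF hL] by simp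
  also have "... = (\<Sum>j<?m. \<sigma> (C y j) * (\<beta> ^ j * \<tau> x))"
   by (intro sum.cong refl) (simp add: scal[OF C(1)[OF y] Lcl(5)[OF Lcl(7)[OF \<alpha>(1)] x]] pow[OF x])
  also have "... = \<tau> y * \<tau> x" by (simp add: \<tau>_def sum_distrib_right mult.assoc)
  finally show ?thesis .
 qed
 have ext: "\<tau> x = \<sigma> x" if x: "x : Fix" for x
 proof -
  have xs: "x = (\<Sum>j<?m. (if j = 0 then x else 0) * \<alpha> ^ j)"
   using card_pos by (simp add: if_distrib[of "%x. x * _"] cong: if_cong)
  have "\<tau> (\<Sum>j<?m. (if j = 0 then x else 0) * \<alpha> ^ j) = (\<Sum>j<?m. \<sigma> (if j = 0 then x else 0) * \<beta> ^ j)"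
   by (rule \<tau>) (simp add: x Fcl(1))
  also have "... = \<sigma> x"
   using card_pos by (simp add: s_zero if_distrib[of \<sigma>] if_distrib[of "%x. x * _"] cong: if_cong)
  finally show ?thesis using xs by simp
 qed
 have "\<tau> 1 = 1" using ext[OF Fcl(2)] s1 by simp
 hence "hom_on L \<tau>" using add mult by (auto simp: hom_on_def)
 thus ?thesis using ext by blast
qed

end

subsection \<open>Transport along an isomorphism of extensions\<close>

text \<open>An extension \<open>\<tau>\<close> of an automorphism of \<open>F\<close> to a field \<open>L\<close>, which it carries to a possibly different
  field \<open>L'\<close>. Everything that defines a Hilbert class field over \<open>F\<close> is carried along.\<close>

locale field_iso =
 fixes L L' F :: "complex set" and \<tau> :: "complex => complex"
 assumes L: "csubfield L" and hom: "hom_on L \<tau>" and im: "\<tau> ` L = L'" and FL: "F <= L" and F: "\<tau> ` F = F"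
begin

abbreviation "\<tau>' \<equiv> inv_into L \<tau>"

lemmas LR = csubfieldD(1)[OF L]
lemmas Lc = csubringD[OF LR] csubring_uminus[OF LR] csubfieldD(2)[OF L]

lemma inj: "inj_on \<tau> L" by (rule hom_on_inj[OF L hom])

lemma L': "csubfield L'"
 unfolding csubfield_def csubring_def
proof (intro conjI ballI)
 note h = hom_on_zero[OF L hom] hom_on_one[OF L hom] hom_on_add[OF L hom] hom_on_diff[OF L hom]
  hom_on_mult[OF L hom] hom_on_inverse[OF L hom]
 show "0 : L'" "1 : L'" unfolding im[symmetric] using Lc(1,2) h(1,2) by force+
 fix x assume "x : L'"
 then obtain a where a: "a : L" "x = \<tau> a" using im by blast
 show "inverse x : L'" unfolding im[symmetric] a(2) h(6)[OF a(1), symmetric] by (rule imageI[OF Lc(7)[OF a(1)]])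
 fix y assume "y : L'"
 then obtain b where b: "b : L" "y = \<tau> b" using im by blast
 show "x + y : L'" unfolding im[symmetric] a(2) b(2) h(3)[OF a(1) b(1), symmetric] by (rule imageI[OF Lc(3)[OF a(1) b(1)]])
 show "x - y : L'" unfolding im[symmetric] a(2) b(2) h(4)[OF a(1) b(1), symmetric] by (rule imageI[OF Lc(4)[OF a(1) b(1)]])
 show "x * y : L'" unfolding im[symmetric] a(2) b(2) h(5)[OF a(1) b(1), symmetric] by (rule imageI[OF Lc(5)[OF a(1) b(1)]])
qed

lemma inv1: "x : L ==> \<tau>' (\<tau> x) = x" by (rule inv_into_f_f[OF inj])

lemma inv2: "y : L' ==> \<tau> (\<tau>' y) = y" unfolding im[symmetric] by (rule f_inv_into_f)

lemma inv_mem: "y : L' ==> \<tau>' y : L" unfolding im[symmetric] by (rule inv_into_into)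

lemma hom_inv: "hom_on L' \<tau>'"
 unfolding hom_on_def
proof (intro conjI ballI)
 show "\<tau>' 1 = 1" using inv1[OF Lc(2)] by (simp add: hom_on_one[OF L hom])
 fix x y assume x: "x : L'" and y: "y : L'"
 note m = inv_mem[OF x] inv_mem[OF y]
 have "\<tau> (\<tau>' x + \<tau>' y) = x + y" "\<tau> (\<tau>' x * \<tau>' y) = x * y"
  by (simp_all add: hom_on_add[OF L hom m] hom_on_mult[OF L hom m] inv2 x y)
 thus "\<tau>' (x + y) = \<tau>' x + \<tau>' y" "\<tau>' (x * y) = \<tau>' x * \<tau>' y"
  using inv1[OF Lc(3)[OF m]] inv1[OF Lc(5)[OF m]] by simp_all
qed

lemma inv_iso: "field_iso L' L F \<tau>'"
proof
 show "\<tau>' ` L' = L" using inv1 inv_mem im by force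
 show "F <= L'" using F FL im by blast
 have "\<tau>' ` F = \<tau>' ` \<tau> ` F" by (simp only: F)
 also have "... = (%x. x) ` F" unfolding image_image using inv1 FL by (intro image_cong) auto
 finally show "\<tau>' ` F = F" by simp
qed (rule L', rule hom_inv)

lemma inv_inv: "x : L ==> inv_into L' \<tau>' x = \<tau> x"
 using field_iso.inv1[OF inv_iso, of "\<tau> x"] inv1 im by auto

lemma image_inverse_image: "S <= L ==> \<tau>' ` \<tau> ` S = S" "T <= L' ==> \<tau> ` \<tau>' ` T = T"
 using inv1 inv2 by (force simp: image_image)+

lemma algebraic_int_iff: "x : L ==> algebraic_int (\<tau> x) \<longleftrightarrow> algebraic_int x"
 using hom_on_algebraic_int[OF L hom] hom_on_algebraic_int[OF L' hom_inv, of "\<tau> x"] inv1 im by fastforce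

lemma image_roi: "\<tau> ` {x : L. algebraic_int x} = {x : L'. algebraic_int x}"
 using algebraic_int_iff im by auto

lemma conj_gal:
 assumes s: "s : carrier (gal_group L F)"
 shows "restrict (%y. \<tau> (s (\<tau>' y))) L' : carrier (gal_group L' F)"
proof -
 have b: "bij_betw s L L" and h: "hom_on L s" and f: "ALL x:F. s x = x" using s by (auto simp: gal_carrier)
 have sL: "s x : L" if "x : L" for x using b that by (auto simp: bij_betw_def)
 have "bij_betw \<tau>' L' L" "bij_betw \<tau> L L'"
  using field_iso.inj[OF inv_iso] field_iso.im[OF inv_iso] inj im by (auto simp: bij_betw_def)
 hence "bij_betw (\<tau> \<circ> (s \<circ> \<tau>')) L' L'" using b by (intro bij_betw_trans)
 hence "bij_betw (%y. \<tau> (s (\<tau>' y))) L' L'" by (simp add: comp_def)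
 moreover have "hom_on L' (restrict (%y. \<tau> (s (\<tau>' y))) L')"
  using h hom hom_inv inv_mem sL csubringD(2,3,5)[OF csubfieldD(1)[OF L']] by (auto simp: hom_on_def)
 moreover have "\<tau> (s (\<tau>' y)) = y" if "y : F" for y
 proof -
  have "\<tau>' y : F" using field_iso.F[OF inv_iso] that by blast
  moreover have "y : L'" using that F FL im by blast
  ultimately show ?thesis using f inv2 by simp
 qed
 moreover have "F <= L'" using F FL im by blast
 ultimately show ?thesis by (auto simp: gal_carrier)
qed

lemma finite_field_ext_image:
 assumes "finite_field_ext L F"
 shows "finite_field_ext L' F"
proof -
 note D = finite_field_extD[OF assms]
 obtain Us where Us: "set Us <= L" "L = {\<Sum>j<length Us. c j * Us ! j |c. ALL j<length Us. c j : F}" using D(4) by blast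
 have im_sum: "\<tau> (\<Sum>j<length Us. c j * Us ! j) = (\<Sum>j<length Us. \<tau> (c j) * \<tau> (Us ! j))" if c: "ALL j<length Us. c j : F" for c
 proof -
  have m: "c j : L" "Us ! j : L" if "j < length Us" for j using that c FL Us(1) by auto
  have "\<tau> (\<Sum>j<length Us. c j * Us ! j) = (\<Sum>j<length Us. \<tau> (c j * Us ! j))"
   using m Lc(5) by (intro hom_on_sum[OF L hom]) simp
  thus ?thesis using m by (simp add: hom_on_mult[OF L hom])
 qed
 have "ring.Span \<CC> F (map \<tau> Us) = L'"
  unfolding Span_conv_sum[OF D(2)]
 proof (intro equalityI subsetI)
  fix x assume "x : {\<Sum>j<length (map \<tau> Us). c j * map \<tau> Us ! j |c. ALL j<length (map \<tau> Us). c j : F}"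
  then obtain c where c: "x = (\<Sum>j<length Us. c j * \<tau> (Us ! j))" "ALL j<length Us. c j : F" by auto
  define d where "d j = \<tau>' (c j)" for j
  have d: "d j : F" "\<tau> (d j) = c j" if "j < length Us" for j
  proof -
   have "c j : F" using c(2) that by blast
   thus "d j : F" "\<tau> (d j) = c j"
    unfolding d_def using field_iso.F[OF inv_iso] field_iso.FL[OF inv_iso] inv2[of "c j"] by blast+
  qed
  hence "x = \<tau> (\<Sum>j<length Us. d j * Us ! j)" using im_sum[of d] c(1) by simp
  moreover have "(\<Sum>j<length Us. d j * Us ! j) : L" using d(1) by (subst Us(2)) blast
  ultimately show "x : L'" using im by blast
 next
  fix x assume "x : L'"
  then obtain a where a: "a : L" "x = \<tau> a" using im by blast
  then obtain c where c: "a = (\<Sum>j<length Us. c j * Us ! j)" "ALL j<length Us. c j : F" using Us(2) by blast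
  have "x = (\<Sum>j<length (map \<tau> Us). \<tau> (c j) * map \<tau> Us ! j)" using a(2) c(1) im_sum[OF c(2)] by simp
  moreover have "ALL j<length (map \<tau> Us). \<tau> (c j) : F" using c(2) F by auto
  ultimately show "x : {\<Sum>j<length (map \<tau> Us). c j * map \<tau> Us ! j |c. ALL j<length (map \<tau> Us). c j : F}"
   by (intro CollectI exI[of _ "%j. \<tau> (c j)"] conjI)
 qed
 moreover have "ring.finite_dimension \<CC> F (ring.Span \<CC> F (map \<tau> Us))"
  using D(2) by (intro ring.Span_finite_dimension[OF ring_C]) (simp_all add: subfield_iff_csubfield)
 ultimately show ?thesis
  using L' D(2) field_iso.FL[OF inv_iso] by (simp add: finite_field_ext_def subfield_iff_csubfield)
qed

lemma galois_ext_image: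
 assumes g: "galois_ext L F"
 shows "galois_ext L' F"
proof -
 have fx: "{x : L. ALL \<sigma>:carrier (gal_group L F). \<sigma> x = x} = F" and fin: "finite_field_ext L F" using g by (simp_all add: galois_ext_def)
 have "x : F" if x: "x : L'" "ALL \<sigma>:carrier (gal_group L' F). \<sigma> x = x" for x
 proof -
  have "s (\<tau>' x) = \<tau>' x" if s: "s : carrier (gal_group L F)" for s
  proof -
   have "restrict (%y. \<tau> (s (\<tau>' y))) L' x = x" using x(2) conj_gal[OF s] by blast
   hence "\<tau> (s (\<tau>' x)) = x" using x(1) by simp
   moreover have "s (\<tau>' x) : L" using s inv_mem[OF x(1)] by (auto simp: gal_carrier bij_betw_def)
   ultimately show ?thesis using inv1 by fastforce
  qed
  hence "\<tau>' x : F" using fx inv_mem[OF x(1)] by blast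
  hence "\<tau> (\<tau>' x) : F" using F by blast
  thus ?thesis using inv2[OF x(1)] by simp
 qed
 moreover have "F <= {x : L'. ALL \<sigma>:carrier (gal_group L' F). \<sigma> x = x}"
  using field_iso.FL[OF inv_iso] by (auto simp: gal_carrier)
 ultimately show ?thesis using finite_field_ext_image[OF fin] by (auto simp: galois_ext_def)
qed

lemma conj_gal_inverse:
 assumes s: "s : carrier (gal_group L' F)"
 shows "EX r:carrier (gal_group L F). s = restrict (%y. \<tau> (r (\<tau>' y))) L'"
proof
 let ?r = "restrict (%y. \<tau>' (s (inv_into L' \<tau>' y))) L"
 show "?r : carrier (gal_group L F)" by (rule field_iso.conj_gal[OF inv_iso s])
 show "s = restrict (%y. \<tau> (?r (\<tau>' y))) L'"
 proof (rule extensionalityI[of _ L'])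
  fix y assume y: "y : L'"
  have "s y : L'" using s y by (auto simp: gal_carrier bij_betw_def)
  thus "s y = restrict (%y. \<tau> (?r (\<tau>' y))) L' y" using y inv_mem[OF y] by (simp add: inv_inv inv2)
 qed (use s in \<open>auto simp: gal_carrier\<close>)
qed

lemma gal_group_image:
 assumes fin: "finite_field_ext L F" and comm: "comm_group (gal_group L F)"
 shows "comm_group (gal_group L' F)" "Coset.order (gal_group L' F) = Coset.order (gal_group L F)"
proof -
 let ?c = "%s. restrict (%y. \<tau> (s (\<tau>' y))) L'"
 have sL: "s x : L" if "s : carrier (gal_group L F)" "x : L" for s x
  using that by (auto simp: gal_carrier bij_betw_def)
 have cc: "compose L' (?c s) (?c t) = ?c (compose L s t)"
  if "s : carrier (gal_group L F)" "t : carrier (gal_group L F)" for s t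
 proof
  fix y
  have "\<tau> (t (\<tau>' y)) : L'" "\<tau>' (\<tau> (t (\<tau>' y))) = t (\<tau>' y)" if "y : L'"
   using sL[OF \<open>t : _\<close> inv_mem[OF that]] inv1 im by auto
  thus "compose L' (?c s) (?c t) y = ?c (compose L s t) y" using inv_mem by (simp add: compose_def)
 qed
 have group: "group (gal_group L' F)"
  using L' field_iso.FL[OF inv_iso] finite_gal[OF finite_field_ext_image[OF fin]] by (rule group_gal)
 show "comm_group (gal_group L' F)"
 proof (rule group.group_comm_groupI[OF group])
  fix a b assume a: "a : carrier (gal_group L' F)" and b: "b : carrier (gal_group L' F)"
  obtain s where s: "s : carrier (gal_group L F)" "a = ?c s" using conj_gal_inverse[OF a] by blast
  obtain t where t: "t : carrier (gal_group L F)" "b = ?c t" using conj_gal_inverse[OF b] by blast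
  have "compose L s t = compose L t s"
   using comm_monoid.m_comm[OF comm_group.axioms(1)[OF comm] s(1) t(1)] by (simp add: gal_mult s(1) t(1))
  thus "a \<otimes>\<^bsub>gal_group L' F\<^esub> b = b \<otimes>\<^bsub>gal_group L' F\<^esub> a"
   using cc[OF s(1) t(1)] cc[OF t(1) s(1)] by (simp add: gal_mult[OF a b] gal_mult[OF b a]) (simp add: s(2) t(2))
 qed
 have "inj_on ?c (carrier (gal_group L F))"
 proof (rule inj_onI)
  fix s t assume s: "s : carrier (gal_group L F)" and t: "t : carrier (gal_group L F)" and eq: "?c s = ?c t"
  show "s = t"
  proof (rule extensionalityI[of _ L])
   fix x assume x: "x : L"
   hence "\<tau> (s x) = \<tau> (t x)" using fun_cong[OF eq, of "\<tau> x"] im inv1 by auto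
   thus "s x = t x" using inj_onD[OF inj] sL s t x by blast
  qed (use s t in \<open>auto simp: gal_carrier\<close>)
 qed
 moreover have "?c ` carrier (gal_group L F) = carrier (gal_group L' F)"
  using conj_gal conj_gal_inverse by blast
 ultimately show "Coset.order (gal_group L' F) = Coset.order (gal_group L F)"
  unfolding Coset.order_def by (metis card_image)
qed

lemma ideal_image:
 assumes I: "ideal I (ring_of_integers L)"
 shows "ideal (\<tau> ` I) (ring_of_integers L')"
proof -
 have i: "I <= {x : L. algebraic_int x}" "0 : I" "!!x y. x : I ==> y : I ==> x + y : I"
  "!!x y. x : I ==> y : {x : L. algebraic_int x} ==> x * y : I"
  using I unfolding ideal_roi_iff[OF L] by blast+
 have IL: "x : L" if "x : I" for x using i(1) that by blast
 show ?thesis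
  unfolding ideal_roi_iff[OF L'] image_roi[symmetric]
 proof (intro conjI ballI)
  show "\<tau> ` I <= \<tau> ` {x : L. algebraic_int x}" by (rule image_mono[OF i(1)])
  show "0 : \<tau> ` I" using i(2) hom_on_zero[OF L hom] by force
  fix x assume "x : \<tau> ` I"
  then obtain a where a: "a : I" "x = \<tau> a" by blast
  {
   fix y assume "y : \<tau> ` I"
   then obtain b where b: "b : I" "y = \<tau> b" by blast
   show "x + y : \<tau> ` I" unfolding a(2) b(2) hom_on_add[OF L hom IL[OF a(1)] IL[OF b(1)], symmetric]
    by (rule imageI[OF i(3)[OF a(1) b(1)]])
  next
   fix y assume "y : \<tau> ` {x : L. algebraic_int x}"
   then obtain b where b: "b : {x : L. algebraic_int x}" "y = \<tau> b" by blast
   hence bL: "b : L" by blast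
   show "x * y : \<tau> ` I" unfolding a(2) b(2) hom_on_mult[OF L hom IL[OF a(1)] bL, symmetric]
    by (rule imageI[OF i(4)[OF a(1) b(1)]])
  }
 qed
qed

lemma ideal_L: "ideal I (ring_of_integers L) ==> I <= L"
 unfolding ideal_roi_iff[OF L] by blast

lemma primes_of_image:
 assumes P: "P : primes_of L"
 shows "\<tau> ` P : primes_of L'"
proof -
 have I: "ideal P (ring_of_integers L)" and nc: "{x : L. algebraic_int x} ~= P" and P0: "P ~= {0}"
  and pr: "!!a b. a : L ==> algebraic_int a ==> b : L ==> algebraic_int b ==> a * b : P ==> a : P | b : P"
  using P unfolding primes_of_def primeideal_def primeideal_axioms_def by auto
 note PL = ideal_L[OF I]
 have mem: "\<tau> x : \<tau> ` P \<longleftrightarrow> x : P" if "x : L" for x using inj_on_image_mem_iff[OF inj that PL] .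
 have "primeideal (\<tau> ` P) (ring_of_integers L')"
 proof (rule primeidealI[OF ideal_image[OF I] cring_roi[OF L']])
  show "carrier (ring_of_integers L') ~= \<tau> ` P"
   using inj_on_image_eq_iff[OF inj _ PL, of "{x : L. algebraic_int x}"] nc by (simp add: image_roi[symmetric])
  fix x y assume xy: "x : carrier (ring_of_integers L')" "y : carrier (ring_of_integers L')" "x \<otimes>\<^bsub>ring_of_integers L'\<^esub> y : \<tau> ` P"
  obtain a b where a: "a : L" "algebraic_int a" "x = \<tau> a" and b: "b : L" "algebraic_int b" "y = \<tau> b"
   using xy(1,2) by (auto simp: image_roi[symmetric])
  hence "a * b : P" using xy(3) mem[OF Lc(5)[OF a(1) b(1)]] by (simp add: hom_on_mult[OF L hom])
  thus "x : \<tau> ` P | y : \<tau> ` P" using pr[OF a(1,2) b(1,2)] a(3) b(3) by blast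
 qed
 moreover have "\<tau> ` P ~= {0}"
 proof
  assume "\<tau> ` P = {0}"
  hence "\<tau> x = 0" if "x : P" for x using that by blast
  hence "x = 0" if "x : P" for x using hom_on_eq_0_iff[OF L hom, of x] PL that by blast
  moreover have "0 : P" using I unfolding ideal_roi_iff[OF L] by blast
  ultimately show False using P0 by blast
 qed
 ultimately show ?thesis by (simp add: primes_of_def)
qed

lemma genideal_image_subset:
 assumes S: "S <= {x : L. algebraic_int x}"
 shows "Idl\<^bsub>ring_of_integers L'\<^esub> (\<tau> ` S) <= \<tau> ` (Idl\<^bsub>ring_of_integers L\<^esub> S)"
proof (rule ring.genideal_minimal)
 show "ring (ring_of_integers L')" using cring_roi[OF L'] by (simp add: cring_def)
 have R: "ring (ring_of_integers L)" using cring_roi[OF L] by (simp add: cring_def)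
 show "ideal (\<tau> ` (Idl\<^bsub>ring_of_integers L\<^esub> S)) (ring_of_integers L')"
  using ring.genideal_ideal[OF R] S by (intro ideal_image) simp
 show "\<tau> ` S <= \<tau> ` (Idl\<^bsub>ring_of_integers L\<^esub> S)" using ring.genideal_self[OF R, of S] S by (intro image_mono) simp
qed

lemma ideal_power_image:
 assumes I: "ideal I (ring_of_integers L)"
 shows "ideal (ideal_power L I e) (ring_of_integers L) & \<tau> ` ideal_power L I e <= ideal_power L' (\<tau> ` I) e"
proof (induction e)
 case 0
 interpret R: cring "ring_of_integers L" by (rule cring_roi[OF L])
 show ?case using R.oneideal by (simp add: ideal_power_def ideals_set_def image_roi)
next
 case (Suc e)
 interpret R: cring "ring_of_integers L" by (rule cring_roi[OF L])
 have s: "ideal_power E J (Suc e) = ideal_prod (ring_of_integers E) (ideal_power E J e) J" for E J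
  by (simp add: ideal_power_def ideals_set_def nat_pow_def)
 have J: "ideal (ideal_power L I e) (ring_of_integers L)" using Suc by blast
 have id: "ideal (ideal_prod (ring_of_integers L) (ideal_power L I e) I) (ring_of_integers L)" by (rule R.ideal_prod_is_ideal[OF J I])
 have "\<tau> z : ideal_prod (ring_of_integers L') (ideal_power L' (\<tau> ` I) e) (\<tau> ` I) & z : L"
  if "z : ideal_prod (ring_of_integers L) (ideal_power L I e) I" for z
  using that
 proof (induction z)
  case (prod i j)
  have L: "i : L" "j : L" using prod ideal_L[OF J] ideal_L[OF I] by blast+
  have "\<tau> i : ideal_power L' (\<tau> ` I) e" "\<tau> j : \<tau> ` I" using prod Suc by blast+
  from ideal_prod.prod[OF this, of "ring_of_integers L'"] show ?case
   using hom_on_mult[OF field_iso.L[OF field_iso_axioms] hom L] Lc(5)[OF L] by simp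
 next
  case (sum s1 s2)
  thus ?case
   using ideal_prod.sum[of "\<tau> s1" "ring_of_integers L'" _ _ "\<tau> s2"] hom_on_add[OF L hom] Lc(3) by simp
 qed
 thus ?case using id unfolding s by blast
qed

lemma ramification_index_image:
 assumes B: "B : primes_of L"
 shows "ramification_index L' F (\<tau> ` B) = ramification_index L F B"
proof -
 interpret i: field_iso L' L F \<tau>' by (rule inv_iso)
 have I: "ideal B (ring_of_integers L)" using B by (simp add: primes_of_def primeideal.axioms(1))
 note BL = ideal_L[OF I]
 have int: "\<tau> ` B Int F = \<tau> ` (B Int F)" using inj_on_image_Int[OF inj BL FL] F by simp
 have BO: "B Int F <= {x : L. algebraic_int x}" using I unfolding ideal_roi_iff[OF L] by blast
 have BO': "\<tau> ` (B Int F) <= {x : L'. algebraic_int x}" using image_mono[OF BO, of \<tau>] by (simp add: image_roi)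
 note p = ideal_power_image[OF I] and I' = ideal_image[OF I]
 have R: "ring (ring_of_integers L)" using cring_roi[OF L] by (simp add: cring_def)
 have GL: "Idl\<^bsub>ring_of_integers L\<^esub> (B Int F) <= L" using ideal_L[OF ring.genideal_ideal[OF R]] BO by simp
 have "Idl\<^bsub>ring_of_integers L\<^esub> (B Int F) <= ideal_power L B e \<longleftrightarrow>
   Idl\<^bsub>ring_of_integers L'\<^esub> (\<tau> ` (B Int F)) <= ideal_power L' (\<tau> ` B) e" for e
 proof
  assume "Idl\<^bsub>ring_of_integers L\<^esub> (B Int F) <= ideal_power L B e"
  hence "\<tau> ` (Idl\<^bsub>ring_of_integers L\<^esub> (B Int F)) <= ideal_power L' (\<tau> ` B) e" using p[of e] by blast
  thus "Idl\<^bsub>ring_of_integers L'\<^esub> (\<tau> ` (B Int F)) <= ideal_power L' (\<tau> ` B) e"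
   using genideal_image_subset[OF BO] by blast
 next
  assume a: "Idl\<^bsub>ring_of_integers L'\<^esub> (\<tau> ` (B Int F)) <= ideal_power L' (\<tau> ` B) e"
  have e: "\<tau>' ` \<tau> ` B = B" "\<tau>' ` \<tau> ` (B Int F) = B Int F" using BL by (intro image_inverse_image; blast)+
  have "Idl\<^bsub>ring_of_integers L\<^esub> (B Int F) <= \<tau>' ` (Idl\<^bsub>ring_of_integers L'\<^esub> (\<tau> ` (B Int F)))"
   using i.genideal_image_subset[OF BO'] unfolding e .
  also have "... <= \<tau>' ` ideal_power L' (\<tau> ` B) e" by (rule image_mono[OF a])
  also have "... <= ideal_power L B e" using i.ideal_power_image[OF I', of e] unfolding e by blast
  finally show "Idl\<^bsub>ring_of_integers L\<^esub> (B Int F) <= ideal_power L B e" .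
 qed
 thus ?thesis unfolding ramification_index_def int by simp
qed

lemma unramified_image:
 assumes u: "unramified_ext L F"
 shows "unramified_ext L' F"
 unfolding unramified_ext_def
proof (intro conjI ballI impI)
 interpret i: field_iso L' L F \<tau>' by (rule inv_iso)
 fix B assume B: "B : primes_of L'"
 have B': "\<tau>' ` B : primes_of L" by (rule i.primes_of_image[OF B])
 have "B <= L'" using i.ideal_L B by (simp add: primes_of_def primeideal.axioms(1))
 hence "\<tau> ` \<tau>' ` B = B" by (rule image_inverse_image(2))
 thus "ramification_index L' F B = 1"
  using ramification_index_image[OF B'] u B' by (simp add: unramified_ext_def)
next
 fix \<phi> assume \<phi>: "\<phi> : embeddings L'" and re: "\<phi> ` F <= \<real>"
 have h: "hom_on L' \<phi>" using \<phi> by (auto simp: embeddings_def Ring.ring_hom_def hom_on_def)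
 define \<psi> where "\<psi> = restrict (%x. \<phi> (\<tau> x)) L"
 have m: "\<tau> x : L'" if "x : L" for x using im that by blast
 have "hom_on L \<psi>" using h hom m Lc(2,3,5) by (auto simp: hom_on_def \<psi>_def)
 hence "\<psi> : embeddings L" by (auto simp: embeddings_def Ring.ring_hom_def hom_on_def \<psi>_def)
 moreover have "\<psi> ` F <= \<real>"
 proof -
  have "\<psi> ` F = \<phi> ` \<tau> ` F" using FL by (auto simp: \<psi>_def image_image)
  thus ?thesis using re F by simp
 qed
 ultimately have "\<psi> ` L <= \<real>" using u by (simp add: unramified_ext_def)
 moreover have "\<psi> ` L = \<phi> ` \<tau> ` L" by (simp add: \<psi>_def image_image)
 ultimately show "\<phi> ` L' <= \<real>" using im by simp
qed

lemma unramified_abelian_p_ext_image: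
 "unramified_abelian_p_ext p L F ==> unramified_abelian_p_ext p L' F"
 using galois_ext_image unramified_image gal_group_image
 by (auto simp: unramified_abelian_p_ext_def galois_ext_def)

end

text \<open>The maximality of the Hilbert class field makes it stable under every extension of an
  automorphism of the ground field; the extension is onto since it permutes the conjugates of each
  element.\<close>

lemma hilbert_p_class_field_galois:
 assumes F: "galois_ext F \<rat>" and L: "is_hilbert_p_class_field p F L"
 shows "galois_ext L \<rat>" "F <= L"
proof -
 have LF: "galois_ext L F" and un: "unramified_abelian_p_ext p L F"
  and max: "!!E. unramified_abelian_p_ext p E F ==> E <= L"
  using L by (auto simp: is_hilbert_p_class_field_def unramified_abelian_p_ext_def)
 have fF: "finite_field_ext F \<rat>" and fL: "finite_field_ext L F" using F LF by (simp_all add: galois_ext_def)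
 note DF = finite_field_extD[OF fF] and DL = finite_field_extD[OF fL]
 show "F <= L" by (rule DL(3))
 have fLQ: "finite_field_ext L \<rat>"
  using fF fL ring.telescopic_base_dim(1)[OF ring_C, of \<rat> F L] unfolding finite_field_ext_def by blast
 note A = aut_group_galois_ext[OF LF] and B = galois_field_if_galois_ext[OF F]
 interpret A: aut_group L "carrier (gal_group L F)" by (rule A(1))
 interpret B: galois_field F "carrier (gal_group F \<rat>)" by (rule B)
 have ext: "EX \<tau>:carrier (gal_group L \<rat>). ALL x:F. \<tau> x = \<sigma> x" if s: "\<sigma> : carrier (gal_group F \<rat>)" for \<sigma>
 proof -
  have bs: "bij_betw \<sigma> F F" using s by (simp add: gal_carrier)
  obtain \<tau> where t: "hom_on L \<tau>" "ALL x:F. \<tau> x = \<sigma> x"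
   using A.extend_hom[of \<sigma>] B.hom[OF s] B.into[OF s] unfolding A(2) by blast
  have "\<tau> ` F = \<sigma> ` F" using t(2) by (intro image_cong) auto
  hence tF: "\<tau> ` F = F" using bs by (simp add: bij_betw_def)
  have "field_iso L (\<tau> ` L) F \<tau>" using DL(1,3) t(1) tF by unfold_locales simp_all
  hence sub: "\<tau> ` L <= L" using max[OF field_iso.unramified_abelian_p_ext_image[OF _ un]] by blast
  have inj: "inj_on \<tau> L" by (rule hom_on_inj[OF DL(1) t(1)])
  have "x : \<tau> ` L" if x: "x : L" for x
  proof -
   obtain f where f: "f ~= 0" "ALL i. poly.coeff f i : \<rat>" "poly f x = 0" using algebraic_if_finite_field_ext[OF fLQ x] by blast
   let ?R = "{y : L. poly f y = 0}"
   have "finite ?R" using poly_roots_finite[OF f(1)] by (rule finite_subset[rotated]) blast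
   moreover have "\<tau> y : ?R" if y: "y : ?R" for y
   proof -
    have "\<tau> (poly f y) = poly f (\<tau> y)"
     using hom_on_poly_eval[OF DL(1) t(1), of f y] f(2) y csubfield_Rats[OF DL(1)] hom_on_Rats[OF DL(1) t(1)]
     by (auto simp: poly_altdef)
    thus ?thesis using y sub hom_on_zero[OF DL(1) t(1)] by auto
   qed
   ultimately have "\<tau> ` ?R = ?R" using inj_on_subset[OF inj, of ?R] by (intro endo_inj_surj) auto
   thus ?thesis using x f(3) by blast
  qed
  hence "bij_betw \<tau> L L" using sub inj by (auto simp: bij_betw_def)
  moreover have "hom_on L (restrict \<tau> L)" using t(1) A.Lcl(2,3,5) by (auto simp: hom_on_def)
  moreover have "restrict \<tau> L x = x" if "x : \<rat>" for x
   using hom_on_Rats[OF DL(1) t(1) that] csubfield_Rats[OF DL(1)] that by auto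
  ultimately have "restrict \<tau> L : carrier (gal_group L \<rat>)" by (simp add: gal_carrier)
  moreover have "ALL x:F. restrict \<tau> L x = \<sigma> x" using t(2) DL(3) by auto
  ultimately show ?thesis by blast
 qed
 have "x : \<rat>" if x: "x : L" "ALL \<sigma>:carrier (gal_group L \<rat>). \<sigma> x = x" for x
 proof -
  have "carrier (gal_group L F) <= carrier (gal_group L \<rat>)" using DF(3) by (auto simp: gal_carrier)
  hence "x : A.Fix" using x unfolding A.Fix_def by blast
  hence xF: "x : F" by (simp add: A(2))
  have "\<sigma> x = x" if "\<sigma> : carrier (gal_group F \<rat>)" for \<sigma> using ext[OF that] x(2) xF by fastforce
  hence "x : B.Fix" using xF unfolding B.Fix_def by blast
  thus ?thesis by (simp add: B.Fix_Rats)
 qed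
 thus "galois_ext L \<rat>" using fLQ finite_field_extD(3)[OF fLQ] by (auto simp: galois_ext_def gal_carrier)
qed

section \<open>The conductor formula\<close>

lemma real_powr_eq_exp_ln: "x > 0 ==> x powr a = exp (a * ln (x :: real))"
 by (simp add: powr_def)

context tower
begin

context
 fixes \<chi> \<theta> :: "(complex => complex) => complex" and f :: nat and I :: "complex set"
 assumes q: "Factorial_Ring.prime (card \<Gamma>)"
  and \<chi>: "\<chi> : Irr (gal_group L \<rat>)" and f: "is_rational_artin_conductor L \<chi> f"
  and \<theta>: "\<theta> : Irr (gal_group L k)" and I: "is_artin_conductor L k \<theta> I"
begin

lemma gal_group_small_update: "gal_group L k = (gal_group L \<rat>)\<lparr>carrier := H\<rparr>"
 using gal_group_small by (simp add: gal_group_def)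

lemma subgroup_H: "subgroup H (gal_group L \<rat>)"
proof -
 interpret H: aut_group L H by (rule H_subgroup)
 show ?thesis
 proof (rule group.subgroupI[OF big.group_G])
  show "H <= carrier (gal_group L \<rat>)" using H_subset by (simp add: big.gal_group_Rats)
  show "H ~= {}" using H.id_mem by blast
  show "a \<otimes>\<^bsub>gal_group L \<rat>\<^esub> b : H" if "a : H" "b : H" for a b
   using that H.comp_mem by (simp add: big.G_mult H_G)
  show "big.ginv a : H" if a: "a : H" for a
  proof -
   have "big.ginv a z = z" if z: "z : k" for z
    using ginv_cancel_small[OF H_G[OF a] z] a z by (simp add: H_def)
   thus ?thesis using big.ginv_G[OF H_G[OF a]] by (simp add: H_def)
  qed
 qed
qed

lemma class_function:
 assumes "x : H" "h : H"
 shows "\<theta> (big.cj x h) = \<theta> h"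
proof -
 note S = subgroup_H
 have grp: "group (gal_group L k)"
  unfolding gal_group_small_update by (rule subgroup.subgroup_is_group[OF S big.group_G])
 have "inv\<^bsub>gal_group L k\<^esub> x = big.ginv x"
  unfolding gal_group_small_update by (rule group.m_inv_consistent[OF big.group_G S assms(1)])
 moreover have "\<theta> (inv\<^bsub>gal_group L k\<^esub> x \<otimes>\<^bsub>gal_group L k\<^esub> h \<otimes>\<^bsub>gal_group L k\<^esub> x) = \<theta> h"
  using Irr_props[OF grp \<theta>] assms unfolding gal_group_small by blast
 ultimately show ?thesis by (simp add: gal_group_small_update)
qed

lemma discriminant_nonzero: "discriminant k ~= 0"
proof -
 obtain B where "big.Prime B" using big.primes_over_nonempty[OF two_is_prime_nat] by (auto simp: big.primes_over_def)
 thus ?thesis using q by (rule discriminant_valuation(2))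
qed

text \<open>A relation between the local exponents, in which the discriminant enters with multiplicity
  \<open>d\<close>, passes to the logarithms of the global invariants.\<close>

lemma ln_conductor_compare:
 assumes rel: "rel = (\<le>) | rel = (=)"
  and loc: "!!p. Factorial_Ring.prime p ==> EX P. small.Prime P & small.residue_char P = p &
   rel (Re (conductor_exponent L \<rat> \<chi> (QPrime p)))
    (d * real (vD p) + conj_avg (%P. Re (conductor_exponent L k \<theta> P)) P)"
 shows "rel (ln (real f)) (d * ln \<bar>real_of_int (discriminant k)\<bar> + ln (real (ideal_norm k I)))"
proof -
 obtain a where a: "ALL p. Factorial_Ring.prime p --> of_nat (a p) = conductor_exponent L \<rat> \<chi> (QPrime p)"
  "finite {p. Factorial_Ring.prime p & a p ~= 0}"
  "ln (real f) = (\<Sum>p\<in>{p. Factorial_Ring.prime p & a p ~= 0}. real (a p) * ln (real p))"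
  using ln_rational_conductor(2)[OF f] by (elim exE conjE)
 obtain b where b: "ALL P. small.Prime P --> of_nat (b P) = conductor_exponent L k \<theta> P" "finite {P. small.Prime P & b P ~= 0}"
  "ln (real (ideal_norm k I)) = (\<Sum>P\<in>{P. small.Prime P & b P ~= 0}. real (b P) * ln (real (small.inorm P)))"
  using small.ln_ideal_norm_conductor[OF I] by (elim exE conjE)
 define T where "T = {p. Factorial_Ring.prime p & a p ~= 0} Un prime_factors (nat \<bar>discriminant k\<bar>) \<union>
  small.residue_char ` {P. small.Prime P & b P ~= 0}"
 have T: "finite T" "!!p. p : T ==> Factorial_Ring.prime p"
  using a(2) b(2) small.residue_char_prime by (auto simp: T_def)
 have "EX P. small.Prime P & small.residue_char P = p & rel (real (a p)) (d * real (vD p) + conj_avg (%P. real (b P)) P)"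
  if p: "p : T" for p
 proof -
  obtain P where P: "small.Prime P" "small.residue_char P = p" "rel (Re (conductor_exponent L \<rat> \<chi> (QPrime p)))
    (d * real (vD p) + conj_avg (%P. Re (conductor_exponent L k \<theta> P)) P)" using loc[OF T(2)[OF p]] by blast
  have "Re (conductor_exponent L \<rat> \<chi> (QPrime p)) = real (a p)" using a(1) T(2)[OF p] by (metis Re_complex_of_real of_real_of_nat_eq)
  moreover have "Re (conductor_exponent L k \<theta> Q) = real (b Q)" if "small.Prime Q" for Q
   using b(1) that by (metis Re_complex_of_real of_real_of_nat_eq)
  hence "conj_avg (%P. Re (conductor_exponent L k \<theta> P)) P = conj_avg (%P. real (b P)) P"
   unfolding conj_avg_def using small.Prime_image[OF P(1)] by simp
  ultimately show ?thesis using P by (intro exI[of _ P]) (simp only: simp_thms)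
 qed
 hence "ALL p:T. EX P. small.Prime P & small.residue_char P = p & rel (real (a p)) (d * real (vD p) + conj_avg (%P. real (b P)) P)"
  by blast
 then obtain \<P> where \<P>: "ALL p:T. small.Prime (\<P> p) & small.residue_char (\<P> p) = p &
  rel (real (a p)) (d * real (vD p) + conj_avg (%P. real (b P)) (\<P> p))" by (rule bchoice[THEN exE])
 let ?R = "%p. d * real (vD p) + conj_avg (%P. real (b P)) (\<P> p)"
 have lnf: "ln (real f) = (\<Sum>p\<in>T. real (a p) * ln (real p))"
  unfolding a(3)
 proof (rule sum.mono_neutral_left[OF T(1)])
  show "{p. Factorial_Ring.prime p & a p ~= 0} <= T" unfolding T_def by blast
  show "ALL p:T - {p. Factorial_Ring.prime p & a p ~= 0}. real (a p) * ln (real p) = 0"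
  proof
   fix p assume "p : T - {p. Factorial_Ring.prime p & a p ~= 0}"
   hence "a p = 0" using T(2) by blast
   thus "real (a p) * ln (real p) = 0" by simp
  qed
 qed
 have ln_p: "ln (real p) >= 0" if "p : T" for p using prime_ge_1_nat[OF T(2)[OF that]] by simp
 have "rel (\<Sum>p\<in>T. real (a p) * ln (real p)) (\<Sum>p\<in>T. ?R p * ln (real p))"
  using rel
 proof
  assume r: "rel = (\<le>)"
  have "real (a p) <= ?R p" if "p : T" for p using \<P> that unfolding r by blast
  thus ?thesis unfolding r by (intro sum_mono mult_right_mono ln_p)
 next
  assume r: "rel = (=)"
  have "real (a p) = ?R p" if "p : T" for p using \<P> that unfolding r by blast
  thus ?thesis unfolding r by (intro sum.cong refl arg_cong2[of _ _ _ _ "(*)"])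
 qed
 also have "(\<Sum>p\<in>T. ?R p * ln (real p)) = d * ln \<bar>real_of_int (discriminant k)\<bar> + ln (real (ideal_norm k I))"
  unfolding b(3)
 proof (rule sum_local_conductors[OF discriminant_nonzero _ T])
  show "small.Prime (\<P> p) & small.residue_char (\<P> p) = p" if "p : T" for p using \<P> that by blast
 qed (unfold T_def, blast+)
 finally show ?thesis unfolding lnf .
qed

lemma positive:
 shows "real f > 0" "real (ideal_norm k I) > 0" "\<bar>real_of_int (discriminant k)\<bar> > 0"
  and "small.Prime P ==> Re (conductor_exponent L k \<theta> P) >= 0"
proof -
 obtain b where b: "ALL P. small.Prime P --> of_nat (b P) = conductor_exponent L k \<theta> P" "ideal_norm k I > 0"
  using small.ln_ideal_norm_conductor[OF I] by (elim exE conjE)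
 show "real f > 0" "real (ideal_norm k I) > 0" "\<bar>real_of_int (discriminant k)\<bar> > 0"
  using ln_rational_conductor(1)[OF f] b(2) discriminant_nonzero by simp_all
 assume "small.Prime P"
 hence "of_nat (b P) = conductor_exponent L k \<theta> P" using b(1) by blast
 thus "Re (conductor_exponent L k \<theta> P) >= 0" by (metis Re_complex_of_real of_nat_0_le_iff of_real_of_nat_eq)
qed

lemma Irr_degrees:
 obtains d where "d > 0" "\<chi> (restrict id L) = of_nat d" "ALL g:G. norm (\<chi> g) <= real d"
proof -
 obtain d where d: "d > 0" "\<chi> (restrict id L) = of_nat d" "ALL g:G. norm (\<chi> g) <= real d"
  using Irr_props[OF big.group_G \<chi>] big.fin unfolding big.gal_group_Rats gal_one by blast
 show ?thesis by (rule that[OF d])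
qed

theorem conductor_restricted_bound:
 assumes res: "restrict \<chi> H = \<theta>"
 shows "real f powr (1 / char_degree (gal_group L \<rat>) \<chi>)
  <= \<bar>real_of_int (discriminant k)\<bar> * real (ideal_norm k I) powr (1 / char_degree (gal_group L k) \<theta>)"
proof -
 interpret H: aut_group L H by (rule H_subgroup)
 obtain d where d: "d > 0" "\<chi> (restrict id L) = of_nat d" "ALL g:G. norm (\<chi> g) <= real d"
  by (rule Irr_degrees)
 have eq: "\<theta> h = \<chi> h" if "h : H" for h using res that by (auto simp: restrict_def)
 have deg: "char_degree (gal_group L \<rat>) \<chi> = real d" "char_degree (gal_group L k) \<theta> = real d"
  using d(2) eq[OF H.id_mem] by (simp_all add: char_degree_def gal_one)
 have "ln (real f) <= real d * ln \<bar>real_of_int (discriminant k)\<bar> + ln (real (ideal_norm k I))"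
 proof (rule ln_conductor_compare)
  show "EX P. small.Prime P & small.residue_char P = p & Re (conductor_exponent L \<rat> \<chi> (QPrime p)) \<le>
    real d * real (vD p) + conj_avg (%P. Re (conductor_exponent L k \<theta> P)) P"
   if "Factorial_Ring.prime p" for p
   by (rule conductor_restricted[OF that q d(2) d(3)[rule_format] class_function eq positive(4)])
 qed simp
 hence "1 / real d * ln (real f) <= ln \<bar>real_of_int (discriminant k)\<bar> + 1 / real d * ln (real (ideal_norm k I))"
  using d(1) by (simp add: field_simps)
 hence "exp (1 / real d * ln (real f)) <= exp (ln \<bar>real_of_int (discriminant k)\<bar> + 1 / real d * ln (real (ideal_norm k I)))"
  by (simp only: exp_le_cancel_iff)
 thus ?thesis
  using positive unfolding deg exp_add by (simp add: real_powr_eq_exp_ln)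
qed

theorem conductor_induced_eq:
 assumes ind: "\<chi> = Ind (gal_group L \<rat>) H \<theta>"
 shows "real f powr (1 / char_degree (gal_group L \<rat>) \<chi>)
  = \<bar>real_of_int (discriminant k)\<bar> powr (1 / real (card \<Gamma>)) *
   real (ideal_norm k I) powr (1 / (real (card \<Gamma>) * char_degree (gal_group L k) \<theta>))"
proof -
 let ?q = "real (card \<Gamma>)"
 have grp: "group (gal_group L k)"
  unfolding gal_group_small_update by (rule subgroup.subgroup_is_group[OF subgroup_H big.group_G])
 obtain t where t: "t > 0" "\<theta> (restrict id L) = of_nat t"
  using Irr_props[OF grp \<theta>] unfolding gal_one by blast
 note ci = conductor_induced[OF _ q class_function ind]
 have "\<chi> (restrict id L) = of_nat (card \<Gamma>) * \<theta> (restrict id L)" by (rule ci(1)[OF two_is_prime_nat])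
 hence deg: "char_degree (gal_group L \<rat>) \<chi> = ?q * real t" "char_degree (gal_group L k) \<theta> = real t"
  using t(2) by (simp_all add: char_degree_def gal_one)
 have q0: "?q > 0" using prime_gt_0_nat[OF q] by simp
 have "Re (conj_avg F P) = conj_avg (%P. Re (F P)) P" for F P
  by (simp add: conj_avg_def Re_divide_of_nat)
 hence Re: "Re (of_nat t * of_nat v + conj_avg F P) = real t * real v + conj_avg (%P. Re (F P)) P" for v F P
  by simp
 have eq: "ln (real f) = real t * ln \<bar>real_of_int (discriminant k)\<bar> + ln (real (ideal_norm k I))"
 proof (rule ln_conductor_compare)
  fix p :: nat assume "Factorial_Ring.prime p"
  from ci(2)[OF this] obtain P where "small.Prime P" "small.residue_char P = p"
   and c: "conductor_exponent L \<rat> \<chi> (QPrime p) = of_nat t * of_nat (vD p) + conj_avg (conductor_exponent L k \<theta>) P"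
   unfolding t(2) by blast
  thus "EX P. small.Prime P & small.residue_char P = p & Re (conductor_exponent L \<rat> \<chi> (QPrime p)) =
    real t * real (vD p) + conj_avg (%P. Re (conductor_exponent L k \<theta> P)) P"
   unfolding c Re by blast
 qed simp
 have "1 / (?q * real t) * ln (real f) = 1 / ?q * ln \<bar>real_of_int (discriminant k)\<bar> + 1 / (?q * real t) * ln (real (ideal_norm k I))"
  unfolding eq using t(1) q0 by (simp add: field_simps)
 hence "exp (1 / (?q * real t) * ln (real f)) = exp (1 / ?q * ln \<bar>real_of_int (discriminant k)\<bar>) * exp (1 / (?q * real t) * ln (real (ideal_norm k I)))"
  by (simp only: exp_add)
 thus ?thesis
  using positive unfolding deg by (simp add: real_powr_eq_exp_ln)
qed

end

end

theorem theorem10: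
  fixes p q n f\<chi> :: nat
    and K k :: "complex set"
    and Kn :: "nat \<Rightarrow> complex set"
    and \<chi> :: "(complex \<Rightarrow> complex) \<Rightarrow> complex"
  assumes "Factorial_Ring.prime p"
    and "galois_ext K \<rat>"
    and "Kn 0 = K"
    and "\<And>m. m \<ge> 1 \<Longrightarrow> is_hilbert_p_class_field p (Kn (m - 1)) (Kn m)"
    and "\<And>m. m \<ge> 1 \<Longrightarrow> Kn m \<noteq> Kn (m - 1)"
    and "k \<subseteq> K"
    and "galois_ext k \<rat>"
    and "Factorial_Ring.prime q"
    and "field_degree k \<rat> = q"
    and "\<chi> \<in> Irr (gal_group (Kn n) \<rat>)"
    and "is_rational_artin_conductor (Kn n) \<chi> f\<chi>"
  shows "(\<forall>\<theta> f\<theta>. \<theta> \<in> Irr (gal_group (Kn n) k) \<longrightarrow>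
      restrict \<chi> (carrier (gal_group (Kn n) k)) = \<theta> \<longrightarrow>
      is_artin_conductor (Kn n) k \<theta> f\<theta> \<longrightarrow>
      real f\<chi> powr (1 / char_degree (gal_group (Kn n) \<rat>) \<chi>)
        \<le> \<bar>real_of_int (discriminant k)\<bar> *
           real (ideal_norm k f\<theta>) powr (1 / char_degree (gal_group (Kn n) k) \<theta>)) \<and>
    (\<forall>\<theta> f\<theta>. \<theta> \<in> Irr (gal_group (Kn n) k) \<longrightarrow>
      \<chi> = Ind (gal_group (Kn n) \<rat>) (carrier (gal_group (Kn n) k)) \<theta> \<longrightarrow>
      is_artin_conductor (Kn n) k \<theta> f\<theta> \<longrightarrow>
      real f\<chi> powr (1 / char_degree (gal_group (Kn n) \<rat>) \<chi>)
        = \<bar>real_of_int (discriminant k)\<bar> powr (1 / real q) *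
          real (ideal_norm k f\<theta>) powr (1 / (real q * char_degree (gal_group (Kn n) k) \<theta>)))"
 proof -
 have Kn: "galois_ext (Kn m) \<rat> & K <= Kn m" for m
 proof (induction m)
  case 0
  show ?case using assms(2,3) by simp
 next
  case (Suc m)
  have "is_hilbert_p_class_field p (Kn m) (Kn (Suc m))" using assms(4)[of "Suc m"] by simp
  from hilbert_p_class_field_galois[OF conjunct1[OF Suc] this] show ?case using Suc by blast
 qed
 have big: "galois_field (Kn n) (carrier (gal_group (Kn n) \<rat>))"
  and small: "galois_field k (carrier (gal_group k \<rat>))"
  using galois_field_if_galois_ext Kn assms(7) by blast+
 interpret tower "Kn n" "carrier (gal_group (Kn n) \<rat>)" k "carrier (gal_group k \<rat>)"
  using big small Kn[of n] assms(6) unfolding tower_def tower_axioms_def by blast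
 have "subfield k \<CC>" using small.L by (simp add: subfield_iff_csubfield)
 hence q: "card (carrier (gal_group k \<rat>)) = q" using small.card_eq_field_degree assms(9) by simp
 have pq: "Factorial_Ring.prime (card (carrier (gal_group k \<rat>)))" using assms(8) q by simp
 note H = gal_group_small
 show ?thesis
  using conductor_restricted_bound[OF pq assms(10,11)] conductor_induced_eq[OF pq assms(10,11)]
  unfolding H q by blast
qed

end
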